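(* Let $n\ge m\ge1$, $1\le k\le n-1$, and let $f\in L^p(\mathfrak M_{n,m})$ with $1\le p<n/(k+m-1)$, so that the Radon transform $\varphi(\tau)=\hat f(\tau)$ is finite for almost all matrix $k$-planes $\tau$. The function $f$ can be recovered from $\varphi$ in the sense of $\Phi'$-distributions by the formula $$c_{n,k,m}\,(f,\phi)=(\check\varphi,I^{-k}\phi),\qquad \phi\in\Phi(\mathfrak M_{n,m}),\qquad c_{n,k,m}=2^{km}\pi^{km/2}\,\Gamma_m\!\left(\tfrac n2\right)\Big/\Gamma_m\!\left(\tfrac{n-k}2\right),$$ where $(I^{-k}\phi)(x)=(\mathcal F^{-1}|y|_m^{k}\mathcal F\phi)(x)$. In particular, for $k$ even, $$c_{n,k,m}\,(f,\phi)=(-1)^{mk/2}(\check\varphi,\Delta^{k/2}\phi),\qquad\phi\in\Phi(\mathfrak M_{n,m}).$$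
   Context: $\mathfrak M_{n,m}$: real $n\times m$ matrices with Lebesgue measure; $x'$ transpose; $|x|_m=\det(x'x)^{1/2}$; $\Gamma_m(\alpha)=\pi^{m(m-1)/4}\prod_{j=0}^{m-1}\Gamma(\alpha-j/2)$; $(f,\phi)=\int_{\mathfrak M_{n,m}}f(x)\phi(x)\,dx$. Fourier transform: $(\mathcal Ff)(y)=\int_{\mathfrak M_{n,m}}\exp(i\operatorname{tr}(y'x))f(x)\,dx$. $V_{n,n-k}=\{\xi\in\mathfrak M_{n,n-k}:\xi'\xi=I_{n-k}\}$ with its $O(n)$-invariant measure of total mass $\sigma_{n,n-k}$. Radon transform over the matrix $k$-plane $\tau=\tau(\xi,t)=\{x:\xi'x=t\}$: $\hat f(\xi,t)=\int_{\mathfrak M_{k,m}}f\left(g_\xi\begin{bmatrix}\omega\\ t\end{bmatrix}\right)d\omega$, $\xi\in V_{n,n-k}$, $t\in\mathfrak M_{n-k,m}$, $g_\xi\in SO(n)$ any rotation sending $\begin{bmatrix}0\\ I_{n-k}\end{bmatrix}$ to $\xi$; "almost all $\tau$" means almost all $(\xi,t)$. Dual Radon transform: $\check\varphi(x)=\sigma_{n,n-k}^{-1}\int_{V_{n,n-k}}\varphi(\xi,\xi'x)\,d\xi$. $\Psi(\mathfrak M_{n,m})$ is the subspace of Schwartz functions on $\mathfrak M_{n,m}$ vanishing together with all derivatives on $\{y:\operatorname{rank}(y)<m\}$; $\Phi(\mathfrak M_{n,m})=\mathcal F(\Psi(\mathfrak M_{n,m}))$. $\Delta=\det(\partial'\partial)$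 is the Cayley–Laplace operator, $\partial=(\partial/\partial x_{i,j})_{n\times m}$. *)

theory Defs
  imports "HOL-Analysis.Analysis"
begin

text \<open>
  A real matrix with rows indexed by \<open>'r\<close> and columns by \<open>'c\<close> has type \<open>real^'c^'r\<close>.  For the
  Radon transform the rows are indexed by a sum type \<open>'k + 'l\<close>, so that \<open>k = CARD('k)\<close>,
  \<open>n - k = CARD('l)\<close>, \<open>n = CARD('k + 'l)\<close>, and the upper and lower blocks of a matrix are those
  of the \<open>Inl\<close> and the \<open>Inr\<close> rows.  The Lebesgue measure on \<open>real^'c^'r\<close> is the product
  of the one-dimensional Lebesgue measures of the entries.
\<close>

definition mat_abs :: "real^'c^'r \<Rightarrow> real" where
  "mat_abs x = sqrt (det (transpose x ** x))"

definition Gamma_cone :: "nat \<Rightarrow> real \<Rightarrow> real" where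
  "Gamma_cone m \<alpha> = pi powr (real m * (real m - 1) / 4) * (\<Prod>j<m. Gamma (\<alpha> - real j / 2))"

definition pairing :: "(real^'c^'r \<Rightarrow> complex) \<Rightarrow> (real^'c^'r \<Rightarrow> complex) \<Rightarrow> complex" where
  "pairing f \<phi> = (LINT x|lebesgue. f x * \<phi> x)"

definition in_Lp :: "real \<Rightarrow> (real^'c^'r \<Rightarrow> complex) \<Rightarrow> bool" where
  "in_Lp p f \<longleftrightarrow> f \<in> borel_measurable lebesgue \<and> integrable lebesgue (\<lambda>x. norm (f x) powr p)"


subsection \<open>Fourier transform\<close>

definition fourier :: "(real^'c^'r \<Rightarrow> complex) \<Rightarrow> real^'c^'r \<Rightarrow> complex" where
  "fourier f y =
     (LINT x|lebesgue. exp (\<i> * complex_of_real (trace (transpose y ** x))) * f x)"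

definition inv_fourier :: "(real^'c^'r \<Rightarrow> complex) \<Rightarrow> real^'c^'r \<Rightarrow> complex" where
  "inv_fourier g x =
     complex_of_real (1 / (2 * pi) ^ (CARD('r) * CARD('c))) *
     (LINT y|lebesgue. exp (- \<i> * complex_of_real (trace (transpose y ** x))) * g y)"

definition riesz_neg :: "nat \<Rightarrow> (real^'c^'r \<Rightarrow> complex) \<Rightarrow> real^'c^'r \<Rightarrow> complex" where
  "riesz_neg k \<phi> = inv_fourier (\<lambda>y. complex_of_real (mat_abs y ^ k) * fourier \<phi> y)"


subsection \<open>Partial derivatives and test functions\<close>

definition partial :: "'r \<times> 'c \<Rightarrow> (real^'c^'r \<Rightarrow> complex) \<Rightarrow> real^'c^'r \<Rightarrow> complex" where
  "partial ij f x =
     vector_derivative (\<lambda>s. f (x + s *\<^sub>R axis (fst ij) (axis (snd ij) 1))) (at 0)"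

fun partials :: "('r \<times> 'c) list \<Rightarrow> (real^'c^'r \<Rightarrow> complex) \<Rightarrow> real^'c^'r \<Rightarrow> complex" where
  "partials [] f = f"
| "partials (ij # ijs) f = partial ij (partials ijs f)"

text \<open>
  Differentiability of all iterated partial derivatives is the same as their existence and
  continuity, since differentiable functions are continuous and functions with continuous
  partial derivatives are differentiable.
\<close>

definition smooth :: "(real^'c^'r \<Rightarrow> complex) \<Rightarrow> bool" where
  "smooth f \<longleftrightarrow> (\<forall>ijs x. partials ijs f differentiable (at x))"

definition schwartz :: "(real^'c^'r \<Rightarrow> complex) set" where
  "schwartz = {f. smooth f \<and>
     (\<forall>N ijs. \<exists>C. \<forall>x. (1 + norm x) ^ N * norm (partials ijs f x) \<le> C)}"

definition Psi_space :: "(real^'c^'r \<Rightarrow> complex) set" where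
  "Psi_space = {\<psi> \<in> schwartz.
     \<forall>y. rank y < CARD('c) \<longrightarrow> (\<forall>ijs. partials ijs \<psi> y = 0)}"

definition Phi_space :: "(real^'c^'r \<Rightarrow> complex) set" where
  "Phi_space = fourier ` Psi_space"


subsection \<open>The Cayley--Laplace operator\<close>

definition d_transpose_d ::
    "'c \<Rightarrow> 'c \<Rightarrow> (real^'c^'r \<Rightarrow> complex) \<Rightarrow> real^'c^'r \<Rightarrow> complex" where
  "d_transpose_d a b f x = (\<Sum>i\<in>UNIV. partial (i, a) (partial (i, b) f) x)"

text \<open>
  The Leibniz expansion of the determinant of a matrix of operators, with composition as the
  product.  The factors are composed in the order of some enumeration of the index type; for
  \<open>d_transpose_d\<close> the order is irrelevant because its entries commute on smooth functions.
\<close>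

definition operator_det :: "('c::finite \<Rightarrow> 'c \<Rightarrow> ('a \<Rightarrow> complex) \<Rightarrow> ('a \<Rightarrow> complex)) \<Rightarrow>
    ('a \<Rightarrow> complex) \<Rightarrow> 'a \<Rightarrow> complex" where
  "operator_det A f x =
     (\<Sum>\<sigma> | \<sigma> permutes UNIV. of_int (sign \<sigma>) *
        foldr (\<lambda>a. A a (\<sigma> a)) (SOME as. distinct as \<and> set as = UNIV) f x)"

definition cayley_laplace :: "(real^'c^'r \<Rightarrow> complex) \<Rightarrow> real^'c^'r \<Rightarrow> complex" where
  "cayley_laplace = operator_det d_transpose_d"


subsection \<open>The Stiefel manifold\<close>

definition stiefel :: "(real^'l^'n) set" where
  "stiefel = {\<xi>. transpose \<xi> ** \<xi> = mat 1}"

definition stiefel_mass :: "nat \<Rightarrow> nat \<Rightarrow> real" where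
  "stiefel_mass n l = 2 ^ l * pi powr (real (n * l) / 2) / Gamma_cone l (real n / 2)"

text \<open>
  These conditions determine the measure uniquely.
\<close>

definition stiefel_measure :: "(real^'l^'n) measure \<Rightarrow> bool" where
  "stiefel_measure \<mu> \<longleftrightarrow>
     space \<mu> = stiefel \<and>
     sets \<mu> = sets (restrict_space borel stiefel) \<and>
     (\<forall>g. orthogonal_matrix g \<longrightarrow> distr \<mu> \<mu> (\<lambda>\<xi>. g ** \<xi>) = \<mu>) \<and>
     emeasure \<mu> (space \<mu>) = ennreal (stiefel_mass CARD('n) CARD('l))"


subsection \<open>Radon transform and its dual\<close>

definition stack :: "real^'c^'k \<Rightarrow> real^'c^'l \<Rightarrow> real^'c^('k + 'l)" where
  "stack \<omega> t = (\<chi> i. case i of Inl a \<Rightarrow> \<omega> $ a | Inr b \<Rightarrow> t $ b)"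

text \<open>
  Two admissible rotations differ by a rotation acting on the upper block only, which
  preserves the Lebesgue measure in \<open>\<omega>\<close>, so the choice does not affect the Radon transform.
\<close>

definition frame_rotation :: "real^'l^('k::finite + 'l::finite) \<Rightarrow> real^('k + 'l)^('k + 'l)" where
  "frame_rotation \<xi> = (SOME g. rotation_matrix g \<and> g ** stack 0 (mat 1) = \<xi>)"

definition radon_converges ::
    "(real^'m^('k::finite + 'l::finite) \<Rightarrow> complex) \<Rightarrow> real^'l^('k + 'l) \<Rightarrow> real^'m^'l \<Rightarrow> bool" where
  "radon_converges f \<xi> t \<longleftrightarrow>
     integrable lebesgue (\<lambda>\<omega>::real^'m^'k. f (frame_rotation \<xi> ** stack \<omega> t))"

definition radon ::
    "(real^'m^('k::finite + 'l::finite) \<Rightarrow> complex) \<Rightarrow> real^'l^('k + 'l) \<Rightarrow> real^'m^'l \<Rightarrow> complex" where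
  "radon f \<xi> t = (LINT \<omega>::real^'m^'k|lebesgue. f (frame_rotation \<xi> ** stack \<omega> t))"

text \<open>
  The completion is needed because the Radon transform of a Lebesgue measurable function
  need not be Borel measurable in \<open>\<xi>\<close>.
\<close>

definition dual_radon :: "(real^'l^'n) measure \<Rightarrow> (real^'l^'n \<Rightarrow> real^'m^'l \<Rightarrow> complex) \<Rightarrow>
    real^'m^'n \<Rightarrow> complex" where
  "dual_radon \<mu> \<phi> x =
     complex_of_real (1 / stiefel_mass CARD('n) CARD('l)) *
     (LINT \<xi>|completion \<mu>. \<phi> \<xi> (transpose \<xi> ** x))"

definition inversion_const :: "nat \<Rightarrow> nat \<Rightarrow> nat \<Rightarrow> real" where
  "inversion_const n k m =
     2 ^ (k * m) * pi powr (real (k * m) / 2) *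
     Gamma_cone m (real n / 2) / Gamma_cone m ((real n - real k) / 2)"

end

theory Submission
  imports Defs "HOL-Probability.Probability"
begin

text \<open>
  Let \<open>l = n - k\<close> and write \<open>|y|\<close> for \<open>mat_abs y\<close>.

  A measure on the \<open>n \<times> m\<close> matrices that is invariant under the left action of \<open>O(n)\<close> and
  homogeneous under the right action of \<open>GL(m)\<close> is unique up to a factor.  Applied to the image of
  the product measure under \<open>(\<xi>, t) \<mapsto> \<xi> t\<close> this gives polar coordinates: the image has density
  const \<open>|y| powr (-k)\<close>, and Gaussian moments give the constant.

  By polar coordinates, the average of \<open>(1 + |\<xi>' z|\<^sup>2) powr (-N)\<close> over \<open>\<xi>\<close> is at most
  const \<open>det (I + z z') powr (-l/2)\<close>, and this function lies in the space dual to \<open>L\<^sup>p\<close> for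
  \<open>p < n / (k + m - 1)\<close>.  Hence \<open>f\<close> is integrable over almost all planes.

  For \<open>\<psi> \<in> \<Psi>\<close> the function \<open>\<theta> y = |y|\<^sup>k \<psi> y\<close> has a rapidly decreasing Fourier transform, because
  \<open>\<psi>\<close> is flat where \<open>|y|\<close> is not smooth.  Pairing the dual Radon transform with \<open>FT \<theta>\<close>, Fubini's
  theorem replaces \<open>FT \<theta>\<close> by its plane integrals, which by the Fourier slice theorem are
  \<open>(2 \<pi>) ^ (k m)\<close> times the Fourier transforms of \<open>s \<mapsto> \<theta> (\<xi> s)\<close>.  In the average over \<open>\<xi>\<close> the density
  \<open>|y| powr (-k)\<close> of the polar coordinates cancels the factor \<open>|y|\<^sup>k\<close> and leaves \<open>FT \<psi>\<close>.
\<close>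

subsection \<open>Lebesgue integrals on Euclidean spaces\<close>

text \<open>The measure on the Stiefel manifold is given by its invariance and total mass alone,
  with no parametrisation, so polar coordinates cannot be read off from a Jacobian. They come from
  uniqueness of homogeneous measures, and the Gaussian is the test function that fixes the factor.
  The hypothesis on \<open>p\<close> acts twice. Together with \<open>1 \<le> p\<close> it forces
  \<open>k + m - 1 < n\<close>, that is \<open>m \<le> l\<close>, so that \<open>\<xi> ** t\<close>
  has full rank for almost all \<open>t\<close> and the Gamma factors are positive. It also gives
  \<open>l * q > n + m - 1\<close> for the conjugate exponent \<open>q\<close> when
  \<open>p > 1\<close>, which makes the \<open>q\<close>-th power of the averaged weight integrable.
  The function \<open>f\<close> is only Lebesgue measurable and the rotations are arbitrary choices,
  so neither may enter a Fubini argument directly: \<open>f\<close> is replaced by a Borel function,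
  the rotations by an average. The replacements agree with the originals only for almost all planes,
  and since the dual transform evaluates at \<open>transpose \<xi> ** x\<close>, exceptional null
  sets have to be followed through that substitution. In the final constant,
  \<open>(2 * pi) ^ (k * m)\<close> stems from Fourier inversion on the planes and the rest from
  polar coordinates.\<close>

lemma
  fixes f :: "'a::euclidean_space \<Rightarrow> real \<Rightarrow> 'b::{real_normed_field,banach,second_countable_topology}"
  assumes "\<And>b. b \<in> Basis \<Longrightarrow> integrable lborel (f b)"
  shows lborel_integrable_prod: "integrable lborel (\<lambda>x::'a. \<Prod>b\<in>Basis. f b (x \<bullet> b))"
    and lborel_integral_prod:
      "(LINT x|lborel. (\<Prod>b\<in>Basis. f b (x \<bullet> b))) = (\<Prod>b\<in>Basis. LINT x|lborel. f b x)"
proof -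
  interpret product_sigma_finite "\<lambda>b::'a. lborel :: real measure" by standard
  have [measurable]: "\<And>b. b \<in> Basis \<Longrightarrow> f b \<in> borel_measurable borel"
    using assms[THEN borel_measurable_integrable] by simp
  have *: "(\<Prod>b\<in>Basis. f b ((\<Sum>b\<in>Basis. x b *\<^sub>R b) \<bullet> b)) = (\<Prod>b\<in>Basis. f b (x b))" for x :: "'a \<Rightarrow> real"
    by (intro prod.cong) auto
  show "integrable lborel (\<lambda>x::'a. \<Prod>b\<in>Basis. f b (x \<bullet> b))"
    by (subst lborel_eq) (auto simp: integrable_distr_eq * intro!: product_integrable_prod assms)
  show "(LINT x|lborel. (\<Prod>b\<in>Basis. f b (x \<bullet> b))) = (\<Prod>b\<in>Basis. LINT x|lborel. f b x)"
    by (subst lborel_eq) (auto simp: integral_distr * intro!: product_integral_prod assms)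
qed

lemma distr_lborel_translation:
  "distr lborel borel (\<lambda>x. x + c) = (lborel :: 'a::euclidean_space measure)"
  using lborel_affine[of 1 c] by (simp add: density_1 add.commute)

lemma lborel_integral_translation:
  fixes f :: "'a::euclidean_space \<Rightarrow> 'b::{banach,second_countable_topology}"
  assumes [measurable]: "f \<in> borel_measurable borel"
  shows "(LINT x|lborel. f (x + c)) = (LINT x|lborel. f x)"
  using integral_distr[of "\<lambda>x. x + c" lborel borel f] distr_lborel_translation[of c] by simp

lemma lborel_integrable_translation:
  fixes f :: "'a::euclidean_space \<Rightarrow> 'b::{banach,second_countable_topology}"
  assumes "integrable lborel f"
  shows "integrable lborel (\<lambda>x. f (x + c))"
proof -
  have [measurable]: "f \<in> borel_measurable borel" using borel_measurable_integrable[OF assms] by simp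
  show ?thesis
    using integrable_distr_eq[of "\<lambda>x. x + c" lborel borel f] distr_lborel_translation[of c] assms by simp
qed

lemma lborel_integral_scale:
  fixes f :: "'a::euclidean_space \<Rightarrow> 'b::{banach,second_countable_topology}"
  assumes [measurable]: "f \<in> borel_measurable borel" and c: "c > 0"
  shows "(LINT x|lborel. f x) = c ^ DIM('a) *\<^sub>R (LINT x|lborel. f (c *\<^sub>R x))"
proof -
  have "(LINT x|lborel. f x)
      = (LINT x|density (distr lborel borel (\<lambda>x::'a. 0 + c *\<^sub>R x)) (\<lambda>_. ennreal (\<bar>c\<bar>^DIM('a))). f x)"
    using c by (subst lborel_affine[of c 0]) simp_all
  also have "\<dots> = c ^ DIM('a) *\<^sub>R (LINT x|lborel. f (c *\<^sub>R x))"
    using c by (subst integral_density) (auto simp: integral_distr)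
  finally show ?thesis .
qed

lemma integrable_inverse_one_plus_square: "integrable lborel (\<lambda>x::real. 1 / (1 + x\<^sup>2))"
  using integrable_inverse_1_plus_square by (simp add: set_integrable_def inverse_eq_divide)

text \<open>The square of \<open>1 + norm x\<close> dominates
  \<open>1 + (x \<bullet> b)\<^sup>2\<close> for each of the coordinates, so the function lies below
  a product of integrable one-dimensional functions. This explains the exponent
  \<open>2 * DIM('a)\<close>, which serves as the standard integrable weight from here on.\<close>

lemma integrable_one_plus_norm_powr:
  "integrable lborel (\<lambda>x::'a::euclidean_space. 1 / (1 + norm x) ^ (2 * DIM('a)))"
proof (rule Bochner_Integration.integrable_bound)
  show "integrable lborel (\<lambda>x::'a. \<Prod>b\<in>Basis. 1 / (1 + (x \<bullet> b)\<^sup>2))"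
    by (intro lborel_integrable_prod integrable_inverse_one_plus_square)
  have "1 + (x \<bullet> b)\<^sup>2 \<le> (1 + norm x)\<^sup>2" if "b \<in> Basis" for x b :: 'a
  proof -
    have "(x \<bullet> b)\<^sup>2 \<le> (norm x)\<^sup>2"
      using Basis_le_norm[OF that, of x] by (simp add: abs_le_square_iff[symmetric])
    moreover have "(1 + norm x)\<^sup>2 = 1 + 2 * norm x + (norm x)\<^sup>2" by (simp add: power2_eq_square algebra_simps)
    ultimately show ?thesis using norm_ge_zero[of x] by linarith
  qed
  then have "(\<Prod>b\<in>(Basis::'a set). 1 + (x \<bullet> b)\<^sup>2) \<le> (\<Prod>b\<in>(Basis::'a set). (1 + norm x)\<^sup>2)" for x :: 'a
    by (intro prod_mono) auto
  moreover have "(\<Prod>b\<in>(Basis::'a set). 1 + (x \<bullet> b)\<^sup>2) > 0" for x :: 'a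
    by (intro prod_pos) (simp add: add_pos_nonneg)
  ultimately have "norm (1 / (1 + norm x) ^ (2 * DIM('a))) \<le> norm (\<Prod>b\<in>Basis. 1 / (1 + (x \<bullet> b)\<^sup>2))" for x :: 'a
  proof -
    have "norm (1 / (1 + norm x) ^ (2 * DIM('a))) = 1 / (1 + norm x) ^ (2 * DIM('a))"
      by (simp add: abs_of_nonneg)
    also have "\<dots> = 1 / (\<Prod>b\<in>(Basis::'a set). (1 + norm x)\<^sup>2)"
      by (simp add: power_mult)
    also have "\<dots> \<le> 1 / (\<Prod>b\<in>(Basis::'a set). 1 + (x \<bullet> b)\<^sup>2)"
      by (intro frac_le order_refl) (fact | simp)+
    also have "\<dots> = (\<Prod>b\<in>Basis. 1 / (1 + (x \<bullet> b)\<^sup>2))" by (simp add: prod_dividef)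
    finally show ?thesis by (simp only: real_norm_def abs_ge_self order_trans)
  qed
  then show "AE x in lborel. norm (1 / (1 + norm (x::'a)) ^ (2 * DIM('a))) \<le> norm (\<Prod>b\<in>Basis. 1 / (1 + (x \<bullet> b)\<^sup>2))"
    by simp
qed auto


subsection \<open>Rapidly decreasing functions\<close>

text \<open>Decay only. Smoothness is treated separately, through classes of functions that are
  closed under directional derivatives.\<close>

definition rapid :: "('a::real_normed_vector \<Rightarrow> complex) \<Rightarrow> bool" where
  "rapid f \<longleftrightarrow> (\<forall>N. \<exists>C. \<forall>x. (1 + norm x) ^ N * norm (f x) \<le> C)"

lemma rapidE:
  assumes "rapid f"
  obtains C where "C \<ge> 0" "\<And>x. norm (f x) \<le> C / (1 + norm x) ^ N"
proof -
  obtain C where C: "\<And>x. (1 + norm x) ^ N * norm (f x) \<le> C"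
    using assms unfolding rapid_def by blast
  have "C \<ge> 0" using order_trans[OF _ C[of 0]] by simp
  moreover have "norm (f x) \<le> C / (1 + norm x) ^ N" for x
    using C[of x] by (simp add: pos_le_divide_eq mult.commute add_pos_nonneg)
  ultimately show ?thesis using that by blast
qed

lemma rapidI:
  assumes "\<And>N. \<exists>C. \<forall>x. (1 + norm x) ^ N * norm (f x) \<le> C"
  shows "rapid f"
  using assms unfolding rapid_def by blast

lemma rapid_integrable:
  fixes f :: "'a::euclidean_space \<Rightarrow> complex"
  assumes "rapid f" and [measurable]: "f \<in> borel_measurable borel"
  shows "integrable lborel f"
proof -
  obtain C where C: "\<And>x. norm (f x) \<le> C / (1 + norm x) ^ (2 * DIM('a))"
    using rapidE[OF assms(1)] by metis
  show ?thesis
  proof (rule Bochner_Integration.integrable_bound)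
    show "integrable lborel (\<lambda>x::'a. C * (1 / (1 + norm x) ^ (2 * DIM('a))))"
      by (intro integrable_mult_right integrable_one_plus_norm_powr)
    show "AE x in lborel. norm (f x) \<le> norm (C * (1 / (1 + norm x) ^ (2 * DIM('a))))"
      using C by (auto intro!: AE_I2 order_trans[OF C] simp: abs_mult divide_right_mono)
  qed auto
qed

lemma rapid_add:
  assumes "rapid f" "rapid g"
  shows "rapid (\<lambda>x. f x + g x)"
proof (rule rapidI)
  fix N
  obtain C D where C: "\<forall>x. (1 + norm x) ^ N * norm (f x) \<le> C" and D: "\<forall>x. (1 + norm x) ^ N * norm (g x) \<le> D"
    using assms unfolding rapid_def by metis
  have "(1 + norm x) ^ N * norm (f x + g x) \<le> C + D" for x
  proof -
    have "(1 + norm x) ^ N * norm (f x + g x) \<le> (1 + norm x) ^ N * (norm (f x) + norm (g x))"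
      by (intro mult_left_mono norm_triangle_ineq) simp
    also have "\<dots> \<le> C + D" using C[rule_format, of x] D[rule_format, of x] by (simp add: distrib_left)
    finally show ?thesis .
  qed
  then show "\<exists>C. \<forall>x. (1 + norm x) ^ N * norm (f x + g x) \<le> C" by blast
qed

lemma rapid_mult:
  fixes f :: "'a::real_normed_vector \<Rightarrow> complex"
  assumes "rapid f" and g: "\<And>x. norm (g x) \<le> A * (1 + norm x) ^ M"
  shows "rapid (\<lambda>x. g x * f x)"
proof (rule rapidI)
  fix N
  obtain C where C: "\<forall>x. (1 + norm x) ^ (N + M) * norm (f x) \<le> C"
    using assms unfolding rapid_def by metis
  have A: "A \<ge> 0" using order_trans[OF norm_ge_zero g[of 0]] by simp
  have "(1 + norm x) ^ N * norm (g x * f x) \<le> A * C" for x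
  proof -
    have "(1 + norm x) ^ N * norm (g x * f x) \<le> (1 + norm x) ^ N * ((A * (1 + norm x) ^ M) * norm (f x))"
      unfolding norm_mult by (intro mult_left_mono mult_right_mono g) auto
    also have "\<dots> = A * ((1 + norm x) ^ (N + M) * norm (f x))" by (simp add: power_add)
    also have "\<dots> \<le> A * C" using C A by (intro mult_left_mono) auto
    finally show ?thesis .
  qed
  then show "\<exists>C. \<forall>x. (1 + norm x) ^ N * norm (g x * f x) \<le> C" by blast
qed

lemma rapid_cmult: "rapid f \<Longrightarrow> rapid (\<lambda>x. c * f x)"
  by (rule rapid_mult[of f "\<lambda>_. c" "norm c" 0]) auto

lemma integrable_norm_rapid:
  fixes f :: "'a::euclidean_space \<Rightarrow> complex"
  assumes "rapid f" and [measurable]: "f \<in> borel_measurable borel"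
  shows "integrable lborel (\<lambda>x. norm x * norm (f x))"
proof -
  have "integrable lborel (\<lambda>x. of_real (norm x) * f x)"
    by (intro rapid_integrable rapid_mult[OF assms(1), of _ 1 1]) auto
  from integrable_norm[OF this] show ?thesis by (simp add: norm_mult)
qed


subsection \<open>The Fourier transform on a Euclidean space\<close>

text \<open>The transform of the theorem with the trace written as an inner product. It is set on an
  arbitrary Euclidean space because the slice theorem also applies it to the upper blocks
  alone.\<close>

definition FT :: "('a::euclidean_space \<Rightarrow> complex) \<Rightarrow> 'a \<Rightarrow> complex" where
  "FT u y = (LINT x|lborel. cis (y \<bullet> x) * u x)"

lemma borel_measurable_cis [measurable (raw)]:
  "f \<in> borel_measurable M \<Longrightarrow> (\<lambda>x. cis (f x)) \<in> borel_measurable M"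
  unfolding cis_conv_exp by measurable

lemma norm_cis_minus_one: "norm (cis t - 1) \<le> \<bar>t\<bar>"
  using iexp_approx1[of t 0] by (simp add: cis_conv_exp)

lemma integrable_cis_mult:
  "u \<in> borel_measurable M \<Longrightarrow> f \<in> borel_measurable M \<Longrightarrow> integrable M (\<lambda>x. cis (f x) * u x) \<longleftrightarrow> integrable M u"
  by (subst (1 2) integrable_norm_iff[symmetric]) (auto simp: norm_mult)

lemma norm_FT_le: "norm (FT u y) \<le> (LINT x|lborel. norm (u x))"
  unfolding FT_def by (rule order_trans[OF integral_norm_bound]) (simp add: norm_mult)

lemma FT_continuous:
  assumes "integrable lborel u"
  shows "continuous_on UNIV (FT u)"
proof -
  have [measurable]: "u \<in> borel_measurable borel" using borel_measurable_integrable[OF assms] by simp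
  show ?thesis
    unfolding continuous_on_sequentially comp_def FT_def
  proof (intro allI ballI impI, elim conjE)
    fix X a assume X: "X \<longlonglongrightarrow> (a::'a)"
    show "(\<lambda>n. LINT x|lborel. cis (X n \<bullet> x) * u x) \<longlonglongrightarrow> (LINT x|lborel. cis (a \<bullet> x) * u x)"
    proof (rule integral_dominated_convergence[where w = "\<lambda>x. norm (u x)"])
      show "AE x in lborel. (\<lambda>n. cis (X n \<bullet> x) * u x) \<longlonglongrightarrow> cis (a \<bullet> x) * u x"
        unfolding cis_conv_exp using X by (intro AE_I2 tendsto_intros)
    qed (use assms in \<open>auto simp: norm_mult\<close>)
  qed
qed

lemma FT_measurable:
  assumes "integrable lborel u"
  shows "FT u \<in> borel_measurable borel"
  using FT_continuous[OF assms] by (rule borel_measurable_continuous_onI)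

section \<open>Gaussians and Fourier inversion\<close>

lemma
  shows integrable_gaussian_real: "integrable lborel (\<lambda>x::real. exp (- x\<^sup>2 / 2))"
    and FT_gaussian_real: "(LINT x|lborel. cis (x * t) * complex_of_real (exp (- x\<^sup>2 / 2))) = sqrt (2 * pi) * exp (- t\<^sup>2 / 2)"
proof -
  have "integrable lborel (\<lambda>x. sqrt (2 * pi) * std_normal_density x)"
    by (intro integrable_mult_right) (rule integrable_normal_density, simp)
  then show "integrable lborel (\<lambda>x::real. exp (- x\<^sup>2 / 2))"
    by (simp add: normal_density_def)
  have "complex_of_real (exp (- t\<^sup>2 / 2)) = char std_normal_distribution t"
    by (simp add: char_std_normal_distribution)
  also have "\<dots> = (LINT x|lborel. std_normal_density x *\<^sub>R iexp (t * x))"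
    unfolding char_def by (subst integral_density) (auto simp: normal_density_nonneg)
  also have "\<dots> = (LINT x|lborel. complex_of_real (1 / sqrt (2 * pi)) * (cis (x * t) * complex_of_real (exp (- x\<^sup>2 / 2))))"
    by (intro Bochner_Integration.integral_cong) (auto simp: normal_density_def scaleR_conv_of_real cis_conv_exp mult_ac)
  also have "\<dots> = complex_of_real (1 / sqrt (2 * pi)) * (LINT x|lborel. cis (x * t) * complex_of_real (exp (- x\<^sup>2 / 2)))"
    by (rule integral_mult_right_zero)
  finally show "(LINT x|lborel. cis (x * t) * complex_of_real (exp (- x\<^sup>2 / 2))) = sqrt (2 * pi) * exp (- t\<^sup>2 / 2)"
    by (simp add: field_simps)
qed

lemma gaussian_eq_prod: "exp (- (norm x)\<^sup>2 / 2) = (\<Prod>b\<in>Basis. exp (- (x \<bullet> b)\<^sup>2 / 2))" for x :: "'a::euclidean_space"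
proof -
  have "(norm x)\<^sup>2 = x \<bullet> x" by (rule power2_norm_eq_inner)
  also have "\<dots> = (\<Sum>b\<in>Basis. (x \<bullet> b)\<^sup>2)"
    by (subst euclidean_inner) (simp add: power2_eq_square)
  finally have "(norm x)\<^sup>2 = (\<Sum>b\<in>Basis. (x \<bullet> b)\<^sup>2)" .
  then show ?thesis
    by (simp add: exp_sum[symmetric] sum_divide_distrib sum_negf)
qed

lemma integrable_gaussian: "integrable lborel (\<lambda>x::'a::euclidean_space. exp (- (norm x)\<^sup>2 / 2))"
  unfolding gaussian_eq_prod by (intro lborel_integrable_prod integrable_gaussian_real)

lemma FT_gaussian:
  "(LINT x|lborel. cis (x \<bullet> y) * complex_of_real (exp (- (norm x)\<^sup>2 / 2)))
    = complex_of_real (sqrt (2 * pi) ^ DIM('a) * exp (- (norm (y::'a::euclidean_space))\<^sup>2 / 2))"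
proof -
  have int: "integrable lborel (\<lambda>x::real. cis (x * t) * complex_of_real (exp (- x\<^sup>2 / 2)))" for t
    by (subst integrable_cis_mult) (use integrable_of_real[OF integrable_gaussian_real] in auto)
  have cis: "cis (x \<bullet> y) = (\<Prod>b\<in>Basis. cis ((x \<bullet> b) * (y \<bullet> b)))" for x
    by (subst euclidean_inner) (simp add: cis_conv_exp sum_distrib_left exp_sum)
  have "(LINT x|lborel. cis (x \<bullet> y) * complex_of_real (exp (- (norm x)\<^sup>2 / 2)))
     = (LINT x|lborel. (\<Prod>b\<in>Basis. cis ((x \<bullet> b) * (y \<bullet> b)) * complex_of_real (exp (- (x \<bullet> b)\<^sup>2 / 2))))"
    unfolding gaussian_eq_prod cis by (simp add: prod.distrib)
  also have "\<dots> = (\<Prod>b\<in>Basis. LINT x|lborel. cis (x * (y \<bullet> b)) * complex_of_real (exp (- x\<^sup>2 / 2)))"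
    by (intro lborel_integral_prod int)
  also have "\<dots> = complex_of_real (sqrt (2 * pi) ^ DIM('a) * exp (- (norm y)\<^sup>2 / 2))"
    unfolding gaussian_eq_prod FT_gaussian_real by (simp add: prod.distrib)
  finally show ?thesis .
qed

lemma integral_gaussian:
  "(LINT x::'a::euclidean_space|lborel. exp (- (norm x)\<^sup>2 / 2)) = sqrt (2 * pi) ^ DIM('a)"
proof -
  have "complex_of_real (LINT x::'a::euclidean_space|lborel. exp (- (norm x)\<^sup>2 / 2)) = sqrt (2 * pi) ^ DIM('a)"
    using FT_gaussian[of "0::'a"] by (simp flip: integral_of_real)
  then show ?thesis using of_real_eq_iff by blast
qed

text \<open>Gaussian regularisation: \<open>FT u\<close> is multiplied by a Gaussian that widens to
  the constant 1, and the same integral, transformed, averages \<open>u\<close> over Gaussians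
  shrinking to 0. Continuity is required at 0 only, so the result can be applied to functions that
  are themselves defined as integrals over fibres.\<close>

theorem FT_inversion_at_zero:
  fixes u :: "'a::euclidean_space \<Rightarrow> complex"
  assumes u: "integrable lborel u" and bdd: "\<And>x. norm (u x) \<le> B" and cont: "isCont u 0"
    and FTu: "integrable lborel (FT u)"
  shows "(LINT y|lborel. FT u y) = complex_of_real ((2 * pi) ^ DIM('a)) * u 0"
proof -
  let ?d = "DIM('a)"
  have [measurable]: "u \<in> borel_measurable borel" using borel_measurable_integrable[OF u] by simp
  have [measurable]: "FT u \<in> borel_measurable borel" by (rule FT_measurable[OF u])
  define G where "G x = exp (- (norm x)\<^sup>2 / 2)" for x :: 'a
  have [measurable]: "G \<in> borel_measurable borel" unfolding G_def by measurable
  have G: "integrable lborel G" unfolding G_def by (rule integrable_gaussian)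
  have G0: "G x \<ge> 0" "G x \<le> 1" for x by (auto simp: G_def)
  have FTG: "(LINT y|lborel. cis (y \<bullet> x) * complex_of_real (G y)) = complex_of_real (sqrt (2 * pi) ^ ?d * G x)" for x
    unfolding G_def by (rule FT_gaussian)
  define s where "s j = inverse (real (Suc j))" for j
  have s: "s j > 0" for j by (simp add: s_def)
  have s0: "s \<longlonglongrightarrow> 0" unfolding s_def by (rule LIMSEQ_inverse_real_of_nat)
  have Gs: "integrable lborel (\<lambda>y. G (s j *\<^sub>R y))" for j
  proof -
    have "integrable (density (distr lborel borel (\<lambda>x::'a. 0 + inverse (s j) *\<^sub>R x)) (\<lambda>_. ennreal (\<bar>inverse (s j)\<bar>^?d))) (\<lambda>y. G (s j *\<^sub>R y))"
      using s[of j] by (subst integrable_density) (auto simp: integrable_distr_eq G)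
    then show ?thesis
      using s[of j] lborel_affine[of "inverse (s j)" "0::'a"] by simp
  qed
  \<comment> \<open>Fubini's theorem moves the transform from \<open>u\<close> to the dilated
    Gaussian, and a dilation of \<open>x\<close> then moves the parameter \<open>s j\<close> into
    \<open>u\<close>. The factor here is that of the transform of \<open>G\<close>; a second equal
    factor appears in the limit as the integral of \<open>G\<close>, and together they give the
    power of \<open>2 * pi\<close>.\<close>
  have key: "(LINT y|lborel. FT u y * G (s j *\<^sub>R y)) = complex_of_real (sqrt (2 * pi) ^ ?d) * (LINT x|lborel. u (s j *\<^sub>R x) * G x)" for j
  proof -
    have int: "integrable (lborel \<Otimes>\<^sub>M lborel) (\<lambda>(y,x). cis (y \<bullet> x) * u x * G (s j *\<^sub>R y))"
    proof (rule lborel_pair.Fubini_integrable)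
      show "integrable lborel (\<lambda>y. LINT x|lborel. norm (case (y, x) of (y, x) \<Rightarrow> cis (y \<bullet> x) * u x * complex_of_real (G (s j *\<^sub>R y))))"
        using G0 Gs by (simp add: norm_mult)
      show "AE y in lborel. integrable lborel (\<lambda>x. case (y, x) of (y, x) \<Rightarrow> cis (y \<bullet> x) * u x * complex_of_real (G (s j *\<^sub>R y)))"
        using u by (auto intro!: integrable_mult_left simp: integrable_cis_mult)
    qed simp
    have "(LINT y|lborel. FT u y * G (s j *\<^sub>R y)) = (LINT y|lborel. LINT x|lborel. cis (y \<bullet> x) * u x * G (s j *\<^sub>R y))"
      unfolding FT_def by simp
    also have "\<dots> = (LINT x|lborel. LINT y|lborel. cis (y \<bullet> x) * u x * G (s j *\<^sub>R y))"
      using lborel_pair.Fubini_integral[OF int] by simp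
    also have "\<dots> = (LINT x|lborel. u x * (LINT y|lborel. cis (y \<bullet> x) * complex_of_real (G (s j *\<^sub>R y))))"
      by (subst integral_mult_right_zero[symmetric]) (simp add: mult_ac)
    also have "\<dots> = (LINT x|lborel. u x * (inverse (s j) ^ ?d *\<^sub>R complex_of_real (sqrt (2 * pi) ^ ?d * G (inverse (s j) *\<^sub>R x))))"
    proof -
      have "(LINT y|lborel. cis (y \<bullet> x) * complex_of_real (G (s j *\<^sub>R y))) = inverse (s j) ^ ?d *\<^sub>R complex_of_real (sqrt (2 * pi) ^ ?d * G (inverse (s j) *\<^sub>R x))" for x
      proof -
        have "(LINT y|lborel. cis (y \<bullet> x) * complex_of_real (G (s j *\<^sub>R y)))
          = inverse (s j) ^ ?d *\<^sub>R (LINT y|lborel. cis (y \<bullet> (inverse (s j) *\<^sub>R x)) * complex_of_real (G y))"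
          using s[of j] lborel_integral_scale[of "\<lambda>y. cis (y \<bullet> x) * complex_of_real (G (s j *\<^sub>R y))" "inverse (s j)"]
          by simp
        then show ?thesis unfolding FTG .
      qed
      then show ?thesis by (simp only:)
    qed
    also have "\<dots> = (LINT x|lborel. inverse (s j) ^ ?d *\<^sub>R (complex_of_real (sqrt (2 * pi) ^ ?d) * (u x * complex_of_real (G (inverse (s j) *\<^sub>R x)))))"
      by (intro Bochner_Integration.integral_cong refl)
         (simp only: scaleR_conv_of_real of_real_mult mult_ac)
    also have "\<dots> = inverse (s j) ^ ?d *\<^sub>R (s j ^ ?d *\<^sub>R (LINT x|lborel. complex_of_real (sqrt (2 * pi) ^ ?d) * (u (s j *\<^sub>R x) * complex_of_real (G x))))"
      using s[of j] lborel_integral_scale[of "\<lambda>x. complex_of_real (sqrt (2 * pi) ^ ?d) * (u x * complex_of_real (G (inverse (s j) *\<^sub>R x)))" "s j"]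
      by simp
    also have "\<dots> = complex_of_real (sqrt (2 * pi) ^ ?d) * (LINT x|lborel. u (s j *\<^sub>R x) * G x)"
      using s[of j] by (simp add: power_inverse)
    finally show ?thesis .
  qed
  have G00: "G 0 = 1" by (simp add: G_def)
  have contG: "isCont G x" for x unfolding G_def by (intro continuous_intros) auto
  have sx: "(\<lambda>j. s j *\<^sub>R x) \<longlonglongrightarrow> 0" for x :: 'a
    using tendsto_scaleR[OF s0 tendsto_const[of x]] by simp
  have "(\<lambda>j. LINT y|lborel. FT u y * G (s j *\<^sub>R y)) \<longlonglongrightarrow> (LINT y|lborel. FT u y)"
  proof (rule integral_dominated_convergence[where w = "\<lambda>y. norm (FT u y)"])
    have "(\<lambda>j. FT u y * complex_of_real (G (s j *\<^sub>R y))) \<longlonglongrightarrow> FT u y * complex_of_real (G 0)" for y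
      by (intro tendsto_intros isCont_tendsto_compose[OF contG sx])
    then show "AE y in lborel. (\<lambda>j. FT u y * complex_of_real (G (s j *\<^sub>R y))) \<longlonglongrightarrow> FT u y"
      by (simp add: G00)
    show "AE y in lborel. norm (FT u y * complex_of_real (G (s j *\<^sub>R y))) \<le> norm (FT u y)" for j
      using G0 by (auto simp: norm_mult mult_left_le)
  qed (use FTu in auto)
  moreover have "(\<lambda>j. LINT x|lborel. u (s j *\<^sub>R x) * G x) \<longlonglongrightarrow> (LINT x|lborel. u 0 * G x)"
  proof (rule integral_dominated_convergence[where w = "\<lambda>x. B * G x"])
    show "AE x in lborel. (\<lambda>j. u (s j *\<^sub>R x) * complex_of_real (G x)) \<longlonglongrightarrow> u 0 * complex_of_real (G x)"
      by (intro AE_I2 tendsto_intros isCont_tendsto_compose[OF cont sx])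
    show "AE x in lborel. norm (u (s j *\<^sub>R x) * complex_of_real (G x)) \<le> B * G x" for j
      using G0 bdd by (auto simp: norm_mult intro!: mult_right_mono)
  qed (use G in auto)
  then have "(\<lambda>j. complex_of_real (sqrt (2 * pi) ^ ?d) * (LINT x|lborel. u (s j *\<^sub>R x) * G x)) \<longlonglongrightarrow> complex_of_real (sqrt (2 * pi) ^ ?d) * (LINT x|lborel. u 0 * G x)"
    by (intro tendsto_intros)
  ultimately have "(LINT y|lborel. FT u y) = complex_of_real (sqrt (2 * pi) ^ ?d) * (LINT x|lborel. u 0 * G x)"
    unfolding key by (rule LIMSEQ_unique)
  also have "(LINT x|lborel. u 0 * complex_of_real (G x)) = u 0 * complex_of_real (sqrt (2 * pi) ^ ?d)"
    using integral_gaussian[where 'a='a] by (simp add: G_def[abs_def])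
  also have "complex_of_real (sqrt (2 * pi) ^ ?d) * (u 0 * complex_of_real (sqrt (2 * pi) ^ ?d))
      = complex_of_real (sqrt (2 * pi) ^ ?d * sqrt (2 * pi) ^ ?d) * u 0"
    by (simp only: of_real_mult mult_ac)
  also have "sqrt (2 * pi) ^ ?d * sqrt (2 * pi) ^ ?d = (2 * pi) ^ ?d"
    by (simp only: power_mult_distrib[symmetric]) simp
  finally show ?thesis .
qed



section \<open>Directional derivatives and the Fourier transform\<close>

lemma has_vector_derivative_0_sequentially:
  fixes f :: "real \<Rightarrow> 'a::real_normed_vector"
  shows "(f has_vector_derivative D) (at 0) \<longleftrightarrow>
    (\<forall>h. (\<forall>n. h n \<noteq> 0) \<and> h \<longlonglongrightarrow> 0 \<longrightarrow> (\<lambda>n. (f (h n) - f 0) /\<^sub>R h n) \<longlonglongrightarrow> D)"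
proof -
  have "(f has_vector_derivative D) (at 0) \<longleftrightarrow> ((\<lambda>h. norm (f h - f 0 - h *\<^sub>R D) / norm h) \<longlongrightarrow> 0) (at 0)"
    by (simp add: has_vector_derivative_def has_derivative_at bounded_linear_scaleR_left)
  also have "\<dots> \<longleftrightarrow> ((\<lambda>h. norm ((f h - f 0) /\<^sub>R h - D)) \<longlongrightarrow> 0) (at 0)"
  proof (rule tendsto_cong)
    have "norm (f h - f 0 - h *\<^sub>R D) / norm h = norm ((f h - f 0) /\<^sub>R h - D)" if "h \<noteq> 0" for h
    proof -
      have "f h - f 0 - h *\<^sub>R D = h *\<^sub>R ((f h - f 0) /\<^sub>R h - D)"
        using that by (simp add: scaleR_diff_right)
      then show ?thesis using that by simp
    qed
    then show "\<forall>\<^sub>F h in at 0. norm (f h - f 0 - h *\<^sub>R D) / norm h = norm ((f h - f 0) /\<^sub>R h - D)"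
      by (auto simp: eventually_at_filter)
  qed
  also have "\<dots> \<longleftrightarrow> ((\<lambda>h. (f h - f 0) /\<^sub>R h) \<longlongrightarrow> D) (at 0)"
    by (simp add: tendsto_norm_zero_iff LIM_zero_iff)
  also have "\<dots> \<longleftrightarrow> (\<forall>h. (\<forall>n. h n \<noteq> 0) \<and> h \<longlonglongrightarrow> 0 \<longrightarrow> (\<lambda>n. (f (h n) - f 0) /\<^sub>R h n) \<longlonglongrightarrow> D)"
    by (auto simp: tendsto_at_iff_sequentially comp_def)
  finally show ?thesis .
qed

text \<open>Differentiability along one direction at every point, without a total derivative: on the
  rank-deficient matrices the class \<open>gdet_flat\<close> is examined along lines only.\<close>

definition has_dirderiv ::
    "('a::real_normed_vector \<Rightarrow> complex) \<Rightarrow> 'a \<Rightarrow> ('a \<Rightarrow> complex) \<Rightarrow> bool" where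
  "has_dirderiv f b f' \<longleftrightarrow> (\<forall>x. ((\<lambda>s. f (x + s *\<^sub>R b)) has_vector_derivative f' x) (at 0))"

lemma has_dirderiv_at:
  assumes "has_dirderiv f b f'"
  shows "((\<lambda>s. f (x + s *\<^sub>R b)) has_vector_derivative f' (x + s *\<^sub>R b)) (at s)"
proof -
  have "((\<lambda>t. f (x + s *\<^sub>R b + t *\<^sub>R b)) has_vector_derivative f' (x + s *\<^sub>R b)) (at (s - s))"
    using assms unfolding has_dirderiv_def by simp
  moreover have "((\<lambda>t. t - s) has_vector_derivative 1) (at s)"
    using has_vector_derivative_diff[OF has_vector_derivative_id has_vector_derivative_const[of s]] by simp
  ultimately have "((\<lambda>t. f (x + s *\<^sub>R b + t *\<^sub>R b)) \<circ> (\<lambda>t. t - s) has_vector_derivative 1 *\<^sub>R f' (x + s *\<^sub>R b)) (at s)"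
    by (intro vector_diff_chain_at)
  then show ?thesis by (simp add: comp_def algebra_simps)
qed

lemma has_dirderiv_bound:
  assumes f: "has_dirderiv f b f'" and B: "\<And>s. 0 < s \<Longrightarrow> s < h \<Longrightarrow> norm (f' (x + s *\<^sub>R b)) \<le> B" and "0 < h"
  shows "norm (f (x + h *\<^sub>R b) - f x) \<le> B * h"
proof -
  have *: "((\<lambda>s. f (x + s *\<^sub>R b)) has_derivative (\<lambda>t. t *\<^sub>R f' (x + s *\<^sub>R b))) (at s within S)" for s S
    using has_dirderiv_at[OF f, of x s] by (simp add: has_vector_derivative_def has_derivative_at_withinI)
  have "\<exists>s\<in>{0<..<h}. norm (f (x + h *\<^sub>R b) - f (x + 0 *\<^sub>R b)) \<le> norm ((h - 0) *\<^sub>R f' (x + s *\<^sub>R b))"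
    by (rule mvt_general[OF \<open>0 < h\<close>])
       (auto intro: * has_derivative_continuous[OF *] simp: continuous_on_eq_continuous_within)
  then obtain s where "0 < s" "s < h" "norm (f (x + h *\<^sub>R b) - f x) \<le> h * norm (f' (x + s *\<^sub>R b))"
    using \<open>0 < h\<close> by auto
  with B[of s] \<open>0 < h\<close> show ?thesis
    by (smt (verit) mult.commute mult_left_mono)
qed

text \<open>Both sides of the difference quotient have the same integral, by translation invariance.\<close>

lemma integral_dirderiv_eq_0:
  fixes f :: "'a::euclidean_space \<Rightarrow> complex"
  assumes f: "has_dirderiv f b f'" and "rapid f" "rapid f'"
    and [measurable]: "f \<in> borel_measurable borel" "f' \<in> borel_measurable borel"
  shows "(LINT x|lborel. f' x) = 0"
proof -
  let ?N = "2 * DIM('a)"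
  define h where "h j = inverse (real (Suc j))" for j
  have h: "h j > 0" "h j \<le> 1" for j by (auto simp: h_def divide_simps)
  have h0: "h \<longlonglongrightarrow> 0" unfolding h_def by (rule LIMSEQ_inverse_real_of_nat)
  obtain C where C0: "C \<ge> 0" and C: "\<And>x. norm (f' x) \<le> C / (1 + norm x) ^ ?N"
    using rapidE[OF \<open>rapid f'\<close>] by metis
  \<comment> \<open>For steps of size at most 1, \<open>1 + norm x \<le> (1 + norm b) * (1 + norm (x
    + s *\<^sub>R b))\<close>. Raised to the power \<open>?N\<close>, this turns the decay of
    \<open>f'\<close> into a majorant that is uniform along the step.\<close>
  define D where "D = C * (1 + norm b) ^ ?N"
  have bound: "norm (f' (x + s *\<^sub>R b)) \<le> D / (1 + norm x) ^ ?N" if "0 < s" "s < h j" for x s j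
  proof -
    have s: "\<bar>s\<bar> \<le> 1" using that h[of j] by auto
    have "norm x \<le> norm (x + s *\<^sub>R b) + norm (s *\<^sub>R b)"
      using norm_triangle_ineq4[of "x + s *\<^sub>R b" "s *\<^sub>R b"] by simp
    also have "norm (s *\<^sub>R b) \<le> norm b" using s by (simp add: mult_left_le_one_le)
    finally have "norm x \<le> norm (x + s *\<^sub>R b) + norm b" by simp
    then have "1 + norm x \<le> (1 + norm b) * (1 + norm (x + s *\<^sub>R b))"
    proof -
      assume "norm x \<le> norm (x + s *\<^sub>R b) + norm b"
      moreover have "0 \<le> norm b * norm (x + s *\<^sub>R b)" by simp
      ultimately show ?thesis unfolding distrib_left distrib_right by linarith
    qed
    then have "(1 + norm x) ^ ?N \<le> (1 + norm b) ^ ?N * (1 + norm (x + s *\<^sub>R b)) ^ ?N"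
      by (subst power_mult_distrib[symmetric], intro power_mono) auto
    then have "C * (1 + norm x) ^ ?N \<le> C * ((1 + norm b) ^ ?N * (1 + norm (x + s *\<^sub>R b)) ^ ?N)"
      using C0 by (rule mult_left_mono)
    then have "C / (1 + norm (x + s *\<^sub>R b)) ^ ?N \<le> D / (1 + norm x) ^ ?N"
    proof -
      assume *: "C * (1 + norm x) ^ ?N \<le> C * ((1 + norm b) ^ ?N * (1 + norm (x + s *\<^sub>R b)) ^ ?N)"
      have "(1 + norm x) ^ ?N > 0" "(1 + norm (x + s *\<^sub>R b)) ^ ?N > 0"
        by (simp_all add: add_pos_nonneg)
      with * show ?thesis
        by (subst pos_divide_le_eq) (simp_all add: D_def pos_le_divide_eq mult_ac)
    qed
    then show ?thesis using C[of "x + s *\<^sub>R b"] by linarith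
  qed
  have "(\<lambda>j. LINT x|lborel. (f (x + h j *\<^sub>R b) - f x) /\<^sub>R h j) \<longlonglongrightarrow> (LINT x|lborel. f' x)"
  proof (rule integral_dominated_convergence[where w = "\<lambda>x. D * (1 / (1 + norm x) ^ ?N)"])
    show "integrable lborel (\<lambda>x::'a. D * (1 / (1 + norm x) ^ ?N))"
      by (intro integrable_mult_right integrable_one_plus_norm_powr)
    have "(\<lambda>j. (f (x + h j *\<^sub>R b) - f (x + 0 *\<^sub>R b)) /\<^sub>R h j) \<longlonglongrightarrow> f' x" for x
    proof -
      have "((\<lambda>s. f (x + s *\<^sub>R b)) has_vector_derivative f' x) (at 0)"
        using f by (simp add: has_dirderiv_def)
      moreover have "\<forall>n. h n \<noteq> 0" using h(1) by (simp add: less_imp_neq[symmetric])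
      ultimately show ?thesis using h0 unfolding has_vector_derivative_0_sequentially by blast
    qed
    then show "AE x in lborel. (\<lambda>j. (f (x + h j *\<^sub>R b) - f x) /\<^sub>R h j) \<longlonglongrightarrow> f' x" by simp
    have "norm ((f (x + h j *\<^sub>R b) - f x) /\<^sub>R h j) \<le> D * (1 / (1 + norm x) ^ ?N)" for x j
    proof -
      have "norm (f (x + h j *\<^sub>R b) - f x) \<le> D / (1 + norm x) ^ ?N * h j"
        by (rule has_dirderiv_bound[OF f _ h(1)]) (rule bound)
      then show ?thesis using h(1)[of j] by (simp add: divide_inverse mult_ac pos_divide_le_eq)
        (simp add: field_simps)
    qed
    then show "AE x in lborel. norm ((f (x + h j *\<^sub>R b) - f x) /\<^sub>R h j) \<le> D * (1 / (1 + norm x) ^ ?N)" for j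
      by simp
  qed auto
  moreover have "(LINT x|lborel. (f (x + h j *\<^sub>R b) - f x) /\<^sub>R h j) = 0" for j
  proof -
    have "integrable lborel f" by (rule rapid_integrable) fact+
    then have "(LINT x|lborel. f (x + h j *\<^sub>R b) - f x) = 0"
      by (subst Bochner_Integration.integral_diff)
         (auto intro: lborel_integrable_translation simp: lborel_integral_translation)
    then show ?thesis by simp
  qed
  ultimately show ?thesis by (simp only: LIMSEQ_const_iff)
qed

lemma has_vector_derivative_cis_linear:
  "((\<lambda>s. cis (a + s * c)) has_vector_derivative \<i> * complex_of_real c * cis a) (at 0)"
proof -
  have "((\<lambda>z. exp (\<i> * (complex_of_real a + z * complex_of_real c))) has_field_derivative
      \<i> * complex_of_real c * cis a) (at (complex_of_real 0))"
    unfolding cis_conv_exp by (rule derivative_eq_intros refl | simp)+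
  from has_vector_derivative_real_field[OF this] show ?thesis by (simp add: cis_conv_exp)
qed

text \<open>Integration by parts: the product rule splits the derivative of
  \<open>cis (y \<bullet> x) * u x\<close> along \<open>b\<close>, and the integral of that
  derivative is zero.\<close>

lemma FT_dirderiv:
  fixes u :: "'a::euclidean_space \<Rightarrow> complex"
  assumes u: "has_dirderiv u b u'" and "rapid u" "rapid u'"
    and [measurable]: "u \<in> borel_measurable borel" "u' \<in> borel_measurable borel"
  shows "FT u' y = - (\<i> * complex_of_real (y \<bullet> b) * FT u y)"
proof -
  have intu: "integrable lborel (\<lambda>x. cis (y \<bullet> x) * u x)" "integrable lborel (\<lambda>x. cis (y \<bullet> x) * u' x)"
    using assms by (auto simp: integrable_cis_mult intro!: rapid_integrable)
  have "(LINT x|lborel. \<i> * complex_of_real (y \<bullet> b) * (cis (y \<bullet> x) * u x) + cis (y \<bullet> x) * u' x) = 0"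
  proof (rule integral_dirderiv_eq_0[where f = "\<lambda>x. cis (y \<bullet> x) * u x" and b = b])
    show "has_dirderiv (\<lambda>x. cis (y \<bullet> x) * u x) b
            (\<lambda>x. \<i> * complex_of_real (y \<bullet> b) * (cis (y \<bullet> x) * u x) + cis (y \<bullet> x) * u' x)"
      unfolding has_dirderiv_def
    proof
      fix x
      have "((\<lambda>s. cis (y \<bullet> x + s * (y \<bullet> b))) has_vector_derivative \<i> * complex_of_real (y \<bullet> b) * cis (y \<bullet> x)) (at 0)"
        by (rule has_vector_derivative_cis_linear)
      moreover have "((\<lambda>s. u (x + s *\<^sub>R b)) has_vector_derivative u' x) (at 0)"
        using u by (simp add: has_dirderiv_def)
      ultimately have "((\<lambda>s. cis (y \<bullet> x + s * (y \<bullet> b)) * u (x + s *\<^sub>R b)) has_vector_derivative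
           cis (y \<bullet> x + 0 * (y \<bullet> b)) * u' x + \<i> * complex_of_real (y \<bullet> b) * cis (y \<bullet> x) * u (x + 0 *\<^sub>R b)) (at 0)"
        by (rule has_vector_derivative_mult)
      then show "((\<lambda>s. cis (y \<bullet> (x + s *\<^sub>R b)) * u (x + s *\<^sub>R b)) has_vector_derivative
           \<i> * complex_of_real (y \<bullet> b) * (cis (y \<bullet> x) * u x) + cis (y \<bullet> x) * u' x) (at 0)"
        by (simp add: inner_add_right algebra_simps)
    qed
    have *: "rapid (\<lambda>x. cis (y \<bullet> x) * v x)" if "rapid v" for v
      using that by (rule rapid_mult[where A = 1 and M = 0]) simp
    show "rapid (\<lambda>x. cis (y \<bullet> x) * u x)" by (rule *) fact
    show "rapid (\<lambda>x. \<i> * complex_of_real (y \<bullet> b) * (cis (y \<bullet> x) * u x) + cis (y \<bullet> x) * u' x)"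
      by (intro rapid_add rapid_cmult *) fact+
  qed simp_all
  then have "\<i> * complex_of_real (y \<bullet> b) * FT u y + FT u' y = 0"
    unfolding FT_def
    by (subst (asm) Bochner_Integration.integral_add) (use intu in \<open>auto intro: integrable_mult_right\<close>)
  then show ?thesis by (simp add: add_eq_0_iff)
qed

text \<open>Each derivative of \<open>u\<close> pays for one factor \<open>y \<bullet> b\<close>,
  and \<open>norm y\<close> is at most the sum of the absolute values of these factors. The class
  \<open>K\<close> takes the place of the Schwartz space, so that closure under one derivative is
  all that has to be verified; the induction runs over all members of \<open>K\<close> at
  once.\<close>

lemma FT_rapid:
  fixes u :: "'a::euclidean_space \<Rightarrow> complex"
  assumes K: "u \<in> K"
    and closed: "\<And>v b. v \<in> K \<Longrightarrow> b \<in> Basis \<Longrightarrow> \<exists>v'\<in>K. has_dirderiv v b v'"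
    and rapid: "\<And>v. v \<in> K \<Longrightarrow> rapid v"
    and meas: "\<And>v. v \<in> K \<Longrightarrow> v \<in> borel_measurable borel"
  shows "rapid (FT u)"
proof (rule rapidI)
  fix N
  show "\<exists>C. \<forall>y. (1 + norm y) ^ N * norm (FT u y) \<le> C"
    using K
  proof (induction N arbitrary: u)
    case 0
    show ?case by (auto intro: norm_FT_le)
  next
    case (Suc N)
    have "\<exists>v'. \<forall>b\<in>Basis. v' b \<in> K \<and> has_dirderiv u b (v' b)"
      using closed[OF Suc.prems] by (intro bchoice) auto
    then obtain v' where v': "\<And>b. b \<in> Basis \<Longrightarrow> v' b \<in> K" "\<And>b. b \<in> Basis \<Longrightarrow> has_dirderiv u b (v' b)"
      by blast
    obtain C0 where C0: "\<And>y. (1 + norm y) ^ N * norm (FT u y) \<le> C0" using Suc by blast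
    have "\<exists>C. \<forall>b\<in>Basis. \<forall>y. (1 + norm y) ^ N * norm (FT (v' b) y) \<le> C b"
      using Suc.IH v' by (intro bchoice) auto
    then obtain C where C: "\<And>b y. b \<in> Basis \<Longrightarrow> (1 + norm y) ^ N * norm (FT (v' b) y) \<le> C b"
      by blast
    have "(1 + norm y) ^ Suc N * norm (FT u y) \<le> C0 + (\<Sum>b\<in>Basis. C b)" for y
    proof -
      have eq: "norm (FT (v' b) y) = \<bar>y \<bullet> b\<bar> * norm (FT u y)" if "b \<in> Basis" for b
        using that v' Suc.prems by (subst FT_dirderiv[of u b]) (auto simp: norm_mult rapid meas)
      have "(1 + norm y) ^ Suc N * norm (FT u y)
          \<le> (1 + (\<Sum>b\<in>Basis. \<bar>y \<bullet> b\<bar>)) * ((1 + norm y) ^ N * norm (FT u y))"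
        using norm_le_l1[of y] by (simp add: mult.assoc mult_right_mono)
      also have "\<dots> = (1 + norm y) ^ N * norm (FT u y) + (\<Sum>b\<in>Basis. (1 + norm y) ^ N * norm (FT (v' b) y))"
        unfolding distrib_right sum_distrib_right mult_1
        by (intro arg_cong2[where f = "(+)"] sum.cong refl) (simp only: eq mult_ac)
      also have "\<dots> \<le> C0 + (\<Sum>b\<in>Basis. C b)"
        by (intro add_mono C0 sum_mono C)
      finally show ?thesis .
    qed
    then show ?case by blast
  qed
qed

lemma has_dirderiv_FT:
  fixes u :: "'a::euclidean_space \<Rightarrow> complex"
  assumes "rapid u" and [measurable]: "u \<in> borel_measurable borel"
  shows "has_dirderiv (FT u) b (FT (\<lambda>x. \<i> * complex_of_real (x \<bullet> b) * u x))"
  \<comment> \<open>The sequential form of the derivative makes dominated convergence available for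
    difference quotients. The majorant comes from
    \<open>norm (cis t - 1) \<le> \<bar>t\<bar>\<close>, at the price of one factor
    \<open>norm x\<close>, which rapid decay absorbs.\<close>
  unfolding has_dirderiv_def has_vector_derivative_0_sequentially
proof (intro allI impI, elim conjE)
  fix y and h :: "nat \<Rightarrow> real"
  assume h: "\<forall>n. h n \<noteq> 0" "h \<longlonglongrightarrow> 0"
  have [simp]: "integrable lborel u" by (rule rapid_integrable) fact+
  let ?g = "\<lambda>n x. (cis ((y + h n *\<^sub>R b) \<bullet> x) * u x - cis (y \<bullet> x) * u x) /\<^sub>R h n"
  have "(\<lambda>n. LINT x|lborel. ?g n x) \<longlonglongrightarrow> (LINT x|lborel. cis (y \<bullet> x) * (\<i> * complex_of_real (x \<bullet> b) * u x))"
  proof (rule integral_dominated_convergence[where w = "\<lambda>x. norm b * (norm x * norm (u x))"])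
    show "integrable lborel (\<lambda>x. norm b * (norm x * norm (u x)))"
      using integrable_norm_rapid[OF assms] by (rule integrable_mult_right)
    have "(\<lambda>n. ?g n x) \<longlonglongrightarrow> cis (y \<bullet> x) * (\<i> * complex_of_real (x \<bullet> b) * u x)" for x
    proof -
      have "(\<lambda>n. (cis (y \<bullet> x + h n * (b \<bullet> x)) - cis (y \<bullet> x + 0 * (b \<bullet> x))) /\<^sub>R h n)
          \<longlonglongrightarrow> \<i> * complex_of_real (b \<bullet> x) * cis (y \<bullet> x)"
        using has_vector_derivative_cis_linear[of "y \<bullet> x" "b \<bullet> x"] h
        unfolding has_vector_derivative_0_sequentially by blast
      then have "(\<lambda>n. (cis (y \<bullet> x + h n * (b \<bullet> x)) - cis (y \<bullet> x + 0 * (b \<bullet> x))) /\<^sub>R h n * u x)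
          \<longlonglongrightarrow> \<i> * complex_of_real (b \<bullet> x) * cis (y \<bullet> x) * u x"
        by (intro tendsto_intros)
      then show ?thesis by (simp add: inner_add_left algebra_simps inner_commute)
    qed
    then show "AE x in lborel. (\<lambda>n. ?g n x) \<longlonglongrightarrow> cis (y \<bullet> x) * (\<i> * complex_of_real (x \<bullet> b) * u x)" by simp
    have "norm (?g n x) \<le> norm b * (norm x * norm (u x))" for n x
    proof -
      have "cis ((y + h n *\<^sub>R b) \<bullet> x) * u x - cis (y \<bullet> x) * u x = cis (y \<bullet> x) * (cis (h n * (b \<bullet> x)) - 1) * u x"
        by (simp add: inner_add_left cis_mult[symmetric] algebra_simps)
      then have "norm (?g n x) = norm (cis (h n * (b \<bullet> x)) - 1) * norm (u x) / \<bar>h n\<bar>"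
        by (simp add: norm_mult divide_inverse)
      also have "\<dots> \<le> \<bar>h n * (b \<bullet> x)\<bar> * norm (u x) / \<bar>h n\<bar>"
        by (intro divide_right_mono mult_right_mono norm_cis_minus_one) auto
      also have "\<dots> = \<bar>b \<bullet> x\<bar> * norm (u x)" using h by (simp add: abs_mult)
      also have "\<dots> \<le> norm b * norm x * norm (u x)"
        by (intro mult_right_mono Cauchy_Schwarz_ineq2) auto
      finally show ?thesis by (simp add: mult_ac)
    qed
    then show "AE x in lborel. norm (?g n x) \<le> norm b * (norm x * norm (u x))" for n by simp
  qed auto
  also have "(\<lambda>n. LINT x|lborel. ?g n x) = (\<lambda>n. (FT u (y + h n *\<^sub>R b) - FT u (y + 0 *\<^sub>R b)) /\<^sub>R h n)"
    unfolding FT_def by (auto simp: integrable_cis_mult)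
  finally show "(\<lambda>n. (FT u (y + h n *\<^sub>R b) - FT u (y + 0 *\<^sub>R b)) /\<^sub>R h n)
      \<longlonglongrightarrow> FT (\<lambda>x. \<i> * complex_of_real (x \<bullet> b) * u x) y"
    by (simp add: FT_def)
qed

subsection \<open>Lebesgue measure on vectors and matrices\<close>

lemma borel_measurable_vec_component [measurable (raw)]:
  fixes f :: "'x \<Rightarrow> 'a::euclidean_space^'n"
  assumes [measurable]: "f \<in> borel_measurable M"
  shows "(\<lambda>x. f x $ i) \<in> borel_measurable M"
proof -
  have "(\<lambda>x::'a^'n. x $ i) \<in> borel_measurable borel"
    by (intro borel_measurable_continuous_onI continuous_intros)
  from measurable_compose[OF assms this] show ?thesis by simp
qed

lemma borel_measurable_vecI:
  fixes f :: "'x \<Rightarrow> 'a::euclidean_space^'n"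
  assumes "\<And>i. (\<lambda>x. f x $ i) \<in> borel_measurable M"
  shows "f \<in> borel_measurable M"
  unfolding borel_measurable_euclidean_space[of f]
  using assms by (auto simp: Basis_vec_def inner_axis)

lemma borel_measurable_vec_lambda [measurable (raw)]:
  fixes f :: "'x \<Rightarrow> 'n::finite \<Rightarrow> 'a::euclidean_space"
  assumes [measurable]: "\<And>i. (\<lambda>x. f x i) \<in> borel_measurable M"
  shows "(\<lambda>x. \<chi> i. f x i) \<in> borel_measurable M"
  by (rule borel_measurable_vecI) simp

lemma borel_measurable_matrix_mult [measurable (raw)]:
  fixes f :: "'x \<Rightarrow> real^'m^'n" and g :: "'x \<Rightarrow> real^'p^'m"
  assumes [measurable]: "f \<in> borel_measurable M" "g \<in> borel_measurable M"
  shows "(\<lambda>x. f x ** g x) \<in> borel_measurable M"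
  unfolding matrix_matrix_mult_def by measurable

lemma borel_measurable_matrix_vector_mult [measurable (raw)]:
  fixes f :: "'x \<Rightarrow> real^'m^'n" and g :: "'x \<Rightarrow> real^'m"
  assumes [measurable]: "f \<in> borel_measurable M" "g \<in> borel_measurable M"
  shows "(\<lambda>x. f x *v g x) \<in> borel_measurable M"
  unfolding matrix_vector_mult_def by measurable

lemma borel_measurable_transpose [measurable (raw)]:
  fixes f :: "'x \<Rightarrow> real^'m^'n"
  assumes [measurable]: "f \<in> borel_measurable M"
  shows "(\<lambda>x. transpose (f x)) \<in> borel_measurable M"
  unfolding transpose_def by measurable

lemma borel_measurable_det [measurable (raw)]:
  fixes f :: "'x \<Rightarrow> real^'n^'n"
  assumes [measurable]: "f \<in> borel_measurable M"
  shows "(\<lambda>x. det (f x)) \<in> borel_measurable M"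
  unfolding det_def by measurable

lemma borel_measurable_stack [measurable (raw)]:
  fixes f :: "'x \<Rightarrow> real^'m^'k" and g :: "'x \<Rightarrow> real^'m^'l"
  assumes [measurable]: "f \<in> borel_measurable M" "g \<in> borel_measurable M"
  shows "(\<lambda>x. stack (f x) (g x)) \<in> borel_measurable M"
proof (rule borel_measurable_vecI)
  fix i :: "'k + 'l"
  show "(\<lambda>x. stack (f x) (g x) $ i) \<in> borel_measurable M"
    by (cases i) (simp_all add: stack_def)
qed

lemma mem_box_vec: "x \<in> box l u \<longleftrightarrow> (\<forall>i. x $ i \<in> box (l $ i) (u $ i))" for x :: "'a::euclidean_space^'n"
  by (auto simp: mem_box Basis_vec_def inner_axis)

lemma mem_box_matrix: "y \<in> box l u \<longleftrightarrow> (\<forall>i j. l $ i $ j < y $ i $ j \<and> y $ i $ j < u $ i $ j)" for y :: "real^'m^'n"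
  by (simp add: mem_box_vec)

lemma prod_Basis_vec: "(\<Prod>b\<in>(Basis::('a::euclidean_space^'n) set). g b) = (\<Prod>i\<in>UNIV. \<Prod>u\<in>Basis. g (axis i u))"
proof -
  have B: "(Basis::('a^'n) set) = (\<lambda>(i,u). axis i u) ` (UNIV \<times> Basis)"
    by (auto simp: Basis_vec_def)
  have "inj_on (\<lambda>(i,u). axis i u :: 'a^'n) (UNIV \<times> Basis)"
    by (auto simp: inj_on_def axis_eq_axis)
  then show ?thesis
    unfolding B by (simp add: prod.reindex comp_def case_prod_unfold prod.cartesian_product)
qed

lemma lborel_vec_eqI:
  fixes M :: "('a::euclidean_space^'n) measure"
  assumes "sets M = sets borel"
    and "\<And>l u. (\<And>i b. b \<in> Basis \<Longrightarrow> l $ i \<bullet> b \<le> u $ i \<bullet> b) \<Longrightarrow>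
      emeasure M (box l u) = (\<Prod>i\<in>UNIV. emeasure lborel (box (l $ i) (u $ i)))"
  shows "lborel = M"
proof (rule lborel_eqI)
  fix l u :: "'a^'n" assume le: "\<And>b. b \<in> Basis \<Longrightarrow> l \<bullet> b \<le> u \<bullet> b"
  have le': "l $ i \<bullet> b \<le> u $ i \<bullet> b" if "b \<in> Basis" for i b
    using le[of "axis i b"] that by (simp add: inner_axis axis_in_Basis_iff)
  have "emeasure M (box l u) = (\<Prod>i\<in>UNIV. emeasure lborel (box (l $ i) (u $ i)))"
    by (rule assms(2)) (rule le')
  also have "\<dots> = (\<Prod>i\<in>UNIV. ennreal (\<Prod>b\<in>Basis. (u $ i - l $ i) \<bullet> b))"
    using le' by (intro prod.cong refl) simp
  also have "\<dots> = ennreal (\<Prod>i\<in>UNIV. \<Prod>b\<in>Basis. (u $ i - l $ i) \<bullet> b)"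
    using le' by (intro prod_ennreal prod_nonneg) (simp add: inner_diff_left)
  also have "\<dots> = (\<Prod>b\<in>Basis. (u - l) \<bullet> b)"
    by (simp add: prod_Basis_vec inner_axis)
  finally show "emeasure M (box l u) = (\<Prod>b\<in>Basis. (u - l) \<bullet> b)" .
qed fact

lemma lborel_vec:
  "(lborel :: ('a::euclidean_space^'n) measure) = distr (\<Pi>\<^sub>M i\<in>UNIV. lborel) borel (\<lambda>f. \<chi> i. f i)"
proof (rule lborel_vec_eqI)
  fix l u :: "'a^'n"
  interpret finite_product_sigma_finite "\<lambda>i::'n. lborel :: 'a measure" UNIV by standard simp
  have "(\<lambda>f. \<chi> i. f i) -` box l u \<inter> space (\<Pi>\<^sub>M i\<in>UNIV. lborel) = (\<Pi>\<^sub>E i\<in>UNIV. box (l $ i) (u $ i))"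
    by (auto simp: space_PiM mem_box_vec PiE_UNIV_domain Pi_iff)
  then show "emeasure (distr (\<Pi>\<^sub>M i\<in>UNIV. lborel) borel (\<lambda>f. \<chi> i. f i)) (box l u)
      = (\<Prod>i\<in>UNIV. emeasure lborel (box (l $ i) (u $ i)))"
    by (simp add: emeasure_distr measure_times)
qed simp

lemma emeasure_lborel_vec_Times:
  fixes A :: "'n::finite \<Rightarrow> 'a::euclidean_space set"
  assumes [measurable]: "\<And>i. A i \<in> sets borel"
  shows "emeasure lborel {x. \<forall>i. x $ i \<in> A i} = (\<Prod>i\<in>UNIV. emeasure lborel (A i))"
proof -
  interpret finite_product_sigma_finite "\<lambda>i::'n. lborel :: 'a measure" UNIV by standard simp
  have "(\<lambda>f. \<chi> i. f i) -` {x. \<forall>i. x $ i \<in> A i} \<inter> space (\<Pi>\<^sub>M i\<in>UNIV. lborel) = (\<Pi>\<^sub>E i\<in>UNIV. A i)"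
    by (auto simp: space_PiM PiE_UNIV_domain Pi_iff)
  then show ?thesis
    by (subst lborel_vec) (simp add: emeasure_distr measure_times)
qed

lemma distr_stack:
  "distr (lborel \<Otimes>\<^sub>M lborel) borel (\<lambda>(\<omega>, t). stack \<omega> t) = (lborel :: (real^'m^('k::finite + 'l::finite)) measure)"
proof (rule lborel_vec_eqI[symmetric])
  fix l u :: "real^'m^('k + 'l)"
  have "(\<lambda>(\<omega>, t). stack \<omega> t) -` box l u
      = {\<omega>. \<forall>i. \<omega> $ i \<in> box (l $ Inl i) (u $ Inl i)} \<times> {t. \<forall>i. t $ i \<in> box (l $ Inr i) (u $ Inr i)}"
    by (auto simp: mem_box_vec[of _ l u] stack_def split: sum.splits)
  then have "emeasure (distr (lborel \<Otimes>\<^sub>M lborel) borel (\<lambda>(\<omega>, t). stack \<omega> t)) (box l u)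
     = emeasure (lborel \<Otimes>\<^sub>M lborel) ({\<omega>. \<forall>i. \<omega> $ i \<in> box (l $ Inl i) (u $ Inl i)} \<times> {t. \<forall>i. t $ i \<in> box (l $ Inr i) (u $ Inr i)})"
    by (subst emeasure_distr) (simp_all add: space_pair_measure)
  also have "\<dots> = (\<Prod>i\<in>UNIV. emeasure lborel (box (l $ Inl i) (u $ Inl i))) * (\<Prod>i\<in>UNIV. emeasure lborel (box (l $ Inr i) (u $ Inr i)))"
    by (subst lborel.emeasure_pair_measure_Times) (simp_all add: emeasure_lborel_vec_Times)
  also have "\<dots> = (\<Prod>i\<in>UNIV <+> UNIV. emeasure lborel (box (l $ i) (u $ i)))"
    by (subst prod.Plus) (simp_all add: comp_def)
  finally show "emeasure (distr (lborel \<Otimes>\<^sub>M lborel) borel (\<lambda>(\<omega>, t). stack \<omega> t)) (box l u)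
      = (\<Prod>i\<in>UNIV. emeasure lborel (box (l $ i) (u $ i)))"
    by simp
qed simp

lemma emeasure_lborel_box_matrix:
  fixes l u :: "real^'m^'n"
  shows "emeasure lborel (box l u) = (\<Prod>i\<in>UNIV. \<Prod>j\<in>UNIV. emeasure lborel {l $ i $ j <..< u $ i $ j})"
proof -
  have *: "emeasure lborel (box a b) = (\<Prod>j\<in>UNIV. emeasure lborel {a $ j <..< b $ j})" for a b :: "real^'m"
  proof -
    have "box a b = {x. \<forall>j. x $ j \<in> {a $ j <..< b $ j}}"
      by (auto simp: mem_box_cart)
    then show ?thesis by (simp only: emeasure_lborel_vec_Times borel_open open_greaterThanLessThan)
  qed
  have "box l u = {x. \<forall>i. x $ i \<in> box (l $ i) (u $ i)}" by (auto simp: mem_box_vec[of _ l u])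
  then have "emeasure lborel (box l u) = (\<Prod>i\<in>UNIV. emeasure lborel (box (l $ i) (u $ i)))"
    by (simp only: emeasure_lborel_vec_Times borel_open open_box)
  then show ?thesis by (simp only: *)
qed

lemma distr_transpose: "distr lborel borel transpose = (lborel :: (real^'m^'n) measure)"
proof (rule lborel_vec_eqI[symmetric])
  fix l u :: "real^'m^'n"
  have "transpose -` box l u = box (transpose l) (transpose u)"
    by (auto simp: mem_box_matrix transpose_def)
  then have "emeasure (distr lborel borel transpose) (box l u) = emeasure lborel (box (transpose l) (transpose u))"
    by (subst emeasure_distr) simp_all
  also have "\<dots> = emeasure lborel (box l u)"
    unfolding emeasure_lborel_box_matrix by (subst prod.swap) (simp add: transpose_def)
  also have "\<dots> = (\<Prod>i\<in>UNIV. emeasure lborel (box (l $ i) (u $ i)))"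
  proof -
    have "box l u = {x. \<forall>i. x $ i \<in> box (l $ i) (u $ i)}" by (auto simp: mem_box_vec[of _ l u])
    then show ?thesis by (simp only: emeasure_lborel_vec_Times borel_open open_box)
  qed
  finally show "emeasure (distr lborel borel transpose) (box l u) = (\<Prod>i\<in>UNIV. emeasure lborel (box (l $ i) (u $ i)))" .
qed simp


subsection \<open>Linear changes of variables\<close>

text \<open>With all other coordinates fixed, the shear translates coordinate \<open>m\<close>, so
  integrating over that coordinate first reduces the claim to translation invariance on the
  line.\<close>

lemma nn_integral_shear:
  fixes h :: "real^'n \<Rightarrow> ennreal"
  assumes [measurable]: "h \<in> borel_measurable borel" and "m \<noteq> n"
  shows "(\<integral>\<^sup>+x. h (\<chi> i. if i = m then x $ m + x $ n else x $ i) \<partial>lborel) = (\<integral>\<^sup>+x. h x \<partial>lborel)"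
proof -
  interpret product_sigma_finite "\<lambda>i::'n. lborel :: real measure" by standard
  have U: "insert m (UNIV - {m}) = UNIV" by auto
  have [measurable]: "(\<lambda>f. \<chi> i. f i) \<in> borel_measurable (\<Pi>\<^sub>M i\<in>UNIV. (lborel :: real measure))"
    by (rule borel_measurable_vecI) simp
  have m1: "(\<lambda>x. h (\<chi> i. if i = m then x m + x n else x i)) \<in> borel_measurable (\<Pi>\<^sub>M i\<in>UNIV. (lborel :: real measure))"
    by measurable
  have m2: "(\<lambda>x. h (\<chi> i. x i)) \<in> borel_measurable (\<Pi>\<^sub>M i\<in>UNIV. (lborel :: real measure))"
    by measurable
  have "(\<integral>\<^sup>+x. h (\<chi> i. if i = m then x $ m + x $ n else x $ i) \<partial>lborel)
      = (\<integral>\<^sup>+x. h (\<chi> i. if i = m then x m + x n else x i) \<partial>(\<Pi>\<^sub>M i\<in>UNIV. lborel))"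
    by (subst lborel_vec, subst nn_integral_distr) (simp_all cong: if_cong)
  also have "\<dots> = (\<integral>\<^sup>+x. \<integral>\<^sup>+y. h (\<chi> i. if i = m then (x(m := y)) m + (x(m := y)) n else (x(m := y)) i) \<partial>lborel \<partial>(\<Pi>\<^sub>M i\<in>UNIV - {m}. lborel))"
    using product_nn_integral_insert[of "UNIV - {m}" m, unfolded U, OF _ _ m1] by simp
  also have "\<dots> = (\<integral>\<^sup>+x. \<integral>\<^sup>+y. h (\<chi> i. (x(m := y)) i) \<partial>lborel \<partial>(\<Pi>\<^sub>M i\<in>UNIV - {m}. lborel))"
  proof (rule nn_integral_cong)
    fix x assume x: "x \<in> space (\<Pi>\<^sub>M i\<in>UNIV - {m}. (lborel :: real measure))"
    have [measurable]: "(\<lambda>y. h (\<chi> i. (x(m := y)) i)) \<in> borel_measurable borel"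
    proof -
      have "(\<lambda>y. (\<chi> i. (x(m := y)) i) :: real^'n) \<in> borel_measurable borel"
        by (rule borel_measurable_vecI) (auto simp: fun_upd_def)
      then show ?thesis by simp
    qed
    have *: "(\<chi> i. if i = m then (x(m := y)) m + (x(m := y)) n else (x(m := y)) i) = (\<chi> i. (x(m := x n + 1 * y)) i)" for y
      using \<open>m \<noteq> n\<close> by (simp add: vec_eq_iff)
    show "(\<integral>\<^sup>+y. h (\<chi> i. if i = m then (x(m := y)) m + (x(m := y)) n else (x(m := y)) i) \<partial>lborel)
        = (\<integral>\<^sup>+y. h (\<chi> i. (x(m := y)) i) \<partial>lborel)"
      unfolding * using nn_integral_real_affine[of "\<lambda>y. h (\<chi> i. (x(m := y)) i)" 1 "x n"] by (simp add: fun_upd_def)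
  qed
  also have "\<dots> = (\<integral>\<^sup>+x. h (\<chi> i. x i) \<partial>(\<Pi>\<^sub>M i\<in>UNIV. lborel))"
    using product_nn_integral_insert[of "UNIV - {m}" m, unfolded U, OF _ _ m2] by simp
  also have "\<dots> = (\<integral>\<^sup>+x. h x \<partial>lborel)"
    by (subst lborel_vec, subst nn_integral_distr) simp_all
  finally show ?thesis .
qed

lemma nn_integral_permute_coordinates:
  fixes h :: "real^'n \<Rightarrow> ennreal"
  assumes [measurable]: "h \<in> borel_measurable borel" and p: "p permutes UNIV"
  shows "(\<integral>\<^sup>+x. h (\<chi> i. x $ p i) \<partial>lborel) = (\<integral>\<^sup>+x. h x \<partial>lborel)"
proof -
  have "lborel = distr lborel borel (\<lambda>x::real^'n. \<chi> i. x $ p i)"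
  proof (rule lborel_vec_eqI)
    fix l u :: "real^'n"
    have bij: "bij p" using p by (rule permutes_bij)
    have "(\<lambda>x::real^'n. \<chi> i. x $ p i) -` box l u = {x. \<forall>j. x $ j \<in> box (l $ inv p j) (u $ inv p j)}"
      using bij by (auto simp: mem_box_vec[of _ l u]) (metis bij_inv_eq_iff)+
    then have "emeasure (distr lborel borel (\<lambda>x::real^'n. \<chi> i. x $ p i)) (box l u)
        = emeasure lborel {x. \<forall>j. x $ j \<in> box (l $ inv p j) (u $ inv p j)}"
      by (subst emeasure_distr) simp_all
    also have "\<dots> = (\<Prod>j\<in>UNIV. emeasure lborel (box (l $ inv p j) (u $ inv p j)))"
      by (rule emeasure_lborel_vec_Times) simp
    also have "\<dots> = (\<Prod>i\<in>UNIV. emeasure lborel (box (l $ i) (u $ i)))"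
      using permutes_inv[OF p] by (rule prod.permute[symmetric, unfolded comp_def])
    finally show "emeasure (distr lborel borel (\<lambda>x::real^'n. \<chi> i. x $ p i)) (box l u)
        = (\<Prod>i\<in>UNIV. emeasure lborel (box (l $ i) (u $ i)))" .
  qed simp
  then have "(\<integral>\<^sup>+x. h x \<partial>lborel) = (\<integral>\<^sup>+x. h x \<partial>distr lborel borel (\<lambda>x::real^'n. \<chi> i. x $ p i))" by simp
  then show ?thesis by (simp add: nn_integral_distr)
qed

lemma nn_integral_stretch_coordinates:
  fixes h :: "real^'n \<Rightarrow> ennreal"
  assumes [measurable]: "h \<in> borel_measurable borel" and c: "\<And>i. c i \<noteq> 0"
  shows "ennreal \<bar>\<Prod>i\<in>UNIV. c i\<bar> * (\<integral>\<^sup>+x. h (\<chi> i. c i * x $ i) \<partial>lborel) = (\<integral>\<^sup>+x. h x \<partial>lborel)"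
proof -
  \<comment> \<open>\<open>lborel_affine_euclidean\<close> expects factors indexed by basis vectors,
    so \<open>c\<close> is carried over to these.\<close>
  define d where "d b = c (SOME i. b = axis i 1)" for b :: "real^'n"
  have d: "d (axis i 1) = c i" for i
    unfolding d_def by (rule arg_cong[where f = c]) (auto simp: axis_eq_axis)
  have eq: "(\<Sum>j\<in>Basis. (d j * (x \<bullet> j)) *\<^sub>R j) = (\<chi> i. c i * x $ i)" for x :: "real^'n"
  proof -
    have B: "(Basis :: (real^'n) set) = (\<lambda>i. axis i 1) ` UNIV" by (auto simp: Basis_vec_def)
    have "(\<Sum>j\<in>Basis. (d j * (x \<bullet> j)) *\<^sub>R j) = (\<Sum>i\<in>UNIV. (c i * x $ i) *\<^sub>R axis i 1)"
      unfolding B by (subst sum.reindex) (simp_all add: inj_on_def axis_eq_axis d inner_axis)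
    also have "\<dots> = (\<chi> i. c i * x $ i)"
      by (simp add: vec_eq_iff axis_def if_distrib cong: if_cong)
    finally show ?thesis .
  qed
  have prod: "(\<Prod>j\<in>(Basis::(real^'n) set). \<bar>d j\<bar>) = \<bar>\<Prod>i\<in>UNIV. c i\<bar>"
    by (simp add: prod_Basis_vec d abs_prod)
  have nz: "\<And>j. j \<in> Basis \<Longrightarrow> d j \<noteq> 0" using c by (auto simp: Basis_vec_def d)
  have "lborel = density (distr lborel borel (\<lambda>x::real^'n. \<chi> i. c i * x $ i)) (\<lambda>_. ennreal \<bar>\<Prod>i\<in>UNIV. c i\<bar>)"
    using lborel_affine_euclidean[of d 0, OF nz] by (simp add: eq prod)
  then have "(\<integral>\<^sup>+x. h x \<partial>lborel) = (\<integral>\<^sup>+x. h x \<partial>density (distr lborel borel (\<lambda>x::real^'n. \<chi> i. c i * x $ i)) (\<lambda>_. ennreal \<bar>\<Prod>i\<in>UNIV. c i\<bar>))"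
    by simp
  then show ?thesis by (simp add: nn_integral_density nn_integral_distr nn_integral_cmult)
qed

text \<open>Factorisation into elementary matrices, along which determinants multiply; the case of a
  zero row contradicts \<open>det A \<noteq> 0\<close>. The claim is proved for all \<open>h\<close>
  simultaneously because in a product the hypothesis for \<open>B\<close> is applied to
  \<open>\<lambda>x. h (A *v x)\<close>.\<close>

lemma nn_integral_matrix_vector_mult:
  fixes A :: "real^'n^'n"
  assumes "h \<in> borel_measurable borel" "det A \<noteq> 0"
  shows "ennreal \<bar>det A\<bar> * (\<integral>\<^sup>+x. h (A *v x) \<partial>lborel) = (\<integral>\<^sup>+x. h x \<partial>lborel)"
proof -
  have "\<forall>h\<in>borel_measurable borel. det A \<noteq> 0 \<longrightarrow> ennreal \<bar>det A\<bar> * (\<integral>\<^sup>+x. h (A *v x) \<partial>lborel) = (\<integral>\<^sup>+x. h x \<partial>lborel)"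
  proof (induction A rule: induct_matrix_elementary_alt)
    case (1 A B)
    show ?case
    proof (intro ballI impI)
      fix h :: "real^'n \<Rightarrow> ennreal" assume [measurable]: "h \<in> borel_measurable borel" and nz: "det (A ** B) \<noteq> 0"
      have "ennreal \<bar>det (A ** B)\<bar> * (\<integral>\<^sup>+x. h ((A ** B) *v x) \<partial>lborel)
         = ennreal \<bar>det A\<bar> * (ennreal \<bar>det B\<bar> * (\<integral>\<^sup>+x. h (A *v (B *v x)) \<partial>lborel))"
        by (simp add: det_mul abs_mult ennreal_mult mult.assoc matrix_vector_mul_assoc)
      also have "ennreal \<bar>det B\<bar> * (\<integral>\<^sup>+x. h (A *v (B *v x)) \<partial>lborel) = (\<integral>\<^sup>+x. h (A *v x) \<partial>lborel)"
        using 1(2)[rule_format, of "\<lambda>x. h (A *v x)"] nz by (simp add: det_mul)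
      also have "ennreal \<bar>det A\<bar> * \<dots> = (\<integral>\<^sup>+x. h x \<partial>lborel)"
        using 1(1)[rule_format, of h] nz by (simp add: det_mul)
      finally show "ennreal \<bar>det (A ** B)\<bar> * (\<integral>\<^sup>+x. h ((A ** B) *v x) \<partial>lborel) = (\<integral>\<^sup>+x. h x \<partial>lborel)" .
    qed
  next
    case (2 A i)
    then show ?case using det_zero_row by blast
  next
    case (3 A)
    have det: "det A = (\<Prod>i\<in>UNIV. A $ i $ i)" using 3 by (intro det_diagonal) auto
    have "A *v x = (\<chi> i. A $ i $ i * x $ i)" for x
    proof -
      have "(\<Sum>j\<in>UNIV. A $ i $ j * x $ j) = (\<Sum>j\<in>UNIV. if j = i then A $ i $ i * x $ i else 0)" for i
        using 3 by (intro sum.cong) auto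
      then show ?thesis by (simp add: matrix_vector_mult_def vec_eq_iff)
    qed
    then show ?case using nn_integral_stretch_coordinates[of _ "\<lambda>i. A $ i $ i"] by (auto simp: det)
  next
    case (4 m n)
    let ?A = "\<chi> i j. mat 1 $ i $ Transposition.transpose m n j :: real^'n^'n"
    have p: "Transposition.transpose m n permutes UNIV" by (rule permutes_swap_id) auto
    have "?A *v x = (\<chi> i. x $ Transposition.transpose m n i)" for x :: "real^'n"
    proof -
      have "(\<Sum>j\<in>UNIV. ?A $ i $ j * x $ j) = x $ Transposition.transpose m n i" for i
      proof -
        have "(\<Sum>j\<in>UNIV. ?A $ i $ j * x $ j) = (\<Sum>j\<in>UNIV. if j = Transposition.transpose m n i then x $ j else 0)"
          by (intro sum.cong) (auto simp: mat_def)
        then show ?thesis by simp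
      qed
      then show ?thesis by (simp add: matrix_vector_mult_def vec_eq_iff)
    qed
    moreover have "\<bar>det ?A\<bar> = 1"
      using det_permute_columns[OF p, of "mat 1 :: real^'n^'n"] by (simp add: sign_def)
    ultimately show ?case using nn_integral_permute_coordinates[OF _ p] by auto
  next
    case (5 m n)
    let ?A = "\<chi> i j. of_bool (i = m \<and> j = n \<or> i = j) :: real^'n^'n"
    have "?A *v x = (\<chi> i. if i = m then x $ m + x $ n else x $ i)" for x :: "real^'n"
    proof -
      have "(\<Sum>j\<in>UNIV. ?A $ i $ j * x $ j) = (if i = m then x $ m + x $ n else x $ i)" for i
      proof -
        have "(\<Sum>j\<in>UNIV. ?A $ i $ j * x $ j) = (\<Sum>j\<in>UNIV. (if j = i then x $ i else 0) + (if i = m \<and> j = n then x $ n else 0))"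
          using 5 by (intro sum.cong) auto
        then show ?thesis by (auto simp: sum.distrib)
      qed
      then show ?thesis by (simp add: matrix_vector_mult_def vec_eq_iff)
    qed
    moreover have "det ?A = 1"
    proof -
      have "?A = (\<chi> k. if k = m then row m (mat 1) + 1 *s row n (mat 1) else row k (mat 1))"
        using 5 by (auto simp: vec_eq_iff row_def mat_def)
      then show ?thesis using det_row_operation[OF 5, where A = "mat 1 :: real^'n^'n" and c = 1] by simp
    qed
    ultimately show ?case using nn_integral_shear[OF _ 5] by auto
  qed
  then show ?thesis using assms by blast
qed

text \<open>Right multiplication acts on each of the \<open>CARD('n)\<close> rows separately, as
  \<open>transpose T\<close>, whence the exponent. The preimage of a box is therefore a product over
  the rows, and boxes determine the measure.\<close>

lemma nn_integral_matrix_mult_right: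
  fixes T :: "real^'m^'m" and h :: "real^'m^'n \<Rightarrow> ennreal"
  assumes [measurable]: "h \<in> borel_measurable borel" and T: "det T \<noteq> 0"
  shows "ennreal (\<bar>det T\<bar> ^ CARD('n)) * (\<integral>\<^sup>+y. h (y ** T) \<partial>lborel) = (\<integral>\<^sup>+y. h y \<partial>lborel)"
proof -
  let ?M = "density (distr lborel borel (\<lambda>y::real^'m^'n. y ** T)) (\<lambda>_. ennreal (\<bar>det T\<bar> ^ CARD('n)))"
  have "lborel = ?M"
  proof (rule lborel_vec_eqI)
    fix l u :: "real^'m^'n"
    have comp: "(y ** T) $ i = transpose T *v (y $ i)" for y :: "real^'m^'n" and i
      by (simp add: vec_eq_iff matrix_matrix_mult_def matrix_vector_mult_def transpose_def mult.commute)
    define A where "A i = (\<lambda>v. transpose T *v v) -` box (l $ i) (u $ i)" for i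
    have [measurable]: "A i \<in> sets borel" for i
    proof -
      have "(\<lambda>v. transpose T *v v) \<in> borel_measurable borel" by measurable
      from measurable_sets[OF this, of "box (l $ i) (u $ i)"] show ?thesis by (simp add: A_def)
    qed
    have em: "ennreal \<bar>det T\<bar> * emeasure lborel (A i) = emeasure lborel (box (l $ i) (u $ i))" for i
    proof -
      have "indicator (A i) x = (indicator (box (l $ i) (u $ i)) (transpose T *v x) :: ennreal)" for x
        by (simp add: A_def indicator_def)
      then show ?thesis
        using nn_integral_matrix_vector_mult[of "indicator (box (l $ i) (u $ i))" "transpose T"] T
        by (simp flip: nn_integral_indicator)
    qed
    have "(\<lambda>y. y ** T) -` box l u = {x. \<forall>i. x $ i \<in> A i}"
      by (auto simp: mem_box_vec[of _ l u] comp A_def)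
    then have "emeasure (distr lborel borel (\<lambda>y::real^'m^'n. y ** T)) (box l u) = (\<Prod>i\<in>UNIV. emeasure lborel (A i))"
      by (simp add: emeasure_distr emeasure_lborel_vec_Times)
    moreover have "emeasure ?M (box l u) = ennreal (\<bar>det T\<bar> ^ CARD('n)) * emeasure (distr lborel borel (\<lambda>y::real^'m^'n. y ** T)) (box l u)"
      by (simp add: emeasure_density nn_integral_cmult)
    ultimately have "emeasure ?M (box l u) = (\<Prod>i\<in>(UNIV::'n set). ennreal \<bar>det T\<bar>) * (\<Prod>i\<in>UNIV. emeasure lborel (A i))"
      by (simp add: ennreal_power)
    also have "\<dots> = (\<Prod>i\<in>UNIV. emeasure lborel (box (l $ i) (u $ i)))"
      by (simp only: prod.distrib[symmetric] em)
    finally show "emeasure ?M (box l u) = (\<Prod>i\<in>UNIV. emeasure lborel (box (l $ i) (u $ i)))" .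
  qed simp
  then have "(\<integral>\<^sup>+y. h y \<partial>lborel) = (\<integral>\<^sup>+y. h y \<partial>?M)" by simp
  also have "\<dots> = ennreal (\<bar>det T\<bar> ^ CARD('n)) * (\<integral>\<^sup>+y. h (y ** T) \<partial>lborel)"
    by (simp add: nn_integral_density nn_integral_distr nn_integral_cmult)
  finally show ?thesis by simp
qed

lemma nn_integral_transpose:
  fixes h :: "real^'m^'n \<Rightarrow> ennreal"
  assumes [measurable]: "h \<in> borel_measurable borel"
  shows "(\<integral>\<^sup>+y. h (transpose y) \<partial>lborel) = (\<integral>\<^sup>+y. h y \<partial>lborel)"
  by (subst distr_transpose[symmetric]) (simp add: nn_integral_distr)

lemma nn_integral_matrix_mult_left:
  fixes A :: "real^'n^'n" and h :: "real^'m^'n \<Rightarrow> ennreal"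
  assumes [measurable]: "h \<in> borel_measurable borel" and A: "det A \<noteq> 0"
  shows "ennreal (\<bar>det A\<bar> ^ CARD('m)) * (\<integral>\<^sup>+y. h (A ** y) \<partial>lborel) = (\<integral>\<^sup>+y. h y \<partial>lborel)"
proof -
  have "(\<integral>\<^sup>+y. h (A ** y) \<partial>lborel) = (\<integral>\<^sup>+z. h (transpose (z ** transpose A)) \<partial>lborel)"
    using nn_integral_transpose[of "\<lambda>y. h (A ** y)"] by (simp add: matrix_transpose_mul)
  then show ?thesis
    using nn_integral_matrix_mult_right[of "\<lambda>z. h (transpose z)" "transpose A"] A
      nn_integral_transpose[of h]
    by simp
qed

lemma abs_det_orthogonal: "orthogonal_matrix (g::real^'n^'n) \<Longrightarrow> \<bar>det g\<bar> = 1"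
  using det_orthogonal_matrix[of g] by auto

lemma distr_orthogonal_mult:
  fixes g :: "real^'n^'n"
  assumes "orthogonal_matrix g"
  shows "distr lborel borel (\<lambda>y. g ** y) = (lborel :: (real^'m^'n) measure)"
proof (rule measure_eqI)
  fix X :: "(real^'m^'n) set" assume "X \<in> sets (distr lborel borel ((**) g))"
  then have [measurable]: "X \<in> sets borel" by simp
  have "emeasure (distr lborel borel (\<lambda>y. g ** y)) X = (\<integral>\<^sup>+y. indicator X (g ** y) \<partial>lborel)"
    by (simp add: nn_integral_distr flip: nn_integral_indicator)
  also have "\<dots> = emeasure lborel X"
    using nn_integral_matrix_mult_left[of "indicator X" g] abs_det_orthogonal[OF assms] by auto
  finally show "emeasure (distr lborel borel (\<lambda>y. g ** y)) X = emeasure lborel X" .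
qed simp

subsection \<open>Linear algebra of rectangular matrices\<close>

abbreviation gdet :: "real^'m^'n \<Rightarrow> real" where
  "gdet x \<equiv> det (transpose x ** x)"

lemma inner_matrix_eq_trace: "x \<bullet> y = trace (transpose x ** y)" for x y :: "real^'m^'n"
  unfolding trace_def matrix_matrix_mult_def transpose_def inner_vec_def
  by (subst sum.swap) simp

lemma inner_mult_left: "(A ** x) \<bullet> y = x \<bullet> (transpose A ** y)" for A :: "real^'n^'p" and x :: "real^'m^'n"
  by (simp add: inner_matrix_eq_trace matrix_transpose_mul matrix_mul_assoc)

lemma inner_transpose: "transpose x \<bullet> transpose y = x \<bullet> y" for x y :: "real^'m^'n"
  unfolding inner_vec_def transpose_def by (subst sum.swap) simp

lemma norm_transpose: "norm (transpose x) = norm x" for x :: "real^'m^'n"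
  by (simp add: norm_eq_sqrt_inner inner_transpose)

lemma norm_isometry_mult:
  fixes x :: "real^'m^'n" and g :: "real^'n^'p"
  assumes "transpose g ** g = mat 1"
  shows "norm (g ** x) = norm x"
  by (simp add: norm_eq_sqrt_inner inner_mult_left matrix_mul_assoc assms)

lemma norm_orthogonal_mult:
  fixes x :: "real^'m^'n"
  shows "orthogonal_matrix g \<Longrightarrow> norm (g ** x) = norm x"
  by (rule norm_isometry_mult) (simp add: orthogonal_matrix)

lemma gdet_mult_right: "gdet (x ** T) = gdet x * (det T)\<^sup>2"
  by (simp add: matrix_transpose_mul det_mul power2_eq_square matrix_mul_assoc[symmetric])
     (simp add: matrix_mul_assoc det_mul)

lemma gdet_isometry_mult:
  fixes x :: "real^'m^'n" and g :: "real^'n^'p"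
  assumes "transpose g ** g = mat 1"
  shows "gdet (g ** x) = gdet x"
  by (metis assms matrix_mul_assoc matrix_mul_rid matrix_transpose_mul)

lemma gdet_orthogonal_mult: "orthogonal_matrix g \<Longrightarrow> gdet (g ** x) = gdet x"
  by (rule gdet_isometry_mult) (simp add: orthogonal_matrix)

text \<open>The matrices \<open>x\<close> and \<open>transpose x ** x\<close> have the same kernel,
  because \<open>v \<bullet> ((transpose x ** x) *v v)\<close> is the squared norm of
  \<open>x *v v\<close>.\<close>

lemma inj_matrix_iff_gdet: "inj ((*v) x) \<longleftrightarrow> gdet x \<noteq> 0" for x :: "real^'m^'n"
proof
  assume "gdet x \<noteq> 0"
  then obtain B where "B ** (transpose x ** x) = mat 1"
    by (metis invertible_det_nz invertible_def)
  then have "(B ** transpose x) ** x = mat 1" by (simp add: matrix_mul_assoc)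
  then show "inj ((*v) x)" using matrix_left_invertible_injective by blast
next
  assume inj: "inj ((*v) x)"
  have "v = 0" if "(transpose x ** x) *v v = 0" for v
  proof -
    have "(x *v v) \<bullet> (x *v v) = v \<bullet> ((transpose x ** x) *v v)"
      by (metis dot_lmul_matrix inner_commute matrix_vector_mul_assoc vector_transpose_matrix)
    then have "x *v v = x *v 0" using that by simp
    then show "v = 0" using inj by (blast dest: injD)
  qed
  then have "\<exists>B. B ** (transpose x ** x) = mat 1"
    by (subst matrix_left_invertible_ker) blast
  then show "gdet x \<noteq> 0" by (metis invertible_det_nz invertible_left_inverse)
qed

lemma rank_lt_iff_gdet: "rank x < CARD('m) \<longleftrightarrow> gdet x = 0" for x :: "real^'m^'n"
  using less_rank_noninjective inj_matrix_iff_gdet by blast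

section \<open>Isometries, polar decomposition and frames\<close>

lemma matrix_isometryI:
  fixes A :: "real^'m^'n"
  assumes "\<And>v. norm (A *v v) = norm v"
  shows "transpose A ** A = mat 1"
proof -
  have "(A *v v) \<bullet> (A *v w) = v \<bullet> w" for v w
    using assms by (simp add: dot_norm matrix_vector_right_distrib[symmetric])
  then have "v \<bullet> ((transpose A ** A) *v w) = v \<bullet> w" for v w
    by (metis dot_lmul_matrix matrix_vector_mul_assoc vector_transpose_matrix transpose_transpose)
  then have "(transpose A ** A) *v w = w" for w
    by (metis vector_eq_ldot)
  then show ?thesis by (simp add: matrix_eq)
qed

lemma matrix_isometryD:
  fixes A :: "real^'m^'n"
  assumes "transpose A ** A = mat 1"
  shows "(A *v v) \<bullet> (A *v w) = v \<bullet> w" "norm (A *v v) = norm v"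
proof -
  show "(A *v v) \<bullet> (A *v w) = v \<bullet> w" for v w
    by (metis assms dot_lmul_matrix matrix_vector_mul_assoc matrix_vector_mul_lid vector_transpose_matrix transpose_transpose)
  then show "norm (A *v v) = norm v" by (simp add: norm_eq_sqrt_inner)
qed

text \<open>An isometry from \<open>real^'m\<close> onto the column space of \<open>x\<close>
  supplies \<open>x1\<close>, and \<open>R\<close> is then \<open>transpose x1 ** x\<close>. No
  positive square root is extracted: \<open>R\<close> need not be symmetric, yet
  \<open>transpose x ** x = transpose R ** R\<close> holds all the same.\<close>

lemma polar_decomposition_exists:
  fixes x :: "real^'m^'n"
  assumes "gdet x \<noteq> 0"
  obtains x1 :: "real^'m^'n" and R where "transpose x1 ** x1 = mat 1" "x = x1 ** R" "det R \<noteq> 0"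
proof -
  have inj: "inj ((*v) x)" using assms inj_matrix_iff_gdet by blast
  have "dim (range ((*v) x)) = CARD('m)"
    using inj by (metis full_rank_injective rank_dim_range)
  then obtain f where f: "linear f" "f ` (UNIV :: (real^'m) set) = range ((*v) x)" "\<And>v. norm (f v) = norm v"
    using isometry_subspaces[of "UNIV :: (real^'m) set" "range ((*v) x)"]
    by (auto simp: linear_subspace_image matrix_vector_mul_linear)
  define x1 where "x1 = matrix f"
  have x1f: "x1 *v v = f v" for v using f(1) by (simp add: x1_def matrix_works)
  have x1: "transpose x1 ** x1 = mat 1"
    by (rule matrix_isometryI) (simp add: x1f f(3))
  have "(x1 ** (transpose x1 ** x)) *v v = x *v v" for v
  proof -
    obtain a where a: "x *v v = x1 *v a" using f(2) x1f by (metis rangeE rangeI)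
    have "(x1 ** (transpose x1 ** x)) *v v = x1 *v (transpose x1 *v (x1 *v a))"
      by (simp add: a flip: matrix_vector_mul_assoc)
    also have "\<dots> = x1 *v a"
      by (simp add: matrix_vector_mul_assoc x1 flip: matrix_mul_assoc)
    finally show ?thesis by (simp add: a)
  qed
  then have eq: "x = x1 ** (transpose x1 ** x)" by (simp add: matrix_eq)
  have "gdet x = gdet (transpose x1 ** x)"
    using gdet_isometry_mult[OF x1, of "transpose x1 ** x", unfolded eq[symmetric]] .
  then have "det (transpose x1 ** x) \<noteq> 0" using assms by (auto simp: det_mul)
  then show ?thesis using that[OF x1 eq] by blast
qed

lemma gdet_nonneg: "gdet x \<ge> 0" for x :: "real^'m^'n"
proof (cases "gdet x = 0")
  case False
  then obtain x1 :: "real^'m^'n" and R where "transpose x1 ** x1 = mat 1" "x = x1 ** R"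
    by (rule polar_decomposition_exists)
  then show ?thesis by (simp add: gdet_mult_right)
qed simp

lemma mat_abs_eq: "mat_abs x = sqrt (gdet x)"
  by (simp add: mat_abs_def)

text \<open>Transitivity of the orthogonal group on frames. The map \<open>F\<close> sends one
  column space to the other through \<open>x1 ** transpose x0\<close>, and one orthogonal complement
  to the other through an isometry \<open>h\<close>, which exists because the complements have equal
  dimension.\<close>

lemma orthogonal_matrix_between_frames:
  fixes x0 x1 :: "real^'m^'n"
  assumes x0: "transpose x0 ** x0 = mat 1" and x1: "transpose x1 ** x1 = mat 1"
  obtains g where "orthogonal_matrix g" "g ** x0 = x1"
proof -
  let ?V = "\<lambda>x::real^'m^'n. range ((*v) x)" and ?N = "\<lambda>x::real^'m^'n. {y. \<forall>v\<in>range ((*v) x). orthogonal v y}"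
  have sub: "subspace (?V x)" for x by (auto simp: linear_subspace_image matrix_vector_mul_linear)
  have dimV: "dim (?V x) = CARD('m)" if "transpose x ** x = mat 1" for x
    using that inj_matrix_iff_gdet[of x] by (metis det_I full_rank_injective rank_dim_range zero_neq_one)
  have dimN: "dim (?N x) + dim (?V x) = CARD('n)" for x
    using dim_subspace_orthogonal_to_vectors[OF sub[of x] subspace_UNIV] by simp
  have subN: "subspace (?N x)" for x
    by (auto simp: subspace_def orthogonal_clauses)
  have "dim (?N x0) = dim (?N x1)" using dimN[of x0] dimN[of x1] dimV[OF x0] dimV[OF x1] by simp
  then obtain h where h: "linear h" "h ` ?N x0 = ?N x1" "\<And>v. v \<in> ?N x0 \<Longrightarrow> norm (h v) = norm v"
    using isometry_subspaces[OF subN subN] by blast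
  define P where "P v = v - x0 *v (transpose x0 *v v)" for v
  have P: "P v \<in> ?N x0" for v
  proof -
    have "(x0 *v a) \<bullet> P v = 0" for a
    proof -
      have "(x0 *v a) \<bullet> v = a \<bullet> (transpose x0 *v v)"
        by (metis dot_lmul_matrix vector_transpose_matrix transpose_transpose inner_commute)
      moreover have "(x0 *v a) \<bullet> (x0 *v (transpose x0 *v v)) = a \<bullet> (transpose x0 *v v)"
        by (rule matrix_isometryD[OF x0])
      ultimately show ?thesis by (simp add: P_def inner_diff_right)
    qed
    then show ?thesis by (auto simp: orthogonal_def)
  qed
  define F where "F v = x1 *v (transpose x0 *v v) + h (P v)" for v
  have lin: "linear (\<lambda>v. A *v (transpose x0 *v v))" for A :: "real^'m^'n"
    by (rule linear_compose[unfolded comp_def]) (rule matrix_vector_mul_linear)+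
  have "linear P" unfolding P_def by (intro linear_compose_sub linear_ident lin)
  then have "linear F" unfolding F_def
    by (intro linear_compose_add linear_compose[unfolded comp_def, OF _ h(1)] lin)
  have "norm (F v) = norm v" for v
  proof -
    have "h (P v) \<in> ?N x1" using h(2) P by blast
    then have "orthogonal (x1 *v (transpose x0 *v v)) (h (P v))" by blast
    then have "(norm (F v))\<^sup>2 = (norm (x1 *v (transpose x0 *v v)))\<^sup>2 + (norm (h (P v)))\<^sup>2"
      unfolding F_def by (rule norm_add_Pythagorean)
    also have "\<dots> = (norm (x0 *v (transpose x0 *v v)))\<^sup>2 + (norm (P v))\<^sup>2"
      using h(3)[OF P] by (simp add: matrix_isometryD[OF x0] matrix_isometryD[OF x1])
    also have "\<dots> = (norm (x0 *v (transpose x0 *v v) + P v))\<^sup>2"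
      using P by (intro norm_add_Pythagorean[symmetric]) blast
    finally show ?thesis by (simp add: P_def)
  qed
  with \<open>linear F\<close> have orth: "orthogonal_matrix (matrix F)"
    using orthogonal_transformation orthogonal_transformation_matrix by blast
  have "(matrix F ** x0) *v a = x1 *v a" for a
  proof -
    have x0a: "transpose x0 *v (x0 *v a) = a" by (simp add: matrix_vector_mul_assoc x0)
    have "(matrix F ** x0) *v a = F (x0 *v a)"
      using \<open>linear F\<close> by (simp add: matrix_works flip: matrix_vector_mul_assoc)
    also have "\<dots> = x1 *v a"
      unfolding F_def P_def x0a using linear_0[OF h(1)] by simp
    finally show ?thesis .
  qed
  then have "matrix F ** x0 = x1" by (simp add: matrix_eq)
  with orth show ?thesis by (rule that)
qed

lemma transpose_stack_mult:
  fixes a :: "real^'m^'k" and b :: "real^'m^'l" and c :: "real^'p^'k" and d :: "real^'p^'l"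
  shows "transpose (stack a b) ** stack c d = transpose a ** c + transpose b ** d"
  by (simp add: vec_eq_iff matrix_matrix_mult_def transpose_def stack_def
      sum.Plus[of UNIV UNIV, unfolded UNIV_Plus_UNIV] comp_def)

lemma stack_mult: "stack a b ** x = stack (a ** x) (b ** x)"
  for a :: "real^'m^'k" and b :: "real^'m^'l" and x :: "real^'p^'m"
  by (auto simp: vec_eq_iff matrix_matrix_mult_def stack_def split: sum.splits)

lemma inner_stack: "stack a b \<bullet> stack c d = a \<bullet> c + b \<bullet> d"
  for a c :: "real^'m^'k" and b d :: "real^'m^'l"
  by (simp add: inner_vec_def stack_def sum.Plus[of UNIV UNIV, unfolded UNIV_Plus_UNIV] comp_def)

lemma norm_stack: "(norm (stack a b))\<^sup>2 = (norm a)\<^sup>2 + (norm b)\<^sup>2"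
  for a :: "real^'m^'k" and b :: "real^'m^'l"
  by (simp only: power2_norm_eq_inner inner_stack)

text \<open>A substitute for the square root of \<open>mat 1 + z ** transpose z\<close>: this matrix
  is the Gram matrix of the identity stacked on \<open>transpose z\<close>, and \<open>R\<close> is
  the factor in the polar decomposition of that stack. Stacking also explains the sum of two squared
  norms.\<close>

lemma sqrt_one_plus_gram_exists:
  fixes z :: "real^'m^'n"
  obtains R :: "real^'n^'n" where "det R \<noteq> 0"
    "\<And>X::real^'p^'n. (norm (R ** X))\<^sup>2 = (norm X)\<^sup>2 + (norm (transpose z ** X))\<^sup>2"
    "(det R)\<^sup>2 = det (mat 1 + z ** transpose z)"
proof -
  define x :: "real^'n^('n + 'm)" where "x = stack (mat 1) (transpose z)"
  have gx: "transpose x ** x = mat 1 + z ** transpose z"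
    by (simp add: x_def transpose_stack_mult)
  have "transpose (stack (mat 1) 0 :: real^'n^('n + 'm)) ** x = mat 1"
  proof -
    have "transpose (0::real^'n^'m) = 0" by (simp add: transpose_def vec_eq_iff)
    moreover have "(0::real^'m^'n) ** transpose z = 0" by (simp add: matrix_matrix_mult_def vec_eq_iff)
    ultimately show ?thesis by (simp add: x_def transpose_stack_mult)
  qed
  then have "gdet x \<noteq> 0"
    using inj_matrix_iff_gdet matrix_left_invertible_injective by blast
  then obtain x1 :: "real^'n^('n + 'm)" and R where x1: "transpose x1 ** x1 = mat 1" "x = x1 ** R" "det R \<noteq> 0"
    by (rule polar_decomposition_exists)
  have 1: "(norm (R ** X))\<^sup>2 = (norm X)\<^sup>2 + (norm (transpose z ** X))\<^sup>2" for X :: "real^'p^'n"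
  proof -
    have "norm (R ** X) = norm (x ** X)"
      using norm_isometry_mult[OF x1(1), of "R ** X"] by (simp add: x1(2) matrix_mul_assoc)
    then show ?thesis by (simp add: x_def stack_mult norm_stack)
  qed
  have "gdet x = (det R)\<^sup>2" using x1 by (simp add: gdet_mult_right)
  then have 2: "(det R)\<^sup>2 = det (mat 1 + z ** transpose z)" by (simp add: gx)
  show ?thesis by (rule that[OF x1(3) 1 2])
qed

subsection \<open>Gram determinants and distances\<close>

lemma infdist_orthogonal_decomp:
  fixes W :: "'a::euclidean_space set"
  assumes "p \<in> W" "subspace W" and orth: "\<And>w. w \<in> W \<Longrightarrow> orthogonal q w"
  shows "infdist (p + q) W = norm q"
proof (rule antisym)
  show "infdist (p + q) W \<le> norm q"
    using infdist_le[OF \<open>p \<in> W\<close>, of "p + q"] by (simp add: dist_norm)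
  have "norm q \<le> dist (p + q) w" if "w \<in> W" for w
  proof -
    have "orthogonal q (p - w)" using that assms by (intro orth subspace_diff)
    then have "(norm (q + (p - w)))\<^sup>2 = (norm q)\<^sup>2 + (norm (p - w))\<^sup>2" by (rule norm_add_Pythagorean)
    then have "(norm q)\<^sup>2 \<le> (norm (q + (p - w)))\<^sup>2" by simp
    then show ?thesis by (simp add: dist_norm algebra_simps)
  qed
  then show "norm q \<le> infdist (p + q) W"
    using \<open>p \<in> W\<close> unfolding infdist_def by (auto intro!: cINF_greatest)
qed

text \<open>The Gram determinant of the vectors \<open>f a\<close>, \<open>a \<in> S\<close>, padded with an identity block.\<close>

definition gram :: "'m::finite set \<Rightarrow> ('m \<Rightarrow> 'a::euclidean_space) \<Rightarrow> real" where
  "gram S f = det (\<chi> a b. if a \<in> S \<and> b \<in> S then f a \<bullet> f b else if a = b then 1 else 0)"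

lemma gram_empty: "gram {} f = 1"
proof -
  have "(\<chi> a b. if a \<in> {} \<and> b \<in> {} then f a \<bullet> f b else if a = b then 1 else 0) = (mat 1 :: real^'a^'a)"
    by (simp add: vec_eq_iff mat_def)
  then show ?thesis unfolding gram_def by (metis det_I)
qed

lemma gdet_eq_gram: "gdet y = gram UNIV (\<lambda>j. transpose y $ j)" for y :: "real^'m^'n"
  unfolding gram_def
  by (intro arg_cong[where f = det]) (simp add: vec_eq_iff matrix_matrix_mult_def transpose_def inner_vec_def)

text \<open>Conjugating by a unitriangular matrix splits off the component of
  \<open>v\<close> orthogonal to the other vectors.\<close>

lemma gram_insert:
  fixes f :: "'m::finite \<Rightarrow> 'a::euclidean_space"
  assumes i: "i \<notin> S"
  shows "gram (insert i S) (f(i := v)) = gram S f * (infdist v (span (f ` S)))\<^sup>2"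
proof -
  obtain p q where p: "p \<in> span (f ` S)" and q: "\<And>w. w \<in> span (f ` S) \<Longrightarrow> orthogonal q w" and v: "v = p + q"
    using orthogonal_subspace_decomp_exists[of "f ` S" v] by blast
  have dist: "infdist v (span (f ` S)) = norm q"
    unfolding v by (rule infdist_orthogonal_decomp[OF p _ q]) simp
  \<comment> \<open>The coefficients are indexed by \<open>S\<close> and not by the vectors, since
    \<open>f\<close> may fail to be injective on \<open>S\<close>.\<close>
  have "span (f ` S) \<subseteq> range (\<lambda>c. \<Sum>a\<in>S. c a *\<^sub>R f a)"
  proof (rule span_minimal)
    show "f ` S \<subseteq> range (\<lambda>c. \<Sum>a\<in>S. c a *\<^sub>R f a)"
    proof clarify
      fix a assume "a \<in> S"
      then have "f a = (\<Sum>b\<in>S. (if b = a then 1 else 0) *\<^sub>R f b)"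
        by (simp add: if_distrib[of "\<lambda>c. c *\<^sub>R _"] cong: if_cong)
      then show "f a \<in> range (\<lambda>c. \<Sum>a\<in>S. c a *\<^sub>R f a)" by (rule range_eqI[where x = "\<lambda>b. if b = a then 1 else 0"])
    qed
    show "subspace (range (\<lambda>c. \<Sum>a\<in>S. c a *\<^sub>R f a))"
      unfolding subspace_def
    proof (intro conjI ballI allI)
      show "0 \<in> range (\<lambda>c. \<Sum>a\<in>S. c a *\<^sub>R f a)" by (rule range_eqI[of _ _ "\<lambda>_. 0"]) simp
      fix x y c assume "x \<in> range (\<lambda>c. \<Sum>a\<in>S. c a *\<^sub>R f a)" "y \<in> range (\<lambda>c. \<Sum>a\<in>S. c a *\<^sub>R f a)"
      then obtain u w where uw: "x = (\<Sum>a\<in>S. u a *\<^sub>R f a)" "y = (\<Sum>a\<in>S. w a *\<^sub>R f a)" by auto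
      then show "x + y \<in> range (\<lambda>c. \<Sum>a\<in>S. c a *\<^sub>R f a)"
        by (intro range_eqI[of _ _ "\<lambda>a. u a + w a"]) (simp add: scaleR_add_left sum.distrib)
      from uw show "c *\<^sub>R x \<in> range (\<lambda>c. \<Sum>a\<in>S. c a *\<^sub>R f a)"
        by (intro range_eqI[of _ _ "\<lambda>a. c * u a"]) (simp add: scaleR_sum_right)
    qed
  qed
  then obtain c where c: "p = (\<Sum>a\<in>S. c a *\<^sub>R f a)" using p by blast
  have fq: "q \<bullet> f b = 0" if "b \<in> S" for b
    using q[of "f b"] that by (auto simp: orthogonal_def span_base)
  have pq: "q \<bullet> p = 0" using q[OF p] by (simp add: orthogonal_def)
  \<comment> \<open>Row \<open>i\<close> of \<open>E\<close> holds the coefficients of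
    \<open>p\<close>, so that conjugation by \<open>E\<close> restores \<open>p\<close> from the
    vectors in \<open>S\<close>. The matrix \<open>H\<close> is the Gram matrix with
    \<open>v\<close> replaced by its orthogonal component \<open>q\<close>, hence block
    diagonal.\<close>
  define E :: "real^'m^'m" where "E = (\<chi> a b. if a = i then (if b = i then 1 else if b \<in> S then c b else 0) else if a = b then 1 else 0)"
  define H :: "real^'m^'m" where "H = (\<chi> a b. if a \<in> S \<and> b \<in> S then f a \<bullet> f b else if a = b then (if a = i then q \<bullet> q else 1) else 0)"
  have Hab: "H $ a $ b = (if a \<in> S \<and> b \<in> S then f a \<bullet> f b else if a = b then (if a = i then q \<bullet> q else 1) else 0)" for a b
    by (simp add: H_def)
  have Emult: "(\<Sum>k\<in>UNIV. E $ a $ k * M k) = (if a = i then M i + (\<Sum>k\<in>S. c k * M k) else M a)" for a and M :: "'m \<Rightarrow> real"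
  proof (cases "a = i")
    case True
    have "(\<Sum>k\<in>UNIV. E $ a $ k * M k) = (\<Sum>k\<in>UNIV. (if k = i then M i else 0) + (if k \<in> S then c k * M k else 0))"
      using True i by (intro sum.cong) (auto simp: E_def)
    then show ?thesis using True by (simp add: sum.distrib sum.If_cases)
  next
    case False
    have "(\<Sum>k\<in>UNIV. E $ a $ k * M k) = (\<Sum>k\<in>UNIV. if k = a then M a else 0)"
      using False by (intro sum.cong) (auto simp: E_def)
    then show ?thesis using False by simp
  qed
  have EH: "(E ** H) $ a $ b = (if a = i then (if b = i then q \<bullet> q else if b \<in> S then p \<bullet> f b else 0) else H $ a $ b)" for a b
  proof -
    have "(E ** H) $ a $ b = (if a = i then H $ i $ b + (\<Sum>k\<in>S. c k * H $ k $ b) else H $ a $ b)"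
      unfolding matrix_matrix_mult_def using Emult[of a "\<lambda>k. H $ k $ b"] by simp
    moreover have "H $ i $ b + (\<Sum>k\<in>S. c k * H $ k $ b) = (if b = i then q \<bullet> q else if b \<in> S then p \<bullet> f b else 0)"
    proof -
      have "H $ i $ b = (if b = i then q \<bullet> q else 0)" using i by (auto simp: H_def)
      moreover have "(\<Sum>k\<in>S. c k * H $ k $ b) = (if b \<in> S then p \<bullet> f b else 0)"
        unfolding c inner_sum_left H_def using i by (auto intro!: sum.cong sum.neutral)
      ultimately show ?thesis using i by auto
    qed
    ultimately show ?thesis by simp
  qed
  have G: "(\<chi> a b. if a \<in> insert i S \<and> b \<in> insert i S then (f(i := v)) a \<bullet> (f(i := v)) b else if a = b then 1 else 0)
      = E ** H ** transpose E"
  proof -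
    have "(E ** H ** transpose E) $ a $ b = (if b = i then (E ** H) $ a $ i + (\<Sum>k\<in>S. c k * (E ** H) $ a $ k) else (E ** H) $ a $ b)" for a b
    proof -
      have "(E ** H ** transpose E) $ a $ b = (\<Sum>k\<in>UNIV. E $ b $ k * (E ** H) $ a $ k)"
        by (simp add: matrix_matrix_mult_def[of "E ** H"] transpose_def mult.commute)
      then show ?thesis using Emult by simp
    qed
    moreover have "(\<Sum>k\<in>S. c k * (E ** H) $ a $ k) = (if a = i then p \<bullet> p else if a \<in> S then f a \<bullet> p else 0)" for a
    proof -
      have "(\<Sum>k\<in>S. c k * (p \<bullet> f k)) = p \<bullet> p"
        by (subst (3) c) (simp add: inner_sum_right)
      moreover have "(\<Sum>k\<in>S. c k * (f a \<bullet> f k)) = f a \<bullet> p"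
        by (subst c) (simp add: inner_sum_right)
      moreover have "(\<Sum>k\<in>S. c k * (E ** H) $ a $ k) = (\<Sum>k\<in>S. if a = i then c k * (p \<bullet> f k) else if a \<in> S then c k * (f a \<bullet> f k) else 0)"
      proof (rule sum.cong)
        fix k assume k: "k \<in> S"
        then have "k \<noteq> i" using i by blast
        moreover have "H $ a $ k = (if a \<in> S then f a \<bullet> f k else 0)" using k i by (auto simp: H_def)
        ultimately show "c k * (E ** H) $ a $ k = (if a = i then c k * (p \<bullet> f k) else if a \<in> S then c k * (f a \<bullet> f k) else 0)"
          unfolding EH using k by simp
      qed simp
      ultimately show ?thesis by simp
    qed
    ultimately have entry: "(E ** H ** transpose E) $ a $ b = (if b = i then (E ** H) $ a $ i + (if a = i then p \<bullet> p else if a \<in> S then f a \<bullet> p else 0) else (E ** H) $ a $ b)" for a b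
      by simp
    have vv: "v \<bullet> v = q \<bullet> q + p \<bullet> p" using pq by (simp add: v inner_add_left inner_add_right inner_commute)
    have vf: "v \<bullet> f b = p \<bullet> f b" "f b \<bullet> v = f b \<bullet> p" if "b \<in> S" for b
      using fq[OF that] by (simp_all add: v inner_add_left inner_add_right inner_commute)
    have "(if a \<in> insert i S \<and> b \<in> insert i S then (f(i := v)) a \<bullet> (f(i := v)) b else if a = b then 1 else 0) = (E ** H ** transpose E) $ a $ b" for a b
    proof (cases "a = i"; cases "b = i")
      assume "a = i" "b = i"
      then show ?thesis unfolding entry EH by (simp add: vv)
    next
      assume "a = i" "b \<noteq> i"
      then show ?thesis unfolding entry EH by (simp add: vf)
    next
      assume "a \<noteq> i" "b = i"
      then show ?thesis unfolding entry EH Hab using i by (simp add: vf)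
    next
      assume "a \<noteq> i" "b \<noteq> i"
      then show ?thesis unfolding entry EH Hab by simp
    qed
    then show ?thesis by (simp only: vec_eq_iff vec_lambda_beta) blast
  qed
  have "det E = 1"
  proof -
    have x: "(\<Sum>b\<in>S. c b *s row b (mat 1 :: real^'m^'m)) \<in> vec.span {row j (mat 1) |j. j \<noteq> i}"
      using i by (intro vec.span_sum vec.span_scale vec.span_base) auto
    have "E = (\<chi> k. if k = i then row i (mat 1) + (\<Sum>b\<in>S. c b *s row b (mat 1)) else row k (mat 1))"
    proof -
      have "(\<Sum>b\<in>S. c b *s row b (mat 1 :: real^'m^'m)) $ k = (if k \<in> S then c k else 0)" for k
      proof -
        have "(\<Sum>b\<in>S. c b *s row b (mat 1 :: real^'m^'m)) $ k = (\<Sum>b\<in>S. if b = k then c k else 0)"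
          unfolding sum_component by (intro sum.cong) (auto simp: row_def mat_def)
        then show ?thesis by simp
      qed
      then show ?thesis using i by (simp add: vec_eq_iff E_def row_def mat_def)
    qed
    then show ?thesis using det_row_span[OF x] by simp
  qed
  moreover have "det H = (q \<bullet> q) * gram S f"
  proof -
    let ?r = "\<lambda>k. \<chi> b. if k \<in> S \<and> b \<in> S then f k \<bullet> f b else if k = b then 1 else (0::real)"
    have "H = (\<chi> k. if k = i then (q \<bullet> q) *s ?r i else ?r k)"
      using i by (auto simp: vec_eq_iff H_def)
    moreover have "(\<chi> k. if k = i then ?r i else ?r k) = (\<chi> a b. if a \<in> S \<and> b \<in> S then f a \<bullet> f b else if a = b then 1 else 0)"
      by (simp add: vec_eq_iff)
    ultimately show ?thesis using det_row_mul[of i "q \<bullet> q" "\<lambda>_. ?r i" ?r] by (simp add: gram_def)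
  qed
  ultimately have "gram (insert i S) (f(i := v)) = (q \<bullet> q) * gram S f"
    unfolding gram_def[of "insert i S"] G by (simp add: det_mul)
  then show ?thesis by (simp add: dist power2_norm_eq_inner)
qed

lemma gram_nonneg: "gram S f \<ge> 0"
proof -
  have "finite S" by simp
  then show ?thesis
  proof (induction S rule: finite_induct)
    case (insert i S)
    then show ?case using gram_insert[of i S f "f i"] by simp
  qed (simp add: gram_empty)
qed

lemma dim_span_of_gram_nz:
  assumes "gram S f \<noteq> 0"
  shows "dim (span (f ` S)) = card S"
proof -
  have "finite S" by simp
  then show ?thesis using assms
  proof (induction S rule: finite_induct)
    case (insert i S)
    have eq: "gram (insert i S) f = gram S f * (infdist (f i) (span (f ` S)))\<^sup>2"
      using gram_insert[OF insert(2), of f "f i"] by simp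
    then have "f i \<notin> span (f ` S)" and nz: "gram S f \<noteq> 0" using insert.prems by auto
    then show ?case using insert.IH[OF nz] insert(1,2) by (simp add: dim_insert)
  qed simp
qed

text \<open>The smallest of the successive distances in a Gram--Schmidt process is at most the
  geometric mean of all of them.\<close>

lemma gram_near_degenerate:
  fixes f :: "'m::finite \<Rightarrow> 'a::euclidean_space"
  assumes "S \<noteq> {}"
  obtains i p where "i \<in> S" "gram S (f(i := p)) = 0" "norm (f i - p) ^ (2 * card S) \<le> gram S f"
proof -
  have "finite S" by simp
  then have "\<exists>i p. i \<in> S \<and> gram S (f(i := p)) = 0 \<and> norm (f i - p) ^ (2 * card S) \<le> gram S f"
    using assms
  proof (induction S rule: finite_ne_induct)
    case (singleton i)
    have "gram {i} (f(i := v)) = (norm v)\<^sup>2" for v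
      using gram_insert[of i "{}" f v] by (simp add: gram_empty)
    from this[of 0] this[of "f i"]
    have "gram {i} (f(i := 0)) = 0" "norm (f i - 0) ^ (2 * card {i}) \<le> gram {i} f" by simp_all
    then show ?case by blast
  next
    case (insert i S)
    obtain p q where p: "p \<in> span (f ` S)" and q: "\<And>w. w \<in> span (f ` S) \<Longrightarrow> orthogonal q w" and v: "f i = p + q"
      using orthogonal_subspace_decomp_exists[of "f ` S" "f i"] by blast
    have dist: "infdist (f i) (span (f ` S)) = norm q"
      unfolding v by (rule infdist_orthogonal_decomp[OF p _ q]) simp
    have eq: "gram (insert i S) f = gram S f * (norm q)\<^sup>2"
      using gram_insert[OF \<open>i \<notin> S\<close>, of f "f i"] dist by simp
    have card: "card (insert i S) = Suc (card S)" using insert by simp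
    show ?case
    proof (cases "norm q ^ (2 * card (insert i S)) \<le> gram (insert i S) f")
      case True
      have "gram (insert i S) (f(i := p)) = 0"
        using gram_insert[OF \<open>i \<notin> S\<close>, of f p] p by simp
      moreover have "norm (f i - p) ^ (2 * card (insert i S)) \<le> gram (insert i S) f" using True v by simp
      ultimately show ?thesis by blast
    next
      \<comment> \<open>Now \<open>gram S f < norm q ^ (2 * card S)\<close>, so the displacement
        provided by the induction hypothesis is smaller than \<open>norm q\<close>. The additional
        factor \<open>(norm (f j - r))\<^sup>2\<close> is therefore bounded by the new factor
        \<open>(norm q)\<^sup>2\<close> of the Gram determinant.\<close>
      case False
      then have lt: "gram S f * (norm q)\<^sup>2 < norm q ^ (2 * card S) * (norm q)\<^sup>2"
        by (simp add: eq card power2_eq_square mult_ac)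
      then have lt': "gram S f < norm q ^ (2 * card S)"
        by (rule mult_right_less_imp_less) simp
      obtain j r where jr: "j \<in> S" "gram S (f(j := r)) = 0" "norm (f j - r) ^ (2 * card S) \<le> gram S f"
        using insert.IH by blast
      have "norm (f j - r) ^ (2 * card S) < norm q ^ (2 * card S)" using jr(3) lt' by linarith
      then have "norm (f j - r) < norm q" by (rule power_less_imp_less_base) simp
      then have "norm (f j - r) ^ (2 * card S) * (norm (f j - r))\<^sup>2 \<le> gram S f * (norm q)\<^sup>2"
        using jr(3) by (intro mult_mono power_mono gram_nonneg) auto
      moreover have "gram (insert i S) (f(j := r)) = 0"
        using gram_insert[OF \<open>i \<notin> S\<close>, of "f(j := r)" "(f(j := r)) i", unfolded fun_upd_triv] jr(2) by simp
      ultimately have "norm (f j - r) ^ (2 * card (insert i S)) \<le> gram (insert i S) f" "gram (insert i S) (f(j := r)) = 0"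
        by (simp_all add: eq card power2_eq_square mult_ac)
      then show ?thesis using jr(1) by blast
    qed
  qed
  then show ?thesis using that by blast
qed

text \<open>An inequality of Lojasiewicz type: \<open>gdet\<close> controls a power of the distance
  to the rank-deficient matrices. It converts vanishing of all derivatives on that set into decay
  faster than every power of \<open>gdet\<close>. The construction changes a single column.\<close>

lemma rank_deficient_nearby:
  fixes y :: "real^'m^'n"
  obtains y0 where "gdet y0 = 0" "norm (y - y0) ^ (2 * CARD('m)) \<le> gdet y"
proof -
  obtain i p where ip: "gram UNIV ((\<lambda>j. transpose y $ j)(i := p)) = 0"
      "norm (transpose y $ i - p) ^ (2 * CARD('m)) \<le> gram UNIV (\<lambda>j. transpose y $ j)"
    using gram_near_degenerate[of "UNIV :: 'm set" "\<lambda>j. transpose y $ j"] by auto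
  define y0 where "y0 = transpose (\<chi> j. if j = i then p else transpose y $ j)"
  have "(\<lambda>j. transpose y0 $ j) = (\<lambda>j. transpose y $ j)(i := p)"
    by (auto simp: y0_def fun_eq_iff)
  then have "gdet y0 = 0"
    unfolding gdet_eq_gram using ip(1) by simp
  moreover have "norm (y - y0) = norm (transpose y $ i - p)"
  proof -
    have "transpose (y - y0) = axis i (transpose y $ i - p)"
      by (auto simp: y0_def vec_eq_iff transpose_def axis_def)
    then have "norm (y - y0) = norm (axis i (transpose y $ i - p) :: real^'n^'m)" by (metis norm_transpose)
    then show ?thesis by (simp add: norm_eq_sqrt_inner inner_axis_axis)
  qed
  ultimately show ?thesis using ip(2) that by (simp add: gdet_eq_gram)
qed

subsection \<open>Gaussian moments of Gram determinants\<close>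

lemma nn_integral_gaussian:
  "(\<integral>\<^sup>+y. ennreal (exp (- (norm y)\<^sup>2)) \<partial>(lborel :: ('a::euclidean_space) measure)) = ennreal (sqrt pi ^ DIM('a))"
proof -
  have "(LINT y::'a|lborel. exp (- (norm y)\<^sup>2 / 2)) = sqrt 2 ^ DIM('a) *\<^sub>R (LINT y::'a|lborel. exp (- (norm (sqrt 2 *\<^sub>R y))\<^sup>2 / 2))"
    by (rule lborel_integral_scale) auto
  then have "sqrt 2 ^ DIM('a) * sqrt pi ^ DIM('a) = sqrt 2 ^ DIM('a) * (LINT y::'a|lborel. exp (- (norm y)\<^sup>2))"
    using integral_gaussian[where 'a='a] by (simp add: power_mult_distrib real_sqrt_mult)
  then have eq: "(LINT y::'a|lborel. exp (- (norm y)\<^sup>2)) = sqrt pi ^ DIM('a)"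
    by simp
  \<comment> \<open>The Bochner integral of a non-integrable function is 0 by convention, so a
    nonzero value certifies integrability.\<close>
  then have "integrable lborel (\<lambda>y::'a. exp (- (norm y)\<^sup>2))"
    by (metis not_integrable_integral_eq pi_gt_zero power_not_zero real_sqrt_eq_zero_cancel_iff less_irrefl)
  then show ?thesis using eq by (subst nn_integral_eq_integral) auto
qed

lemma nn_integral_gaussian_matrix_left:
  fixes R :: "real^'n^'n"
  assumes "det R \<noteq> 0"
  shows "(\<integral>\<^sup>+y. ennreal (exp (- (norm (R ** y))\<^sup>2)) \<partial>(lborel :: (real^'m^'n) measure))
    = ennreal (sqrt pi ^ (CARD('n) * CARD('m)) / \<bar>det R\<bar> ^ CARD('m))" (is "?I = _")
proof -
  have "ennreal (\<bar>det R\<bar> ^ CARD('m)) * ?I = ennreal (sqrt pi ^ (CARD('n) * CARD('m)))"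
    using nn_integral_matrix_mult_left[of "\<lambda>y::real^'m^'n. ennreal (exp (- (norm y)\<^sup>2))" R] assms
      nn_integral_gaussian[where 'a = "real^'m^'n"] by simp
  also have "\<dots> = ennreal (\<bar>det R\<bar> ^ CARD('m)) * ennreal (sqrt pi ^ (CARD('n) * CARD('m)) / \<bar>det R\<bar> ^ CARD('m))"
    using assms by (simp flip: ennreal_mult)
  finally show ?thesis
    using assms by (subst (asm) ennreal_mult_cancel_left) auto
qed

text \<open>Read from right to left, this writes a negative power as a superposition of
  exponentials. That device, followed by an exchange of integrals, evaluates or bounds the negative
  powers met below.\<close>

lemma nn_integral_Gamma_scaled:
  fixes a x :: real
  assumes "a > 0" "x > 0"
  shows "(\<integral>\<^sup>+u. ennreal (indicator {0..} u * (u powr (a - 1) * exp (- (u * x)))) \<partial>lborel) = ennreal (Gamma a * x powr (- a))"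
proof -
  have "ennreal (Gamma a) = (\<integral>\<^sup>+u. ennreal (indicator {0..} u * u powr (a - 1) / exp u) \<partial>lborel)"
    by (rule Gamma_conv_nn_integral_real[OF \<open>a > 0\<close>])
  also have "\<dots> = ennreal x * (\<integral>\<^sup>+u. ennreal (indicator {0..} (x * u) * (x * u) powr (a - 1) / exp (x * u)) \<partial>lborel)"
    using assms by (subst nn_integral_real_affine[of _ x 0]) auto
  also have "(\<integral>\<^sup>+u. ennreal (indicator {0..} (x * u) * (x * u) powr (a - 1) / exp (x * u)) \<partial>lborel)
      = (\<integral>\<^sup>+u. ennreal (x powr (a - 1)) * ennreal (indicator {0..} u * (u powr (a - 1) * exp (- (u * x)))) \<partial>lborel)"
    using assms
    by (intro nn_integral_cong)
       (auto simp: indicator_def zero_le_mult_iff powr_mult exp_minus divide_inverse mult_ac simp flip: ennreal_mult)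
  also have "\<dots> = ennreal (x powr (a - 1)) * (\<integral>\<^sup>+u. ennreal (indicator {0..} u * (u powr (a - 1) * exp (- (u * x)))) \<partial>lborel)"
    by (rule nn_integral_cmult) measurable
  finally have "ennreal (x powr a) * (\<integral>\<^sup>+u. ennreal (indicator {0..} u * (u powr (a - 1) * exp (- (u * x)))) \<partial>lborel) = ennreal (Gamma a)"
    using assms by (simp add: mult.assoc[symmetric] powr_diff flip: ennreal_mult)
  also have "\<dots> = ennreal (x powr a) * ennreal (Gamma a * x powr (- a))"
    using assms by (simp add: powr_minus Gamma_real_nonneg flip: ennreal_mult)
  finally show ?thesis using assms by (subst (asm) ennreal_mult_cancel_left) auto
qed

text \<open>The power of \<open>1 + u\<close> is written as a Gamma integral in \<open>v\<close>.
  After the exchange, integration over \<open>u\<close> yields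
  \<open>Gamma a * v powr (- a)\<close>, and what remains is the integral for
  \<open>Gamma (c - a)\<close>.\<close>

lemma nn_integral_Beta_halfline:
  fixes a c :: real
  assumes "0 < a" "a < c"
  shows "(\<integral>\<^sup>+u. ennreal (indicator {0..} u * (u powr (a - 1) * (1 + u) powr (- c))) \<partial>lborel)
    = ennreal (Gamma a * Gamma (c - a) / Gamma c)"
proof -
  have [simp]: "Gamma c > 0" "Gamma a > 0" "Gamma (c - a) > 0" using assms by (auto intro!: Gamma_real_pos)
  then have [simp]: "Gamma c \<ge> 0" "Gamma a \<ge> 0" "Gamma (c - a) \<ge> 0" "Gamma c \<noteq> 0" "Gamma a \<noteq> 0" by linarith+
  let ?f = "\<lambda>u v. ennreal (indicator {0..} u * u powr (a - 1)) * ennreal (indicator {0..} v * (v powr (c - 1) * exp (- (v * (1 + u)))))"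
  have "ennreal (Gamma c) * (\<integral>\<^sup>+u. ennreal (indicator {0..} u * (u powr (a - 1) * (1 + u) powr (- c))) \<partial>lborel)
      = (\<integral>\<^sup>+u. ennreal (Gamma c) * ennreal (indicator {0..} u * (u powr (a - 1) * (1 + u) powr (- c))) \<partial>lborel)"
    by (rule nn_integral_cmult[symmetric]) measurable
  also have "\<dots> = (\<integral>\<^sup>+u. \<integral>\<^sup>+v. ?f u v \<partial>lborel \<partial>lborel)"
  proof (rule nn_integral_cong)
    fix u :: real
    have "(\<integral>\<^sup>+v. ?f u v \<partial>lborel) = ennreal (indicator {0..} u * u powr (a - 1)) *
        (\<integral>\<^sup>+v. ennreal (indicator {0..} v * (v powr (c - 1) * exp (- (v * (1 + u))))) \<partial>lborel)"
      by (rule nn_integral_cmult) measurable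
    then show "ennreal (Gamma c) * ennreal (indicator {0..} u * (u powr (a - 1) * (1 + u) powr (- c))) = (\<integral>\<^sup>+v. ?f u v \<partial>lborel)"
      using assms nn_integral_Gamma_scaled[of c "1 + u"]
      by (auto simp: indicator_def mult_ac simp flip: ennreal_mult)
  qed
  also have "\<dots> = (\<integral>\<^sup>+v. \<integral>\<^sup>+u. ?f u v \<partial>lborel \<partial>lborel)"
    by (rule lborel_pair.Fubini'[symmetric]) measurable
  also have "\<dots> = (\<integral>\<^sup>+v. ennreal (Gamma a) * ennreal (indicator {0..} v * (v powr (c - a - 1) * exp (- (v * 1)))) \<partial>lborel)"
  proof (rule nn_integral_cong_AE)
    have "(\<integral>\<^sup>+u. ?f u v \<partial>lborel) = ennreal (Gamma a) * ennreal (indicator {0..} v * (v powr (c - a - 1) * exp (- (v * 1))))" if "v \<noteq> 0" for v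
    proof (cases "v > 0")
      case True
      have "(\<integral>\<^sup>+u. ?f u v \<partial>lborel) = (\<integral>\<^sup>+u. ennreal (v powr (c - 1) * exp (- v)) * ennreal (indicator {0..} u * (u powr (a - 1) * exp (- (u * v)))) \<partial>lborel)"
        using True by (intro nn_integral_cong)
          (auto simp: indicator_def distrib_left exp_add exp_minus exp_diff field_simps simp flip: ennreal_mult)
      also have "\<dots> = ennreal (v powr (c - 1) * exp (- v)) * (\<integral>\<^sup>+u. ennreal (indicator {0..} u * (u powr (a - 1) * exp (- (u * v)))) \<partial>lborel)"
        by (rule nn_integral_cmult) measurable
      also have "\<dots> = ennreal (v powr (c - 1) * exp (- v)) * ennreal (Gamma a * v powr (- a))"
        using nn_integral_Gamma_scaled[OF \<open>0 < a\<close> True] by simp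
      also have "\<dots> = ennreal (Gamma a) * ennreal (v powr (c - 1) * v powr (- a) * exp (- v))"
        by (simp add: mult_ac flip: ennreal_mult)
      also have "v powr (c - 1) * v powr (- a) = v powr (c - a - 1)"
        by (simp add: algebra_simps flip: powr_add)
      finally show ?thesis using True by simp
    next
      case False
      then show ?thesis using that by simp
    qed
    from eventually_mono[OF AE_lborel_singleton[of "0::real"] this]
    show "AE v in lborel. (\<integral>\<^sup>+u. ?f u v \<partial>lborel) = ennreal (Gamma a) * ennreal (indicator {0..} v * (v powr (c - a - 1) * exp (- (v * 1))))"
      .
  qed
  also have "\<dots> = ennreal (Gamma a) * (\<integral>\<^sup>+v. ennreal (indicator {0..} v * (v powr (c - a - 1) * exp (- (v * 1)))) \<partial>lborel)"
    by (rule nn_integral_cmult) measurable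
  also have "\<dots> = ennreal (Gamma c) * ennreal (Gamma a * Gamma (c - a) / Gamma c)"
    using assms nn_integral_Gamma_scaled[of "c - a" 1] by (simp flip: ennreal_mult)
  finally show ?thesis by (subst (asm) ennreal_mult_cancel_left) auto
qed

text \<open>The rows of \<open>g\<close> form an orthonormal basis of \<open>W\<close> joined with
  one of its orthogonal complement, and \<open>I\<close> collects the indices of the latter.\<close>

lemma subspace_adapted_coordinates:
  fixes W :: "(real^'n) set"
  assumes W: "subspace W"
  obtains g :: "real^'n^'n" and I where "orthogonal_matrix g" "card I = CARD('n) - dim W"
    "\<And>y. (infdist y W)\<^sup>2 = (\<Sum>i\<in>I. ((g *v y) $ i)\<^sup>2)"
proof -
  define N where "N = {y. \<forall>w\<in>W. orthogonal w y}"
  have N: "subspace N" by (auto simp: N_def subspace_def orthogonal_clauses)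
  obtain B where B: "B \<subseteq> W" "pairwise orthogonal B" "\<And>x. x \<in> B \<Longrightarrow> norm x = 1" "independent B" "card B = dim W" "span B = W"
    using orthonormal_basis_subspace[OF W] by metis
  obtain C where C: "C \<subseteq> N" "pairwise orthogonal C" "\<And>x. x \<in> C \<Longrightarrow> norm x = 1" "independent C" "card C = dim N" "span C = N"
    using orthonormal_basis_subspace[OF N] by metis
  have fin: "finite B" "finite C" using B C by (auto intro: independent_imp_finite)
  have dimN: "dim N + dim W = CARD('n)"
    using dim_subspace_orthogonal_to_vectors[OF W subspace_UNIV] by (simp add: N_def)
  have orthBC: "orthogonal b c" if "b \<in> B" "c \<in> C" for b c
    using that B(1) C(1) by (auto simp: N_def)
  have disj: "B \<inter> C = {}"
    using orthBC B(3) by (metis disjoint_iff norm_zero orthogonal_self zero_neq_one)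
  have "card (B \<union> C) = CARD('n)"
    using fin disj B(5) C(5) dimN by (simp add: card_Un_disjoint)
  then obtain \<phi> where \<phi>: "bij_betw \<phi> (UNIV :: 'n set) (B \<union> C)"
    using fin by (metis finite_Un finite_same_card_bij finite)
  have \<phi>in: "\<phi> i \<in> B \<union> C" for i using \<phi> by (auto simp: bij_betw_def)
  define g :: "real^'n^'n" where "g = (\<chi> i. \<phi> i)"
  have gv: "(g *v y) $ i = \<phi> i \<bullet> y" for y i
    by (simp add: g_def matrix_vector_mult_def inner_vec_def)
  have "norm (\<phi> i) = 1" for i using \<phi>in[of i] B(3) C(3) by auto
  moreover have "orthogonal (\<phi> i) (\<phi> j)" if "i \<noteq> j" for i j
  proof -
    have "\<phi> i \<noteq> \<phi> j" using that \<phi> by (auto simp: bij_betw_def inj_on_def)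
    then show ?thesis
      using \<phi>in[of i] \<phi>in[of j] B(2) C(2) by (auto simp: pairwise_def intro: orthBC iffD1[OF orthogonal_commute orthBC])
  qed
  ultimately have orth: "orthogonal_matrix g"
    unfolding orthogonal_matrix_orthonormal_rows by (auto simp: row_def g_def)
  define I where "I = {i. \<phi> i \<in> C}"
  have "\<phi> ` I = C" using \<phi> by (auto simp: I_def bij_betw_def)
  then have cardI: "card I = CARD('n) - dim W"
    using \<phi> C(5) dimN card_image[of \<phi> I] by (auto simp: bij_betw_def inj_on_def)
  have "(infdist y W)\<^sup>2 = (\<Sum>i\<in>I. ((g *v y) $ i)\<^sup>2)" for y
  proof -
    obtain p q where p: "p \<in> span W" and q: "\<And>w. w \<in> span W \<Longrightarrow> orthogonal q w" and y: "y = p + q"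
      using orthogonal_subspace_decomp_exists[of W y] by blast
    have sW: "span W = W" using W by (simp add: span_eq_iff)
    have "infdist y W = norm q"
      unfolding y using p q W by (intro infdist_orthogonal_decomp) (auto simp: sW)
    also have "(norm q)\<^sup>2 = (norm (g *v q))\<^sup>2"
      using orth by (simp add: matrix_isometryD orthogonal_matrix)
    also have "\<dots> = (\<Sum>i\<in>UNIV. ((g *v q) $ i)\<^sup>2)"
      unfolding power2_norm_eq_inner inner_vec_def by (simp add: power2_eq_square)
    also have "\<dots> = (\<Sum>i\<in>UNIV. if i \<in> I then ((g *v y) $ i)\<^sup>2 else 0)"
    proof (rule sum.cong)
      fix i
      have "\<phi> i \<bullet> q = 0" if "i \<notin> I"
        using that \<phi>in[of i] B(1) q[of "\<phi> i"] by (auto simp: I_def sW orthogonal_def inner_commute)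
      moreover have "\<phi> i \<bullet> p = 0" if "i \<in> I"
        using that C(1) p by (auto simp: I_def N_def sW orthogonal_def inner_commute)
      ultimately show "((g *v q) $ i)\<^sup>2 = (if i \<in> I then ((g *v y) $ i)\<^sup>2 else 0)"
        unfolding gv y by (simp add: inner_add_right)
    qed simp
    finally show ?thesis by (simp add: sum.If_cases)
  qed
  then show ?thesis using that[OF orth cardI] by blast
qed

text \<open>In adapted coordinates the exponent is that of the standard Gaussian with
  \<open>CARD('n) - dim W\<close> coordinates stretched by \<open>sqrt (1 + u)\<close>.\<close>

lemma nn_integral_gaussian_infdist:
  fixes W :: "(real^'n) set"
  assumes W: "subspace W" and u: "u \<ge> 0"
  shows "(\<integral>\<^sup>+y. ennreal (exp (- (norm y)\<^sup>2 - u * (infdist y W)\<^sup>2)) \<partial>lborel)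
    = ennreal (sqrt pi ^ CARD('n) * (1 + u) powr (- (real CARD('n) - real (dim W)) / 2))"
proof -
  obtain g :: "real^'n^'n" and I where g: "orthogonal_matrix g" and I: "card I = CARD('n) - dim W"
    and dist: "\<And>y. (infdist y W)\<^sup>2 = (\<Sum>i\<in>I. ((g *v y) $ i)\<^sup>2)"
    using subspace_adapted_coordinates[OF W] by blast
  define c where "c i = (if i \<in> I then sqrt (1 + u) else 1)" for i
  have c: "c i \<noteq> 0" for i using u by (simp add: c_def)
  have dimW: "dim W \<le> CARD('n)" using dim_subset_UNIV[of W] by simp
  have prod_c: "\<bar>\<Prod>i\<in>UNIV. c i\<bar> = (1 + u) powr ((real CARD('n) - real (dim W)) / 2)"
  proof -
    have "(\<Prod>i\<in>UNIV. c i) = sqrt (1 + u) ^ card I"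
      unfolding c_def by (simp add: prod.If_cases)
    also have "\<dots> = (1 + u) powr (real (card I) / 2)"
      using u by (simp add: powr_half_sqrt[symmetric] powr_realpow[symmetric] powr_powr)
    finally show ?thesis using dimW by (simp add: I of_nat_diff)
  qed
  let ?h = "\<lambda>x::real^'n. ennreal (exp (- (norm x)\<^sup>2))"
  have "exp (- (norm y)\<^sup>2 - u * (infdist y W)\<^sup>2) = exp (- (norm (\<chi> i. c i * (g *v y) $ i))\<^sup>2)" for y
  proof -
    have "(norm (\<chi> i. c i * (g *v y) $ i))\<^sup>2 = (\<Sum>i\<in>UNIV. ((g *v y) $ i)\<^sup>2 + u * (if i \<in> I then ((g *v y) $ i)\<^sup>2 else 0))"
      unfolding power2_norm_eq_inner inner_vec_def
      using u by (intro sum.cong) (auto simp: c_def algebra_simps power2_eq_square)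
    also have "\<dots> = (norm (g *v y))\<^sup>2 + u * (infdist y W)\<^sup>2"
      unfolding dist power2_norm_eq_inner inner_vec_def
      by (simp add: sum.distrib sum_distrib_left[symmetric] sum.If_cases power2_eq_square)
    also have "norm (g *v y) = norm y" using g by (simp add: matrix_isometryD orthogonal_matrix)
    finally show ?thesis by simp
  qed
  then have "(\<integral>\<^sup>+y. ennreal (exp (- (norm y)\<^sup>2 - u * (infdist y W)\<^sup>2)) \<partial>lborel)
      = (\<integral>\<^sup>+y. ?h (\<chi> i. c i * (g *v y) $ i) \<partial>lborel)" by simp
  also have "\<dots> = (\<integral>\<^sup>+x. ?h (\<chi> i. c i * x $ i) \<partial>lborel)"
    using nn_integral_matrix_vector_mult[of "\<lambda>x. ?h (\<chi> i. c i * x $ i)" g] abs_det_orthogonal[OF g] by auto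
  finally have eq: "ennreal \<bar>\<Prod>i\<in>UNIV. c i\<bar> * (\<integral>\<^sup>+y. ennreal (exp (- (norm y)\<^sup>2 - u * (infdist y W)\<^sup>2)) \<partial>lborel)
      = ennreal (sqrt pi ^ CARD('n))"
    using nn_integral_stretch_coordinates[of ?h c, OF _ c] nn_integral_gaussian[where 'a = "real^'n"] by simp
  also have "\<dots> = ennreal \<bar>\<Prod>i\<in>UNIV. c i\<bar> * ennreal (sqrt pi ^ CARD('n) * (1 + u) powr (- (real CARD('n) - real (dim W)) / 2))"
  proof -
    have "(1 + u) powr (- (real CARD('n) - real (dim W)) / 2) = inverse ((1 + u) powr ((real CARD('n) - real (dim W)) / 2))"
      by (simp only: minus_divide_left[symmetric] powr_minus)
    then show ?thesis using u by (simp add: prod_c flip: ennreal_mult)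
  qed
  finally show ?thesis
    using u by (subst (asm) ennreal_mult_cancel_left) (auto simp: prod_c)
qed

lemma subspace_null_set:
  fixes W :: "(real^'n) set"
  assumes "subspace W" "dim W < CARD('n)"
  shows "AE y in lborel. y \<notin> W"
proof -
  have "negligible W" using assms(2) by (intro negligible_lowdim) simp
  moreover have "W \<in> sets borel" using closed_subspace[OF assms(1)] by simp
  ultimately have "W \<in> null_sets lborel"
    by (simp add: negligible_iff_null_sets null_sets_completion_iff)
  then show ?thesis by (rule AE_not_in)
qed

text \<open>Under the normalised Gaussian the squared distance from \<open>W\<close> is Gamma
  distributed with shape half the codimension, and this is one of its negative moments. The upper
  bound on \<open>2 * a\<close> is the convergence condition of the Beta integral to which the
  computation leads.\<close>

lemma nn_integral_infdist_powr:
  fixes W :: "(real^'n) set"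
  assumes W: "subspace W" and dim: "dim W < CARD('n)" and a: "0 < a" "2 * a < real CARD('n) - real (dim W)"
  shows "(\<integral>\<^sup>+y. ennreal (((infdist y W)\<^sup>2) powr (- a) * exp (- (norm y)\<^sup>2)) \<partial>lborel)
    = ennreal (sqrt pi ^ CARD('n) * Gamma ((real CARD('n) - real (dim W)) / 2 - a) / Gamma ((real CARD('n) - real (dim W)) / 2))"
proof -
  define c where "c = (real CARD('n) - real (dim W)) / 2"
  have c: "a < c" "0 < c" using a by (auto simp: c_def)
  have [simp]: "Gamma c > 0" "Gamma a > 0" "Gamma (c - a) > 0" using a c by (auto intro!: Gamma_real_pos)
  then have [simp]: "Gamma c \<ge> 0" "Gamma a \<ge> 0" "Gamma (c - a) \<ge> 0" "Gamma c \<noteq> 0" "Gamma a \<noteq> 0" by linarith+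
  have [measurable]: "(\<lambda>y. infdist y W) \<in> borel_measurable borel"
    by (intro borel_measurable_continuous_onI continuous_intros)
  let ?f = "\<lambda>y u. ennreal (indicator {0..} u * u powr (a - 1)) * ennreal (exp (- (norm y)\<^sup>2 - u * (infdist y W)\<^sup>2))"
  have Wcl: "infdist y W > 0" if "y \<notin> W" for y
    using closed_subspace[OF W] subspace_0[OF W] that in_closed_iff_infdist_zero[of W y] infdist_nonneg[of y W] by fastforce
  have "ennreal (Gamma a) * (\<integral>\<^sup>+y. ennreal (((infdist y W)\<^sup>2) powr (- a) * exp (- (norm y)\<^sup>2)) \<partial>lborel)
     = (\<integral>\<^sup>+y. ennreal (Gamma a) * ennreal (((infdist y W)\<^sup>2) powr (- a) * exp (- (norm y)\<^sup>2)) \<partial>lborel)"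
    by (rule nn_integral_cmult[symmetric]) measurable
  also have "\<dots> = (\<integral>\<^sup>+y. \<integral>\<^sup>+u. ?f y u \<partial>lborel \<partial>lborel)"
  proof (rule nn_integral_cong_AE)
    have "ennreal (Gamma a) * ennreal (((infdist y W)\<^sup>2) powr (- a) * exp (- (norm y)\<^sup>2)) = (\<integral>\<^sup>+u. ?f y u \<partial>lborel)" if "y \<notin> W" for y
    proof -
      have "(\<integral>\<^sup>+u. ?f y u \<partial>lborel) = (\<integral>\<^sup>+u. ennreal (exp (- (norm y)\<^sup>2)) * ennreal (indicator {0..} u * (u powr (a - 1) * exp (- (u * (infdist y W)\<^sup>2)))) \<partial>lborel)"
        by (intro nn_integral_cong) (auto simp: exp_diff exp_minus field_simps simp flip: ennreal_mult)
      also have "\<dots> = ennreal (exp (- (norm y)\<^sup>2)) * (\<integral>\<^sup>+u. ennreal (indicator {0..} u * (u powr (a - 1) * exp (- (u * (infdist y W)\<^sup>2)))) \<partial>lborel)"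
        by (rule nn_integral_cmult) measurable
      also have "\<dots> = ennreal (exp (- (norm y)\<^sup>2)) * ennreal (Gamma a * ((infdist y W)\<^sup>2) powr (- a))"
        using nn_integral_Gamma_scaled[OF a(1), of "(infdist y W)\<^sup>2"] Wcl[OF that] by simp
      finally show ?thesis by (simp add: mult_ac flip: ennreal_mult)
    qed
    from eventually_mono[OF subspace_null_set[OF W dim] this]
    show "AE y in lborel. ennreal (Gamma a) * ennreal (((infdist y W)\<^sup>2) powr (- a) * exp (- (norm y)\<^sup>2)) = (\<integral>\<^sup>+u. ?f y u \<partial>lborel)"
      .
  qed
  also have "\<dots> = (\<integral>\<^sup>+u. \<integral>\<^sup>+y. ?f y u \<partial>lborel \<partial>lborel)"
    by (rule lborel_pair.Fubini') measurable
  also have "\<dots> = (\<integral>\<^sup>+u. ennreal (sqrt pi ^ CARD('n)) * ennreal (indicator {0..} u * (u powr (a - 1) * (1 + u) powr (- c))) \<partial>lborel)"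
  proof (rule nn_integral_cong)
    fix u :: real
    have "(\<integral>\<^sup>+y. ?f y u \<partial>lborel) = ennreal (indicator {0..} u * u powr (a - 1)) * (\<integral>\<^sup>+y. ennreal (exp (- (norm y)\<^sup>2 - u * (infdist y W)\<^sup>2)) \<partial>lborel)"
      by (rule nn_integral_cmult) measurable
    then show "(\<integral>\<^sup>+y. ?f y u \<partial>lborel) = ennreal (sqrt pi ^ CARD('n)) * ennreal (indicator {0..} u * (u powr (a - 1) * (1 + u) powr (- c)))"
      using nn_integral_gaussian_infdist[OF W, of u]
      by (auto simp: indicator_def c_def minus_divide_left mult_ac simp flip: ennreal_mult)
  qed
  also have "\<dots> = ennreal (sqrt pi ^ CARD('n)) * (\<integral>\<^sup>+u. ennreal (indicator {0..} u * (u powr (a - 1) * (1 + u) powr (- c))) \<partial>lborel)"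
    by (rule nn_integral_cmult) measurable
  also have "\<dots> = ennreal (Gamma a) * ennreal (sqrt pi ^ CARD('n) * Gamma (c - a) / Gamma c)"
    using nn_integral_Beta_halfline[OF a(1) c(1)] by (simp add: mult_ac less_imp_le flip: ennreal_mult)
  finally have "(\<integral>\<^sup>+y. ennreal (((infdist y W)\<^sup>2) powr (- a) * exp (- (norm y)\<^sup>2)) \<partial>lborel) = ennreal (sqrt pi ^ CARD('n) * Gamma (c - a) / Gamma c)"
    by (subst (asm) ennreal_mult_cancel_left) auto
  then show ?thesis by (simp only: c_def)
qed

text \<open>Bartlett's decomposition. The vectors are integrated out one at a time: the next vector
  enters only through its distance from the span of the others, and by assumption that integral
  depends only on the dimension of the span. Hence the product.\<close>

lemma nn_integral_gram_powr:
  fixes \<beta> :: "nat \<Rightarrow> ennreal" and S :: "'m::finite set"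
  assumes \<beta>: "\<And>W::(real^'n) set. subspace W \<Longrightarrow> dim W < d \<Longrightarrow>
      (\<integral>\<^sup>+y. ennreal (((infdist y W)\<^sup>2) powr s * exp (- (norm y)\<^sup>2)) \<partial>lborel) = \<beta> (dim W)"
    and "card S \<le> d"
  shows "(\<integral>\<^sup>+f. ennreal (gram S f powr s * exp (- (\<Sum>i\<in>S. (norm (f i))\<^sup>2))) \<partial>(\<Pi>\<^sub>M i\<in>S. (lborel :: (real^'n) measure)))
    = (\<Prod>j<card S. \<beta> j)"
proof -
  interpret product_sigma_finite "\<lambda>i::'m. lborel :: (real^'n) measure" by standard
  have meas: "gram S \<in> borel_measurable (\<Pi>\<^sub>M i\<in>S. (lborel :: (real^'n) measure))" for S :: "'m set"
    unfolding gram_def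
  proof (intro borel_measurable_det borel_measurable_vec_lambda)
    fix a b show "(\<lambda>f. if a \<in> S \<and> b \<in> S then f a \<bullet> f b else if a = b then 1 else 0) \<in> borel_measurable (\<Pi>\<^sub>M i\<in>S. (lborel :: (real^'n) measure))"
      by (cases "a \<in> S \<and> b \<in> S") auto
  qed
  have "finite S" by simp
  then show ?thesis using assms(2)
  proof (induction S rule: finite_induct)
    case empty
    have "(\<lambda>f. ennreal (gram {} f powr s * exp (- (\<Sum>i\<in>{}. (norm (f i))\<^sup>2)))) = (\<lambda>_. 1)"
      by (simp add: gram_empty)
    then show ?case by (simp add: nn_integral_empty gram_empty space_PiM emeasure_PiM_empty)
  next
    case (insert i S)
    note [measurable] = meas
    have card: "card S < d" using insert by simp
    have "(\<integral>\<^sup>+f. ennreal (gram (insert i S) f powr s * exp (- (\<Sum>i\<in>insert i S. (norm (f i))\<^sup>2))) \<partial>(\<Pi>\<^sub>M i\<in>insert i S. (lborel :: (real^'n) measure)))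
       = (\<integral>\<^sup>+f. \<integral>\<^sup>+v. ennreal (gram (insert i S) (f(i := v)) powr s * exp (- (\<Sum>j\<in>insert i S. (norm ((f(i := v)) j))\<^sup>2))) \<partial>lborel \<partial>(\<Pi>\<^sub>M i\<in>S. (lborel :: (real^'n) measure)))"
      by (rule product_nn_integral_insert[OF insert(1,2)]) measurable
    also have "\<dots> = (\<integral>\<^sup>+f. ennreal (gram S f powr s * exp (- (\<Sum>i\<in>S. (norm (f i))\<^sup>2))) * \<beta> (card S) \<partial>(\<Pi>\<^sub>M i\<in>S. (lborel :: (real^'n) measure)))"
    proof (rule nn_integral_cong)
      fix f :: "'m \<Rightarrow> real^'n"
      let ?W = "span (f ` S)"
      have sum: "(\<Sum>j\<in>insert i S. (norm ((f(i := v)) j))\<^sup>2) = (norm v)\<^sup>2 + (\<Sum>j\<in>S. (norm (f j))\<^sup>2)" for v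
      proof -
        have "(\<Sum>j\<in>S. (norm ((f(i := v)) j))\<^sup>2) = (\<Sum>j\<in>S. (norm (f j))\<^sup>2)"
          using insert(2) by (intro sum.cong) auto
        then show ?thesis using insert(1,2) by simp
      qed
      have [measurable]: "(\<lambda>y. infdist y ?W) \<in> borel_measurable borel"
        by (intro borel_measurable_continuous_onI continuous_intros)
      have "(\<integral>\<^sup>+v. ennreal (gram (insert i S) (f(i := v)) powr s * exp (- (\<Sum>j\<in>insert i S. (norm ((f(i := v)) j))\<^sup>2))) \<partial>lborel)
         = (\<integral>\<^sup>+v. ennreal (gram S f powr s * exp (- (\<Sum>i\<in>S. (norm (f i))\<^sup>2))) * ennreal (((infdist v ?W)\<^sup>2) powr s * exp (- (norm v)\<^sup>2)) \<partial>lborel)"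
        unfolding gram_insert[OF insert(2)] sum
        by (intro nn_integral_cong) (simp add: powr_mult gram_nonneg exp_diff exp_minus field_simps flip: ennreal_mult)
      also have "\<dots> = ennreal (gram S f powr s * exp (- (\<Sum>i\<in>S. (norm (f i))\<^sup>2))) * (\<integral>\<^sup>+v. ennreal (((infdist v ?W)\<^sup>2) powr s * exp (- (norm v)\<^sup>2)) \<partial>lborel)"
        by (rule nn_integral_cmult) measurable
      also have "\<dots> = ennreal (gram S f powr s * exp (- (\<Sum>i\<in>S. (norm (f i))\<^sup>2))) * \<beta> (card S)"
      \<comment> \<open>For degenerate \<open>f\<close> the span has the wrong dimension, but then
        the weight is zero because \<open>0 powr s = 0\<close>.\<close>
      proof (cases "gram S f = 0")
        case False
        then have "dim ?W = card S" by (rule dim_span_of_gram_nz)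
        then show ?thesis using \<beta>[of ?W] card by simp
      qed simp
      finally show "(\<integral>\<^sup>+v. ennreal (gram (insert i S) (f(i := v)) powr s * exp (- (\<Sum>j\<in>insert i S. (norm ((f(i := v)) j))\<^sup>2))) \<partial>lborel)
         = ennreal (gram S f powr s * exp (- (\<Sum>i\<in>S. (norm (f i))\<^sup>2))) * \<beta> (card S)" .
    qed
    also have "\<dots> = (\<integral>\<^sup>+f. ennreal (gram S f powr s * exp (- (\<Sum>i\<in>S. (norm (f i))\<^sup>2))) \<partial>(\<Pi>\<^sub>M i\<in>S. (lborel :: (real^'n) measure))) * \<beta> (card S)"
      by (rule nn_integral_multc) measurable
    also have "\<dots> = (\<Prod>j<card (insert i S). \<beta> j)"
      using insert by simp
    finally show ?case .
  qed
qed

lemma nn_integral_gdet_powr: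
  fixes \<beta> :: "nat \<Rightarrow> ennreal"
  assumes \<beta>: "\<And>W::(real^'n) set. subspace W \<Longrightarrow> dim W < CARD('m) \<Longrightarrow>
      (\<integral>\<^sup>+y. ennreal (((infdist y W)\<^sup>2) powr s * exp (- (norm y)\<^sup>2)) \<partial>lborel) = \<beta> (dim W)"
  shows "(\<integral>\<^sup>+y. ennreal (gdet y powr s * exp (- (norm y)\<^sup>2)) \<partial>(lborel :: (real^'m^'n) measure)) = (\<Prod>j<CARD('m). \<beta> j)"
proof -
  have [measurable]: "(\<lambda>f. \<chi> i. f i) \<in> borel_measurable (\<Pi>\<^sub>M i\<in>(UNIV::'m set). (lborel :: (real^'n) measure))"
    by (rule borel_measurable_vecI) simp
  have "(\<integral>\<^sup>+y. ennreal (gdet y powr s * exp (- (norm y)\<^sup>2)) \<partial>(lborel :: (real^'m^'n) measure))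
      = (\<integral>\<^sup>+z. ennreal (gdet (transpose z) powr s * exp (- (norm (transpose z))\<^sup>2)) \<partial>(lborel :: (real^'n^'m) measure))"
    by (rule nn_integral_transpose[symmetric]) measurable
  also have "\<dots> = (\<integral>\<^sup>+f. ennreal (gdet (transpose (\<chi> i. f i)) powr s * exp (- (norm (transpose (\<chi> i. f i) :: real^'m^'n))\<^sup>2)) \<partial>(\<Pi>\<^sub>M i\<in>(UNIV::'m set). (lborel :: (real^'n) measure)))"
    by (subst lborel_vec, subst nn_integral_distr) simp_all
  also have "\<dots> = (\<integral>\<^sup>+f. ennreal (gram UNIV f powr s * exp (- (\<Sum>i\<in>UNIV. (norm (f i))\<^sup>2))) \<partial>(\<Pi>\<^sub>M i\<in>(UNIV::'m set). (lborel :: (real^'n) measure)))"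
  proof (rule nn_integral_cong)
    fix f :: "'m \<Rightarrow> real^'n"
    have *: "(norm (\<chi> i. f i))\<^sup>2 = (\<Sum>i\<in>UNIV. (norm (f i))\<^sup>2)"
      by (simp add: power2_norm_eq_inner inner_vec_def)
    show "ennreal (gdet (transpose (\<chi> i. f i)) powr s * exp (- (norm (transpose (\<chi> i. f i) :: real^'m^'n))\<^sup>2))
      = ennreal (gram UNIV f powr s * exp (- (\<Sum>i\<in>UNIV. (norm (f i))\<^sup>2)))"
    proof -
      have "($) (vec_lambda f) = f" by (simp add: fun_eq_iff)
      then have "gdet (transpose (\<chi> i. f i)) = gram UNIV f"
        using gdet_eq_gram[of "transpose (\<chi> i. f i)"] by (simp only: transpose_transpose)
      then show ?thesis using * by (simp only: norm_transpose)
    qed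
  qed
  also have "\<dots> = (\<Prod>j<CARD('m). \<beta> j)"
    using nn_integral_gram_powr[where S = "UNIV :: 'm set", OF \<beta>] by simp
  finally show ?thesis .
qed

text \<open>The Gaussian moment of order 0. Because \<open>0 powr 0 = 0\<close>, the function
  \<open>gdet y powr 0\<close> is the indicator of full rank, and its Gaussian integral turns out to
  equal the full one, so the complement is null.\<close>

lemma AE_gdet_nonzero:
  assumes "CARD('m) \<le> CARD('n)"
  shows "AE y::real^'m^'n in lborel. gdet y \<noteq> 0"
proof -
  let ?c = "\<lambda>y::real^'m^'n. ennreal (exp (- (norm y)\<^sup>2))"
  have "(\<integral>\<^sup>+y. ennreal (((infdist y W)\<^sup>2) powr 0 * exp (- (norm y)\<^sup>2)) \<partial>lborel) = ennreal (sqrt pi ^ CARD('n))"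
    if W: "subspace W" "dim W < CARD('m)" for W :: "(real^'n) set"
  proof -
    have dim: "dim W < CARD('n)" using W(2) assms by simp
    have nz: "infdist y W \<noteq> 0" if "y \<notin> W" for y
      using closed_subspace[OF \<open>subspace W\<close>] subspace_0[OF \<open>subspace W\<close>] that in_closed_iff_infdist_zero[of W y] by blast
    have "(\<integral>\<^sup>+y. ennreal (((infdist y W)\<^sup>2) powr 0 * exp (- (norm y)\<^sup>2)) \<partial>lborel) = (\<integral>\<^sup>+y. ennreal (exp (- (norm y)\<^sup>2)) \<partial>(lborel :: (real^'n) measure))"
      using subspace_null_set[OF W(1) dim] by (intro nn_integral_cong_AE) (auto elim!: eventually_mono simp: nz)
    then show ?thesis by (simp add: nn_integral_gaussian)
  qed
  from nn_integral_gdet_powr[OF this]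
  have 1: "(\<integral>\<^sup>+y. ennreal (gdet y powr 0 * exp (- (norm y)\<^sup>2)) \<partial>(lborel :: (real^'m^'n) measure)) = ennreal (sqrt pi ^ (CARD('n) * CARD('m)))"
    by (simp add: prod_constant ennreal_power power_mult)
  have "(\<integral>\<^sup>+y. ?c y - ennreal (gdet y powr 0 * exp (- (norm y)\<^sup>2)) \<partial>(lborel :: (real^'m^'n) measure))
      = (\<integral>\<^sup>+y. ?c y \<partial>lborel) - (\<integral>\<^sup>+y. ennreal (gdet y powr 0 * exp (- (norm y)\<^sup>2)) \<partial>(lborel :: (real^'m^'n) measure))"
  proof (rule Nonnegative_Lebesgue_Integration.nn_integral_diff)
    show "(\<integral>\<^sup>+y. ennreal (gdet y powr 0 * exp (- (norm y)\<^sup>2)) \<partial>(lborel :: (real^'m^'n) measure)) \<noteq> \<infinity>"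
      by (simp only: 1) simp
    show "AE y in lborel. ennreal (gdet y powr 0 * exp (- (norm y)\<^sup>2)) \<le> ?c y"
      by (auto intro!: AE_I2 ennreal_leI)
  qed measurable
  also have "\<dots> = 0" unfolding 1 using nn_integral_gaussian[where 'a = "real^'m^'n"] by simp
  finally have "AE y in lborel. ?c y - ennreal (gdet y powr 0 * exp (- (norm y)\<^sup>2)) = 0"
    by (subst (asm) nn_integral_0_iff_AE) measurable
  then show ?thesis by (auto elim!: eventually_mono split: if_splits)
qed

text \<open>The factor with index \<open>j\<close> is a moment in codimension
  \<open>CARD('n) - j\<close>; the last one, \<open>j = CARD('m) - 1\<close>, limits
  \<open>a\<close>.\<close>

lemma nn_integral_gdet_powr_neg:
  assumes "CARD('m) \<le> CARD('n)" and a: "0 < a" "2 * a < real CARD('n) - real CARD('m) + 1"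
  shows "(\<integral>\<^sup>+y. ennreal (gdet y powr (- a) * exp (- (norm y)\<^sup>2)) \<partial>(lborel :: (real^'m^'n) measure))
    = ennreal (\<Prod>j<CARD('m). sqrt pi ^ CARD('n) * Gamma ((real CARD('n) - real j) / 2 - a) / Gamma ((real CARD('n) - real j) / 2))"
proof -
  define \<beta> where "\<beta> j = sqrt pi ^ CARD('n) * Gamma ((real CARD('n) - real j) / 2 - a) / Gamma ((real CARD('n) - real j) / 2)" for j
  have "\<beta> j \<ge> 0" if "j < CARD('m)" for j
  proof -
    have "real j \<le> real CARD('m) - 1" using that by linarith
    then show ?thesis
      using a unfolding \<beta>_def by (intro divide_nonneg_nonneg mult_nonneg_nonneg less_imp_le[OF Gamma_real_pos]) auto
  qed
  moreover have "(\<integral>\<^sup>+y. ennreal (gdet y powr (- a) * exp (- (norm y)\<^sup>2)) \<partial>(lborel :: (real^'m^'n) measure)) = (\<Prod>j<CARD('m). ennreal (\<beta> j))"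
  proof (rule nn_integral_gdet_powr)
    fix W :: "(real^'n) set" assume W: "subspace W" "dim W < CARD('m)"
    have "real (dim W) \<le> real CARD('m) - 1" using W(2) by linarith
    then show "(\<integral>\<^sup>+y. ennreal (((infdist y W)\<^sup>2) powr (- a) * exp (- (norm y)\<^sup>2)) \<partial>lborel) = ennreal (\<beta> (dim W))"
      unfolding \<beta>_def using W assms by (intro nn_integral_infdist_powr) auto
  qed
  ultimately show ?thesis unfolding \<beta>_def[symmetric] by (subst (asm) prod_ennreal) auto
qed

subsection \<open>The matrix t-integral\<close>

lemma AE_det_nonzero: "AE X::real^'n^'n in lborel. det X \<noteq> 0"
  using AE_gdet_nonzero[where 'm = 'n and 'n = 'n, OF order_refl] by (rule eventually_mono) (auto simp: det_mul)

lemma gdet_square: "gdet X = (det X)\<^sup>2" for X :: "real^'n^'n"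
  by (simp add: det_mul power2_eq_square)

lemma power2_powr: "(x\<^sup>2) powr s = \<bar>x\<bar> powr (2 * s)" for x s :: real
proof (cases "x = 0")
  case False
  then have "x\<^sup>2 = \<bar>x\<bar> powr 2" by (simp add: powr_numeral)
  then have "(x\<^sup>2) powr s = (\<bar>x\<bar> powr 2) powr s" by (rule arg_cong)
  then show ?thesis by (simp only: powr_powr)
qed simp

lemma det_one_plus_gram_pos: "det (mat 1 + z ** transpose z) \<ge> 1 \<or> det (mat 1 + z ** transpose z) > 0"
  for z :: "real^'m^'n"
proof -
  obtain R :: "real^'n^'n" where "det R \<noteq> 0" "(det R)\<^sup>2 = det (mat 1 + z ** transpose z)"
    by (rule sqrt_one_plus_gram_exists[where 'p = 'n])
  then show ?thesis by (metis zero_less_power2)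
qed

lemma det_one_plus_gram_pos': "det (mat 1 + transpose z ** z) > 0" for z :: "real^'m^'n"
  using det_one_plus_gram_pos[of "transpose z"] by auto

lemma nn_integral_nonzero:
  assumes [measurable]: "f \<in> borel_measurable lborel" and "AE x in lborel. f x \<noteq> 0"
  shows "(\<integral>\<^sup>+x. f x \<partial>(lborel :: 'a::euclidean_space measure)) \<noteq> 0"
proof
  assume "(\<integral>\<^sup>+x. f x \<partial>(lborel :: 'a measure)) = 0"
  then have "AE x::'a in lborel. f x = 0" by (simp add: nn_integral_0_iff_AE)
  with assms(2) have "AE x::'a in lborel. False" by eventually_elim simp
  then show False using AE_iff_null[of lborel "\<lambda>_::'a. False"] by (auto simp: null_sets_def)
qed

text \<open>Up to the factor \<open>c\<close>, the power of the determinant is the integral over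
  square \<open>X\<close> of \<open>\<bar>det X\<bar> powr (a - n)\<close> times a Gaussian in
  \<open>X\<close> and \<open>transpose z ** X\<close>. Exchanging the integrals makes the one over
  \<open>z\<close> Gaussian and leaves a moment of \<open>gdet X\<close> of order
  \<open>- (n + m - a) / 2\<close>, to which the two bounds on \<open>a\<close> correspond. Since
  \<open>c\<close> is not 0, finiteness of the product gives finiteness of the integral.\<close>

lemma nn_integral_t_density_finite:
  fixes a :: real
  assumes a: "real CARD('n) + real CARD('m) - 1 < a" "a < real CARD('n) + real CARD('m)"
  shows "(\<integral>\<^sup>+z. ennreal (det (mat 1 + z ** transpose z) powr (- a / 2)) \<partial>(lborel :: (real^'m^'n) measure)) < \<infinity>"
proof -
  let ?n = "real CARD('n)"
  define c where "c = (\<integral>\<^sup>+X. ennreal (\<bar>det X\<bar> powr (a - ?n) * exp (- (norm X)\<^sup>2)) \<partial>(lborel :: (real^'n^'n) measure))"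
  have "c \<noteq> 0"
    unfolding c_def using AE_det_nonzero[where 'n = 'n] by (intro nn_integral_nonzero) (auto elim!: eventually_mono)
  have J: "(\<integral>\<^sup>+X. ennreal (\<bar>det X\<bar> powr (a - ?n) * exp (- (norm X)\<^sup>2 - (norm (transpose z ** X))\<^sup>2)) \<partial>(lborel :: (real^'n^'n) measure))
      = c * ennreal (det (mat 1 + z ** transpose z) powr (- a / 2))" (is "?J = _") for z :: "real^'m^'n"
  proof -
    obtain R :: "real^'n^'n" where R: "det R \<noteq> 0" "\<And>X::real^'n^'n. (norm (R ** X))\<^sup>2 = (norm X)\<^sup>2 + (norm (transpose z ** X))\<^sup>2"
      "(det R)\<^sup>2 = det (mat 1 + z ** transpose z)"
      using sqrt_one_plus_gram_exists[of z] by metis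
    have "c = ennreal (\<bar>det R\<bar> ^ CARD('n)) * (\<integral>\<^sup>+X. ennreal (\<bar>det (R ** X)\<bar> powr (a - ?n) * exp (- (norm (R ** X))\<^sup>2)) \<partial>(lborel :: (real^'n^'n) measure))"
      unfolding c_def by (rule nn_integral_matrix_mult_left[symmetric, OF _ R(1)]) measurable
    also have "\<dots> = ennreal (\<bar>det R\<bar> ^ CARD('n)) * (\<integral>\<^sup>+X. ennreal (\<bar>det R\<bar> powr (a - ?n)) * ennreal (\<bar>det X\<bar> powr (a - ?n) * exp (- (norm X)\<^sup>2 - (norm (transpose z ** X))\<^sup>2)) \<partial>lborel)"
      by (simp add: R(2) det_mul abs_mult powr_mult algebra_simps flip: ennreal_mult)
    also have "\<dots> = ennreal (\<bar>det R\<bar> ^ CARD('n)) * (ennreal (\<bar>det R\<bar> powr (a - ?n)) * ?J)"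
      by (subst nn_integral_cmult) auto
    also have "\<dots> = ennreal (\<bar>det R\<bar> powr a) * ?J"
      using R(1) by (simp add: mult.assoc[symmetric] powr_diff powr_realpow flip: ennreal_mult)
    finally have c: "c = ennreal (\<bar>det R\<bar> powr a) * ?J" .
    have "det (mat 1 + z ** transpose z) powr (- a / 2) = inverse (\<bar>det R\<bar> powr a)"
      unfolding R(3)[symmetric] power2_powr by (simp add: powr_minus)
    then have "c * ennreal (det (mat 1 + z ** transpose z) powr (- a / 2)) = ennreal (\<bar>det R\<bar> powr a * inverse (\<bar>det R\<bar> powr a)) * ?J"
      unfolding c by (simp add: mult_ac ennreal_mult)
    also have "\<bar>det R\<bar> powr a * inverse (\<bar>det R\<bar> powr a) = 1" using R(1) by simp
    finally show ?thesis by simp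
  qed
  let ?f = "\<lambda>z X. ennreal (\<bar>det X\<bar> powr (a - ?n) * exp (- (norm X)\<^sup>2 - (norm (transpose z ** X))\<^sup>2))"
  have "c * (\<integral>\<^sup>+z. ennreal (det (mat 1 + z ** transpose z) powr (- a / 2)) \<partial>(lborel :: (real^'m^'n) measure))
     = (\<integral>\<^sup>+z. c * ennreal (det (mat 1 + z ** transpose z) powr (- a / 2)) \<partial>(lborel :: (real^'m^'n) measure))"
    by (rule nn_integral_cmult[symmetric]) measurable
  also have "\<dots> = (\<integral>\<^sup>+z. \<integral>\<^sup>+X. ?f z X \<partial>(lborel :: (real^'n^'n) measure) \<partial>(lborel :: (real^'m^'n) measure))"
    by (simp only: J)
  also have "\<dots> = (\<integral>\<^sup>+X. \<integral>\<^sup>+z. ?f z X \<partial>(lborel :: (real^'m^'n) measure) \<partial>(lborel :: (real^'n^'n) measure))"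
    by (rule lborel_pair.Fubini') measurable
  also have "\<dots> = (\<integral>\<^sup>+X. ennreal (sqrt pi ^ (CARD('n) * CARD('m))) * ennreal (gdet X powr - ((?n + real CARD('m) - a) / 2) * exp (- (norm X)\<^sup>2)) \<partial>(lborel :: (real^'n^'n) measure))"
  proof (rule nn_integral_cong_AE, rule eventually_mono[OF AE_det_nonzero])
    fix X :: "real^'n^'n" assume X: "det X \<noteq> 0"
    have norm: "norm (transpose z ** X) = norm (transpose X ** z)" for z :: "real^'m^'n"
      by (metis matrix_transpose_mul norm_transpose transpose_transpose)
    have "(\<integral>\<^sup>+z. ?f z X \<partial>(lborel :: (real^'m^'n) measure))
       = (\<integral>\<^sup>+z. ennreal (\<bar>det X\<bar> powr (a - ?n) * exp (- (norm X)\<^sup>2)) * ennreal (exp (- (norm (transpose X ** z))\<^sup>2)) \<partial>(lborel :: (real^'m^'n) measure))"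
      by (intro nn_integral_cong) (simp add: norm exp_diff exp_minus field_simps flip: ennreal_mult)
    also have "\<dots> = ennreal (\<bar>det X\<bar> powr (a - ?n) * exp (- (norm X)\<^sup>2)) * (\<integral>\<^sup>+z. ennreal (exp (- (norm (transpose X ** z))\<^sup>2)) \<partial>(lborel :: (real^'m^'n) measure))"
      by (rule nn_integral_cmult) measurable
    also have "\<dots> = ennreal (\<bar>det X\<bar> powr (a - ?n) * exp (- (norm X)\<^sup>2)) * ennreal (sqrt pi ^ (CARD('n) * CARD('m)) / \<bar>det X\<bar> ^ CARD('m))"
      using X by (subst nn_integral_gaussian_matrix_left) auto
    also have "\<dots> = ennreal (sqrt pi ^ (CARD('n) * CARD('m))) * ennreal (\<bar>det X\<bar> powr (a - ?n) / \<bar>det X\<bar> ^ CARD('m) * exp (- (norm X)\<^sup>2))"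
      by (simp add: mult_ac flip: ennreal_mult)
    also have "\<bar>det X\<bar> powr (a - ?n) / \<bar>det X\<bar> ^ CARD('m) = gdet X powr - ((?n + real CARD('m) - a) / 2)"
    proof -
      have "2 * - ((?n + real CARD('m) - a) / 2) = (a - ?n) - real CARD('m)" by (simp add: field_simps)
      then have "gdet X powr - ((?n + real CARD('m) - a) / 2) = \<bar>det X\<bar> powr ((a - ?n) - real CARD('m))"
        unfolding gdet_square power2_powr by (rule arg_cong)
      then show ?thesis using X by (simp only: powr_diff) (simp add: powr_realpow)
    qed
    finally show "(\<integral>\<^sup>+z. ?f z X \<partial>(lborel :: (real^'m^'n) measure)) = ennreal (sqrt pi ^ (CARD('n) * CARD('m))) * ennreal (gdet X powr - ((?n + real CARD('m) - a) / 2) * exp (- (norm X)\<^sup>2))" .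
  qed
  also have "\<dots> = ennreal (sqrt pi ^ (CARD('n) * CARD('m))) * (\<integral>\<^sup>+X. ennreal (gdet X powr - ((?n + real CARD('m) - a) / 2) * exp (- (norm X)\<^sup>2)) \<partial>(lborel :: (real^'n^'n) measure))"
    by (rule nn_integral_cmult) measurable
  also have "\<dots> < \<infinity>"
    using a by (subst nn_integral_gdet_powr_neg) (auto simp: ennreal_mult_less_top)
  finally show ?thesis using \<open>c \<noteq> 0\<close> by (auto simp: ennreal_mult_less_top)
qed


subsection \<open>Homogeneous measures on rectangular matrices\<close>

text \<open>The number \<open>l\<close> is the degree of homogeneity: Lebesgue measure has degree
  \<open>CARD('n)\<close>, and a left-invariant image of matrices with \<open>l\<close> rows has
  degree \<open>l\<close>. Gaussian integrability plays the part of local finiteness and provides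
  the normalising constant; the full-rank condition makes polar decomposition available almost
  everywhere.\<close>

definition homogeneous_measure :: "nat \<Rightarrow> (real^'m^'n) measure \<Rightarrow> bool" where
  "homogeneous_measure l \<rho> \<longleftrightarrow> sets \<rho> = sets borel \<and>
     (\<forall>g. orthogonal_matrix g \<longrightarrow> distr \<rho> borel (\<lambda>x. g ** x) = \<rho>) \<and>
     (\<forall>T h. det T \<noteq> 0 \<longrightarrow> h \<in> borel_measurable borel \<longrightarrow>
        ennreal (\<bar>det T\<bar> ^ l) * (\<integral>\<^sup>+x. h (x ** T) \<partial>\<rho>) = (\<integral>\<^sup>+x. h x \<partial>\<rho>)) \<and>
     (AE x in \<rho>. gdet x \<noteq> 0) \<and>
     (\<integral>\<^sup>+x. ennreal (exp (- (norm x)\<^sup>2)) \<partial>\<rho>) < \<infinity>"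

context
  fixes l :: nat and \<rho> :: "(real^'m^'n) measure"
  assumes hom: "homogeneous_measure l \<rho>"
begin

lemma sets_hom [measurable_cong, simp]: "sets \<rho> = sets borel"
  using hom by (simp add: homogeneous_measure_def)

lemma space_hom [simp]: "space \<rho> = UNIV"
  using sets_eq_imp_space_eq[OF sets_hom] by simp

lemma borel_measurable_hom [simp]: "borel_measurable \<rho> = borel_measurable borel"
  by (rule measurable_cong_sets) auto

lemma hom_orthogonal:
  assumes "orthogonal_matrix g" and [measurable]: "h \<in> borel_measurable borel"
  shows "(\<integral>\<^sup>+x. h (g ** x) \<partial>\<rho>) = (\<integral>\<^sup>+x. h x \<partial>\<rho>)"
proof -
  have "distr \<rho> borel (\<lambda>x. g ** x) = \<rho>" using hom assms(1) by (simp add: homogeneous_measure_def)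
  then have "(\<integral>\<^sup>+x. h x \<partial>\<rho>) = (\<integral>\<^sup>+x. h x \<partial>distr \<rho> borel (\<lambda>x. g ** x))" by simp
  also have "\<dots> = (\<integral>\<^sup>+x. h (g ** x) \<partial>\<rho>)" by (rule nn_integral_distr) measurable
  finally show ?thesis by simp
qed

lemma hom_scale:
  "det T \<noteq> 0 \<Longrightarrow> h \<in> borel_measurable borel \<Longrightarrow>
    ennreal (\<bar>det T\<bar> ^ l) * (\<integral>\<^sup>+x. h (x ** T) \<partial>\<rho>) = (\<integral>\<^sup>+x. h x \<partial>\<rho>)"
  using hom by (simp add: homogeneous_measure_def)

lemma hom_AE: "AE x in \<rho>. gdet x \<noteq> 0"
  using hom by (simp add: homogeneous_measure_def)

lemma hom_gaussian: "(\<integral>\<^sup>+x. ennreal (exp (- (norm x)\<^sup>2)) \<partial>\<rho>) < \<infinity>"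
  using hom by (simp add: homogeneous_measure_def)

lemma hom_bounded_finite:
  assumes [measurable]: "A \<in> sets borel" and A: "A \<subseteq> cball 0 r"
  shows "emeasure \<rho> A < \<infinity>"
proof -
  have "ennreal (exp (- r\<^sup>2)) * emeasure \<rho> A = (\<integral>\<^sup>+x. ennreal (exp (- r\<^sup>2)) * indicator A x \<partial>\<rho>)"
    by (simp add: nn_integral_cmult_indicator)
  also have "\<dots> \<le> (\<integral>\<^sup>+x. ennreal (exp (- (norm x)\<^sup>2)) \<partial>\<rho>)"
  proof (rule nn_integral_mono)
    fix x show "ennreal (exp (- r\<^sup>2)) * indicator A x \<le> ennreal (exp (- (norm x)\<^sup>2))"
      using A by (auto simp: indicator_def intro!: ennreal_leI power_mono)
  qed
  also have "\<dots> < \<infinity>" by (rule hom_gaussian)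
  finally show ?thesis by (auto simp: ennreal_mult_less_top)
qed

lemma hom_sigma_finite: "sigma_finite_measure \<rho>"
proof
  have "cball 0 (real i) \<in> sets \<rho>" "emeasure \<rho> (cball 0 (real i)) \<noteq> \<infinity>" for i
    using hom_bounded_finite[of "cball 0 (real i)" "real i"] by auto
  moreover have "(\<Union>i. cball 0 (real i)) = (UNIV :: (real^'m^'n) set)"
    by (auto simp: real_arch_simple)
  ultimately show "\<exists>A. countable A \<and> A \<subseteq> sets \<rho> \<and> \<Union>A = space \<rho> \<and> (\<forall>a\<in>A. emeasure \<rho> a \<noteq> \<infinity>)"
    by (intro exI[of _ "range (\<lambda>i::nat. cball 0 (real i))"]) auto
qed

text \<open>Integrating a left-invariant function against the kernel
  \<open>gdet x powr (b - m/2) * det (x'x + Y'Y) powr (-b)\<close>, whose integral over square matrices \<open>Y\<close> does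
  not depend on \<open>x\<close>, and substituting \<open>x := xY\<close> shows that the integral depends on \<open>\<rho>\<close>
  only through a constant.\<close>

lemma hom_invariant_integral:
  fixes x0 :: "real^'m^'n" and \<Psi> :: "real^'m^'n \<Rightarrow> ennreal"
  assumes x0: "transpose x0 ** x0 = mat 1" and [measurable]: "\<Psi> \<in> borel_measurable borel"
    and inv: "\<And>g x. orthogonal_matrix g \<Longrightarrow> \<Psi> (g ** x) = \<Psi> x"
    and b: "b = real CARD('m) - 1 / 4"
  shows "(\<integral>\<^sup>+Y. ennreal (det (mat 1 + transpose Y ** Y) powr (- b)) \<partial>(lborel :: (real^'m^'m) measure)) * (\<integral>\<^sup>+x. \<Psi> x \<partial>\<rho>)
    = (\<integral>\<^sup>+x. ennreal (gdet x powr (b - real CARD('m) / 2 - real l / 2) * det (mat 1 + transpose x ** x) powr (- b)) \<partial>\<rho>)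
      * (\<integral>\<^sup>+Y. \<Psi> (x0 ** Y) * ennreal (\<bar>det Y\<bar> powr (real l - real CARD('m))) \<partial>(lborel :: (real^'m^'m) measure))"
    (is "?c * _ = ?D * ?K")
proof -
  interpret sigma_finite_measure \<rho> by (rule hom_sigma_finite)
  interpret pair_sigma_finite \<rho> "lborel :: (real^'m^'m) measure" ..
  let ?m = "real CARD('m)"
  let ?w = "\<lambda>(x::real^'m^'n) (Y::real^'m^'m). ennreal (gdet x powr (b - ?m / 2) * det (transpose x ** x + transpose Y ** Y) powr (- b))"
  let ?w1 = "\<lambda>x::real^'m^'n. gdet x powr (b - ?m / 2) * det (mat 1 + transpose x ** x) powr (- b)"
  have factor: "transpose (Y ** R) ** (Y ** R) = transpose R ** (transpose Y ** Y) ** R" for Y :: "real^'m^'p" and R :: "real^'m^'m"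
    by (simp add: matrix_transpose_mul matrix_mul_assoc)
  have sum_factor: "transpose R ** R + transpose (Y ** R) ** (Y ** R) = transpose R ** (mat 1 + transpose Y ** Y) ** R" for Y :: "real^'m^'p" and R :: "real^'m^'m"
  proof -
    have "(A + B) ** C = A ** C + B ** C" for A B C :: "real^'m^'m"
      by (simp add: vec_eq_iff matrix_matrix_mult_def distrib_right sum.distrib)
    then show ?thesis by (simp add: factor matrix_add_ldistrib)
  qed
  have det_sum_factor: "det (transpose R ** R + transpose (Y ** R) ** (Y ** R)) = (det R)\<^sup>2 * det (mat 1 + transpose Y ** Y)" for Y :: "real^'m^'p" and R :: "real^'m^'m"
    unfolding sum_factor by (simp add: det_mul power2_eq_square)
  \<comment> \<open>With \<open>x = x1 ** R\<close>, the substitution \<open>Y := Y ** R\<close>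
    takes \<open>(det R)\<^sup>2\<close> out of the determinant. The exponent of
    \<open>gdet x\<close> is chosen so that all powers of \<open>det R\<close>, including the
    Jacobian, cancel.\<close>
  have kernel: "(\<integral>\<^sup>+Y. ?w x Y \<partial>lborel) = ?c" if nz: "gdet x \<noteq> 0" for x :: "real^'m^'n"
  proof -
    obtain x1 :: "real^'m^'n" and R where x1: "transpose x1 ** x1 = mat 1" "x = x1 ** R" "det R \<noteq> 0"
      using polar_decomposition_exists[OF nz] by metis
    have xx: "transpose x ** x = transpose R ** R" by (simp add: x1(2) factor x1(1))
    have gx: "gdet x = (det R)\<^sup>2" by (simp add: x1(2) gdet_mult_right x1(1))
    have "(\<integral>\<^sup>+Y. ?w x Y \<partial>lborel) = ennreal (\<bar>det R\<bar> ^ CARD('m)) * (\<integral>\<^sup>+Y. ?w x (Y ** R) \<partial>lborel)"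
      by (rule nn_integral_matrix_mult_right[symmetric, OF _ x1(3)]) measurable
    also have "(\<integral>\<^sup>+Y. ?w x (Y ** R) \<partial>lborel) = (\<integral>\<^sup>+Y. ennreal (\<bar>det R\<bar> powr (- ?m)) * ennreal (det (mat 1 + transpose Y ** Y) powr (- b)) \<partial>(lborel :: (real^'m^'m) measure))"
    proof (rule nn_integral_cong)
      fix Y :: "real^'m^'m"
      have "gdet x powr (b - ?m / 2) * det (transpose x ** x + transpose (Y ** R) ** (Y ** R)) powr (- b)
        = ((det R)\<^sup>2) powr (b - ?m / 2) * ((det R)\<^sup>2) powr (- b) * det (mat 1 + transpose Y ** Y) powr (- b)"
        unfolding gx unfolding xx det_sum_factor using det_one_plus_gram_pos'[of Y] by (simp add: powr_mult)
      also have "((det R)\<^sup>2) powr (b - ?m / 2) * ((det R)\<^sup>2) powr (- b) = \<bar>det R\<bar> powr (- ?m)"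
        unfolding power2_powr by (simp add: powr_add[symmetric] algebra_simps)
      finally show "?w x (Y ** R) = ennreal (\<bar>det R\<bar> powr (- ?m)) * ennreal (det (mat 1 + transpose Y ** Y) powr (- b))"
        by (simp flip: ennreal_mult)
    qed
    also have "\<dots> = ennreal (\<bar>det R\<bar> powr (- ?m)) * ?c"
      by (rule nn_integral_cmult) measurable
    also have "ennreal (\<bar>det R\<bar> ^ CARD('m)) * (ennreal (\<bar>det R\<bar> powr (- ?m)) * ?c) = ?c"
    proof -
      have "\<bar>det R\<bar> ^ CARD('m) * \<bar>det R\<bar> powr (- ?m) = 1"
        using x1(3) by (simp add: powr_minus powr_realpow)
      then show ?thesis by (simp add: mult.assoc[symmetric] flip: ennreal_mult)
    qed
    finally show ?thesis .
  qed
  \<comment> \<open>A rotation replaces the frame \<open>x1\<close> of \<open>x\<close> by the fixed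
    \<open>x0\<close>, which \<open>\<Psi>\<close> does not notice, and the factor \<open>R\<close>
    is absorbed into \<open>Y\<close>. Only a power of \<open>gdet x\<close> is left of the
    dependence on \<open>x\<close>.\<close>
  have fib: "(\<integral>\<^sup>+Y. \<Psi> (x ** Y) * ennreal (\<bar>det Y\<bar> powr (real l - ?m)) \<partial>lborel) = ennreal (gdet x powr (- real l / 2)) * ?K"
    if nz: "gdet x \<noteq> 0" for x :: "real^'m^'n"
  proof -
    obtain x1 :: "real^'m^'n" and R where x1: "transpose x1 ** x1 = mat 1" "x = x1 ** R" "det R \<noteq> 0"
      using polar_decomposition_exists[OF nz] by metis
    have gx: "gdet x = (det R)\<^sup>2" by (simp add: x1(2) gdet_mult_right x1(1))
    obtain g where g: "orthogonal_matrix g" "g ** x1 = x0"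
      using orthogonal_matrix_between_frames[OF x1(1) x0] .
    have \<Psi>: "\<Psi> (x ** Y) = \<Psi> (x0 ** (R ** Y))" for Y
      using inv[OF g(1), of "x ** Y"] by (simp add: x1(2) g(2)[symmetric] matrix_mul_assoc)
    let ?I = "\<integral>\<^sup>+Y. \<Psi> (x ** Y) * ennreal (\<bar>det Y\<bar> powr (real l - ?m)) \<partial>lborel"
    have "?K = ennreal (\<bar>det R\<bar> ^ CARD('m)) * (\<integral>\<^sup>+Y. \<Psi> (x0 ** (R ** Y)) * ennreal (\<bar>det (R ** Y)\<bar> powr (real l - ?m)) \<partial>(lborel :: (real^'m^'m) measure))"
      by (rule nn_integral_matrix_mult_left[symmetric, OF _ x1(3)]) measurable
    also have "(\<integral>\<^sup>+Y. \<Psi> (x0 ** (R ** Y)) * ennreal (\<bar>det (R ** Y)\<bar> powr (real l - ?m)) \<partial>(lborel :: (real^'m^'m) measure))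
       = (\<integral>\<^sup>+Y. ennreal (\<bar>det R\<bar> powr (real l - ?m)) * (\<Psi> (x ** Y) * ennreal (\<bar>det Y\<bar> powr (real l - ?m))) \<partial>lborel)"
      by (simp add: \<Psi> det_mul abs_mult powr_mult ennreal_mult mult_ac)
    also have "\<dots> = ennreal (\<bar>det R\<bar> powr (real l - ?m)) * ?I"
      by (rule nn_integral_cmult) measurable
    finally have K: "?K = ennreal (\<bar>det R\<bar> powr real l) * ?I"
      using x1(3) by (simp add: mult.assoc[symmetric] powr_diff powr_realpow flip: ennreal_mult)
    have "gdet x powr (- real l / 2) * \<bar>det R\<bar> powr real l = 1"
      unfolding gx power2_powr using x1(3) by (simp add: powr_minus)
    then show ?thesis unfolding K by (simp add: mult.assoc[symmetric] flip: ennreal_mult)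
  qed
  have "?c * (\<integral>\<^sup>+x. \<Psi> x \<partial>\<rho>) = (\<integral>\<^sup>+x. \<Psi> x * ?c \<partial>\<rho>)"
    by (subst mult.commute) (rule nn_integral_multc[symmetric], simp)
  also have "\<dots> = (\<integral>\<^sup>+x. \<integral>\<^sup>+Y. \<Psi> x * ?w x Y \<partial>lborel \<partial>\<rho>)"
  proof (rule nn_integral_cong_AE, rule eventually_mono[OF hom_AE])
    fix x :: "real^'m^'n" assume x: "gdet x \<noteq> 0"
    have "(\<integral>\<^sup>+Y. \<Psi> x * ?w x Y \<partial>lborel) = \<Psi> x * (\<integral>\<^sup>+Y. ?w x Y \<partial>(lborel :: (real^'m^'m) measure))"
      by (rule nn_integral_cmult) measurable
    then show "\<Psi> x * ?c = (\<integral>\<^sup>+Y. \<Psi> x * ?w x Y \<partial>lborel)" by (simp add: kernel[OF x])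
  qed
  also have "\<dots> = (\<integral>\<^sup>+Y. \<integral>\<^sup>+x. \<Psi> x * ?w x Y \<partial>\<rho> \<partial>lborel)"
    by (rule Fubini'[symmetric]) measurable
  also have "\<dots> = (\<integral>\<^sup>+Y. \<integral>\<^sup>+x. ennreal (?w1 x) * (\<Psi> (x ** Y) * ennreal (\<bar>det Y\<bar> powr (real l - ?m))) \<partial>\<rho> \<partial>lborel)"
  proof (rule nn_integral_cong_AE, rule eventually_mono[OF AE_det_nonzero])
    fix Y :: "real^'m^'m" assume Y: "det Y \<noteq> 0"
    have "(\<integral>\<^sup>+x. \<Psi> x * ?w x Y \<partial>\<rho>) = ennreal (\<bar>det Y\<bar> ^ l) * (\<integral>\<^sup>+x. \<Psi> (x ** Y) * ?w (x ** Y) Y \<partial>\<rho>)"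
      by (rule hom_scale[symmetric, OF Y]) measurable
    also have "\<dots> = (\<integral>\<^sup>+x. ennreal (\<bar>det Y\<bar> ^ l) * (\<Psi> (x ** Y) * ?w (x ** Y) Y) \<partial>\<rho>)"
      by (rule nn_integral_cmult[symmetric]) simp
    also have "\<dots> = (\<integral>\<^sup>+x. ennreal (?w1 x) * (\<Psi> (x ** Y) * ennreal (\<bar>det Y\<bar> powr (real l - ?m))) \<partial>\<rho>)"
    proof (rule nn_integral_cong)
      fix x :: "real^'m^'n"
      have d: "det (transpose (x ** Y) ** (x ** Y) + transpose Y ** Y) = (det Y)\<^sup>2 * det (mat 1 + transpose x ** x)"
        using det_sum_factor[of Y x] by (simp add: add.commute)
      have "\<bar>det Y\<bar> ^ l * (gdet (x ** Y) powr (b - ?m / 2) * det (transpose (x ** Y) ** (x ** Y) + transpose Y ** Y) powr (- b))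
         = \<bar>det Y\<bar> powr real l * (((det Y)\<^sup>2) powr (b - ?m / 2) * ((det Y)\<^sup>2) powr (- b)) * ?w1 x"
        unfolding d unfolding gdet_mult_right using Y det_one_plus_gram_pos'[of x] gdet_nonneg[of x]
        by (simp add: powr_mult powr_realpow mult_ac)
      also have "((det Y)\<^sup>2) powr (b - ?m / 2) * ((det Y)\<^sup>2) powr (- b) = \<bar>det Y\<bar> powr (- ?m)"
        unfolding power2_powr by (simp add: powr_add[symmetric] algebra_simps)
      also have "\<bar>det Y\<bar> powr real l * \<bar>det Y\<bar> powr (- ?m) = \<bar>det Y\<bar> powr (real l - ?m)"
        by (simp add: powr_add[symmetric])
      finally have e: "\<bar>det Y\<bar> ^ l * (gdet (x ** Y) powr (b - ?m / 2) * det (transpose (x ** Y) ** (x ** Y) + transpose Y ** Y) powr (- b))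
         = \<bar>det Y\<bar> powr (real l - ?m) * ?w1 x" .
      have "ennreal (\<bar>det Y\<bar> ^ l) * (\<Psi> (x ** Y) * ?w (x ** Y) Y) = \<Psi> (x ** Y) * (ennreal (\<bar>det Y\<bar> ^ l) * ?w (x ** Y) Y)"
        by (simp only: mult_ac)
      also have "ennreal (\<bar>det Y\<bar> ^ l) * ?w (x ** Y) Y = ennreal (\<bar>det Y\<bar> powr (real l - ?m) * ?w1 x)"
        unfolding e[symmetric] by (rule ennreal_mult[symmetric]) auto
      also have "\<dots> = ennreal (\<bar>det Y\<bar> powr (real l - ?m)) * ennreal (?w1 x)"
        by (rule ennreal_mult) auto
      finally show "ennreal (\<bar>det Y\<bar> ^ l) * (\<Psi> (x ** Y) * ?w (x ** Y) Y) = ennreal (?w1 x) * (\<Psi> (x ** Y) * ennreal (\<bar>det Y\<bar> powr (real l - ?m)))"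
        by (simp only: mult_ac)
    qed
    finally show "(\<integral>\<^sup>+x. \<Psi> x * ?w x Y \<partial>\<rho>) = (\<integral>\<^sup>+x. ennreal (?w1 x) * (\<Psi> (x ** Y) * ennreal (\<bar>det Y\<bar> powr (real l - ?m))) \<partial>\<rho>)" .
  qed
  also have "\<dots> = (\<integral>\<^sup>+x. \<integral>\<^sup>+Y. ennreal (?w1 x) * (\<Psi> (x ** Y) * ennreal (\<bar>det Y\<bar> powr (real l - ?m))) \<partial>lborel \<partial>\<rho>)"
    by (rule Fubini') measurable
  also have "\<dots> = (\<integral>\<^sup>+x. ennreal (gdet x powr (b - ?m / 2 - real l / 2) * det (mat 1 + transpose x ** x) powr (- b)) * ?K \<partial>\<rho>)"
  proof (rule nn_integral_cong_AE, rule eventually_mono[OF hom_AE])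
    fix x :: "real^'m^'n" assume x: "gdet x \<noteq> 0"
    have "(\<integral>\<^sup>+Y. ennreal (?w1 x) * (\<Psi> (x ** Y) * ennreal (\<bar>det Y\<bar> powr (real l - ?m))) \<partial>lborel)
       = ennreal (?w1 x) * (\<integral>\<^sup>+Y. \<Psi> (x ** Y) * ennreal (\<bar>det Y\<bar> powr (real l - ?m)) \<partial>(lborel :: (real^'m^'m) measure))"
      by (rule nn_integral_cmult) measurable
    also have "\<dots> = ennreal (?w1 x * gdet x powr (- real l / 2)) * ?K"
      unfolding fib[OF x] by (simp add: mult.assoc[symmetric] flip: ennreal_mult)
    also have "?w1 x * gdet x powr (- real l / 2) = gdet x powr (b - ?m / 2 - real l / 2) * det (mat 1 + transpose x ** x) powr (- b)"
    proof -
      have "gdet x powr (b - ?m / 2 - real l / 2) = gdet x powr (b - ?m / 2) * gdet x powr (- real l / 2)"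
        by (subst powr_add[symmetric]) simp
      then show ?thesis by (simp only: mult_ac)
    qed
    finally show "(\<integral>\<^sup>+Y. ennreal (?w1 x) * (\<Psi> (x ** Y) * ennreal (\<bar>det Y\<bar> powr (real l - ?m))) \<partial>lborel)
       = ennreal (gdet x powr (b - ?m / 2 - real l / 2) * det (mat 1 + transpose x ** x) powr (- b)) * ?K" .
  qed
  also have "\<dots> = ?D * ?K"
    by (rule nn_integral_multc) simp
  finally show ?thesis .
qed

end

text \<open>By \<open>hom_invariant_integral\<close> the integral is, up to \<open>c\<close>, a
  factor depending on the measure times a factor depending on the integrand. Comparison with the
  Gaussian, itself an invariant integrand, eliminates both. The cross-multiplied form avoids
  division in the extended reals.\<close>

lemma homogeneous_measures_invariant_proportional:
  fixes x0 :: "real^'m^'n" and \<Psi> :: "real^'m^'n \<Rightarrow> ennreal"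
  assumes h1: "homogeneous_measure l \<rho>1" and h2: "homogeneous_measure l \<rho>2"
    and x0: "transpose x0 ** x0 = mat 1" and m: "\<Psi> \<in> borel_measurable borel"
    and inv: "\<And>g x. orthogonal_matrix g \<Longrightarrow> \<Psi> (g ** x) = \<Psi> x"
  shows "(\<integral>\<^sup>+x. ennreal (exp (- (norm x)\<^sup>2)) \<partial>\<rho>2) * (\<integral>\<^sup>+x. \<Psi> x \<partial>\<rho>1)
    = (\<integral>\<^sup>+x. ennreal (exp (- (norm x)\<^sup>2)) \<partial>\<rho>1) * (\<integral>\<^sup>+x. \<Psi> x \<partial>\<rho>2)"
proof -
  \<comment> \<open>For square matrices of size \<open>CARD('m)\<close>, finiteness of
    \<open>c\<close> through \<open>nn_integral_t_density_finite\<close> asks that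
    \<open>2 * b\<close> lie strictly between \<open>2 * CARD('m) - 1\<close> and
    \<open>2 * CARD('m)\<close>.\<close>
  define b where "b = real CARD('m) - 1 / 4"
  define c where "c = (\<integral>\<^sup>+Y. ennreal (det (mat 1 + transpose Y ** Y) powr (- b)) \<partial>(lborel :: (real^'m^'m) measure))"
  have "c = (\<integral>\<^sup>+Y. ennreal (det (mat 1 + Y ** transpose Y) powr (- (2 * b) / 2)) \<partial>(lborel :: (real^'m^'m) measure))"
    unfolding c_def
    using nn_integral_transpose[of "\<lambda>Y::real^'m^'m. ennreal (det (mat 1 + Y ** transpose Y) powr (- b))"] by simp
  also have "\<dots> < \<infinity>" by (rule nn_integral_t_density_finite) (auto simp: b_def)
  finally have c: "c \<noteq> \<infinity>" by simp
  have c0: "c \<noteq> 0" unfolding c_def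
  proof (rule nn_integral_nonzero)
    have "ennreal (det (mat 1 + transpose Y ** Y) powr (- b)) \<noteq> 0" for Y :: "real^'m^'m"
      using det_one_plus_gram_pos'[of Y] by simp
    then show "AE Y::real^'m^'m in lborel. ennreal (det (mat 1 + transpose Y ** Y) powr (- b)) \<noteq> 0" by simp
    have "(\<lambda>Y::real^'m^'m. ennreal (det (mat 1 + transpose Y ** Y) powr (- b))) \<in> borel_measurable borel" by measurable
    then show "(\<lambda>Y::real^'m^'m. ennreal (det (mat 1 + transpose Y ** Y) powr (- b))) \<in> borel_measurable lborel" by simp
  qed
  define D where "D \<rho> = (\<integral>\<^sup>+x. ennreal (gdet x powr (b - real CARD('m) / 2 - real l / 2) * det (mat 1 + transpose x ** x) powr (- b)) \<partial>\<rho>)" for \<rho> :: "(real^'m^'n) measure"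
  define K where "K \<Phi> = (\<integral>\<^sup>+Y. \<Phi> (x0 ** Y) * ennreal (\<bar>det Y\<bar> powr (real l - real CARD('m))) \<partial>(lborel :: (real^'m^'m) measure))" for \<Phi>
  have L: "c * (\<integral>\<^sup>+x. \<Phi> x \<partial>\<rho>) = D \<rho> * K \<Phi>"
    if "homogeneous_measure l \<rho>" "\<Phi> \<in> borel_measurable borel" "\<And>g x. orthogonal_matrix g \<Longrightarrow> \<Phi> (g ** x) = \<Phi> x" for \<rho> \<Phi>
    unfolding c_def D_def K_def by (rule hom_invariant_integral[OF that(1) x0 that(2) that(3) b_def])
  have G: "(\<lambda>x. ennreal (exp (- (norm x)\<^sup>2))) \<in> borel_measurable (borel :: (real^'m^'n) measure)" by measurable
  have Ginv: "orthogonal_matrix g \<Longrightarrow> ennreal (exp (- (norm (g ** x))\<^sup>2)) = ennreal (exp (- (norm x)\<^sup>2))" for g :: "real^'n^'n" and x :: "real^'m^'n"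
    by (simp add: norm_orthogonal_mult)
  have "c * c * ((\<integral>\<^sup>+x. ennreal (exp (- (norm x)\<^sup>2)) \<partial>\<rho>2) * (\<integral>\<^sup>+x. \<Psi> x \<partial>\<rho>1))
     = (c * (\<integral>\<^sup>+x. ennreal (exp (- (norm x)\<^sup>2)) \<partial>\<rho>2)) * (c * (\<integral>\<^sup>+x. \<Psi> x \<partial>\<rho>1))"
    by (simp only: mult_ac)
  also have "\<dots> = (c * (\<integral>\<^sup>+x. ennreal (exp (- (norm x)\<^sup>2)) \<partial>\<rho>1)) * (c * (\<integral>\<^sup>+x. \<Psi> x \<partial>\<rho>2))"
    using L[OF h1 m inv] L[OF h2 m inv] L[OF h1 G Ginv] L[OF h2 G Ginv] by (simp only: mult_ac)
  also have "\<dots> = c * c * ((\<integral>\<^sup>+x. ennreal (exp (- (norm x)\<^sup>2)) \<partial>\<rho>1) * (\<integral>\<^sup>+x. \<Psi> x \<partial>\<rho>2))"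
    by (simp only: mult_ac)
  finally have "c * c * ((\<integral>\<^sup>+x. ennreal (exp (- (norm x)\<^sup>2)) \<partial>\<rho>2) * (\<integral>\<^sup>+x. \<Psi> x \<partial>\<rho>1))
     = c * c * ((\<integral>\<^sup>+x. ennreal (exp (- (norm x)\<^sup>2)) \<partial>\<rho>1) * (\<integral>\<^sup>+x. \<Psi> x \<partial>\<rho>2))" .
  moreover have "c * c \<noteq> \<top>" "c * c \<noteq> 0" using c c0 by (auto simp: ennreal_mult_eq_top_iff)
  ultimately show ?thesis by (simp only: ennreal_mult_cancel_left) blast
qed

section \<open>From rotation-invariant integrands to all measurable ones\<close>

lemma norm_matrix_mult_le: "norm (A ** B) \<le> norm A * norm B"
  for A :: "real^'n^'p" and B :: "real^'m^'n"
proof -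
  have row: "norm ((A ** B) $ i) \<le> norm (A $ i) * norm B" for i
  proof -
    have "(A ** B) $ i = (\<Sum>k\<in>UNIV. A $ i $ k *\<^sub>R B $ k)"
      by (simp add: vec_eq_iff matrix_matrix_mult_def)
    then have "norm ((A ** B) $ i) \<le> (\<Sum>k\<in>UNIV. \<bar>A $ i $ k\<bar> * \<bar>norm (B $ k)\<bar>)"
      by (auto intro!: order_trans[OF norm_sum] sum_mono)
    also have "\<dots> \<le> L2_set (\<lambda>k. A $ i $ k) UNIV * L2_set (\<lambda>k. norm (B $ k)) UNIV"
      by (rule L2_set_mult_ineq)
    also have "\<dots> = norm (A $ i) * norm B" by (simp add: norm_vec_def L2_set_def)
    finally show ?thesis .
  qed
  have "norm (A ** B) \<le> L2_set (\<lambda>i. norm (A $ i) * norm B) UNIV"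
    unfolding norm_vec_def[of "A ** B"] by (intro L2_set_mono row) auto
  also have "\<dots> = norm A * norm B"
    by (simp add: norm_vec_def[of A] L2_set_left_distrib)
  finally show ?thesis .
qed

lemma matrix_diff_rdistrib: "(A - B) ** C = A ** C - B ** C"
  for A B :: "real^'n^'p" and C :: "real^'m^'n"
  by (simp add: vec_eq_iff matrix_matrix_mult_def left_diff_distrib sum_subtractf)

lemma norm_mult_orthogonal_right:
  fixes x :: "real^'n^'p"
  assumes "orthogonal_matrix g"
  shows "norm (x ** g) = norm x"
proof -
  have "norm (x ** g) = norm (transpose g ** transpose x)"
    using norm_transpose[of "x ** g"] by (simp only: matrix_transpose_mul)
  also have "\<dots> = norm (transpose x)"
    by (rule norm_orthogonal_mult) (simp add: assms)
  also have "\<dots> = norm x" by (rule norm_transpose)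
  finally show ?thesis .
qed

lemma mat_one_close:
  fixes X :: "real^'n^'n" and y :: "real^'m^'n"
  assumes "norm (X - mat 1) \<le> 1 / 2"
  shows "norm y \<le> 2 * norm (X ** y)"
proof -
  have "y = X ** y - (X - mat 1) ** y"
    by (simp add: matrix_diff_rdistrib)
  then have "norm y \<le> norm (X ** y) + norm ((X - mat 1) ** y)"
    by (metis norm_triangle_ineq4)
  also have "norm ((X - mat 1) ** y) \<le> 1 / 2 * norm y"
    using norm_matrix_mult_le[of "X - mat 1" y] assms by (meson mult_right_mono norm_ge_zero order_trans)
  finally show ?thesis by simp
qed

text \<open>For \<open>X\<close> within distance \<open>1 / 2\<close> of the identity,
  \<open>mat_one_close\<close> confines the support of \<open>\<lambda>y. \<psi> (X ** y)\<close> to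
  one fixed ball. That ball has finite measure, so its indicator gives the bound and is also the
  majorant for the limit.\<close>

lemma
  fixes \<rho> :: "(real^'m^'n) measure" and \<psi> :: "real^'m^'n \<Rightarrow> real"
  assumes hom: "homogeneous_measure l \<rho>"
    and cont: "continuous_on UNIV \<psi>" and bdd: "\<And>y. 0 \<le> \<psi> y \<and> \<psi> y \<le> 1" and supp: "\<And>y. norm y > r \<Longrightarrow> \<psi> y = 0"
  shows hom_integral_translate_le: "norm (X - mat 1) \<le> 1 / 2 \<Longrightarrow> (\<integral>\<^sup>+y. ennreal (\<psi> (X ** y)) \<partial>\<rho>) \<le> emeasure \<rho> (cball 0 (2 * r))"
    and hom_integral_translate_tendsto: "Xs \<longlonglongrightarrow> mat 1 \<Longrightarrow> (\<lambda>j. \<integral>\<^sup>+y. ennreal (\<psi> (Xs j ** y)) \<partial>\<rho>) \<longlonglongrightarrow> (\<integral>\<^sup>+y. ennreal (\<psi> (mat 1 ** y)) \<partial>\<rho>)"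
proof -
  note [measurable_cong] = sets_hom[OF hom]
  have [measurable]: "\<psi> \<in> borel_measurable borel" using cont by (rule borel_measurable_continuous_onI)
  have pt: "ennreal (\<psi> (X ** y)) \<le> indicator (cball 0 (2 * r)) y" if "norm (X - mat 1) \<le> 1 / 2" for X y
    using mat_one_close[OF that, of y] supp[of "X ** y"] bdd[of "X ** y"] by (auto simp: indicator_def)
  have cb: "(\<integral>\<^sup>+y. indicator (cball 0 (2 * r)) y \<partial>\<rho>) = emeasure \<rho> (cball 0 (2 * r))"
    by (subst nn_integral_indicator) (auto simp: sets_hom[OF hom])
  show "(\<integral>\<^sup>+y. ennreal (\<psi> (X ** y)) \<partial>\<rho>) \<le> emeasure \<rho> (cball 0 (2 * r))" if "norm (X - mat 1) \<le> 1 / 2" for X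
    unfolding cb[symmetric] by (intro nn_integral_mono pt that)
  assume X: "Xs \<longlonglongrightarrow> mat 1"
  then have "eventually (\<lambda>j. norm (Xs j - mat 1) < 1 / 2) sequentially"
    by (auto simp: tendsto_iff dist_norm elim!: allE[of _ "1/2"])
  then obtain N where N: "\<And>j. j \<ge> N \<Longrightarrow> norm (Xs j - mat 1) < 1 / 2" by (auto simp: eventually_sequentially)
  show "(\<lambda>j. \<integral>\<^sup>+y. ennreal (\<psi> (Xs j ** y)) \<partial>\<rho>) \<longlonglongrightarrow> (\<integral>\<^sup>+y. ennreal (\<psi> (mat 1 ** y)) \<partial>\<rho>)"
  proof (rule LIMSEQ_offset, rule nn_integral_dominated_convergence)
    show "AE y in \<rho>. ennreal (\<psi> (Xs (j + N) ** y)) \<le> indicator (cball 0 (2 * r)) y" for j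
      using N[of "j + N"] by (intro AE_I2 pt) auto
    show "(\<integral>\<^sup>+y. indicator (cball 0 (2 * r)) y \<partial>\<rho>) < \<infinity>"
      unfolding cb by (rule hom_bounded_finite[OF hom, of _ "2 * r"]) auto
    have "(\<lambda>j. Xs (j + N) ** y) \<longlonglongrightarrow> mat 1 ** y" for y
      unfolding matrix_matrix_mult_def using LIMSEQ_ignore_initial_segment[OF X, of N] by (intro tendsto_intros)
    then show "AE y in \<rho>. (\<lambda>j. ennreal (\<psi> (Xs (j + N) ** y))) \<longlonglongrightarrow> ennreal (\<psi> (mat 1 ** y))"
      using cont by (intro AE_I2 tendsto_ennrealI isCont_tendsto_compose[where g = \<psi>])
        (auto simp: continuous_on_eq_continuous_at)
  qed (auto simp: borel_measurable_hom[OF hom] intro!: borel_measurable_indicator)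
qed

lemma
  fixes f :: "real^'n^'n \<Rightarrow> real^'m^'n \<Rightarrow> ennreal"
  assumes hom: "homogeneous_measure l \<rho>" and f: "(\<lambda>(X, y). f X y) \<in> borel_measurable (borel \<Otimes>\<^sub>M borel)"
  shows hom_borel_measurable_nn_integral: "(\<lambda>X. \<integral>\<^sup>+y. f X y \<partial>\<rho>) \<in> borel_measurable borel"
    and hom_Fubini: "(\<integral>\<^sup>+X. \<integral>\<^sup>+y. f X y \<partial>\<rho> \<partial>lborel) = (\<integral>\<^sup>+y. \<integral>\<^sup>+X. f X y \<partial>lborel \<partial>\<rho>)"
proof -
  interpret sigma_finite_measure \<rho> by (rule hom_sigma_finite[OF hom])
  interpret pair_sigma_finite "lborel :: (real^'n^'n) measure" \<rho> ..
  have e: "sets (borel \<Otimes>\<^sub>M \<rho>) = sets (borel \<Otimes>\<^sub>M borel)" "sets (lborel \<Otimes>\<^sub>M \<rho>) = sets (borel \<Otimes>\<^sub>M borel)"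
    by (intro sets_pair_measure_cong; simp add: sets_hom[OF hom])+
  have "(\<lambda>(X, y). f X y) \<in> borel_measurable (borel \<Otimes>\<^sub>M \<rho>)" "(\<lambda>(X, y). f X y) \<in> borel_measurable (lborel \<Otimes>\<^sub>M \<rho>)"
    using f measurable_cong_sets[OF e(1) refl] measurable_cong_sets[OF e(2) refl] by blast+
  then show "(\<lambda>X. \<integral>\<^sup>+y. f X y \<partial>\<rho>) \<in> borel_measurable borel"
    "(\<integral>\<^sup>+X. \<integral>\<^sup>+y. f X y \<partial>\<rho> \<partial>lborel) = (\<integral>\<^sup>+y. \<integral>\<^sup>+X. f X y \<partial>lborel \<partial>\<rho>)"
    using Fubini'[of f] by (simp_all add: borel_measurable_nn_integral)
qed

lemma frame_exists:
  assumes "CARD('m) \<le> CARD('n)"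
  obtains x0 :: "real^'m^'n" where "transpose x0 ** x0 = mat 1"
proof -
  have "\<exists>x::real^'m^'n. gdet x \<noteq> 0"
  proof (rule ccontr)
    assume "\<not> ?thesis"
    then have "AE x::real^'m^'n in lborel. False" using AE_gdet_nonzero[OF assms] by auto
    then show False using AE_iff_null[of lborel "\<lambda>_::real^'m^'n. False"] by (auto simp: null_sets_def)
  qed
  then obtain x :: "real^'m^'n" where "gdet x \<noteq> 0" by blast
  then obtain x1 :: "real^'m^'n" and R where "transpose x1 ** x1 = mat 1" "x = x1 ** R" "det R \<noteq> 0"
    by (rule polar_decomposition_exists)
  then show ?thesis using that by blast
qed

text \<open>An averaging argument without Haar measure: instead of the orthogonal group one
  averages over its \<open>\<epsilon>\<close>-neighbourhood in the space of all square matrices, which has positive Lebesgue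
  measure and is invariant under right multiplication by orthogonal matrices.\<close>

lemma homogeneous_measures_continuous_le:
  fixes \<psi> :: "real^'m^'n \<Rightarrow> real"
  assumes h1: "homogeneous_measure l \<rho>1" and h2: "homogeneous_measure l \<rho>2"
    and card: "CARD('m) \<le> CARD('n)"
    and cont: "continuous_on UNIV \<psi>" and bdd: "\<And>y. 0 \<le> \<psi> y \<and> \<psi> y \<le> 1" and supp: "\<And>y. norm y > r \<Longrightarrow> \<psi> y = 0"
  shows "(\<integral>\<^sup>+x. ennreal (exp (- (norm x)\<^sup>2)) \<partial>\<rho>1) * (\<integral>\<^sup>+x. ennreal (\<psi> x) \<partial>\<rho>2)
    \<le> (\<integral>\<^sup>+x. ennreal (exp (- (norm x)\<^sup>2)) \<partial>\<rho>2) * (\<integral>\<^sup>+x. ennreal (\<psi> x) \<partial>\<rho>1)"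
    (is "?\<kappa>1 * _ \<le> ?\<kappa>2 * _")
proof (rule ccontr)
  assume less0: "\<not> ?thesis"
  have [measurable]: "\<psi> \<in> borel_measurable borel" using cont by (rule borel_measurable_continuous_onI)
  have \<kappa>: "?\<kappa>1 < \<top>" "?\<kappa>2 < \<top>" using hom_gaussian[OF h1] hom_gaussian[OF h2] by simp_all
  define a where "a \<rho> X = (\<integral>\<^sup>+y. ennreal (\<psi> (X ** y)) \<partial>\<rho>)" for \<rho> and X :: "real^'n^'n"
  have [measurable]: "a \<rho>1 \<in> borel_measurable borel" "a \<rho>2 \<in> borel_measurable borel"
    unfolding a_def
    by (rule hom_borel_measurable_nn_integral[OF h1], measurable)
       (rule hom_borel_measurable_nn_integral[OF h2], measurable)
  have less: "?\<kappa>2 * a \<rho>1 (mat 1) < ?\<kappa>1 * a \<rho>2 (mat 1)" using less0 by (simp add: a_def not_le)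
  \<comment> \<open>Both sides are continuous at the identity along sequences, so the strict
    inequality persists nearby.\<close>
  have "\<exists>\<epsilon>>0. \<forall>X. norm (X - mat 1) < \<epsilon> \<longrightarrow> ?\<kappa>2 * a \<rho>1 X < ?\<kappa>1 * a \<rho>2 X"
  proof (rule ccontr)
    assume "\<not> ?thesis"
    then have *: "\<And>\<epsilon>. \<epsilon> > 0 \<Longrightarrow> \<exists>X. norm (X - mat 1) < \<epsilon> \<and> ?\<kappa>1 * a \<rho>2 X \<le> ?\<kappa>2 * a \<rho>1 X"
      by (meson not_less)
    have "\<forall>j. \<exists>X. norm (X - mat 1) < inverse (real (Suc j)) \<and> ?\<kappa>1 * a \<rho>2 X \<le> ?\<kappa>2 * a \<rho>1 X"
      by (intro allI *) simp
    then obtain Xs where Xs: "\<And>j. norm (Xs j - mat 1) < inverse (real (Suc j))" "\<And>j. ?\<kappa>1 * a \<rho>2 (Xs j) \<le> ?\<kappa>2 * a \<rho>1 (Xs j)"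
      by metis
    have "(\<lambda>j. Xs j - mat 1) \<longlonglongrightarrow> 0"
      by (rule Lim_null_comparison[OF _ LIMSEQ_inverse_real_of_nat]) (use Xs(1) in \<open>auto intro!: always_eventually less_imp_le simp del: of_nat_Suc\<close>)
    then have X1: "Xs \<longlonglongrightarrow> mat 1" by (simp add: LIM_zero_iff)
    have "?\<kappa>1 * a \<rho>2 (mat 1) \<le> ?\<kappa>2 * a \<rho>1 (mat 1)"
    proof (rule LIMSEQ_le)
      show "(\<lambda>j. ?\<kappa>1 * a \<rho>2 (Xs j)) \<longlonglongrightarrow> ?\<kappa>1 * a \<rho>2 (mat 1)" "(\<lambda>j. ?\<kappa>2 * a \<rho>1 (Xs j)) \<longlonglongrightarrow> ?\<kappa>2 * a \<rho>1 (mat 1)"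
        unfolding a_def using \<kappa> hom_integral_translate_tendsto[OF h1 cont bdd supp X1] hom_integral_translate_tendsto[OF h2 cont bdd supp X1]
        by (auto intro!: ennreal_tendsto_cmult)
    qed (use Xs(2) in auto)
    with less show False by simp
  qed
  then obtain \<epsilon>0 where \<epsilon>0: "\<epsilon>0 > 0" "\<And>X. norm (X - mat 1) < \<epsilon>0 \<Longrightarrow> ?\<kappa>2 * a \<rho>1 X < ?\<kappa>1 * a \<rho>2 X" by blast
  define \<epsilon> where "\<epsilon> = min \<epsilon>0 (1 / 2)"
  have \<epsilon>: "\<epsilon> > 0" "\<epsilon> \<le> 1 / 2" "\<And>X. norm (X - mat 1) < \<epsilon> \<Longrightarrow> ?\<kappa>2 * a \<rho>1 X < ?\<kappa>1 * a \<rho>2 X"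
    using \<epsilon>0 by (auto simp: \<epsilon>_def)
  define N :: "(real^'n^'n) set" where "N = (\<Union>g\<in>{g. orthogonal_matrix g}. ball g \<epsilon>)"
  have "open N" unfolding N_def by blast
  then have [measurable]: "N \<in> sets borel" by simp
  \<comment> \<open>Invariance of the measure lets a rotation of \<open>y\<close> be undone on
    \<open>X\<close>. Every \<open>X\<close> in \<open>N\<close> can thus be moved close to the
    identity without changing either integral, and the strict inequality spreads over all of
    \<open>N\<close>.\<close>
  have ashift: "a \<rho> X = a \<rho> (X ** transpose g)" if "homogeneous_measure l \<rho>" "orthogonal_matrix g" for \<rho> X g
  proof -
    have "(\<integral>\<^sup>+y. ennreal (\<psi> ((X ** transpose g) ** (g ** y))) \<partial>\<rho>) = a \<rho> (X ** transpose g)"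
      unfolding a_def by (rule hom_orthogonal[OF that(1) that(2)]) measurable
    moreover have "(X ** transpose g) ** (g ** y) = X ** y" for y :: "real^'m^'n"
      using that(2) by (metis matrix_mul_assoc matrix_mul_rid orthogonal_matrix)
    ultimately show ?thesis by (simp add: a_def)
  qed
  have Nnear: "\<exists>g. orthogonal_matrix g \<and> norm (X ** transpose g - mat 1) < \<epsilon>" if XN: "X \<in> N" for X
  proof -
    obtain g where g: "orthogonal_matrix g" "dist g X < \<epsilon>" using XN by (auto simp: N_def)
    have "X ** transpose g - mat 1 = (X - g) ** transpose g"
    proof -
      have "(X - g) ** transpose g = X ** transpose g - g ** transpose g"
        by (simp add: vec_eq_iff matrix_matrix_mult_def left_diff_distrib sum_subtractf)
      then show ?thesis using g(1) by (simp add: orthogonal_matrix_def)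
    qed
    then have "norm (X ** transpose g - mat 1) = norm (X - g)"
      using g(1) by (simp add: norm_mult_orthogonal_right)
    then show ?thesis using g by (auto simp: dist_norm norm_minus_commute)
  qed
  have lessN: "?\<kappa>2 * a \<rho>1 X < ?\<kappa>1 * a \<rho>2 X" if "X \<in> N" for X
    using Nnear[OF that] \<epsilon>(3) ashift[OF h1] ashift[OF h2] by metis
  have boundN: "a \<rho>2 X \<le> emeasure \<rho>2 (cball 0 (2 * r))" if XN: "X \<in> N" for X
  proof -
    obtain g where g: "orthogonal_matrix g" "norm (X ** transpose g - mat 1) < \<epsilon>" using Nnear[OF XN] by blast
    show ?thesis unfolding ashift[OF h2 g(1), of X] unfolding a_def
      using g(2) \<epsilon>(2) by (intro hom_integral_translate_le[OF h2 cont bdd supp]) auto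
  qed
  have "N \<subseteq> ball 0 (norm (mat 1 :: real^'n^'n) + 1)"
  proof
    fix X assume "X \<in> N"
    then obtain g where g: "orthogonal_matrix g" "dist g X < \<epsilon>" by (auto simp: N_def)
    have "norm g = norm (mat 1 :: real^'n^'n)" using norm_orthogonal_mult[OF g(1), of "mat 1 :: real^'n^'n"] by simp
    moreover have "norm X \<le> norm g + dist g X" by (metis dist_norm norm_minus_commute norm_triangle_sub)
    ultimately show "X \<in> ball 0 (norm (mat 1 :: real^'n^'n) + 1)" using g(2) \<epsilon>(2) by simp
  qed
  then have "emeasure lborel N \<le> emeasure lborel (ball (0 :: real^'n^'n) (norm (mat 1 :: real^'n^'n) + 1))"
    by (rule emeasure_mono) simp
  also have "\<dots> < \<infinity>" by (rule emeasure_lborel_ball_finite)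
  finally have Nfin: "emeasure lborel N < \<infinity>" .
  \<comment> \<open>Averaging over \<open>N\<close>, which is stable under right multiplication by
    orthogonal matrices, produces a left-invariant function. For it proportionality is known, which
    contradicts the strict inequality once that is integrated over \<open>N\<close>.\<close>
  define \<Psi> where "\<Psi> y = (\<integral>\<^sup>+X. indicator N X * ennreal (\<psi> (X ** y)) \<partial>(lborel :: (real^'n^'n) measure))" for y
  have [measurable]: "\<Psi> \<in> borel_measurable borel"
  proof -
    have e: "sets (borel \<Otimes>\<^sub>M (lborel :: (real^'n^'n) measure)) = sets ((borel :: (real^'m^'n) measure) \<Otimes>\<^sub>M borel)"
      by (intro sets_pair_measure_cong) simp_all
    have "(\<lambda>p. snd p ** fst p) \<in> borel_measurable ((borel :: (real^'m^'n) measure) \<Otimes>\<^sub>M (borel :: (real^'n^'n) measure))"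
      by measurable
    then have "(\<lambda>(y, X). indicator N X * ennreal (\<psi> (X ** y))) \<in> borel_measurable ((borel :: (real^'m^'n) measure) \<Otimes>\<^sub>M (borel :: (real^'n^'n) measure))"
      by (simp add: case_prod_beta)
    then have "(\<lambda>(y, X). indicator N X * ennreal (\<psi> (X ** y))) \<in> borel_measurable ((borel :: (real^'m^'n) measure) \<Otimes>\<^sub>M (lborel :: (real^'n^'n) measure))"
      using measurable_cong_sets[OF e refl] by blast
    from lborel.borel_measurable_nn_integral[OF this] show ?thesis unfolding \<Psi>_def .
  qed
  have Nright: "X ** transpose g \<in> N \<longleftrightarrow> X \<in> N" if "orthogonal_matrix g" for X g
  proof -
    have *: "X ** h \<in> N" if XN: "X \<in> N" and h: "orthogonal_matrix h" for X h
    proof -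
      obtain g where g: "orthogonal_matrix g" "dist g X < \<epsilon>" using XN by (auto simp: N_def)
      have "g ** h - X ** h = (g - X) ** h"
        by (simp add: vec_eq_iff matrix_matrix_mult_def left_diff_distrib sum_subtractf)
      then have "dist (g ** h) (X ** h) = dist g X"
        using h by (simp add: dist_norm norm_mult_orthogonal_right)
      then have "X ** h \<in> ball (g ** h) \<epsilon>" using g(2) by simp
      moreover have "orthogonal_matrix (g ** h)" using g(1) h by (rule orthogonal_matrix_mul)
      ultimately show ?thesis unfolding N_def by blast
    qed
    have "(X ** transpose g) ** g = X"
      using that by (metis matrix_mul_assoc matrix_mul_rid orthogonal_matrix)
    then show ?thesis using *[of X "transpose g"] *[of "X ** transpose g" g] that by auto
  qed
  have \<Psi>inv: "\<Psi> (g ** y) = \<Psi> y" if g: "orthogonal_matrix g" for g y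
  proof -
    have d: "\<bar>det (transpose g)\<bar> = 1" using abs_det_orthogonal[OF g] by simp
    have "\<Psi> (g ** y) = (\<integral>\<^sup>+X. indicator N (X ** transpose g) * ennreal (\<psi> ((X ** transpose g) ** (g ** y))) \<partial>(lborel :: (real^'n^'n) measure))"
      unfolding \<Psi>_def
      using nn_integral_matrix_mult_right[of "\<lambda>X::real^'n^'n. indicator N X * ennreal (\<psi> (X ** (g ** y)))" "transpose g"] d
      by (auto simp: matrix_mul_assoc)
    moreover have "(X ** transpose g) ** (g ** y) = X ** y" for X :: "real^'n^'n"
      using g by (metis matrix_mul_assoc matrix_mul_rid orthogonal_matrix)
    ultimately show ?thesis by (simp add: \<Psi>_def indicator_def Nright[OF g])
  qed
  have int: "(\<integral>\<^sup>+y. \<Psi> y \<partial>\<rho>) = (\<integral>\<^sup>+X. indicator N X * a \<rho> X \<partial>lborel)" if "homogeneous_measure l \<rho>" for \<rho>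
  proof -
    have "(\<integral>\<^sup>+y. \<Psi> y \<partial>\<rho>) = (\<integral>\<^sup>+X. \<integral>\<^sup>+y. indicator N X * ennreal (\<psi> (X ** y)) \<partial>\<rho> \<partial>lborel)"
      unfolding \<Psi>_def by (rule hom_Fubini[OF that, symmetric]) measurable
    also have "\<dots> = (\<integral>\<^sup>+X. indicator N X * a \<rho> X \<partial>lborel)"
      unfolding a_def by (intro nn_integral_cong nn_integral_cmult) (simp add: borel_measurable_hom[OF that])
    finally show ?thesis .
  qed
  obtain x0 :: "real^'m^'n" where x0: "transpose x0 ** x0 = mat 1" using frame_exists[OF card] .
  have "?\<kappa>2 * (\<integral>\<^sup>+x. \<Psi> x \<partial>\<rho>1) = ?\<kappa>1 * (\<integral>\<^sup>+x. \<Psi> x \<partial>\<rho>2)"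
    by (rule homogeneous_measures_invariant_proportional[OF h1 h2 x0]) (auto intro: \<Psi>inv)
  then have eq: "(\<integral>\<^sup>+X. indicator N X * (?\<kappa>2 * a \<rho>1 X) \<partial>lborel) = (\<integral>\<^sup>+X. indicator N X * (?\<kappa>1 * a \<rho>2 X) \<partial>lborel)"
    unfolding int[OF h1] int[OF h2]
    by (simp add: nn_integral_cmult[symmetric] mult.left_commute)
  moreover have "(\<integral>\<^sup>+X. indicator N X * (?\<kappa>2 * a \<rho>1 X) \<partial>lborel) < (\<integral>\<^sup>+X. indicator N X * (?\<kappa>1 * a \<rho>2 X) \<partial>lborel)"
  proof (rule nn_integral_less)
    have "(\<integral>\<^sup>+X. indicator N X * (?\<kappa>1 * a \<rho>2 X) \<partial>lborel) \<le> (\<integral>\<^sup>+X. (?\<kappa>1 * emeasure \<rho>2 (cball 0 (2 * r))) * indicator N X \<partial>lborel)"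
      by (intro nn_integral_mono) (auto simp: indicator_def intro!: mult_left_mono boundN)
    also have "\<dots> = (?\<kappa>1 * emeasure \<rho>2 (cball 0 (2 * r))) * emeasure lborel N"
      by (rule nn_integral_cmult_indicator) simp
    also have "\<dots> < \<infinity>"
      using \<kappa> Nfin hom_bounded_finite[OF h2, of "cball 0 (2 * r)" "2 * r"] by (auto simp: ennreal_mult_less_top)
    finally show "(\<integral>\<^sup>+X. indicator N X * (?\<kappa>2 * a \<rho>1 X) \<partial>lborel) \<noteq> \<infinity>" using eq by auto
    show "AE X in lborel. indicator N X * (?\<kappa>2 * a \<rho>1 X) \<le> indicator N X * (?\<kappa>1 * a \<rho>2 X)"
      using lessN by (auto simp: indicator_def intro!: AE_I2 less_imp_le)
    show "\<not> (AE X in lborel. indicator N X * (?\<kappa>1 * a \<rho>2 X) \<le> indicator N X * (?\<kappa>2 * a \<rho>1 X))"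
    proof
      assume "AE X in lborel. indicator N X * (?\<kappa>1 * a \<rho>2 X) \<le> indicator N X * (?\<kappa>2 * a \<rho>1 X)"
      then have "AE X in lborel. X \<notin> N"
        by (rule eventually_mono) (use lessN in \<open>force simp: indicator_def not_le\<close>)
      then have "emeasure lborel N = 0"
        using AE_iff_null[of lborel "\<lambda>X. X \<notin> N"] by (simp add: null_sets_def)
      moreover have "ball (mat 1) \<epsilon> \<subseteq> N" unfolding N_def using orthogonal_matrix_id by blast
      ultimately have "emeasure lborel (ball (mat 1 :: real^'n^'n) \<epsilon>) = 0"
        by (metis emeasure_mono le_zero_eq sets_lborel \<open>N \<in> sets borel\<close>)
      moreover have "emeasure lborel (ball (mat 1 :: real^'n^'n) \<epsilon>) > 0"
        using \<epsilon>(1) content_ball_pos[of \<epsilon> "mat 1 :: real^'n^'n"]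
        by (metis emeasure_eq_ennreal_measure ennreal_0 less_irrefl measure_def zero_less_iff_neq_zero enn2real_eq_0_iff)
      ultimately show False by simp
    qed
    have "(\<lambda>X. indicator N X * (?\<kappa>2 * a \<rho>1 X)) \<in> borel_measurable borel" "(\<lambda>X. indicator N X * (?\<kappa>1 * a \<rho>2 X)) \<in> borel_measurable borel"
      by (auto intro!: borel_measurable_times_ennreal borel_measurable_indicator)
    then show "(\<lambda>X. indicator N X * (?\<kappa>2 * a \<rho>1 X)) \<in> borel_measurable lborel" "(\<lambda>X. indicator N X * (?\<kappa>1 * a \<rho>2 X)) \<in> borel_measurable lborel"
      by simp_all
  qed
  ultimately show False by simp
qed

text \<open>The preceding inequality, used with the measures in both orders, is an equality for
  continuous functions of bounded support. Indicators of open boxes are increasing limits of such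
  functions, built from the distance to the complement, and boxes generate the Borel sets.\<close>

theorem homogeneous_measures_proportional:
  fixes h :: "real^'m^'n \<Rightarrow> ennreal"
  assumes h1: "homogeneous_measure l \<rho>1" and h2: "homogeneous_measure l \<rho>2"
    and card: "CARD('m) \<le> CARD('n)" and h: "h \<in> borel_measurable borel"
  shows "(\<integral>\<^sup>+x. ennreal (exp (- (norm x)\<^sup>2)) \<partial>\<rho>2) * (\<integral>\<^sup>+x. h x \<partial>\<rho>1)
    = (\<integral>\<^sup>+x. ennreal (exp (- (norm x)\<^sup>2)) \<partial>\<rho>1) * (\<integral>\<^sup>+x. h x \<partial>\<rho>2)"
    (is "?\<kappa>2 * _ = ?\<kappa>1 * _")
proof -
  note [measurable_cong] = sets_hom[OF h1] sets_hom[OF h2]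
  have \<kappa>: "?\<kappa>1 < \<top>" "?\<kappa>2 < \<top>" using hom_gaussian[OF h1] hom_gaussian[OF h2] by simp_all
  have box: "?\<kappa>2 * emeasure \<rho>1 (box a b) = ?\<kappa>1 * emeasure \<rho>2 (box a b)" for a b :: "real^'m^'n"
  proof -
    define D where "D x = infdist x (- box a b)" for x
    define \<psi> where "\<psi> j x = min 1 (real j * D x)" for j :: nat and x
    have ne: "- box a b \<noteq> {}"
    proof
      assume "- box a b = {}"
      then have "box a b = (UNIV :: (real^'m^'n) set)" by blast
      then show False using bounded_box[of a b] not_bounded_UNIV by metis
    qed
    have cont: "continuous_on UNIV (\<psi> j)" for j unfolding \<psi>_def D_def by (intro continuous_intros)
    have bdd: "0 \<le> \<psi> j x \<and> \<psi> j x \<le> 1" for j x by (auto simp: \<psi>_def D_def infdist_nonneg)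
    obtain r where r: "\<And>x. x \<in> box a b \<Longrightarrow> norm x \<le> r" using bounded_box[of a b] by (auto simp: bounded_iff)
    have supp: "\<psi> j x = 0" if "norm x > r" for j x
    proof -
      have "x \<in> - box a b" using r that by force
      then show ?thesis by (simp add: \<psi>_def D_def)
    qed
    have lim: "(SUP j. ennreal (\<psi> j x)) = indicator (box a b) x" for x
    proof (cases "x \<in> box a b")
      case True
      have "closed (- box a b)" by (intro closed_Compl open_box)
      then have "infdist x (- box a b) \<noteq> 0" using True in_closed_iff_infdist_zero[OF _ ne, of x] by blast
      then have "D x > 0" unfolding D_def using infdist_nonneg[of x "- box a b"] by linarith
      then obtain j where "real j * D x > 1" by (metis reals_Archimedean3)
      then have "ennreal (\<psi> j x) = 1" by (simp add: \<psi>_def)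
      then have "1 \<le> (SUP j. ennreal (\<psi> j x))" by (metis SUP_upper UNIV_I)
      moreover have "(SUP j. ennreal (\<psi> j x)) \<le> 1" using bdd by (intro SUP_least) simp
      ultimately have "(SUP j. ennreal (\<psi> j x)) = 1" by (rule antisym[rotated])
      then show ?thesis using True by simp
    next
      case False
      then have "\<psi> j x = 0" for j by (simp add: \<psi>_def D_def)
      then show ?thesis using False by simp
    qed
    have "incseq (\<lambda>j x. ennreal (\<psi> j x))"
      unfolding incseq_def le_fun_def \<psi>_def D_def
      by (intro allI impI ennreal_leI min.mono order_refl mult_right_mono infdist_nonneg) simp
    then have em: "emeasure \<rho> (box a b) = (SUP j. \<integral>\<^sup>+x. ennreal (\<psi> j x) \<partial>\<rho>)" if "homogeneous_measure l \<rho>" for \<rho>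
    proof -
      note [measurable_cong] = sets_hom[OF that]
      have [measurable]: "\<psi> j \<in> borel_measurable borel" for j using cont by (rule borel_measurable_continuous_onI)
      have "emeasure \<rho> (box a b) = (\<integral>\<^sup>+x. (SUP j. ennreal (\<psi> j x)) \<partial>\<rho>)"
        unfolding lim by (subst nn_integral_indicator) (auto simp: sets_hom[OF that])
      also have "\<dots> = (SUP j. \<integral>\<^sup>+x. ennreal (\<psi> j x) \<partial>\<rho>)"
        by (rule nn_integral_monotone_convergence_SUP) (use \<open>incseq _\<close> in \<open>auto simp: borel_measurable_hom[OF that]\<close>)
      finally show ?thesis .
    qed
    have "?\<kappa>2 * (\<integral>\<^sup>+x. ennreal (\<psi> j x) \<partial>\<rho>1) = ?\<kappa>1 * (\<integral>\<^sup>+x. ennreal (\<psi> j x) \<partial>\<rho>2)" for j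
      using homogeneous_measures_continuous_le[OF h1 h2 card cont bdd supp] homogeneous_measures_continuous_le[OF h2 h1 card cont bdd supp]
      by (rule antisym[rotated])
    then show ?thesis unfolding em[OF h1] em[OF h2] SUP_mult_left_ennreal by simp
  qed
  have "density \<rho>1 (\<lambda>_. ?\<kappa>2) = density \<rho>2 (\<lambda>_. ?\<kappa>1)"
  proof (rule measure_eqI_generator_eq)
    let ?E = "range (\<lambda>(a, b). box a b :: (real^'m^'n) set)"
    show "Int_stable ?E" by (auto simp: Int_stable_def box_Int_box)
    show "?E \<subseteq> Pow UNIV" "sets (density \<rho>1 (\<lambda>_. ?\<kappa>2)) = sigma_sets UNIV ?E" "sets (density \<rho>2 (\<lambda>_. ?\<kappa>1)) = sigma_sets UNIV ?E"
      by (simp_all add: borel_eq_box sets_hom[OF h1] sets_hom[OF h2])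
    let ?A = "\<lambda>n::nat. box (- (real n *\<^sub>R One)) (real n *\<^sub>R One) :: (real^'m^'n) set"
    show "range ?A \<subseteq> ?E" "(\<Union>i. ?A i) = UNIV" unfolding UN_box_eq_UNIV by auto
    show "emeasure (density \<rho>1 (\<lambda>_. ?\<kappa>2)) (?A i) \<noteq> \<infinity>" for i
    proof -
      obtain r where "\<And>x. x \<in> ?A i \<Longrightarrow> norm x \<le> r" using bounded_box by (metis bounded_iff)
      then have r: "?A i \<subseteq> cball 0 r" by auto
      show ?thesis using \<kappa> hom_bounded_finite[OF h1 _ r]
        by (subst emeasure_density_const) (auto simp: sets_hom[OF h1] ennreal_mult_eq_top_iff)
    qed
    show "emeasure (density \<rho>1 (\<lambda>_. ?\<kappa>2)) X = emeasure (density \<rho>2 (\<lambda>_. ?\<kappa>1)) X" if "X \<in> ?E" for X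
      using that box by (auto simp: emeasure_density_const sets_hom[OF h1] sets_hom[OF h2])
  qed
  then have "(\<integral>\<^sup>+x. h x \<partial>density \<rho>1 (\<lambda>_. ?\<kappa>2)) = (\<integral>\<^sup>+x. h x \<partial>density \<rho>2 (\<lambda>_. ?\<kappa>1))" by simp
  then show ?thesis
    using h by (simp add: nn_integral_density nn_integral_cmult borel_measurable_hom[OF h1] borel_measurable_hom[OF h2])
qed

subsection \<open>Polar coordinates on rectangular matrices\<close>

lemma borel_measurable_nn_integral_lborelI:
  fixes f :: "'a::euclidean_space \<Rightarrow> 'b::euclidean_space \<Rightarrow> ennreal"
  assumes "(\<lambda>(x, t). f x t) \<in> borel_measurable (borel \<Otimes>\<^sub>M borel)"
  shows "(\<lambda>x. \<integral>\<^sup>+t. f x t \<partial>lborel) \<in> borel_measurable borel"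
proof -
  have e: "sets ((borel :: 'a measure) \<Otimes>\<^sub>M (lborel :: 'b measure)) = sets (borel \<Otimes>\<^sub>M borel)"
    by (intro sets_pair_measure_cong) simp_all
  have "(\<lambda>(x, t). f x t) \<in> borel_measurable ((borel :: 'a measure) \<Otimes>\<^sub>M (lborel :: 'b measure))"
    using assms measurable_cong_sets[OF e refl] by blast
  then show ?thesis by (rule lborel.borel_measurable_nn_integral)
qed

lemma Gamma_cone_pos:
  assumes "real m - 1 < 2 * \<alpha>"
  shows "Gamma_cone m \<alpha> > 0"
  unfolding Gamma_cone_def using assms
  by (intro mult_pos_pos prod_pos Gamma_real_pos) (auto simp: of_nat_diff)

lemma stiefel_mass_pos:
  assumes "l \<le> n"
  shows "stiefel_mass n l > 0"
  unfolding stiefel_mass_def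
proof (intro divide_pos_pos mult_pos_pos)
  show "Gamma_cone l (real n / 2) > 0" by (rule Gamma_cone_pos) (use assms in simp)
qed auto

lemma stiefel_mult: "orthogonal_matrix g \<Longrightarrow> \<xi> \<in> stiefel \<Longrightarrow> g ** \<xi> \<in> stiefel"
  by (simp add: stiefel_def matrix_transpose_mul orthogonal_matrix)
     (metis matrix_mul_assoc matrix_mul_rid)

section \<open>The Stiefel measure and the image of its product with Lebesgue measure\<close>

context
  fixes \<mu> :: "(real^'l^'n) measure"
  assumes \<mu>: "stiefel_measure \<mu>"
begin

lemma space_stiefel: "space \<mu> = stiefel"
  using \<mu> by (simp add: stiefel_measure_def)

lemma sets_stiefel: "sets \<mu> = sets (restrict_space borel stiefel)"
  using \<mu> by (simp add: stiefel_measure_def)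

lemma borel_measurable_stiefelI:
  assumes "f \<in> borel_measurable borel"
  shows "f \<in> borel_measurable \<mu>"
  using measurable_restrict_space1[OF assms] measurable_cong_sets[OF sets_stiefel refl] by blast

lemma id_measurable_stiefel: "(\<lambda>\<xi>. \<xi>) \<in> borel_measurable \<mu>"
  by (rule borel_measurable_stiefelI) simp

lemma emeasure_stiefel: "emeasure \<mu> (space \<mu>) = ennreal (stiefel_mass CARD('n) CARD('l))"
  using \<mu> unfolding stiefel_measure_def by blast

lemma finite_measure_stiefel: "finite_measure \<mu>"
  by (rule finite_measureI) (simp add: emeasure_stiefel)

lemma borel_measurable_stiefel_pairI:
  fixes f :: "(real^'l^'n) \<times> 'b::euclidean_space \<Rightarrow> 'c::topological_space"
  assumes "f \<in> borel_measurable (borel \<Otimes>\<^sub>M borel)"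
  shows "f \<in> borel_measurable (\<mu> \<Otimes>\<^sub>M lborel)"
proof -
  have "fst \<in> borel_measurable (\<mu> \<Otimes>\<^sub>M (lborel :: 'b measure))"
    by (rule measurable_compose[OF measurable_fst id_measurable_stiefel])
  moreover have "snd \<in> borel_measurable (\<mu> \<Otimes>\<^sub>M (lborel :: 'b measure))"
    using measurable_snd[of \<mu> "lborel :: 'b measure"] by simp
  ultimately have "(\<lambda>p. (fst p, snd p)) \<in> (\<mu> \<Otimes>\<^sub>M (lborel :: 'b measure)) \<rightarrow>\<^sub>M (borel \<Otimes>\<^sub>M borel)"
    by (rule measurable_Pair)
  from measurable_compose[OF this assms] show ?thesis by simp
qed

lemma nn_integral_stiefel_orthogonal:
  assumes g: "orthogonal_matrix g" and [measurable]: "h \<in> borel_measurable borel"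
  shows "(\<integral>\<^sup>+\<xi>. h (g ** \<xi>) \<partial>\<mu>) = (\<integral>\<^sup>+\<xi>. h \<xi> \<partial>\<mu>)"
proof -
  have d: "distr \<mu> \<mu> (\<lambda>\<xi>. g ** \<xi>) = \<mu>" using \<mu> g by (simp add: stiefel_measure_def)
  have "(\<lambda>\<xi>. g ** \<xi>) \<in> measurable \<mu> (restrict_space borel stiefel)"
  proof (rule measurable_restrict_space2)
    show "(\<lambda>\<xi>. g ** \<xi>) \<in> borel_measurable \<mu>" by (rule borel_measurable_stiefelI) measurable
  qed (auto simp: space_stiefel stiefel_mult[OF g])
  then have m: "(\<lambda>\<xi>. g ** \<xi>) \<in> measurable \<mu> \<mu>"
    using measurable_cong_sets[OF refl sets_stiefel] by blast
  have "(\<integral>\<^sup>+\<xi>. h \<xi> \<partial>\<mu>) = (\<integral>\<^sup>+\<xi>. h \<xi> \<partial>distr \<mu> \<mu> (\<lambda>\<xi>. g ** \<xi>))" by (simp only: d)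
  also have "\<dots> = (\<integral>\<^sup>+\<xi>. h (g ** \<xi>) \<partial>\<mu>)"
    by (rule nn_integral_distr[OF m]) (simp only: d, rule borel_measurable_stiefelI, simp)
  finally show ?thesis by simp
qed

lemma stiefel_nn_Fubini:
  fixes f :: "real^'l^'n \<Rightarrow> 'b::euclidean_space \<Rightarrow> ennreal"
  assumes "(\<lambda>(\<xi>, t). f \<xi> t) \<in> borel_measurable (borel \<Otimes>\<^sub>M borel)"
  shows "(\<integral>\<^sup>+\<xi>. \<integral>\<^sup>+t. f \<xi> t \<partial>lborel \<partial>\<mu>) = (\<integral>\<^sup>+t. \<integral>\<^sup>+\<xi>. f \<xi> t \<partial>\<mu> \<partial>lborel)"
proof -
  interpret finite_measure \<mu> by (rule finite_measure_stiefel)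
  interpret pair_sigma_finite \<mu> "lborel :: 'b measure" ..
  show ?thesis
    by (rule Fubini'[symmetric]) (rule borel_measurable_stiefel_pairI[OF assms])
qed

definition polar_measure :: "(real^'m^'n) measure" where
  "polar_measure = distr (\<mu> \<Otimes>\<^sub>M (lborel :: (real^'m^'l) measure)) borel (\<lambda>(\<xi>, t). \<xi> ** t)"

lemma polar_map_measurable: "(\<lambda>(\<xi>, t). \<xi> ** t) \<in> borel_measurable (\<mu> \<Otimes>\<^sub>M (lborel :: (real^'m^'l) measure))"
  by (rule borel_measurable_stiefel_pairI) measurable

lemma nn_integral_polar_measure:
  fixes h :: "real^'m^'n \<Rightarrow> ennreal"
  assumes [measurable]: "h \<in> borel_measurable borel"
  shows "(\<integral>\<^sup>+x. h x \<partial>polar_measure) = (\<integral>\<^sup>+\<xi>. \<integral>\<^sup>+t. h (\<xi> ** t) \<partial>(lborel :: (real^'m^'l) measure) \<partial>\<mu>)"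
proof -
  have "(\<integral>\<^sup>+x. h x \<partial>polar_measure) = (\<integral>\<^sup>+p. h (fst p ** snd p) \<partial>(\<mu> \<Otimes>\<^sub>M (lborel :: (real^'m^'l) measure)))"
    unfolding polar_measure_def
    by (subst nn_integral_distr[OF polar_map_measurable]) (simp_all add: case_prod_beta)
  also have "\<dots> = (\<integral>\<^sup>+\<xi>. \<integral>\<^sup>+t. h (\<xi> ** t) \<partial>(lborel :: (real^'m^'l) measure) \<partial>\<mu>)"
    by (subst lborel.nn_integral_fst[symmetric]) (auto intro!: borel_measurable_stiefel_pairI)
  finally show ?thesis .
qed

lemma polar_measure_gaussian:
  "(\<integral>\<^sup>+x. ennreal (exp (- (norm x)\<^sup>2)) \<partial>(polar_measure :: (real^'m^'n) measure))
    = ennreal (stiefel_mass CARD('n) CARD('l) * sqrt pi ^ (CARD('l) * CARD('m)))" (is "?I = _")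
proof -
  have "?I = (\<integral>\<^sup>+\<xi>. \<integral>\<^sup>+t. ennreal (exp (- (norm (\<xi> ** t))\<^sup>2)) \<partial>(lborel :: (real^'m^'l) measure) \<partial>\<mu>)"
    by (rule nn_integral_polar_measure) measurable
  also have "\<dots> = (\<integral>\<^sup>+\<xi>. ennreal (sqrt pi ^ (CARD('l) * CARD('m))) \<partial>\<mu>)"
  proof (rule nn_integral_cong)
    fix \<xi> assume "\<xi> \<in> space \<mu>"
    then have "norm (\<xi> ** t) = norm t" for t :: "real^'m^'l"
      by (intro norm_isometry_mult) (simp add: space_stiefel stiefel_def)
    then show "(\<integral>\<^sup>+t. ennreal (exp (- (norm (\<xi> ** t))\<^sup>2)) \<partial>(lborel :: (real^'m^'l) measure)) = ennreal (sqrt pi ^ (CARD('l) * CARD('m)))"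
      using nn_integral_gaussian[where 'a = "real^'m^'l"] by simp
  qed
  also have "\<dots> = ennreal (stiefel_mass CARD('n) CARD('l) * sqrt pi ^ (CARD('l) * CARD('m)))"
    by (simp add: emeasure_stiefel mult.commute flip: ennreal_mult'')
  finally show ?thesis .
qed

text \<open>Left invariance is inherited from \<mu>, the degree of homogeneity from the
  \<open>CARD('l)\<close> rows of \<open>t\<close>. Since \<xi> is an isometry,
  \<open>\<xi> ** t\<close> has the Gram determinant of \<open>t\<close>, which is nonzero almost
  everywhere by the assumption on the dimensions.\<close>

lemma homogeneous_polar_measure:
  assumes "CARD('m) \<le> CARD('l)"
  shows "homogeneous_measure CARD('l) (polar_measure :: (real^'m^'n) measure)"
  unfolding homogeneous_measure_def
proof (intro conjI allI impI)
  show s: "sets polar_measure = sets (borel :: (real^'m^'n) measure)"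
    by (simp add: polar_measure_def)
  show "distr polar_measure borel (\<lambda>x. g ** x) = (polar_measure :: (real^'m^'n) measure)" if g: "orthogonal_matrix g" for g
  proof (rule measure_eqI)
    show "sets (distr polar_measure borel (\<lambda>x. g ** x)) = sets (polar_measure :: (real^'m^'n) measure)" using s by simp
    fix X :: "(real^'m^'n) set" assume "X \<in> sets (distr polar_measure borel (\<lambda>x. g ** x))"
    then have [measurable]: "X \<in> sets borel" by simp
    have gm: "(\<lambda>x. g ** x) \<in> measurable (polar_measure :: (real^'m^'n) measure) borel"
    proof -
      have "(\<lambda>x. g ** x) \<in> borel_measurable (borel :: (real^'m^'n) measure)" by measurable
      then show ?thesis using measurable_cong_sets[OF s refl] by blast
    qed
    have "emeasure (distr polar_measure borel (\<lambda>x. g ** x)) X = (\<integral>\<^sup>+x. indicator X x \<partial>distr polar_measure borel (\<lambda>x. g ** x))"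
      by simp
    also have "\<dots> = (\<integral>\<^sup>+x. indicator X (g ** x) \<partial>polar_measure)"
      by (rule nn_integral_distr[OF gm]) simp
    also have "\<dots> = (\<integral>\<^sup>+\<xi>. \<integral>\<^sup>+t. indicator X ((g ** \<xi>) ** t) \<partial>(lborel :: (real^'m^'l) measure) \<partial>\<mu>)"
      by (subst nn_integral_polar_measure) (simp_all add: matrix_mul_assoc)
    also have "\<dots> = (\<integral>\<^sup>+\<xi>. \<integral>\<^sup>+t. indicator X (\<xi> ** t) \<partial>(lborel :: (real^'m^'l) measure) \<partial>\<mu>)"
      by (rule nn_integral_stiefel_orthogonal[OF g], rule borel_measurable_nn_integral_lborelI) measurable
    also have "\<dots> = (\<integral>\<^sup>+x. indicator X x \<partial>polar_measure)"
      by (rule nn_integral_polar_measure[symmetric]) simp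
    also have "\<dots> = emeasure polar_measure X" using s by simp
    finally show "emeasure (distr polar_measure borel (\<lambda>x. g ** x)) X = emeasure polar_measure X" .
  qed
  show "ennreal (\<bar>det T\<bar> ^ CARD('l)) * (\<integral>\<^sup>+x. h (x ** T) \<partial>polar_measure) = (\<integral>\<^sup>+x. h x \<partial>polar_measure)"
    if T: "det T \<noteq> 0" and [measurable]: "h \<in> borel_measurable borel" for T and h :: "real^'m^'n \<Rightarrow> ennreal"
  proof -
    have "ennreal (\<bar>det T\<bar> ^ CARD('l)) * (\<integral>\<^sup>+x. h (x ** T) \<partial>polar_measure)
      = ennreal (\<bar>det T\<bar> ^ CARD('l)) * (\<integral>\<^sup>+\<xi>. \<integral>\<^sup>+t. h (\<xi> ** (t ** T)) \<partial>(lborel :: (real^'m^'l) measure) \<partial>\<mu>)"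
      by (subst nn_integral_polar_measure) (simp_all add: matrix_mul_assoc)
    also have "\<dots> = (\<integral>\<^sup>+\<xi>. ennreal (\<bar>det T\<bar> ^ CARD('l)) * (\<integral>\<^sup>+t. h (\<xi> ** (t ** T)) \<partial>(lborel :: (real^'m^'l) measure)) \<partial>\<mu>)"
      by (rule nn_integral_cmult[symmetric])
         (rule borel_measurable_stiefelI, rule borel_measurable_nn_integral_lborelI, measurable)
    also have "\<dots> = (\<integral>\<^sup>+\<xi>. \<integral>\<^sup>+t. h (\<xi> ** t) \<partial>(lborel :: (real^'m^'l) measure) \<partial>\<mu>)"
      by (intro nn_integral_cong nn_integral_matrix_mult_right[OF _ T]) measurable
    finally show ?thesis by (simp add: nn_integral_polar_measure)
  qed
  show "AE x in (polar_measure :: (real^'m^'n) measure). gdet x \<noteq> 0"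
  proof -
    have "(\<integral>\<^sup>+x. indicator {x. gdet x = 0} x \<partial>(polar_measure :: (real^'m^'n) measure))
        = (\<integral>\<^sup>+\<xi>. \<integral>\<^sup>+t. indicator {x. gdet x = 0} (\<xi> ** t) \<partial>(lborel :: (real^'m^'l) measure) \<partial>\<mu>)"
      by (rule nn_integral_polar_measure) measurable
    also have "\<dots> = (\<integral>\<^sup>+\<xi>. 0 \<partial>\<mu>)"
    proof (rule nn_integral_cong)
      fix \<xi> assume "\<xi> \<in> space \<mu>"
      then have "gdet (\<xi> ** t) = gdet t" for t :: "real^'m^'l"
        by (intro gdet_isometry_mult) (simp add: space_stiefel stiefel_def)
      then have "(\<integral>\<^sup>+t. indicator {x. gdet x = 0} (\<xi> ** t) \<partial>(lborel :: (real^'m^'l) measure)) = (\<integral>\<^sup>+t. 0 \<partial>(lborel :: (real^'m^'l) measure))"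
        using AE_gdet_nonzero[OF assms] by (intro nn_integral_cong_AE) (auto elim!: eventually_mono)
      then show "(\<integral>\<^sup>+t. indicator {x. gdet x = 0} (\<xi> ** t) \<partial>(lborel :: (real^'m^'l) measure)) = 0" by simp
    qed
    finally have "emeasure (polar_measure :: (real^'m^'n) measure) {x. gdet x = 0} = 0"
      by (subst (asm) nn_integral_indicator) (simp_all add: s)
    then show ?thesis
      by (intro AE_I[of _ _ "{x. gdet x = 0}"]) (auto simp: s)
  qed
  show "(\<integral>\<^sup>+x. ennreal (exp (- (norm x)\<^sup>2)) \<partial>(polar_measure :: (real^'m^'n) measure)) < \<infinity>"
    by (simp add: polar_measure_gaussian)
qed

end

text \<open>Lebesgue measure has degree \<open>CARD('n)\<close>, and the density contributes
  \<open>\<bar>det T\<bar> powr (l - n)\<close>, which lowers the degree to \<open>l\<close>. The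
  exponent of the density is dictated by this.\<close>

lemma
  assumes l: "CARD('m) \<le> l" "l < CARD('n)"
  shows homogeneous_density_measure: "homogeneous_measure l (density lborel (\<lambda>y::real^'m^'n. ennreal (gdet y powr (- ((real CARD('n) - real l) / 2)))))"
    and gaussian_density_measure: "(\<integral>\<^sup>+x. ennreal (exp (- (norm x)\<^sup>2)) \<partial>density lborel (\<lambda>y::real^'m^'n. ennreal (gdet y powr (- ((real CARD('n) - real l) / 2)))))
      = ennreal (\<Prod>j<CARD('m). sqrt pi ^ CARD('n) * Gamma ((real l - real j) / 2) / Gamma ((real CARD('n) - real j) / 2))"
proof -
  let ?a = "(real CARD('n) - real l) / 2"
  let ?w = "\<lambda>y::real^'m^'n. ennreal (gdet y powr (- ?a))"
  let ?M = "density lborel ?w"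
  have dens: "(\<integral>\<^sup>+x. h x \<partial>?M) = (\<integral>\<^sup>+x. ?w x * h x \<partial>lborel)" if [measurable]: "h \<in> borel_measurable borel" for h
    by (subst nn_integral_density) auto
  have "(\<integral>\<^sup>+x. ennreal (exp (- (norm x)\<^sup>2)) \<partial>?M) = (\<integral>\<^sup>+y. ennreal (gdet y powr (- ?a) * exp (- (norm y)\<^sup>2)) \<partial>(lborel :: (real^'m^'n) measure))"
    by (subst dens) (simp_all add: ennreal_mult)
  also have "\<dots> = ennreal (\<Prod>j<CARD('m). sqrt pi ^ CARD('n) * Gamma ((real CARD('n) - real j) / 2 - ?a) / Gamma ((real CARD('n) - real j) / 2))"
    using l by (intro nn_integral_gdet_powr_neg) auto
  also have "(\<lambda>j. (real CARD('n) - real j) / 2 - ?a) = (\<lambda>j. (real l - real j) / 2)"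
    by (auto simp: field_simps)
  finally show g: "(\<integral>\<^sup>+x. ennreal (exp (- (norm x)\<^sup>2)) \<partial>?M)
      = ennreal (\<Prod>j<CARD('m). sqrt pi ^ CARD('n) * Gamma ((real l - real j) / 2) / Gamma ((real CARD('n) - real j) / 2))" .
  show "homogeneous_measure l ?M"
    unfolding homogeneous_measure_def
  proof (intro conjI allI impI)
    show "sets ?M = sets borel" by simp
    show "distr ?M borel (\<lambda>x. g ** x) = ?M" if o: "orthogonal_matrix g" for g
    proof (rule measure_eqI)
      fix X :: "(real^'m^'n) set" assume "X \<in> sets (distr ?M borel (\<lambda>x. g ** x))"
      then have [measurable]: "X \<in> sets borel" by simp
      have gm: "(\<lambda>x. g ** x) \<in> borel_measurable ?M" by simp
      have "emeasure (distr ?M borel (\<lambda>x. g ** x)) X = (\<integral>\<^sup>+x. indicator X x \<partial>distr ?M borel (\<lambda>x. g ** x))"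
        by simp
      also have "\<dots> = (\<integral>\<^sup>+x. indicator X (g ** x) \<partial>?M)"
        by (rule nn_integral_distr[OF gm]) simp
      also have "\<dots> = (\<integral>\<^sup>+x. ?w (g ** x) * indicator X (g ** x) \<partial>lborel)"
        by (subst dens) (simp_all only: gdet_orthogonal_mult[OF o], measurable)
      also have "\<dots> = (\<integral>\<^sup>+x. ?w x * indicator X x \<partial>lborel)"
        using nn_integral_matrix_mult_left[of "\<lambda>x::real^'m^'n. ?w x * indicator X x" g] abs_det_orthogonal[OF o] by auto
      also have "\<dots> = emeasure ?M X" by (simp add: emeasure_density)
      finally show "emeasure (distr ?M borel (\<lambda>x. g ** x)) X = emeasure ?M X" .
    qed simp
    show "ennreal (\<bar>det T\<bar> ^ l) * (\<integral>\<^sup>+x. h (x ** T) \<partial>?M) = (\<integral>\<^sup>+x. h x \<partial>?M)"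
      if T: "det T \<noteq> 0" and [measurable]: "h \<in> borel_measurable borel" for T and h :: "real^'m^'n \<Rightarrow> ennreal"
    proof -
      have "(\<integral>\<^sup>+x. h x \<partial>?M) = (\<integral>\<^sup>+x. ?w x * h x \<partial>lborel)" by (rule dens) measurable
      also have "\<dots> = ennreal (\<bar>det T\<bar> ^ CARD('n)) * (\<integral>\<^sup>+x. ?w (x ** T) * h (x ** T) \<partial>lborel)"
        by (rule nn_integral_matrix_mult_right[symmetric, OF _ T]) measurable
      also have "(\<integral>\<^sup>+x. ?w (x ** T) * h (x ** T) \<partial>lborel) = (\<integral>\<^sup>+x. ennreal (\<bar>det T\<bar> powr (real l - real CARD('n))) * (?w x * h (x ** T)) \<partial>lborel)"
      proof (rule nn_integral_cong)
        fix x :: "real^'m^'n"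
        have "gdet (x ** T) powr (- ?a) = gdet x powr (- ?a) * \<bar>det T\<bar> powr (2 * - ?a)"
          unfolding gdet_mult_right by (simp only: powr_mult gdet_nonneg zero_le_power2 power2_powr)
        also have "2 * - ?a = real l - real CARD('n)" by (simp add: field_simps)
        finally show "?w (x ** T) * h (x ** T) = ennreal (\<bar>det T\<bar> powr (real l - real CARD('n))) * (?w x * h (x ** T))"
          by (simp add: ennreal_mult mult_ac)
      qed
      also have "\<dots> = ennreal (\<bar>det T\<bar> powr (real l - real CARD('n))) * (\<integral>\<^sup>+x. ?w x * h (x ** T) \<partial>lborel)"
        by (rule nn_integral_cmult) auto
      also have "(\<integral>\<^sup>+x. ?w x * h (x ** T) \<partial>lborel) = (\<integral>\<^sup>+x. h (x ** T) \<partial>?M)"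
        by (rule dens[symmetric]) measurable
      also have "ennreal (\<bar>det T\<bar> ^ CARD('n)) * (ennreal (\<bar>det T\<bar> powr (real l - real CARD('n))) * (\<integral>\<^sup>+x. h (x ** T) \<partial>?M))
         = ennreal (\<bar>det T\<bar> ^ l) * (\<integral>\<^sup>+x. h (x ** T) \<partial>?M)"
        using T by (simp add: mult.assoc[symmetric] powr_diff powr_realpow flip: ennreal_mult)
      finally show ?thesis by simp
    qed
    show "AE x in ?M. gdet x \<noteq> 0"
      using AE_gdet_nonzero[where 'm = 'm and 'n = 'n] l by (subst AE_density) (auto elim!: eventually_mono)
    show "(\<integral>\<^sup>+x. ennreal (exp (- (norm x)\<^sup>2)) \<partial>?M) < \<infinity>" unfolding g by simp
  qed
qed

text \<open>In the notation of the theorem this is \<Gamma>_m(n/2) / (\<Gamma>_m(l/2)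
  \<pi>^((n-l)m/2)). It is the quotient of the Gaussian integrals of the two homogeneous measures,
  with the mass of the Stiefel manifold split off.\<close>

definition polar_const :: "nat \<Rightarrow> nat \<Rightarrow> nat \<Rightarrow> real" where
  "polar_const n l m = (\<Prod>j<m. Gamma ((real n - real j) / 2) / Gamma ((real l - real j) / 2)) / sqrt pi ^ ((n - l) * m)"

lemma polar_const_pos:
  assumes "m \<le> l" "l \<le> n"
  shows "polar_const n l m > 0"
  unfolding polar_const_def using assms
  by (intro divide_pos_pos prod_pos Gamma_real_pos) auto

theorem polar_coordinates:
  fixes \<mu> :: "(real^'l^'n) measure" and h :: "real^'m^'n \<Rightarrow> ennreal"
  assumes \<mu>: "stiefel_measure \<mu>" and ml: "CARD('m) \<le> CARD('l)" and ln: "CARD('l) < CARD('n)"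
    and [measurable]: "h \<in> borel_measurable borel"
  shows "(\<integral>\<^sup>+\<xi>. \<integral>\<^sup>+t. h (\<xi> ** t) \<partial>(lborel :: (real^'m^'l) measure) \<partial>\<mu>)
    = ennreal (stiefel_mass CARD('n) CARD('l) * polar_const CARD('n) CARD('l) CARD('m)) *
      (\<integral>\<^sup>+y. ennreal (gdet y powr (- ((real CARD('n) - real CARD('l)) / 2))) * h y \<partial>lborel)"
    (is "?L = _ * ?R")
proof -
  let ?n = "CARD('n)" and ?l = "CARD('l)" and ?m = "CARD('m)"
  let ?\<sigma> = "stiefel_mass ?n ?l"
  define \<kappa>2 where "\<kappa>2 = (\<Prod>j<?m. sqrt pi ^ ?n * Gamma ((real ?l - real j) / 2) / Gamma ((real ?n - real j) / 2))"
  have Gpos: "Gamma ((real ?l - real j) / 2) > 0" "Gamma ((real ?n - real j) / 2) > 0" if "j < ?m" for j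
    using that ml ln by (auto intro!: Gamma_real_pos)
  have \<kappa>2: "\<kappa>2 > 0" unfolding \<kappa>2_def by (intro prod_pos) (auto intro!: divide_pos_pos mult_pos_pos Gpos)
  have \<sigma>: "?\<sigma> > 0" using ln by (intro stiefel_mass_pos) simp
  have "\<kappa>2 * polar_const ?n ?l ?m = sqrt pi ^ (?l * ?m)"
  proof -
    have "\<kappa>2 * (\<Prod>j<?m. Gamma ((real ?n - real j) / 2) / Gamma ((real ?l - real j) / 2)) = (\<Prod>j<?m. sqrt pi ^ ?n)"
      unfolding \<kappa>2_def prod.distrib[symmetric]
    proof (rule prod.cong)
      fix j assume "j \<in> {..<?m}"
      then show "sqrt pi ^ ?n * Gamma ((real ?l - real j) / 2) / Gamma ((real ?n - real j) / 2) *
         (Gamma ((real ?n - real j) / 2) / Gamma ((real ?l - real j) / 2)) = sqrt pi ^ ?n"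
        using Gpos[of j] by simp
    qed simp
    also have "\<dots> = sqrt pi ^ ((?n - ?l) * ?m) * sqrt pi ^ (?l * ?m)"
      using ln by (simp add: power_mult[symmetric] power_add[symmetric] distrib_right[symmetric])
    finally show ?thesis unfolding polar_const_def by (simp add: field_simps)
  qed
  then have c: "\<kappa>2 * (?\<sigma> * polar_const ?n ?l ?m) = ?\<sigma> * sqrt pi ^ (?l * ?m)" by (simp add: mult_ac)
  have "ennreal \<kappa>2 * ?L = ennreal (?\<sigma> * sqrt pi ^ (?l * ?m)) * ?R"
    using homogeneous_measures_proportional[OF homogeneous_polar_measure[OF \<mu> ml] homogeneous_density_measure[OF ml ln], of h] ml ln
    unfolding polar_measure_gaussian[OF \<mu>] gaussian_density_measure[OF ml ln] \<kappa>2_def[symmetric]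
    by (simp add: nn_integral_polar_measure[OF \<mu>] nn_integral_density)
  also have "\<dots> = ennreal \<kappa>2 * (ennreal (?\<sigma> * polar_const ?n ?l ?m) * ?R)"
    unfolding c[symmetric] using \<kappa>2 \<sigma> polar_const_pos[OF ml, of ?n] ln
    by (subst ennreal_mult) (auto simp: mult.assoc)
  finally show ?thesis using \<kappa>2 by (simp add: ennreal_mult_cancel_left)
qed

text \<open>The factor \<open>(2 * pi) ^ (k * m)\<close> is that of Fourier inversion on
  \<open>k\<close> by \<open>m\<close> matrices. Half of its power of \<open>pi\<close> cancels
  against the denominator in \<open>polar_const\<close>.\<close>

lemma inversion_const_eq_polar_const:
  assumes "m \<le> n - k" "k \<le> n"
  shows "inversion_const n k m = (2 * pi) ^ (k * m) * polar_const n (n - k) m"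
proof -
  have "Gamma_cone m (real n / 2) / Gamma_cone m ((real n - real k) / 2)
     = (\<Prod>j<m. Gamma ((real n - real j) / 2) / Gamma ((real (n - k) - real j) / 2))"
    using assms by (simp add: Gamma_cone_def prod_dividef diff_divide_distrib of_nat_diff)
  moreover have "2 ^ (k * m) * pi powr (real (k * m) / 2) = (2 * pi) ^ (k * m) / sqrt pi ^ (k * m)"
  proof -
    have "pi powr (real (k * m) / 2) = sqrt pi ^ (k * m)"
      by (simp add: powr_half_sqrt[symmetric] powr_realpow[symmetric] powr_powr)
    moreover have "pi ^ (k * m) = sqrt pi ^ (k * m) * sqrt pi ^ (k * m)"
      by (simp flip: power_mult_distrib)
    ultimately show ?thesis by (simp add: power_mult_distrib)
  qed
  moreover have "n - (n - k) = k" using assms by simp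
  moreover have "inversion_const n k m = (2 ^ (k * m) * pi powr (real (k * m) / 2)) *
      (Gamma_cone m (real n / 2) / Gamma_cone m ((real n - real k) / 2))"
    by (simp add: inversion_const_def)
  ultimately show ?thesis
    by (simp only: polar_const_def) simp
qed

subsection \<open>Averaging over the Stiefel manifold\<close>

lemma pred_cball [measurable]:
  "Measurable.pred borel (\<lambda>x :: 'a :: metric_space. x \<in> cball a r)"
proof -
  have "{x \<in> space borel. x \<in> cball a r} = cball a r" by (simp only: space_borel) blast
  then show ?thesis unfolding pred_def using borel_closed[OF closed_cball, of a r] by (simp only:)
qed

lemma inverse_power_eq_Gamma_integral:
  assumes "N > 0" "r \<ge> 0"
  shows "ennreal (Gamma (real N) * inverse ((1 + r) ^ N))
    = (\<integral>\<^sup>+s. ennreal (indicator {0..} s * (s powr (real N - 1) * exp (- (s * (1 + r))))) \<partial>lborel)"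
proof -
  have "(1 + r) powr (- real N) = inverse ((1 + r) ^ N)"
    using assms by (simp add: powr_minus powr_realpow)
  then show ?thesis using nn_integral_Gamma_scaled[of "real N" "1 + r"] assms by simp
qed

text \<open>The negative power is a Gamma integral in \<open>s\<close>, and for fixed
  \<open>s\<close> the integral over the ball is bounded by a full Gaussian integral, whose
  determinant supplies the power of \<open>det (mat 1 + z ** transpose z)\<close>. This costs a
  singularity \<open>s powr (- n * l / 2)\<close> at 0, which \<open>s powr (N - 1)\<close> absorbs
  by the assumption on \<open>N\<close>.\<close>

lemma ball_integral_le:
  fixes z :: "real^'m^'n"
  assumes N: "real N > real (CARD('n) * CARD('l)) / 2"
  shows "ennreal (Gamma (real N)) * (\<integral>\<^sup>+Y. indicator (cball 0 1) Y * ennreal (inverse ((1 + (norm (transpose Y ** z))\<^sup>2) ^ N)) \<partial>(lborel :: (real^'l^'n) measure))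
    \<le> ennreal (exp 1 * sqrt pi ^ (CARD('n) * CARD('l)) * (Gamma (real N) + Gamma (real N - real (CARD('n) * CARD('l)) / 2))
        * det (mat 1 + z ** transpose z) powr (- real CARD('l) / 2))"
proof -
  let ?nl = "CARD('n) * CARD('l)"
  have N0: "N > 0" using N by (metis divide_nonneg_pos gr0I less_eq_real_def not_less of_nat_0 of_nat_0_le_iff zero_less_numeral)
  have Gp: "Gamma (real N) > 0" "Gamma (real N - real ?nl / 2) > 0" using N N0 by (auto intro!: Gamma_real_pos)
  have zn: "norm (transpose Y ** z) = norm (transpose z ** Y)" for Y :: "real^'l^'n"
    using norm_transpose[of "transpose Y ** z"] by (simp add: matrix_transpose_mul)
  obtain R :: "real^'n^'n" where R: "det R \<noteq> 0" "\<And>X::real^'l^'n. (norm (R ** X))\<^sup>2 = (norm X)\<^sup>2 + (norm (transpose z ** X))\<^sup>2"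
      "(det R)\<^sup>2 = det (mat 1 + z ** transpose z)"
    using sqrt_one_plus_gram_exists[of z] by metis
  have Rdet: "inverse (\<bar>det R\<bar> ^ CARD('l)) = det (mat 1 + z ** transpose z) powr (- real CARD('l) / 2)"
    unfolding R(3)[symmetric] power2_powr using R(1) by (simp add: powr_minus powr_realpow)
  let ?g = "\<lambda>s. indicator {0..} s * (s powr (real N - 1) * exp (- s)) :: real"
  let ?f = "\<lambda>(Y::real^'l^'n) s. indicator (cball 0 1) Y * ennreal (?g s * exp (- (s * (norm (transpose Y ** z))\<^sup>2)))"
  have gauss: "(\<integral>\<^sup>+Y. indicator (cball 0 1) Y * ennreal (exp (- (s * (norm (transpose Y ** z))\<^sup>2))) \<partial>(lborel :: (real^'l^'n) measure))
     \<le> ennreal (exp 1 * (sqrt pi ^ ?nl * inverse (\<bar>det R\<bar> ^ CARD('l)) * (1 + s powr (- (real ?nl / 2)))))" if s: "s > 0" for s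
  proof -
    \<comment> \<open>On the unit ball \<open>r * (norm Y)\<^sup>2 \<le> 1\<close>, so this term may
      be added to the exponent at the cost of a factor \<open>exp 1\<close>. Together with
      \<open>r \<le> s\<close> this completes the exponent to
      \<open>r * (norm (R ** Y))\<^sup>2\<close>, a Gaussian on the whole space.\<close>
    define r where "r = min s 1"
    have r: "0 < r" "r \<le> 1" "r \<le> s" using s by (auto simp: r_def)
    have det: "det (sqrt r *\<^sub>R R) \<noteq> 0" "\<bar>det (sqrt r *\<^sub>R R)\<bar> = sqrt r ^ CARD('n) * \<bar>det R\<bar>"
    proof -
      have "sqrt r *\<^sub>R R = (\<chi> i. sqrt r *s R $ i)" by (simp add: vec_eq_iff)
      then have "det (sqrt r *\<^sub>R R) = sqrt r ^ CARD('n) * det R"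
        using det_rows_mul[of "\<lambda>_. sqrt r" "\<lambda>i. R $ i"] by simp
      then show "det (sqrt r *\<^sub>R R) \<noteq> 0" "\<bar>det (sqrt r *\<^sub>R R)\<bar> = sqrt r ^ CARD('n) * \<bar>det R\<bar>"
        using R(1) r by (auto simp: abs_mult)
    qed
    have pt: "indicator (cball 0 1) Y * ennreal (exp (- (s * (norm (transpose Y ** z))\<^sup>2)))
        \<le> ennreal (exp 1) * ennreal (exp (- (norm ((sqrt r *\<^sub>R R) ** Y))\<^sup>2))" for Y :: "real^'l^'n"
    proof (cases "norm Y \<le> 1")
      case True
      have "(sqrt r *\<^sub>R R) ** Y = sqrt r *\<^sub>R (R ** Y)"
        by (simp add: vec_eq_iff matrix_matrix_mult_def sum_distrib_left mult.assoc)
      then have e: "(norm ((sqrt r *\<^sub>R R) ** Y))\<^sup>2 = r * (norm Y)\<^sup>2 + r * (norm (transpose Y ** z))\<^sup>2"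
        using r by (simp add: power_mult_distrib R(2) zn distrib_left)
      have "r * (norm Y)\<^sup>2 \<le> 1" using True r by (simp add: mult_le_one power_le_one)
      moreover have "r * (norm (transpose Y ** z))\<^sup>2 \<le> s * (norm (transpose Y ** z))\<^sup>2"
        using r by (intro mult_right_mono) auto
      ultimately have "exp (- (s * (norm (transpose Y ** z))\<^sup>2)) \<le> exp (1 + (- (norm ((sqrt r *\<^sub>R R) ** Y))\<^sup>2))"
        unfolding e by simp
      also have "\<dots> = exp 1 * exp (- (norm ((sqrt r *\<^sub>R R) ** Y))\<^sup>2)" by (rule exp_add)
      finally show ?thesis using True by (simp add: ennreal_leI flip: ennreal_mult)
    qed simp
    have "(\<integral>\<^sup>+Y. indicator (cball 0 1) Y * ennreal (exp (- (s * (norm (transpose Y ** z))\<^sup>2))) \<partial>(lborel :: (real^'l^'n) measure))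
      \<le> (\<integral>\<^sup>+Y. ennreal (exp 1) * ennreal (exp (- (norm ((sqrt r *\<^sub>R R) ** Y))\<^sup>2)) \<partial>(lborel :: (real^'l^'n) measure))"
      by (intro nn_integral_mono pt)
    also have "\<dots> = ennreal (exp 1) * (\<integral>\<^sup>+Y. ennreal (exp (- (norm ((sqrt r *\<^sub>R R) ** Y))\<^sup>2)) \<partial>(lborel :: (real^'l^'n) measure))"
      by (rule nn_integral_cmult) auto
    also have "\<dots> = ennreal (exp 1) * ennreal (sqrt pi ^ ?nl / \<bar>det (sqrt r *\<^sub>R R)\<bar> ^ CARD('l))"
      by (simp only: nn_integral_gaussian_matrix_left[OF det(1)])
    also have "\<dots> \<le> ennreal (exp 1 * (sqrt pi ^ ?nl * inverse (\<bar>det R\<bar> ^ CARD('l)) * (1 + s powr (- (real ?nl / 2)))))"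
    proof -
      have "sqrt r ^ (CARD('n) * CARD('l)) = r powr (real ?nl / 2)"
        using r by (simp add: powr_half_sqrt[symmetric] powr_realpow[symmetric] powr_powr)
      then have "sqrt pi ^ ?nl / \<bar>det (sqrt r *\<^sub>R R)\<bar> ^ CARD('l) = sqrt pi ^ ?nl * inverse (\<bar>det R\<bar> ^ CARD('l)) * r powr (- (real ?nl / 2))"
      proof -
        assume e: "sqrt r ^ (CARD('n) * CARD('l)) = r powr (real ?nl / 2)"
        have "\<bar>det (sqrt r *\<^sub>R R)\<bar> ^ CARD('l) = r powr (real ?nl / 2) * \<bar>det R\<bar> ^ CARD('l)"
          unfolding det(2) power_mult_distrib e[symmetric] by (simp only: power_mult)
        then show ?thesis by (simp only: powr_minus divide_inverse inverse_mult_distrib mult_ac)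
      qed
      moreover have "r powr (- (real ?nl / 2)) \<le> 1 + s powr (- (real ?nl / 2))"
        by (auto simp: r_def min_def)
      ultimately have "sqrt pi ^ ?nl / \<bar>det (sqrt r *\<^sub>R R)\<bar> ^ CARD('l) \<le> sqrt pi ^ ?nl * inverse (\<bar>det R\<bar> ^ CARD('l)) * (1 + s powr (- (real ?nl / 2)))"
        by (simp add: mult_left_mono)
      then have "exp 1 * (sqrt pi ^ ?nl / \<bar>det (sqrt r *\<^sub>R R)\<bar> ^ CARD('l)) \<le> exp 1 * (sqrt pi ^ ?nl * inverse (\<bar>det R\<bar> ^ CARD('l)) * (1 + s powr (- (real ?nl / 2))))"
        by (rule mult_left_mono) simp
      moreover have "ennreal (exp 1) * ennreal (sqrt pi ^ ?nl / \<bar>det (sqrt r *\<^sub>R R)\<bar> ^ CARD('l)) = ennreal (exp 1 * (sqrt pi ^ ?nl / \<bar>det (sqrt r *\<^sub>R R)\<bar> ^ CARD('l)))"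
        by (rule ennreal_mult[symmetric]) auto
      ultimately show ?thesis by (simp only: ennreal_leI)
    qed
    finally show ?thesis .
  qed
  have "ennreal (Gamma (real N)) * (\<integral>\<^sup>+Y. indicator (cball 0 1) Y * ennreal (inverse ((1 + (norm (transpose Y ** z))\<^sup>2) ^ N)) \<partial>(lborel :: (real^'l^'n) measure))
     = (\<integral>\<^sup>+Y. ennreal (Gamma (real N)) * (indicator (cball 0 1) Y * ennreal (inverse ((1 + (norm (transpose Y ** z))\<^sup>2) ^ N))) \<partial>(lborel :: (real^'l^'n) measure))"
    by (rule nn_integral_cmult[symmetric]) auto
  also have "\<dots> = (\<integral>\<^sup>+Y. \<integral>\<^sup>+s. ?f Y s \<partial>lborel \<partial>lborel)"
  proof (rule nn_integral_cong)
    fix Y :: "real^'l^'n"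
    have "ennreal (Gamma (real N)) * (indicator (cball 0 1) Y * ennreal (inverse ((1 + (norm (transpose Y ** z))\<^sup>2) ^ N)))
       = indicator (cball 0 1) Y * ennreal (Gamma (real N) * inverse ((1 + (norm (transpose Y ** z))\<^sup>2) ^ N))"
      using Gp by (simp add: ennreal_mult mult_ac)
    also have "\<dots> = indicator (cball 0 1) Y * (\<integral>\<^sup>+s. ennreal (indicator {0..} s * (s powr (real N - 1) * exp (- (s * (1 + (norm (transpose Y ** z))\<^sup>2))))) \<partial>lborel)"
      by (simp only: inverse_power_eq_Gamma_integral[OF N0 zero_le_power2])
    also have "\<dots> = (\<integral>\<^sup>+s. ?f Y s \<partial>lborel)"
      by (subst nn_integral_cmult[symmetric]) (auto simp: distrib_left exp_add exp_diff exp_minus field_simps intro!: nn_integral_cong)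
    finally show "ennreal (Gamma (real N)) * (indicator (cball 0 1) Y * ennreal (inverse ((1 + (norm (transpose Y ** z))\<^sup>2) ^ N))) = (\<integral>\<^sup>+s. ?f Y s \<partial>lborel)" .
  qed
  also have "\<dots> = (\<integral>\<^sup>+s. \<integral>\<^sup>+Y. ?f Y s \<partial>lborel \<partial>lborel)"
  proof (rule lborel_pair.Fubini'[symmetric])
    have "(\<lambda>x. ?f (fst x) (snd x)) \<in> borel_measurable (borel \<Otimes>\<^sub>M borel)"
      by measurable
    then show "(\<lambda>(Y, s). ?f Y s) \<in> borel_measurable (lborel \<Otimes>\<^sub>M lborel)"
      unfolding case_prod_beta
      by (simp add: measurable_cong_sets[OF sets_pair_measure_cong[OF sets_lborel sets_lborel] refl])
  qed
  also have "\<dots> \<le> (\<integral>\<^sup>+s. ennreal (exp 1 * sqrt pi ^ ?nl * inverse (\<bar>det R\<bar> ^ CARD('l))) *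
       (ennreal (indicator {0..} s * (s powr (real N - 1) * exp (- (s * 1)))) + ennreal (indicator {0..} s * (s powr (real N - real ?nl / 2 - 1) * exp (- (s * 1))))) \<partial>lborel)"
  proof (rule nn_integral_mono_AE, rule eventually_mono[OF AE_lborel_singleton[of 0]])
    fix s :: real assume "s \<noteq> 0"
    show "(\<integral>\<^sup>+Y. ?f Y s \<partial>lborel) \<le> ennreal (exp 1 * sqrt pi ^ ?nl * inverse (\<bar>det R\<bar> ^ CARD('l))) *
       (ennreal (indicator {0..} s * (s powr (real N - 1) * exp (- (s * 1)))) + ennreal (indicator {0..} s * (s powr (real N - real ?nl / 2 - 1) * exp (- (s * 1)))))"
    proof (cases "s > 0")
      case True
      have "(\<integral>\<^sup>+Y. ?f Y s \<partial>(lborel :: (real^'l^'n) measure)) = (\<integral>\<^sup>+Y. ennreal (?g s) * (indicator (cball 0 1) Y * ennreal (exp (- (s * (norm (transpose Y ** z))\<^sup>2)))) \<partial>(lborel :: (real^'l^'n) measure))"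
      proof (rule nn_integral_cong)
        fix Y :: "real^'l^'n"
        have "0 \<le> ?g s" by simp
        then have "ennreal (?g s * exp (- (s * (norm (transpose Y ** z))\<^sup>2))) = ennreal (?g s) * ennreal (exp (- (s * (norm (transpose Y ** z))\<^sup>2)))"
          by (rule ennreal_mult) simp
        then show "?f Y s = ennreal (?g s) * (indicator (cball 0 1) Y * ennreal (exp (- (s * (norm (transpose Y ** z))\<^sup>2))))"
          by (simp only: mult.left_commute)
      qed
      also have "\<dots> = ennreal (?g s) * (\<integral>\<^sup>+Y. indicator (cball 0 1) Y * ennreal (exp (- (s * (norm (transpose Y ** z))\<^sup>2))) \<partial>(lborel :: (real^'l^'n) measure))"
        by (rule nn_integral_cmult) auto
      also have "\<dots> \<le> ennreal (?g s) * ennreal (exp 1 * (sqrt pi ^ ?nl * inverse (\<bar>det R\<bar> ^ CARD('l)) * (1 + s powr (- (real ?nl / 2)))))"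
        by (intro mult_left_mono gauss True) simp
      also have "\<dots> = ennreal (?g s * (exp 1 * (sqrt pi ^ ?nl * inverse (\<bar>det R\<bar> ^ CARD('l)) * (1 + s powr (- (real ?nl / 2))))))"
        using True by (intro ennreal_mult[symmetric]) (auto intro!: mult_nonneg_nonneg)
      also have "?g s * (exp 1 * (sqrt pi ^ ?nl * inverse (\<bar>det R\<bar> ^ CARD('l)) * (1 + s powr (- (real ?nl / 2)))))
         = exp 1 * sqrt pi ^ ?nl * inverse (\<bar>det R\<bar> ^ CARD('l)) * (s powr (real N - 1) * exp (- s) + (s powr (real N - 1) * s powr (- (real ?nl / 2))) * exp (- s))"
        using True by (simp add: algebra_simps)
      also have "s powr (real N - 1) * s powr (- (real ?nl / 2)) = s powr (real N - real ?nl / 2 - 1)"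
        by (simp add: powr_add[symmetric] algebra_simps)
      also have "ennreal (exp 1 * sqrt pi ^ ?nl * inverse (\<bar>det R\<bar> ^ CARD('l)) * (s powr (real N - 1) * exp (- s) + s powr (real N - real ?nl / 2 - 1) * exp (- s)))
        = ennreal (exp 1 * sqrt pi ^ ?nl * inverse (\<bar>det R\<bar> ^ CARD('l))) * (ennreal (s powr (real N - 1) * exp (- s)) + ennreal (s powr (real N - real ?nl / 2 - 1) * exp (- s)))"
        by (subst ennreal_mult) (auto simp del: times_divide_eq_right)
      finally show ?thesis using True by simp
    next
      case False
      then have "indicat_real {0..} s = 0" using \<open>s \<noteq> 0\<close> by simp
      then show ?thesis by (simp only: mult_zero_left mult_zero_right ennreal_0 nn_integral_const) simp
    qed
  qed
  also have "\<dots> = ennreal (exp 1 * sqrt pi ^ ?nl * inverse (\<bar>det R\<bar> ^ CARD('l))) *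
      ((\<integral>\<^sup>+s. ennreal (indicator {0..} s * (s powr (real N - 1) * exp (- (s * 1)))) \<partial>lborel) + (\<integral>\<^sup>+s. ennreal (indicator {0..} s * (s powr (real N - real ?nl / 2 - 1) * exp (- (s * 1)))) \<partial>lborel))"
    by (subst nn_integral_cmult) (auto simp: nn_integral_add)
  also have "\<dots> = ennreal (exp 1 * sqrt pi ^ ?nl * inverse (\<bar>det R\<bar> ^ CARD('l))) * (ennreal (Gamma (real N)) + ennreal (Gamma (real N - real ?nl / 2)))"
    using nn_integral_Gamma_scaled[of "real N" 1] nn_integral_Gamma_scaled[of "real N - real ?nl / 2" 1] N N0 by simp
  also have "\<dots> = ennreal (exp 1 * sqrt pi ^ ?nl * inverse (\<bar>det R\<bar> ^ CARD('l)) * (Gamma (real N) + Gamma (real N - real ?nl / 2)))"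
    using Gp by (subst ennreal_plus[symmetric]) (auto simp del: ennreal_plus simp flip: ennreal_mult)
  also have "exp 1 * sqrt pi ^ ?nl * inverse (\<bar>det R\<bar> ^ CARD('l)) * (Gamma (real N) + Gamma (real N - real ?nl / 2))
     = exp 1 * sqrt pi ^ ?nl * (Gamma (real N) + Gamma (real N - real ?nl / 2)) * inverse (\<bar>det R\<bar> ^ CARD('l))"
    by (simp only: mult_ac)
  finally show ?thesis unfolding Rdet .
qed

text \<open>The average is compared with an integral over the unit ball of \<open>real^'l^'n\<close>, where the columns
  of the matrix decouple.\<close>

lemma stiefel_average_le:
  fixes \<mu> :: "(real^'l^'n) measure"
  assumes \<mu>: "stiefel_measure \<mu>" and ln: "CARD('l) < CARD('n)" and N: "real N > real (CARD('n) * CARD('l)) / 2"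
  obtains C where "C \<ge> 0" "\<And>z::real^'m^'n. (\<integral>\<^sup>+\<xi>. ennreal (inverse ((1 + (norm (transpose \<xi> ** z))\<^sup>2) ^ N)) \<partial>\<mu>)
    \<le> ennreal (C * det (mat 1 + z ** transpose z) powr (- real CARD('l) / 2))"
proof -
  let ?e = "(real CARD('n) - real CARD('l)) / 2"
  \<comment> \<open>The weight with exponent \<open>?e\<close> is there to cancel the density of the
    polar coordinates. As \<open>norm t \<le> 1\<close> makes \<open>transpose t\<close> a
    contraction, passing from \<xi> to \<open>\<xi> ** t\<close> only increases the integrand, and
    \<open>v\<close> splits off.\<close>
  define v where "v = (\<integral>\<^sup>+t. indicator (cball 0 1) t * ennreal (gdet t powr ?e) \<partial>(lborel :: (real^'l^'l) measure))"
  define c where "c = stiefel_mass CARD('n) CARD('l) * polar_const CARD('n) CARD('l) CARD('l)"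
  define B where "B = exp 1 * sqrt pi ^ (CARD('n) * CARD('l)) * (Gamma (real N) + Gamma (real N - real (CARD('n) * CARD('l)) / 2)) / Gamma (real N)"
  have N0: "real N > 0" using N by (meson divide_nonneg_pos less_le_trans not_less of_nat_0_le_iff zero_less_numeral le_less_trans)
  have Gp: "Gamma (real N) > 0" "Gamma (real N - real (CARD('n) * CARD('l)) / 2) > 0" using N N0 by (auto intro!: Gamma_real_pos)
  have c0: "c > 0" unfolding c_def using ln by (intro mult_pos_pos stiefel_mass_pos polar_const_pos) auto
  have B0: "B > 0" unfolding B_def using Gp by (intro divide_pos_pos mult_pos_pos add_pos_pos) auto
  have vm: "(\<lambda>t::real^'l^'l. indicator (cball 0 1) t * ennreal (gdet t powr ?e)) \<in> borel_measurable borel"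
  proof (intro borel_measurable_times_ennreal)
    show "(\<lambda>t::real^'l^'l. ennreal (gdet t powr ?e)) \<in> borel_measurable borel" by measurable
  qed (intro borel_measurable_indicator, simp)
  have bound: "v * (\<integral>\<^sup>+\<xi>. ennreal (inverse ((1 + (norm (transpose \<xi> ** z))\<^sup>2) ^ N)) \<partial>\<mu>)
    \<le> ennreal (c * B * det (mat 1 + z ** transpose z) powr (- real CARD('l) / 2))" for z :: "real^'m^'n"
  proof -
    let ?w = "\<lambda>Y::real^'l^'n. inverse ((1 + (norm (transpose Y ** z))\<^sup>2) ^ N)"
    let ?h = "\<lambda>Y::real^'l^'n. indicator (cball 0 1) Y * ennreal (gdet Y powr ?e * ?w Y)"
    have "v * (\<integral>\<^sup>+\<xi>. ennreal (?w \<xi>) \<partial>\<mu>) = (\<integral>\<^sup>+\<xi>. v * ennreal (?w \<xi>) \<partial>\<mu>)"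
      by (rule nn_integral_cmult[symmetric]) (rule borel_measurable_stiefelI[OF \<mu>], measurable)
    also have "\<dots> \<le> (\<integral>\<^sup>+\<xi>. \<integral>\<^sup>+t. ?h (\<xi> ** t) \<partial>(lborel :: (real^'l^'l) measure) \<partial>\<mu>)"
    proof (rule nn_integral_mono)
      fix \<xi> assume "\<xi> \<in> space \<mu>"
      then have \<xi>: "transpose \<xi> ** \<xi> = mat 1" by (simp add: space_stiefel[OF \<mu>] stiefel_def)
      have "v * ennreal (?w \<xi>) = (\<integral>\<^sup>+t. indicator (cball 0 1) t * ennreal (gdet t powr ?e) * ennreal (?w \<xi>) \<partial>(lborel :: (real^'l^'l) measure))"
        unfolding v_def by (rule nn_integral_multc[symmetric]) (simp add: vm)
      also have "\<dots> \<le> (\<integral>\<^sup>+t. ?h (\<xi> ** t) \<partial>(lborel :: (real^'l^'l) measure))"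
      proof (rule nn_integral_mono)
        fix t :: "real^'l^'l"
        show "indicator (cball 0 1) t * ennreal (gdet t powr ?e) * ennreal (?w \<xi>) \<le> ?h (\<xi> ** t)"
        proof (cases "norm t \<le> 1")
          case True
          have "norm (transpose (\<xi> ** t) ** z) = norm (transpose t ** (transpose \<xi> ** z))"
            by (simp add: matrix_transpose_mul matrix_mul_assoc)
          also have "\<dots> \<le> norm (transpose t) * norm (transpose \<xi> ** z)" by (rule norm_matrix_mult_le)
          also have "\<dots> \<le> norm (transpose \<xi> ** z)" using True by (simp add: norm_transpose mult_left_le_one_le)
          finally have "?w \<xi> \<le> ?w (\<xi> ** t)"
            by (intro le_imp_inverse_le power_mono add_left_mono) (auto intro!: zero_less_power add_pos_nonneg)
          then have "gdet t powr ?e * ?w \<xi> \<le> gdet t powr ?e * ?w (\<xi> ** t)" by (intro mult_left_mono) auto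
          then have "ennreal (gdet t powr ?e * ?w \<xi>) \<le> ennreal (gdet (\<xi> ** t) powr ?e * ?w (\<xi> ** t))"
            by (simp only: gdet_isometry_mult[OF \<xi>] ennreal_leI)
          then show ?thesis using True norm_isometry_mult[OF \<xi>, of t] by (simp add: ennreal_mult)
        qed simp
      qed
      finally show "v * ennreal (?w \<xi>) \<le> (\<integral>\<^sup>+t. ?h (\<xi> ** t) \<partial>(lborel :: (real^'l^'l) measure))" .
    qed
    also have "\<dots> = ennreal c * (\<integral>\<^sup>+Y. ennreal (gdet Y powr (- ?e)) * ?h Y \<partial>lborel)"
      unfolding c_def
    proof (rule polar_coordinates[OF \<mu> order_refl ln], intro borel_measurable_times_ennreal)
      show "(\<lambda>Y. ennreal (gdet Y powr ?e * ?w Y)) \<in> borel_measurable borel" by measurable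
    qed (intro borel_measurable_indicator, simp)
    also have "(\<integral>\<^sup>+Y. ennreal (gdet Y powr (- ?e)) * ?h Y \<partial>lborel) \<le> (\<integral>\<^sup>+Y. indicator (cball 0 1) Y * ennreal (?w Y) \<partial>lborel)"
    proof (rule nn_integral_mono)
      fix Y :: "real^'l^'n"
      have "gdet Y powr (- ?e) * gdet Y powr ?e \<le> 1"
        by (cases "gdet Y = 0") (simp_all add: powr_minus)
      then have "gdet Y powr (- ?e) * (gdet Y powr ?e * ?w Y) \<le> 1 * ?w Y"
        unfolding mult.assoc[symmetric] by (intro mult_right_mono) auto
      then show "ennreal (gdet Y powr (- ?e)) * ?h Y \<le> indicator (cball 0 1) Y * ennreal (?w Y)"
        by (auto simp: indicator_def ennreal_leI simp flip: ennreal_mult)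
    qed
    also have "(\<integral>\<^sup>+Y. indicator (cball 0 1) Y * ennreal (?w Y) \<partial>lborel) \<le> ennreal (B * det (mat 1 + z ** transpose z) powr (- real CARD('l) / 2))" (is "?I \<le> ennreal ?b")
    proof -
      have "?b \<ge> 0" using B0 by simp
      have "ennreal (Gamma (real N)) * ?I \<le> ennreal (Gamma (real N) * ?b)"
        using ball_integral_le[OF N, of z] Gp by (simp add: B_def)
      then have "ennreal (Gamma (real N)) * ?I \<le> ennreal (Gamma (real N)) * ennreal ?b"
        using Gp \<open>?b \<ge> 0\<close> by (simp add: ennreal_mult)
      then show ?thesis using Gp by (subst (asm) ennreal_mult_le_mult_iff) auto
    qed
    finally show ?thesis using c0 B0 by (simp add: mult.assoc ennreal_mult mult_left_mono)
  qed
  have "v \<noteq> 0"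
  proof
    assume "v = 0"
    then have "AE t::real^'l^'l in lborel. indicator (cball 0 1) t * ennreal (gdet t powr ?e) = 0"
      unfolding v_def by (subst (asm) nn_integral_0_iff_AE) (simp_all add: vm)
    then have "AE t::real^'l^'l in lborel. t \<notin> cball 0 1"
      using AE_gdet_nonzero[where 'm = 'l and 'n = 'l, OF order_refl]
      by eventually_elim (auto simp: indicator_def split: if_splits)
    then have "emeasure lborel (cball 0 1 :: (real^'l^'l) set) = 0"
      using AE_iff_null[of lborel "\<lambda>t::real^'l^'l. t \<notin> cball 0 1"] by (simp add: null_sets_def cball_def)
    then have "measure lborel (cball 0 1 :: (real^'l^'l) set) = 0" by (simp add: measure_def)
    then show False using content_cball_pos[of 1 "0::real^'l^'l"] by simp
  qed
  \<comment> \<open>Division takes place by a positive real number below \<open>v\<close>, so that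
    only \<open>v \<noteq> 0\<close> enters and not its finiteness.\<close>
  define w where "w = enn2real (min v 1)"
  have w: "w > 0" "ennreal w \<le> v"
  proof -
    have "min v 1 < \<top>" by (simp add: min_less_iff_disj)
    then have e: "ennreal w = min v 1" unfolding w_def by simp
    then show "ennreal w \<le> v" by simp
    have "min v 1 > 0" using \<open>v \<noteq> 0\<close> by (simp add: zero_less_iff_neq_zero)
    then show "w > 0" using e by (metis ennreal_less_zero_iff)
  qed
  show ?thesis
  proof (rule that[of "c * B / w"])
    show "c * B / w \<ge> 0" using c0 B0 w by simp
    fix z :: "real^'m^'n"
    let ?I = "\<integral>\<^sup>+\<xi>. ennreal (inverse ((1 + (norm (transpose \<xi> ** z))\<^sup>2) ^ N)) \<partial>\<mu>"
    let ?d = "det (mat 1 + z ** transpose z) powr (- real CARD('l) / 2)"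
    have "ennreal w * ?I \<le> v * ?I" by (intro mult_right_mono w) simp
    also have "\<dots> \<le> ennreal (c * B * ?d)" by (rule bound)
    also have "\<dots> = ennreal w * ennreal (c * B / w * ?d)"
      using w c0 B0 by (simp flip: ennreal_mult)
    finally show "?I \<le> ennreal (c * B / w * ?d)"
      using w by (subst (asm) ennreal_mult_le_mult_iff) auto
  qed
qed

text \<open>By Fubini's theorem \<open>norm (f z)\<close> is integrated against the average
  \<open>A z\<close>. For \<open>p = 1\<close> it suffices that \<open>A\<close> is bounded by the
  total mass. For \<open>p > 1\<close> Young's inequality reduces the claim to integrability of
  \<open>A z\<close> to the conjugate power \<open>q\<close>, which follows from the decay of
  \<open>A\<close> because \<open>?l * q > ?n + ?m - 1\<close>.\<close>

theorem Lp_stiefel_integrable: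
  fixes \<mu> :: "(real^'l^'n) measure" and f :: "real^'m^'n \<Rightarrow> complex"
  assumes \<mu>: "stiefel_measure \<mu>" and ln: "CARD('l) < CARD('n)" and N: "real N > real (CARD('n) * CARD('l)) / 2"
    and [measurable]: "f \<in> borel_measurable borel" and fp: "integrable lborel (\<lambda>x. norm (f x) powr p)"
    and p: "1 \<le> p" "p * (real CARD('n) - real CARD('l) + real CARD('m) - 1) < real CARD('n)"
  shows "(\<integral>\<^sup>+\<xi>. \<integral>\<^sup>+z. ennreal (norm (f z) * inverse ((1 + (norm (transpose \<xi> ** z))\<^sup>2) ^ N)) \<partial>lborel \<partial>\<mu>) < \<infinity>"
proof -
  let ?n = "real CARD('n)" and ?l = "real CARD('l)" and ?m = "real CARD('m)"
  let ?w = "\<lambda>(\<xi>::real^'l^'n) z. inverse ((1 + (norm (transpose \<xi> ** z))\<^sup>2) ^ N)"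
  define A where "A z = (\<integral>\<^sup>+\<xi>. ennreal (?w \<xi> z) \<partial>\<mu>)" for z :: "real^'m^'n"
  define s where "s = stiefel_mass CARD('n) CARD('l)"
  have s0: "s > 0" unfolding s_def using ln by (intro stiefel_mass_pos) simp
  obtain C where C: "C \<ge> 0" "\<And>z. A z \<le> ennreal (C * det (mat 1 + z ** transpose z) powr (- ?l / 2))"
    unfolding A_def using stiefel_average_le[OF \<mu> ln N, where 'm = 'm] by metis
  have As: "A z \<le> ennreal s" for z
  proof -
    have "A z \<le> (\<integral>\<^sup>+\<xi>. 1 \<partial>\<mu>)"
      unfolding A_def
      by (intro nn_integral_mono) (auto simp: inverse_le_1_iff one_le_power intro!: ennreal_le_1[THEN iffD2])
    then show ?thesis by (simp add: emeasure_stiefel[OF \<mu>] s_def)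
  qed
  have "(\<integral>\<^sup>+\<xi>. \<integral>\<^sup>+z. ennreal (norm (f z) * ?w \<xi> z) \<partial>lborel \<partial>\<mu>) = (\<integral>\<^sup>+z. \<integral>\<^sup>+\<xi>. ennreal (norm (f z) * ?w \<xi> z) \<partial>\<mu> \<partial>lborel)"
    by (rule stiefel_nn_Fubini[OF \<mu>]) measurable
  also have "\<dots> = (\<integral>\<^sup>+z. ennreal (norm (f z)) * A z \<partial>lborel)"
  proof (rule nn_integral_cong)
    fix z
    have "(\<integral>\<^sup>+\<xi>. ennreal (norm (f z) * ?w \<xi> z) \<partial>\<mu>) = (\<integral>\<^sup>+\<xi>. ennreal (norm (f z)) * ennreal (?w \<xi> z) \<partial>\<mu>)"
      by (simp add: ennreal_mult)
    also have "\<dots> = ennreal (norm (f z)) * A z"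
      unfolding A_def by (rule nn_integral_cmult) (rule borel_measurable_stiefelI[OF \<mu>], measurable)
    finally show "(\<integral>\<^sup>+\<xi>. ennreal (norm (f z) * ?w \<xi> z) \<partial>\<mu>) = ennreal (norm (f z)) * A z" .
  qed
  also have "\<dots> < \<infinity>"
  proof (cases "p = 1")
    case True
    have "(\<integral>\<^sup>+z. ennreal (norm (f z)) * A z \<partial>lborel) \<le> (\<integral>\<^sup>+z. ennreal s * ennreal (norm (f z) powr p) \<partial>lborel)"
      by (intro nn_integral_mono) (auto simp: True mult.commute intro!: mult_right_mono As)
    also have "\<dots> = ennreal s * (\<integral>\<^sup>+z. ennreal (norm (f z) powr p) \<partial>lborel)"
      by (rule nn_integral_cmult) auto
    also have "\<dots> < \<infinity>"
      using fp by (auto simp: ennreal_mult_less_top integrable_iff_bounded)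
    finally show ?thesis .
  next
    case False
    then have p1: "p > 1" using p by simp
    define q where "q = p / (p - 1)"
    have q: "q > 1" "1 / p + 1 / q = 1" using p1 by (auto simp: q_def field_simps)
    have "1 \<le> CARD('m)" "1 \<le> CARD('n)" by (simp_all add: Suc_leI)
    then have m1: "?m \<ge> 1" "?n \<ge> 1" by linarith+
    have lq: "?l * q > ?n + ?m - 1"
    proof -
      have "(?n + ?m - 1) * (p - 1) < ?l * p"
      proof -
        have e: "(?n + ?m - 1) * (p - 1) = p * (?n - ?l + ?m - 1) + ?l * p - (?n + ?m - 1)"
          by (simp add: algebra_simps)
        show ?thesis unfolding e using p(2) m1 by linarith
      qed
      then show ?thesis using p1 by (simp add: q_def pos_less_divide_eq)
    qed
    \<comment> \<open>The finiteness of the t-integral is available only for exponents below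
      \<open>?n + ?m\<close>, so the decay is used to the power \<open>a / ?l\<close> only. The
      remaining power \<open>q - a / ?l\<close> of the average is bounded by the mass
      \<open>s\<close>.\<close>
    define a where "a = min (?l * q) (?n + ?m - 1 / 2)"
    have a: "?n + ?m - 1 < a" "a < ?n + ?m" "a \<le> ?l * q" using lq by (auto simp: a_def)
    have ap: "a > 0" using a(1) m1 by linarith
    have l0: "?l > 0" by simp
    define D where "D z = det (mat 1 + z ** transpose z) powr (- ?l / 2)" for z :: "real^'m^'n"
    have D0: "D z \<ge> 0" for z by (simp add: D_def)
    define K where "K = s powr (q - a / ?l) * C powr (a / ?l)"
    have pt: "ennreal (norm (f z)) * A z \<le> ennreal (norm (f z) powr p / p) + ennreal (K / q) * ennreal (det (mat 1 + z ** transpose z) powr (- a / 2))" for z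
    proof -
      define \<alpha> where "\<alpha> = enn2real (A z)"
      have Afin: "A z < \<top>" using As[of z] by (metis ennreal_less_top le_less_trans)
      then have \<alpha>: "A z = ennreal \<alpha>" by (simp add: \<alpha>_def)
      have \<alpha>0: "\<alpha> \<ge> 0" by (simp add: \<alpha>_def)
      have \<alpha>s: "\<alpha> \<le> s" using As[of z] s0 by (simp add: \<alpha> ennreal_le_iff)
      have \<alpha>C: "\<alpha> \<le> C * D z" using C(2)[of z] C(1) D0[of z] by (simp add: \<alpha> ennreal_le_iff D_def)
      have "\<alpha> powr q \<le> K * det (mat 1 + z ** transpose z) powr (- a / 2)"
      proof -
        have "\<alpha> powr q = \<alpha> powr (q - a / ?l) * \<alpha> powr (a / ?l)"
          by (simp add: powr_add[symmetric])
        also have "\<dots> \<le> s powr (q - a / ?l) * (C * D z) powr (a / ?l)"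
        proof (intro mult_mono powr_mono2)
          show "0 \<le> q - a / ?l" using a(3) l0 by (simp add: field_simps)
          show "0 \<le> a / ?l" using ap by simp
        qed (use \<alpha>0 \<alpha>s \<alpha>C in auto)
        also have "(C * D z) powr (a / ?l) = C powr (a / ?l) * det (mat 1 + z ** transpose z) powr (- a / 2)"
          using C(1) D0[of z] by (simp add: powr_mult D_def powr_powr)
        finally show ?thesis by (simp add: K_def mult.assoc)
      qed
      then have "\<alpha> powr q / q \<le> (K / q) * det (mat 1 + z ** transpose z) powr (- a / 2)"
        using q by (simp add: divide_right_mono)
      moreover have "norm (f z) * \<alpha> \<le> norm (f z) powr p / p + \<alpha> powr q / q"
        using Youngs_inequality[OF p1 q(1) q(2)] \<alpha>0 by simp
      ultimately have "norm (f z) * \<alpha> \<le> norm (f z) powr p / p + (K / q) * det (mat 1 + z ** transpose z) powr (- a / 2)" by linarith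
      moreover have "K / q \<ge> 0" using q by (simp add: K_def)
      moreover have "0 \<le> (K / q) * det (mat 1 + z ** transpose z) powr (- a / 2)"
        using \<open>K / q \<ge> 0\<close> by (rule mult_nonneg_nonneg) simp
      ultimately have "ennreal (norm (f z) * \<alpha>) \<le> ennreal (norm (f z) powr p / p) + ennreal ((K / q) * det (mat 1 + z ** transpose z) powr (- a / 2))"
        using p1 by (subst ennreal_plus[symmetric]) (auto simp del: ennreal_plus intro!: ennreal_leI)
      also have "ennreal ((K / q) * det (mat 1 + z ** transpose z) powr (- a / 2)) = ennreal (K / q) * ennreal (det (mat 1 + z ** transpose z) powr (- a / 2))"
        using \<open>K / q \<ge> 0\<close> by (rule ennreal_mult) simp
      finally show ?thesis using \<alpha>0 by (simp only: \<alpha> ennreal_mult norm_ge_zero)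
    qed
    have "(\<integral>\<^sup>+z. ennreal (norm (f z)) * A z \<partial>lborel)
       \<le> (\<integral>\<^sup>+z. ennreal (norm (f z) powr p / p) + ennreal (K / q) * ennreal (det (mat 1 + z ** transpose z) powr (- a / 2)) \<partial>lborel)"
      by (intro nn_integral_mono pt)
    also have "\<dots> = (\<integral>\<^sup>+z. ennreal (norm (f z) powr p / p) \<partial>lborel) + ennreal (K / q) * (\<integral>\<^sup>+z. ennreal (det (mat 1 + z ** transpose z) powr (- a / 2)) \<partial>(lborel :: (real^'m^'n) measure))"
      by (subst nn_integral_add) (auto simp: nn_integral_cmult)
    also have "\<dots> < \<infinity>"
    proof -
      have "integrable lborel (\<lambda>x. norm (f x) powr p / p)" using fp by simp
      then have "(\<integral>\<^sup>+z. ennreal (norm (f z) powr p / p) \<partial>lborel) < \<infinity>"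
        using p1 by (simp add: integrable_iff_bounded)
      then show ?thesis using nn_integral_t_density_finite[OF a(1) a(2)] by (simp add: ennreal_mult_less_top)
    qed
    finally show ?thesis .
  qed
  finally show ?thesis .
qed

subsection \<open>Test functions that are flat on the rank-deficient matrices\<close>

lemma has_derivative_dirderiv:
  assumes "(f has_derivative f') (at x)"
  shows "((\<lambda>s. f (x + s *\<^sub>R b)) has_vector_derivative f' b) (at 0)"
proof -
  have "((\<lambda>s::real. x + s *\<^sub>R b) has_derivative (\<lambda>s. s *\<^sub>R b)) (at 0)"
    by (auto intro!: derivative_eq_intros)
  moreover have "(f has_derivative f') (at (x + 0 *\<^sub>R b))" using assms by simp
  ultimately have "((\<lambda>s. f (x + s *\<^sub>R b)) has_derivative (\<lambda>s. f' (s *\<^sub>R b))) (at 0)"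
    by (rule has_derivative_compose)
  moreover have "f' (s *\<^sub>R b) = s *\<^sub>R f' b" for s
    using has_derivative_bounded_linear[OF assms] by (rule linear_simps(5))
  ultimately show ?thesis by (simp add: has_vector_derivative_def)
qed

lemma partial_eqI:
  assumes "((\<lambda>s. f (x + s *\<^sub>R axis (fst ij) (axis (snd ij) 1))) has_vector_derivative d) (at 0)"
  shows "partial ij f x = d"
  unfolding partial_def using assms by (rule vector_derivative_at)

lemma has_derivative_partial:
  assumes "(f has_derivative f') (at x)"
  shows "partial (i, j) f x = f' (axis i (axis j 1))"
  by (rule partial_eqI) (simp add: has_derivative_dirderiv[OF assms])

lemma Basis_matrix:
  assumes "b \<in> (Basis :: (real^'m^'n) set)"
  obtains i j where "b = axis i (axis j 1)"
  using assms by (auto simp: Basis_vec_def)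

lemma smooth_dirderiv_partials:
  assumes "smooth f"
  shows "has_dirderiv (partials ijs f) (axis i (axis j 1)) (partials ((i, j) # ijs) f)"
  unfolding has_dirderiv_def
proof
  fix x
  obtain f' where f': "(partials ijs f has_derivative f') (at x)"
    using assms by (auto simp: smooth_def differentiable_def)
  show "((\<lambda>s. partials ijs f (x + s *\<^sub>R axis i (axis j 1))) has_vector_derivative partials ((i, j) # ijs) f x) (at 0)"
    using has_derivative_dirderiv[OF f'] by (simp add: has_derivative_partial[OF f'])
qed

lemma matrix_sum_axis: "(v :: real^'m^'n) = (\<Sum>i\<in>UNIV. \<Sum>j\<in>UNIV. (v $ i $ j) *\<^sub>R axis i (axis j 1))"
proof -
  have "(\<Sum>b\<in>UNIV. if P then g b else 0) = (if P then sum g UNIV else (0::real))" for P and g :: "'m \<Rightarrow> real"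
    by simp
  then show ?thesis
    by (simp add: vec_eq_iff axis_def if_distrib[of "\<lambda>x. x $ _"] if_distrib[of "\<lambda>x. _ * x"] sum.delta cong: if_cong)
qed

lemma onorm_le_sum_partial:
  fixes f :: "real^'m^'n \<Rightarrow> complex"
  assumes f': "(f has_derivative f') (at x)"
  shows "onorm f' \<le> (\<Sum>i\<in>UNIV. \<Sum>j\<in>UNIV. norm (partial (i, j) f x))"
proof (rule onorm_le)
  fix v :: "real^'m^'n"
  have lin: "linear f'" using has_derivative_bounded_linear[OF f'] by (rule bounded_linear.linear)
  have "f' v = (\<Sum>i\<in>UNIV. \<Sum>j\<in>UNIV. (v $ i $ j) *\<^sub>R partial (i, j) f x)"
    by (subst matrix_sum_axis) (simp add: linear_sum[OF lin] linear_scale[OF lin] has_derivative_partial[OF f'])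
  also have "norm \<dots> \<le> (\<Sum>i\<in>UNIV. \<Sum>j\<in>UNIV. norm ((v $ i $ j) *\<^sub>R partial (i, j) f x))"
    by (rule sum_norm_le)+ simp
  also have "\<dots> \<le> (\<Sum>i\<in>UNIV. \<Sum>j\<in>UNIV. norm (partial (i, j) f x) * norm v)"
  proof (intro sum_mono)
    fix i j
    have "\<bar>v $ i $ j\<bar> \<le> norm (v $ i)" by (rule component_le_norm_cart)
    also have "\<dots> \<le> norm v" by (rule Finite_Cartesian_Product.norm_nth_le)
    finally show "norm ((v $ i $ j) *\<^sub>R partial (i, j) f x) \<le> norm (partial (i, j) f x) * norm v"
      by (subst mult.commute) (auto intro: mult_right_mono)
  qed
  finally show "norm (f' v) \<le> (\<Sum>i\<in>UNIV. \<Sum>j\<in>UNIV. norm (partial (i, j) f x)) * norm v"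
    by (simp add: sum_distrib_right)
qed

section \<open>Vanishing to infinite order on the rank-deficient matrices\<close>

lemma schwartzD:
  assumes "f \<in> schwartz"
  shows "smooth f" "rapid (partials ijs f)"
  using assms by (auto simp: schwartz_def rapid_def)

lemma Psi_spaceD:
  assumes "\<psi> \<in> Psi_space"
  shows "\<psi> \<in> schwartz" "gdet y = 0 \<Longrightarrow> partials ijs \<psi> y = 0"
  using assms by (auto simp: Psi_space_def rank_lt_iff_gdet)

lemma smooth_continuous: "smooth f \<Longrightarrow> continuous_on S (partials ijs f)"
  unfolding smooth_def
  by (auto intro!: continuous_at_imp_continuous_on differentiable_imp_continuous_within)

lemma smooth_borel_measurable: "smooth f \<Longrightarrow> partials ijs f \<in> borel_measurable borel"
  by (intro borel_measurable_continuous_onI smooth_continuous)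

text \<open>Induction on the order of vanishing: the derivative vanishes at \<open>y0\<close>, and
  the mean value inequality on the segment from \<open>y0\<close> to \<open>y\<close>, fed with the
  order \<open>M\<close> of all derivatives one step higher, gains one power of the distance. Along
  a segment of length at most 1 the polynomial weights are comparable up to
  \<open>2 ^ N\<close>.\<close>

lemma Psi_space_flat_dist:
  fixes \<psi> :: "real^'m^'n \<Rightarrow> complex"
  assumes \<psi>: "\<psi> \<in> Psi_space"
  shows "\<exists>C. \<forall>y y0. gdet y0 = 0 \<longrightarrow> norm (y - y0) \<le> 1 \<longrightarrow>
    (1 + norm y) ^ N * norm (partials ijs \<psi> y) \<le> C * norm (y - y0) ^ M"
proof (induction M arbitrary: ijs)
  case 0
  then show ?case using schwartzD(2)[OF Psi_spaceD(1)[OF \<psi>], of ijs] unfolding rapid_def by simp blast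
next
  case (Suc M)
  obtain C where C: "\<And>i j y y0. gdet y0 = 0 \<Longrightarrow> norm (y - y0) \<le> 1 \<Longrightarrow>
      (1 + norm y) ^ N * norm (partials ((i, j) # ijs) \<psi> y) \<le> C i j * norm (y - y0) ^ M"
    using Suc.IH[of "(_, _) # ijs"] by metis
  have sm: "smooth \<psi>" using schwartzD Psi_spaceD \<psi> by blast
  define S where "S = (\<Sum>i\<in>UNIV. \<Sum>j\<in>UNIV. C i j)"
  have C0: "C i j * norm (y - y0) ^ M \<ge> 0" if "gdet y0 = 0" "norm (y - y0) \<le> 1" for i j and y y0 :: "real^'m^'n"
    by (rule order_trans[OF _ C[OF that]]) simp
  have "(1 + norm y) ^ N * norm (partials ijs \<psi> y) \<le> 2 ^ N * S * norm (y - y0) ^ Suc M"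
    if y0: "gdet y0 = 0" "norm (y - y0) \<le> 1" for y y0 :: "real^'m^'n"
  proof -
    obtain F where F: "\<And>x. (partials ijs \<psi> has_derivative F x) (at x)"
      using sm unfolding smooth_def differentiable_def by metis
    define B where "B = 2 ^ N * S * norm (y - y0) ^ M / (1 + norm y) ^ N"
    have "norm (partials ijs \<psi> y - partials ijs \<psi> y0) \<le> B * norm (y - y0)"
    proof (rule differentiable_bound[where S = "closed_segment y0 y" and f' = F])
      show "convex (closed_segment y0 y)" by simp
      fix x assume "x \<in> closed_segment y0 y"
      then obtain u where u: "0 \<le> u" "u \<le> 1" "x = y0 + u *\<^sub>R (y - y0)"
        by (auto simp: closed_segment_def algebra_simps)
      have xy0: "norm (x - y0) \<le> norm (y - y0)" using u by (simp add: mult_left_le_one_le)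
      have "y - x = (1 - u) *\<^sub>R (y - y0)" using u by (simp add: algebra_simps)
      then have xy: "norm (y - x) \<le> 1" using u y0(2) by (simp add: mult_le_one)
      show "(partials ijs \<psi> has_derivative F x) (at x within closed_segment y0 y)"
        by (rule has_derivative_at_withinI[OF F])
      have "norm y \<le> norm x + norm (y - x)" by (rule norm_triangle_sub)
      then have "norm y \<le> norm x + 1" using xy by simp
      then have "1 + norm y \<le> 2 + 1 * norm x" by simp
      also have "\<dots> \<le> 2 + 2 * norm x" by (intro add_left_mono mult_right_mono) auto
      finally have le: "1 + norm y \<le> 2 * (1 + norm x)" by (simp add: distrib_left)
      have "(1 + norm y) ^ N * onorm (F x) \<le> (1 + norm y) ^ N * (\<Sum>i\<in>UNIV. \<Sum>j\<in>UNIV. norm (partial (i, j) (partials ijs \<psi>) x))"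
        by (intro mult_left_mono onorm_le_sum_partial F) simp
      also have "\<dots> \<le> (2 * (1 + norm x)) ^ N * (\<Sum>i\<in>UNIV. \<Sum>j\<in>UNIV. norm (partial (i, j) (partials ijs \<psi>) x))"
        by (intro mult_right_mono power_mono le sum_nonneg) auto
      also have "\<dots> = 2 ^ N * (\<Sum>i\<in>UNIV. \<Sum>j\<in>UNIV. (1 + norm x) ^ N * norm (partials ((i, j) # ijs) \<psi> x))"
        by (simp only: power_mult_distrib sum_distrib_left mult.assoc partials.simps)
      also have "\<dots> \<le> 2 ^ N * (\<Sum>i\<in>UNIV. \<Sum>j\<in>UNIV. C i j * norm (y - y0) ^ M)"
      proof (intro mult_left_mono sum_mono)
        fix i j
        have "(1 + norm x) ^ N * norm (partials ((i, j) # ijs) \<psi> x) \<le> C i j * norm (x - y0) ^ M"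
          using C[OF y0(1), of x] xy0 y0(2) by (meson order_trans)
        also have "\<dots> \<le> C i j * norm (y - y0) ^ M"
        proof (cases "norm (y - y0) = 0")
          case True
          then show ?thesis using xy0 by simp
        next
          case False
          then have "norm (y - y0) ^ M > 0" by simp
          then have "C i j \<ge> 0" using C0[OF y0, of i j] by (metis not_le mult_neg_pos)
          then show ?thesis by (intro mult_left_mono power_mono xy0) auto
        qed
        finally show "(1 + norm x) ^ N * norm (partials ((i, j) # ijs) \<psi> x) \<le> C i j * norm (y - y0) ^ M" .
      qed simp
      also have "\<dots> = 2 ^ N * S * norm (y - y0) ^ M"
        by (simp add: S_def sum_distrib_right mult.assoc)
      finally show "onorm (F x) \<le> B"
        unfolding B_def by (subst pos_le_divide_eq) (simp_all add: mult.commute add_pos_nonneg)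
    qed auto
    moreover have "partials ijs \<psi> y0 = 0" using Psi_spaceD(2)[OF \<psi> y0(1)] .
    ultimately have "norm (partials ijs \<psi> y) \<le> 2 ^ N * S * norm (y - y0) ^ Suc M / (1 + norm y) ^ N"
      by (simp add: B_def mult_ac)
    then show ?thesis
      by (simp add: pos_le_divide_eq add_pos_nonneg mult.commute)
  qed
  then show ?case by blast
qed

text \<open>Where \<open>gdet y \<le> 1\<close>, a rank-deficient matrix lies within distance 1, and
  order \<open>2 * CARD('m) * M\<close> in that distance is order \<open>M\<close> in
  \<open>gdet\<close>. Where \<open>gdet y > 1\<close>, Schwartz decay alone gives the
  bound.\<close>

lemma Psi_space_flat:
  fixes \<psi> :: "real^'m^'n \<Rightarrow> complex"
  assumes \<psi>: "\<psi> \<in> Psi_space"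
  shows "\<exists>C\<ge>0. \<forall>y. (1 + norm y) ^ N * norm (partials ijs \<psi> y) \<le> C * gdet y ^ M"
proof -
  obtain C where C: "\<And>y y0. gdet y0 = 0 \<Longrightarrow> norm (y - y0) \<le> 1 \<Longrightarrow>
    (1 + norm y) ^ N * norm (partials ijs \<psi> y) \<le> C * norm (y - y0) ^ (2 * CARD('m) * M)"
    using Psi_space_flat_dist[OF \<psi>] by blast
  obtain D where D: "\<And>y. (1 + norm y) ^ N * norm (partials ijs \<psi> y) \<le> D"
    using schwartzD(2)[OF Psi_spaceD(1)[OF \<psi>], of ijs] unfolding rapid_def by blast
  have D0: "D \<ge> 0" by (rule order_trans[OF _ D[of 0]]) simp
  have "(1 + norm y) ^ N * norm (partials ijs \<psi> y) \<le> (\<bar>C\<bar> + D) * gdet y ^ M" for y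
  proof (cases "gdet y \<le> 1")
    case True
    obtain y0 where y0: "gdet y0 = 0" "norm (y - y0) ^ (2 * CARD('m)) \<le> gdet y"
      using rank_deficient_nearby .
    have "norm (y - y0) ^ (2 * CARD('m)) \<le> 1" using y0(2) True by linarith
    then have "norm (y - y0) \<le> 1"
      using one_less_power[of "norm (y - y0)" "2 * CARD('m)"] by (meson not_less zero_less_card_finite nat_0_less_mult_iff pos2)
    from C[OF y0(1) this] have "(1 + norm y) ^ N * norm (partials ijs \<psi> y) \<le> C * (norm (y - y0) ^ (2 * CARD('m))) ^ M"
      by (simp add: power_mult)
    also have "\<dots> \<le> \<bar>C\<bar> * gdet y ^ M"
      by (intro mult_mono power_mono y0(2)) auto
    also have "\<dots> \<le> (\<bar>C\<bar> + D) * gdet y ^ M"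
      using D0 gdet_nonneg[of y] by (intro mult_right_mono) auto
    finally show ?thesis .
  next
    case False
    have "(1 + norm y) ^ N * norm (partials ijs \<psi> y) \<le> D * 1" using D by simp
    also have "\<dots> \<le> (\<bar>C\<bar> + D) * gdet y ^ M"
      using False D0 by (intro mult_mono one_le_power) auto
    finally show ?thesis .
  qed
  then show ?thesis using D0 by (intro exI[of _ "\<bar>C\<bar> + D"]) auto
qed

section \<open>Growth and derivatives of polynomials\<close>

lemma real_polynomial_growth:
  assumes "real_polynomial_function q"
  shows "\<exists>A M. \<forall>x. \<bar>q x\<bar> \<le> A * (1 + norm x) ^ M"
  using assms
proof induction
  case (linear f)
  obtain K where K: "K > 0" "\<And>x. \<bar>f x\<bar> \<le> norm x * K"
    using bounded_linear.pos_bounded[OF linear] by auto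
  have "\<bar>f x\<bar> \<le> K * (1 + norm x) ^ 1" for x
    using K(2)[of x] K(1) by (simp add: algebra_simps)
  then show ?case by blast
next
  case (const c)
  have "\<bar>c\<bar> \<le> \<bar>c\<bar> * (1 + norm x) ^ 0" for x :: 'a by simp
  then show ?case by blast
next
  case (add f g)
  then obtain A M B L where f: "\<And>x. \<bar>f x\<bar> \<le> A * (1 + norm x) ^ M" and g: "\<And>x. \<bar>g x\<bar> \<le> B * (1 + norm x) ^ L"
    by metis
  have "A \<ge> 0" "B \<ge> 0" using order_trans[OF abs_ge_zero f[of 0]] order_trans[OF abs_ge_zero g[of 0]] by auto
  have "\<bar>f x + g x\<bar> \<le> (A + B) * (1 + norm x) ^ (M + L)" for x
  proof -
    have "\<bar>f x + g x\<bar> \<le> A * (1 + norm x) ^ M + B * (1 + norm x) ^ L"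
      using f[of x] g[of x] by linarith
    also have "\<dots> \<le> A * (1 + norm x) ^ (M + L) + B * (1 + norm x) ^ (M + L)"
      using \<open>A \<ge> 0\<close> \<open>B \<ge> 0\<close> by (intro add_mono mult_left_mono power_increasing) auto
    finally show ?thesis by (simp add: distrib_right)
  qed
  then show ?case by blast
next
  case (mult f g)
  then obtain A M B L where f: "\<And>x. \<bar>f x\<bar> \<le> A * (1 + norm x) ^ M" and g: "\<And>x. \<bar>g x\<bar> \<le> B * (1 + norm x) ^ L"
    by metis
  have "A \<ge> 0" using order_trans[OF abs_ge_zero f[of 0]] by auto
  then have "\<bar>f x * g x\<bar> \<le> (A * B) * (1 + norm x) ^ (M + L)" for x
    using mult_mono[OF f[of x] g[of x]] by (simp add: abs_mult power_add mult_ac)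
  then show ?case by blast
qed

lemma real_polynomial_dirderiv:
  assumes "real_polynomial_function q"
  shows "\<exists>q'. real_polynomial_function q' \<and> (\<forall>x. ((\<lambda>s. q (x + s *\<^sub>R b)) has_real_derivative q' x) (at 0))"
  using assms
proof induction
  case (linear f)
  have "((\<lambda>s. f (x + s *\<^sub>R b)) has_real_derivative f b) (at 0)" for x
    using has_derivative_dirderiv[OF bounded_linear_imp_has_derivative[OF linear], of x b]
    by (simp add: has_real_derivative_iff_has_vector_derivative)
  then show ?case by blast
next
  case (const c)
  have "((\<lambda>s. c) has_real_derivative 0) (at 0)" by simp
  then show ?case by blast
next
  case (add f g)
  then obtain f' g' where "real_polynomial_function f'" "real_polynomial_function g'"
    "\<And>x. ((\<lambda>s. f (x + s *\<^sub>R b)) has_real_derivative f' x) (at 0)"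
    "\<And>x. ((\<lambda>s. g (x + s *\<^sub>R b)) has_real_derivative g' x) (at 0)" by blast
  then show ?case
    by (intro exI[of _ "\<lambda>x. f' x + g' x"]) (auto intro!: DERIV_add)
next
  case (mult f g)
  then obtain f' g' where fg: "real_polynomial_function f'" "real_polynomial_function g'"
    "\<And>x. ((\<lambda>s. f (x + s *\<^sub>R b)) has_real_derivative f' x) (at 0)"
    "\<And>x. ((\<lambda>s. g (x + s *\<^sub>R b)) has_real_derivative g' x) (at 0)" by blast
  have "((\<lambda>s. f (x + s *\<^sub>R b) * g (x + s *\<^sub>R b)) has_real_derivative f' x * g x + g' x * f x) (at 0)" for x
    using DERIV_mult[OF fg(3)[of x] fg(4)[of x]] by simp
  then show ?case using fg mult.hyps
    by (intro exI[of _ "\<lambda>x. f' x * g x + g' x * f x"] conjI allI real_polynomial_function.intros(3) real_polynomial_function.intros(4))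
qed

lemma real_polynomial_gdet: "real_polynomial_function (gdet :: real^'m^'n \<Rightarrow> real)"
proof -
  have c: "real_polynomial_function (\<lambda>x :: real^'m^'n. x $ i $ j)" for i j
    by (intro real_polynomial_function.intros(1) bounded_linear_compose[OF bounded_linear_vec_nth bounded_linear_vec_nth])
  show ?thesis
    unfolding det_def matrix_matrix_mult_def transpose_def
    by (intro real_polynomial_function_sum real_polynomial_function.intros(4) real_polynomial_function.intros(2)
        real_polynomial_function_prod) (auto intro!: c real_polynomial_function_sum real_polynomial_function.intros(4)
        finite_permutations)
qed

lemma real_polynomial_borel_measurable:
  "real_polynomial_function q \<Longrightarrow> q \<in> borel_measurable borel"
  by (intro borel_measurable_continuous_onI continuous_at_imp_continuous_on ballI
      continuous_real_polymonial_function)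

text \<open>
  The function \<open>mat_abs y ^ k\<close> is not smooth for odd \<open>k\<close>, so the class contains arbitrary real
  powers of \<open>gdet\<close>; since \<open>0 powr r = 0\<close>, its members vanish on the rank-deficient matrices even
  for negative \<open>r\<close>.  It is closed under differentiation, and the flatness of \<open>\<psi>\<close> compensates
  the negative powers.
\<close>

inductive_set gdet_flat :: "(real^'m^'n \<Rightarrow> complex) \<Rightarrow> (real^'m^'n \<Rightarrow> complex) set" for \<psi> where
  base: "real_polynomial_function q \<Longrightarrow>
    (\<lambda>y. complex_of_real (gdet y powr r * q y) * partials ijs \<psi> y) \<in> gdet_flat \<psi>"
| add: "u \<in> gdet_flat \<psi> \<Longrightarrow> v \<in> gdet_flat \<psi> \<Longrightarrow> (\<lambda>y. u y + v y) \<in> gdet_flat \<psi>"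

text \<open>The square on the right serves the differentiability proof: it forces members to vanish,
  together with their directional derivatives, wherever \<open>gdet\<close> does. Near these points
  flatness of \<psi> beats any negative power of \<open>gdet\<close>; for large \<open>gdet\<close>
  its polynomial growth is beaten by the decay of \<psi>.\<close>

lemma gdet_flat_bound:
  fixes \<psi> :: "real^'m^'n \<Rightarrow> complex"
  assumes \<psi>: "\<psi> \<in> Psi_space" and "u \<in> gdet_flat \<psi>"
  shows "\<exists>C\<ge>0. \<forall>y. (1 + norm y) ^ N * norm (u y) \<le> C * (gdet y)\<^sup>2"
  using assms(2)
proof (induction)
  case (base q r ijs)
  obtain A L where A: "\<And>y. \<bar>q y\<bar> \<le> A * (1 + norm y) ^ L"
    using real_polynomial_growth[OF base] by blast
  obtain B K where B: "\<And>y :: real^'m^'n. \<bar>gdet y\<bar> \<le> B * (1 + norm y) ^ K"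
    using real_polynomial_growth[OF real_polynomial_gdet] by blast
  have A0: "A \<ge> 0" "B \<ge> 0"
    using order_trans[OF abs_ge_zero A[of 0]] order_trans[OF abs_ge_zero B[of 0]] by auto
  \<comment> \<open>An order of flatness that compensates \<open>gdet y powr r\<close> for either
    sign of \<open>r\<close> and still leaves the square; for \<open>gdet y > 1\<close> the same
    \<open>J\<close> bounds the exponent from above.\<close>
  define J where "J = nat \<lceil>\<bar>r\<bar> + 2\<rceil>"
  have J: "real J \<ge> \<bar>r\<bar> + 2" unfolding J_def by linarith
  obtain C where C: "C \<ge> 0" "\<And>y. (1 + norm y) ^ (N + L) * norm (partials ijs \<psi> y) \<le> C * gdet y ^ J"
    using Psi_space_flat[OF \<psi>] by blast
  obtain D where D: "D \<ge> 0" "\<And>y. (1 + norm y) ^ (N + L + K * J) * norm (partials ijs \<psi> y) \<le> D * gdet y ^ 0"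
    using Psi_space_flat[OF \<psi>] by blast
  have "(1 + norm y) ^ N * norm (complex_of_real (gdet y powr r * q y) * partials ijs \<psi> y) \<le>
      (A * C + A * (B ^ J * D)) * (gdet y)\<^sup>2" for y
  proof -
    have "(1 + norm y) ^ N * norm (complex_of_real (gdet y powr r * q y) * partials ijs \<psi> y)
        = \<bar>q y\<bar> * (gdet y powr r * ((1 + norm y) ^ N * norm (partials ijs \<psi> y)))"
      by (simp add: norm_mult abs_mult)
    also have "\<dots> \<le> (A * (1 + norm y) ^ L) * (gdet y powr r * ((1 + norm y) ^ N * norm (partials ijs \<psi> y)))"
      by (intro mult_right_mono A mult_nonneg_nonneg) auto
    also have "\<dots> = A * (gdet y powr r * ((1 + norm y) ^ (N + L) * norm (partials ijs \<psi> y)))"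
      by (simp add: power_add)
    also have "\<dots> \<le> A * ((C + B ^ J * D) * (gdet y)\<^sup>2)"
    proof (rule mult_left_mono[OF _ A0(1)])
      consider "gdet y = 0" | "0 < gdet y" "gdet y \<le> 1" | "gdet y > 1"
        using gdet_nonneg[of y] by linarith
      then show "gdet y powr r * ((1 + norm y) ^ (N + L) * norm (partials ijs \<psi> y)) \<le> (C + B ^ J * D) * (gdet y)\<^sup>2"
      proof cases
        case 1
        then show ?thesis by simp
      next
        case 2
        have "gdet y powr r * ((1 + norm y) ^ (N + L) * norm (partials ijs \<psi> y)) \<le> gdet y powr r * (C * gdet y ^ J)"
          by (intro mult_left_mono C) simp
        also have "\<dots> = C * gdet y powr (r + real J)"
          using 2 by (simp add: powr_add powr_realpow)
        also have "\<dots> \<le> C * gdet y powr (real 2)"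
          using 2 J C(1) by (intro mult_left_mono powr_mono') auto
        also have "\<dots> = C * (gdet y)\<^sup>2" using 2 by (simp only: powr_realpow)
        also have "\<dots> \<le> (C + B ^ J * D) * (gdet y)\<^sup>2"
          using A0 D(1) by (intro mult_right_mono) auto
        finally show ?thesis .
      next
        case 3
        have "gdet y powr r \<le> gdet y powr (real J)" using J 3 by (intro powr_mono) auto
        also have "\<dots> = gdet y ^ J" using 3 by (simp add: powr_realpow)
        also have "\<dots> \<le> (B * (1 + norm y) ^ K) ^ J" using B[of y] 3 by (intro power_mono) auto
        finally have "gdet y powr r * ((1 + norm y) ^ (N + L) * norm (partials ijs \<psi> y))
            \<le> (B * (1 + norm y) ^ K) ^ J * ((1 + norm y) ^ (N + L) * norm (partials ijs \<psi> y))"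
          by (intro mult_right_mono) auto
        also have "\<dots> = B ^ J * ((1 + norm y) ^ (N + L + K * J) * norm (partials ijs \<psi> y))"
          by (simp add: power_mult_distrib power_add mult_ac flip: power_mult)
        also have "\<dots> \<le> B ^ J * D"
          using D(2)[of y] A0 by (intro mult_left_mono) auto
        also have "\<dots> \<le> (C + B ^ J * D) * (gdet y)\<^sup>2"
        proof -
          have "B ^ J * D * 1 \<le> (C + B ^ J * D) * (gdet y)\<^sup>2"
            using A0 D(1) C(1) 3 by (intro mult_mono one_le_power) auto
          then show ?thesis by simp
        qed
        finally show ?thesis .
      qed
    qed
    finally show ?thesis by (simp add: algebra_simps)
  qed
  then show ?case using A0 C(1) D(1) by (intro exI[of _ "A * C + A * (B ^ J * D)"]) auto
next
  case (add u v)
  then obtain C D where C: "C \<ge> 0" "\<And>y. (1 + norm y) ^ N * norm (u y) \<le> C * (gdet y)\<^sup>2"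
    and D: "D \<ge> 0" "\<And>y. (1 + norm y) ^ N * norm (v y) \<le> D * (gdet y)\<^sup>2" by metis
  have "(1 + norm y) ^ N * norm (u y + v y) \<le> (C + D) * (gdet y)\<^sup>2" for y
  proof -
    have "(1 + norm y) ^ N * norm (u y + v y) \<le> (1 + norm y) ^ N * (norm (u y) + norm (v y))"
      by (intro mult_left_mono norm_triangle_ineq) simp
    then show ?thesis using C(2)[of y] D(2)[of y] by (simp add: distrib_left distrib_right)
  qed
  then show ?case using C D by (intro exI[of _ "C + D"]) auto
qed

lemma gdet_flat_rapid:
  fixes \<psi> :: "real^'m^'n \<Rightarrow> complex"
  assumes "\<psi> \<in> Psi_space" "u \<in> gdet_flat \<psi>"
  shows "rapid u"
proof (rule rapidI)
  fix N
  obtain B K where B: "\<And>y :: real^'m^'n. \<bar>(gdet y)\<^sup>2\<bar> \<le> B * (1 + norm y) ^ K"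
    using real_polynomial_growth[OF real_polynomial_function.intros(4)[OF real_polynomial_gdet real_polynomial_gdet]]
    unfolding power2_eq_square by blast
  obtain C where C: "C \<ge> 0" "\<And>y. (1 + norm y) ^ (N + K) * norm (u y) \<le> C * (gdet y)\<^sup>2"
    using gdet_flat_bound[OF assms] by blast
  have "(1 + norm y) ^ N * norm (u y) \<le> C * B" for y
  proof -
    have "(1 + norm y) ^ K * ((1 + norm y) ^ N * norm (u y)) \<le> C * (gdet y)\<^sup>2"
      using C(2)[of y] by (simp add: power_add mult_ac)
    also have "\<dots> \<le> C * (B * (1 + norm y) ^ K)"
      using B[of y] C(1) by (intro mult_left_mono) auto
    finally have "(1 + norm y) ^ K * ((1 + norm y) ^ N * norm (u y)) \<le> (1 + norm y) ^ K * (C * B)"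
      by (simp add: mult_ac)
    then show ?thesis by (rule mult_left_le_imp_le) (simp add: add_pos_nonneg)
  qed
  then show "\<exists>C. \<forall>y. (1 + norm y) ^ N * norm (u y) \<le> C" by blast
qed

lemma gdet_flat_borel_measurable:
  fixes \<psi> :: "real^'m^'n \<Rightarrow> complex"
  assumes "\<psi> \<in> Psi_space" "u \<in> gdet_flat \<psi>"
  shows "u \<in> borel_measurable borel"
  using assms(2)
proof induction
  case (base q r ijs)
  have [measurable]: "q \<in> borel_measurable borel" "partials ijs \<psi> \<in> borel_measurable borel"
      "gdet \<in> borel_measurable (borel :: (real^'m^'n) measure)"
    using base assms(1) real_polynomial_gdet
    by (auto intro: real_polynomial_borel_measurable smooth_borel_measurable schwartzD Psi_spaceD)
  show ?case by measurable
qed measurable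

lemma has_dirderiv_add:
  "has_dirderiv u b u' \<Longrightarrow> has_dirderiv v b v' \<Longrightarrow> has_dirderiv (\<lambda>x. u x + v x) b (\<lambda>x. u' x + v' x)"
  unfolding has_dirderiv_def by (auto intro: has_vector_derivative_add)

lemma gdet_flat_vanishing:
  assumes "\<psi> \<in> Psi_space" "u \<in> gdet_flat \<psi>" "gdet y = 0"
  shows "u y = 0"
proof -
  obtain C where "\<And>y. (1 + norm y) ^ 0 * norm (u y) \<le> C * (gdet y)\<^sup>2"
    using gdet_flat_bound[OF assms(1,2)] by blast
  from this[of y] show ?thesis using assms(3) by simp
qed

text \<open>The difference quotient is dominated by that of \<open>C * (gdet y)\<^sup>2\<close>,
  whose derivative carries a factor \<open>gdet y = 0\<close>.\<close>

lemma gdet_flat_derivative_0: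
  fixes \<psi> :: "real^'m^'n \<Rightarrow> complex"
  assumes "\<psi> \<in> Psi_space" "u \<in> gdet_flat \<psi>" and y: "gdet y = 0"
  shows "((\<lambda>s. u (y + s *\<^sub>R b)) has_vector_derivative 0) (at 0)"
proof -
  obtain C where C: "C \<ge> 0" "\<And>y. (1 + norm y) ^ 0 * norm (u y) \<le> C * (gdet y)\<^sup>2"
    using gdet_flat_bound[OF assms(1,2)] by blast
  have u0: "u y = 0" using gdet_flat_vanishing assms by blast
  obtain D' where D': "\<And>x :: real^'m^'n. ((\<lambda>s. gdet (x + s *\<^sub>R b)) has_real_derivative D' x) (at 0)"
    using real_polynomial_dirderiv[OF real_polynomial_gdet] by blast
  have "((\<lambda>s. C * (gdet (y + s *\<^sub>R b))\<^sup>2) has_real_derivative C * (of_nat 2 * (D' y * gdet (y + 0 *\<^sub>R b) ^ (2 - Suc 0)))) (at 0)"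
    by (intro DERIV_cmult DERIV_power D')
  then have "((\<lambda>s. C * (gdet (y + s *\<^sub>R b))\<^sup>2) has_real_derivative 0) (at 0)"
    using y by simp
  then have lim: "(\<lambda>s. C * (gdet (y + s *\<^sub>R b))\<^sup>2 / s) \<midarrow>0\<rightarrow> 0"
    using y by (simp add: DERIV_def)
  have "(\<lambda>s. u (y + s *\<^sub>R b) /\<^sub>R s) \<midarrow>0\<rightarrow> 0"
  proof (rule Lim_null_comparison[OF always_eventually])
    show "\<forall>s. norm (u (y + s *\<^sub>R b) /\<^sub>R s) \<le> \<bar>C * (gdet (y + s *\<^sub>R b))\<^sup>2 / s\<bar>"
    proof
      fix s :: real
      have "norm (u (y + s *\<^sub>R b)) \<le> C * (gdet (y + s *\<^sub>R b))\<^sup>2"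
        using C(2)[of "y + s *\<^sub>R b"] by simp
      then show "norm (u (y + s *\<^sub>R b) /\<^sub>R s) \<le> \<bar>C * (gdet (y + s *\<^sub>R b))\<^sup>2 / s\<bar>"
        using C(1) by (simp add: divide_inverse abs_mult mult.commute mult_left_mono)
    qed
    show "(\<lambda>s. \<bar>C * (gdet (y + s *\<^sub>R b))\<^sup>2 / s\<bar>) \<midarrow>0\<rightarrow> 0"
      using tendsto_rabs[OF lim] by simp
  qed
  then show ?thesis
    using u0 tendsto_norm_zero[of "\<lambda>s. u (y + s *\<^sub>R b) /\<^sub>R s"]
    unfolding has_vector_derivative_def has_derivative_at
    by (simp add: bounded_linear_zero divide_inverse mult.commute)
qed

text \<open>Where \<open>gdet\<close> is positive, the three terms of \<open>v\<close> are the
  product rule. Where it is zero the power is not differentiable in general, but the derivative of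
  \<open>u\<close> and the value of \<open>v\<close> both vanish there by the quadratic
  bound.\<close>

lemma gdet_flat_dirderiv:
  fixes \<psi> :: "real^'m^'n \<Rightarrow> complex"
  assumes \<psi>: "\<psi> \<in> Psi_space" and "u \<in> gdet_flat \<psi>" and "b \<in> Basis"
  shows "\<exists>u'\<in>gdet_flat \<psi>. has_dirderiv u b u'"
  using assms(2)
proof induction
  case (base q r ijs)
  obtain i j where b: "b = axis i (axis j 1)" using Basis_matrix assms(3) .
  obtain D' where D': "real_polynomial_function D'" "\<And>x :: real^'m^'n. ((\<lambda>s. gdet (x + s *\<^sub>R b)) has_real_derivative D' x) (at 0)"
    using real_polynomial_dirderiv[OF real_polynomial_gdet] by blast
  obtain q' where q': "real_polynomial_function q'" "\<And>x. ((\<lambda>s. q (x + s *\<^sub>R b)) has_real_derivative q' x) (at 0)"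
    using real_polynomial_dirderiv[OF base] by blast
  define u where "u = (\<lambda>y. complex_of_real (gdet y powr r * q y) * partials ijs \<psi> y)"
  define v where "v = (\<lambda>y. (complex_of_real (gdet y powr (r - 1) * (r * (D' y * q y))) * partials ijs \<psi> y
     + complex_of_real (gdet y powr r * q' y) * partials ijs \<psi> y)
     + complex_of_real (gdet y powr r * q y) * partials ((i, j) # ijs) \<psi> y)"
  have u: "u \<in> gdet_flat \<psi>" unfolding u_def using base by (rule gdet_flat.base)
  have v: "v \<in> gdet_flat \<psi>" unfolding v_def
    by (intro gdet_flat.add gdet_flat.base base D' q' real_polynomial_function.intros(2,4))
  have "((\<lambda>s. u (x + s *\<^sub>R b)) has_vector_derivative v x) (at 0)" for x
  proof (cases "gdet x = 0")
    case True
    then show ?thesis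
      using gdet_flat_derivative_0[OF \<psi> u True] gdet_flat_vanishing[OF \<psi> v True] by simp
  next
    case False
    then have pos: "gdet (x + 0 *\<^sub>R b) > 0" using gdet_nonneg[of x] by simp
    have "((\<lambda>s. gdet (x + s *\<^sub>R b) powr r) has_real_derivative r * gdet (x + 0 *\<^sub>R b) powr (r - 1) * D' x) (at 0)"
      using DERIV_chain2[where f = "\<lambda>z. z powr r" and g = "\<lambda>s. gdet (x + s *\<^sub>R b)", OF has_real_derivative_powr[OF pos] D'(2)] by simp
    from DERIV_mult[OF this q'(2)[of x]]
    have "((\<lambda>s. gdet (x + s *\<^sub>R b) powr r * q (x + s *\<^sub>R b)) has_real_derivative
        gdet x powr (r - 1) * (r * (D' x * q x)) + gdet x powr r * q' x) (at 0)"
      by (simp add: mult_ac add_ac)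
    then have 1: "((\<lambda>s. complex_of_real (gdet (x + s *\<^sub>R b) powr r * q (x + s *\<^sub>R b))) has_vector_derivative
        complex_of_real (gdet x powr (r - 1) * (r * (D' x * q x)) + gdet x powr r * q' x)) (at 0)"
      by (intro has_vector_derivative_of_real) (simp add: has_real_derivative_iff_has_vector_derivative)
    have 2: "((\<lambda>s. partials ijs \<psi> (x + s *\<^sub>R b)) has_vector_derivative partials ((i, j) # ijs) \<psi> x) (at 0)"
      using smooth_dirderiv_partials[OF schwartzD(1)[OF Psi_spaceD(1)[OF \<psi>]]] unfolding has_dirderiv_def b by blast
    have 3: "v x = complex_of_real (gdet (x + 0 *\<^sub>R b) powr r * q (x + 0 *\<^sub>R b)) * partials ((i, j) # ijs) \<psi> x
       + complex_of_real (gdet x powr (r - 1) * (r * (D' x * q x)) + gdet x powr r * q' x) * partials ijs \<psi> (x + 0 *\<^sub>R b)"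
      unfolding v_def by (simp only: scaleR_zero_left add_0_right add_0_left of_real_add distrib_right add_ac)
    show ?thesis
      unfolding 3 u_def by (rule has_vector_derivative_mult[OF 1 2])
  qed
  then have "has_dirderiv u b v" unfolding has_dirderiv_def by (rule allI)
  then show ?case using v unfolding u_def by (rule bexI)
next
  case (add u v)
  from add.IH obtain u' v' where "u' \<in> gdet_flat \<psi>" "v' \<in> gdet_flat \<psi>"
    "has_dirderiv u b u'" "has_dirderiv v b v'" by blast
  then show ?case
    by (intro bexI[of _ "\<lambda>y. u' y + v' y"] has_dirderiv_add gdet_flat.add)
qed

lemma gdet_flat_FT_rapid:
  assumes "\<psi> \<in> Psi_space" "u \<in> gdet_flat \<psi>"
  shows "rapid (FT u)"
  by (rule FT_rapid[OF assms(2)])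
    (use assms in \<open>auto intro: gdet_flat_dirderiv gdet_flat_rapid gdet_flat_borel_measurable\<close>)

lemma gdet_flat_mat_abs_power:
  assumes \<psi>: "\<psi> \<in> Psi_space"
  shows "(\<lambda>y. complex_of_real (mat_abs y ^ k) * \<psi> y) \<in> gdet_flat \<psi>"
proof -
  have "(\<lambda>y. complex_of_real (gdet y powr (real k / 2) * 1) * partials [] \<psi> y) \<in> gdet_flat \<psi>"
    by (rule gdet_flat.base) (rule real_polynomial_function.intros)
  moreover have "complex_of_real (gdet y powr (real k / 2) * 1) * partials [] \<psi> y = complex_of_real (mat_abs y ^ k) * \<psi> y" for y
  proof (cases "gdet y = 0")
    \<comment> \<open>The powers may disagree here: for \<open>k = 0\<close> one has
      \<open>0 powr 0 = 0\<close> but \<open>0 ^ 0 = 1\<close>. Both sides vanish because \<psi>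
      does.\<close>
    case True
    then show ?thesis using Psi_spaceD(2)[OF \<psi> True, of "[]"] by simp
  next
    case False
    then have "gdet y > 0" using gdet_nonneg[of y] by simp
    then have "gdet y powr (real k / 2) = mat_abs y ^ k"
      by (simp add: mat_abs_eq powr_half_sqrt[symmetric] powr_realpow[symmetric] powr_powr)
    then show ?thesis by simp
  qed
  ultimately show ?thesis by (simp only:)
qed

subsection \<open>The Fourier transform on matrices\<close>

lemma integral_lebesgue:
  fixes f :: "'a::euclidean_space \<Rightarrow> 'b::{banach,second_countable_topology}"
  assumes "f \<in> borel_measurable borel"
  shows "(LINT x|lebesgue. f x) = (LINT x|lborel. f x)"
  using assms by (intro integral_completion) simp

lemma lborel_integral_minus:
  fixes f :: "'a::euclidean_space \<Rightarrow> 'b::{banach,second_countable_topology}"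
  assumes [measurable]: "f \<in> borel_measurable borel"
  shows "(LINT x|lborel. f (- x)) = (LINT x|lborel. f x)"
proof -
  have "distr lborel borel (\<lambda>x. - x) = (lborel :: 'a measure)"
    using lborel_affine[of "-1" "0 :: 'a"] by (simp add: density_1)
  then show ?thesis using integral_distr[of "\<lambda>x. - x" lborel borel f] by simp
qed

lemma fourier_eq_FT:
  assumes [measurable]: "f \<in> borel_measurable borel"
  shows "fourier f = FT f"
proof
  fix y
  have "(LINT x|lebesgue. exp (\<i> * complex_of_real (trace (transpose y ** x))) * f x) = (LINT x|lebesgue. cis (y \<bullet> x) * f x)"
    by (simp add: inner_matrix_eq_trace cis_conv_exp)
  also have "\<dots> = (LINT x|lborel. cis (y \<bullet> x) * f x)" by (rule integral_lebesgue) measurable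
  finally show "fourier f y = FT f y" by (simp add: fourier_def FT_def)
qed

lemma inv_fourier_eq_FT:
  fixes g :: "real^'m^'n \<Rightarrow> complex"
  assumes [measurable]: "g \<in> borel_measurable borel"
  shows "inv_fourier g x = complex_of_real (1 / (2 * pi) ^ (CARD('n) * CARD('m))) * FT g (- x)"
proof -
  have "(LINT y|lebesgue. exp (- \<i> * complex_of_real (trace (transpose y ** x))) * g y) = (LINT y|lebesgue. cis ((- x) \<bullet> y) * g y)"
    by (simp add: inner_matrix_eq_trace[symmetric] cis_conv_exp inner_commute)
  also have "\<dots> = (LINT y|lborel. cis ((- x) \<bullet> y) * g y)" by (rule integral_lebesgue) measurable
  finally show ?thesis by (simp add: inv_fourier_def FT_def)
qed

lemma FT_translation:
  assumes [measurable]: "u \<in> borel_measurable borel"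
  shows "FT (\<lambda>z. u (z + x)) y = cis ((- x) \<bullet> y) * FT u y"
proof -
  have "FT (\<lambda>z. u (z + x)) y = (LINT z|lborel. cis ((- x) \<bullet> y) * (cis (y \<bullet> (z + x)) * u (z + x)))"
    unfolding FT_def mult.assoc[symmetric] cis_mult by (simp add: inner_add_right inner_commute)
  also have "\<dots> = cis ((- x) \<bullet> y) * (LINT z|lborel. cis (y \<bullet> (z + x)) * u (z + x))"
    by simp
  also have "(LINT z|lborel. cis (y \<bullet> (z + x)) * u (z + x)) = FT u y"
    unfolding FT_def by (rule lborel_integral_translation[where f = "\<lambda>z. cis (y \<bullet> z) * u z"]) measurable
  finally show ?thesis .
qed

lemma FT_FT:
  fixes u :: "'a::euclidean_space \<Rightarrow> complex"
  assumes u: "integrable lborel u" "\<And>x. norm (u x) \<le> B" "isCont u x" "integrable lborel (FT u)"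
  shows "FT (FT u) (- x) = complex_of_real ((2 * pi) ^ DIM('a)) * u x"
proof -
  have [measurable]: "u \<in> borel_measurable borel" using borel_measurable_integrable[OF u(1)] by simp
  have [measurable]: "FT u \<in> borel_measurable borel" by (rule FT_measurable[OF u(1)])
  have FTw: "FT (\<lambda>z. u (z + x)) = (\<lambda>y. cis ((- x) \<bullet> y) * FT u y)" by (rule ext) (rule FT_translation, measurable)
  have "(LINT y|lborel. FT (\<lambda>z. u (z + x)) y) = complex_of_real ((2 * pi) ^ DIM('a)) * u (0 + x)"
  proof (rule FT_inversion_at_zero)
    show "integrable lborel (\<lambda>z. u (z + x))" by (rule lborel_integrable_translation[OF u(1)])
    show "norm (u (z + x)) \<le> B" for z by (rule u(2))
    show "isCont (\<lambda>z. u (z + x)) 0" using isCont_o2[of 0 "\<lambda>z. z + x" u] u(3) by simp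
    show "integrable lborel (FT (\<lambda>z. u (z + x)))" unfolding FTw using u(4) by (subst integrable_cis_mult) auto
  qed
  then show ?thesis unfolding FTw by (simp add: FT_def)
qed

lemma Psi_space_gdet_flat:
  assumes "\<psi> \<in> Psi_space"
  shows "\<psi> \<in> gdet_flat \<psi>"
  using gdet_flat_mat_abs_power[OF assms, of 0] by simp

lemma rapid_bounded:
  assumes "rapid f"
  obtains B where "\<And>x. norm (f x) \<le> B"
proof -
  obtain C where "\<And>x. norm (f x) \<le> C / (1 + norm x) ^ 0" using rapidE[OF assms] by metis
  then show ?thesis using that[of C] by simp
qed

lemma Psi_space_facts:
  fixes \<psi> :: "real^'m^'n \<Rightarrow> complex"
  assumes \<psi>: "\<psi> \<in> Psi_space"
  shows "rapid \<psi>" "continuous_on UNIV \<psi>" "\<psi> \<in> borel_measurable borel" "rapid (FT \<psi>)"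
    "rapid (\<lambda>y. complex_of_real (mat_abs y ^ k) * \<psi> y)"
    "rapid (FT (\<lambda>y. complex_of_real (mat_abs y ^ k) * \<psi> y))"
  using gdet_flat_FT_rapid[OF \<psi>] gdet_flat_rapid[OF \<psi>] gdet_flat_borel_measurable[OF \<psi>]
    gdet_flat_mat_abs_power[OF \<psi>] Psi_space_gdet_flat[OF \<psi>]
    smooth_continuous[OF schwartzD(1)[OF Psi_spaceD(1)[OF \<psi>]], of UNIV "[]"]
  by auto

lemma mat_abs_minus: "mat_abs (- x) = mat_abs (x :: real^'m^'n)"
proof -
  have "transpose (- x) ** (- x) = transpose x ** x"
    by (simp add: vec_eq_iff matrix_matrix_mult_def transpose_def)
  then show ?thesis by (simp add: mat_abs_def)
qed

text \<open>On a test function given as \<open>FT \<psi>\<close> the operator is multiplication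
  acting on \<psi>. Transforming twice reflects the argument, the inverse transform reflects it
  back, and \<open>mat_abs\<close> is even, so no reflection remains.\<close>

lemma riesz_neg_FT:
  fixes \<psi> :: "real^'m^'n \<Rightarrow> complex"
  assumes \<psi>: "\<psi> \<in> Psi_space"
  shows "riesz_neg k (FT \<psi>) = FT (\<lambda>y. complex_of_real (mat_abs y ^ k) * \<psi> y)"
proof
  fix x :: "real^'m^'n"
  let ?d = "(2 * pi) ^ (CARD('n) * CARD('m))"
  note [measurable] = Psi_space_facts(3)[OF \<psi>]
  have int: "integrable lborel \<psi>" "integrable lborel (FT \<psi>)"
    using Psi_space_facts[OF \<psi>] FT_measurable rapid_integrable by blast+
  have [measurable]: "FT \<psi> \<in> borel_measurable borel" "FT (FT \<psi>) \<in> borel_measurable borel"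
    using int FT_measurable by blast+
  have [measurable]: "mat_abs \<in> borel_measurable (borel :: (real^'m^'n) measure)"
    unfolding mat_abs_def by measurable
  obtain B where B: "\<And>y. norm (\<psi> y) \<le> B" using rapid_bounded[OF Psi_space_facts(1)[OF \<psi>]] by blast
  have FF: "fourier (FT \<psi>) y = complex_of_real ?d * \<psi> (- y)" for y
  proof -
    have "FT (FT \<psi>) (- (- y)) = complex_of_real ((2 * pi) ^ DIM(real^'m^'n)) * \<psi> (- y)"
      by (rule FT_FT[OF int(1) B _ int(2)])
        (use Psi_space_facts(2)[OF \<psi>] in \<open>simp add: continuous_on_eq_continuous_at\<close>)
    then show ?thesis by (simp add: fourier_eq_FT)
  qed
  have "riesz_neg k (FT \<psi>) x = complex_of_real (1 / ?d) * FT (\<lambda>y. complex_of_real (mat_abs y ^ k) * (complex_of_real ?d * \<psi> (- y))) (- x)"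
    unfolding riesz_neg_def FF by (rule inv_fourier_eq_FT) measurable
  also have "\<dots> = complex_of_real (1 / ?d) * (LINT y|lborel. complex_of_real ?d * (cis (x \<bullet> (- y)) * (complex_of_real (mat_abs (- y) ^ k) * \<psi> (- y))))"
    unfolding FT_def mat_abs_minus by (simp add: mult_ac)
  also have "\<dots> = (LINT y|lborel. cis (x \<bullet> (- y)) * (complex_of_real (mat_abs (- y) ^ k) * \<psi> (- y)))"
    by simp
  also have "\<dots> = (LINT y|lborel. cis (x \<bullet> y) * (complex_of_real (mat_abs y ^ k) * \<psi> y))"
    by (rule lborel_integral_minus[where f = "\<lambda>y. cis (x \<bullet> y) * (complex_of_real (mat_abs y ^ k) * \<psi> y)"]) measurable
  finally show "riesz_neg k (FT \<psi>) x = FT (\<lambda>y. complex_of_real (mat_abs y ^ k) * \<psi> y) x"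
    by (simp add: FT_def)
qed

subsection \<open>The Cayley--Laplace operator\<close>

lemma rapid_real_polynomial_mult:
  assumes "rapid u" "real_polynomial_function q"
  shows "rapid (\<lambda>x. complex_of_real (q x) * u x)"
proof -
  obtain A M where "\<And>x. \<bar>q x\<bar> \<le> A * (1 + norm x) ^ M" using real_polynomial_growth[OF assms(2)] by blast
  then show ?thesis by (intro rapid_mult[OF assms(1)]) simp
qed

lemma real_polynomial_component: "real_polynomial_function (\<lambda>x :: real^'m^'n. x $ i $ j)"
  by (intro real_polynomial_function.intros(1) bounded_linear_compose[OF bounded_linear_vec_nth bounded_linear_vec_nth])

lemma partial_FT:
  fixes u :: "real^'m^'n \<Rightarrow> complex"
  assumes "rapid u" "u \<in> borel_measurable borel"
  shows "partial (i, j) (FT u) = FT (\<lambda>x. \<i> * complex_of_real (x $ i $ j) * u x)"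
proof
  fix y
  have "x \<bullet> axis i (axis j 1) = x $ i $ j" for x :: "real^'m^'n"
    by (simp add: inner_axis)
  then show "partial (i, j) (FT u) y = FT (\<lambda>x. \<i> * complex_of_real (x $ i $ j) * u x) y"
    using has_dirderiv_FT[OF assms, of "axis i (axis j 1)"] unfolding has_dirderiv_def
    by (intro partial_eqI) simp
qed

lemma FT_sum:
  assumes "finite I" "\<And>i. i \<in> I \<Longrightarrow> integrable lborel (u i)"
  shows "(\<Sum>i\<in>I. FT (u i) y) = FT (\<lambda>x. \<Sum>i\<in>I. u i x) y"
proof -
  have [measurable]: "i \<in> I \<Longrightarrow> u i \<in> borel_measurable borel" for i
    using borel_measurable_integrable[OF assms(2)] by simp
  show ?thesis
    unfolding FT_def sum_distrib_left
    by (rule Bochner_Integration.integral_sum[symmetric]) (simp add: integrable_cis_mult assms(2))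
qed

text \<open>Each partial derivative of a transform puts a factor \<open>\<i>\<close> and one entry
  of \<open>x\<close> under the integral. Two of them give the minus sign, and the sum over the rows
  gives an entry of the Gram matrix.\<close>

lemma d_transpose_d_FT:
  fixes u :: "real^'m^'n \<Rightarrow> complex"
  assumes u: "rapid u" and [measurable]: "u \<in> borel_measurable borel"
  shows "d_transpose_d a b (FT u) = FT (\<lambda>x. complex_of_real (- ((transpose x ** x) $ a $ b)) * u x)"
proof
  fix y
  have r: "rapid (\<lambda>x. \<i> * complex_of_real (x $ i $ j) * v x)" if "rapid v" for i j and v :: "real^'m^'n \<Rightarrow> complex"
    using rapid_cmult[OF rapid_real_polynomial_mult[OF that real_polynomial_component[of i j]], of \<i>] by (simp add: mult.assoc)
  have "d_transpose_d a b (FT u) y = (\<Sum>i\<in>UNIV. FT (\<lambda>x. \<i> * complex_of_real (x $ i $ a) * (\<i> * complex_of_real (x $ i $ b) * u x)) y)"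
    unfolding d_transpose_d_def by (intro sum.cong refl) (simp add: partial_FT u r)
  also have "\<dots> = FT (\<lambda>x. \<Sum>i\<in>UNIV. \<i> * complex_of_real (x $ i $ a) * (\<i> * complex_of_real (x $ i $ b) * u x)) y"
    by (rule FT_sum) (auto intro!: rapid_integrable r u)
  also have "(\<lambda>x. \<Sum>i\<in>UNIV. \<i> * complex_of_real (x $ i $ a) * (\<i> * complex_of_real (x $ i $ b) * u x))
      = (\<lambda>x. complex_of_real (- ((transpose x ** x) $ a $ b)) * u x)"
  proof
    fix x
    have "\<i> * complex_of_real (x $ i $ a) * (\<i> * complex_of_real (x $ i $ b) * u x) = complex_of_real (- (x $ i $ a * x $ i $ b)) * u x" for i
    proof -
      have "\<i> * complex_of_real (x $ i $ a) * (\<i> * complex_of_real (x $ i $ b) * u x) = (\<i> * \<i>) * (complex_of_real (x $ i $ a) * complex_of_real (x $ i $ b) * u x)"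
        by (simp only: mult_ac)
      then show ?thesis by simp
    qed
    then show "(\<Sum>i\<in>UNIV. \<i> * complex_of_real (x $ i $ a) * (\<i> * complex_of_real (x $ i $ b) * u x)) = complex_of_real (- ((transpose x ** x) $ a $ b)) * u x"
      by (simp add: matrix_matrix_mult_def transpose_def sum_negf sum_distrib_right)
  qed
  finally show "d_transpose_d a b (FT u) y = FT (\<lambda>x. complex_of_real (- ((transpose x ** x) $ a $ b)) * u x) y" .
qed

lemma real_polynomial_gram_entry: "real_polynomial_function (\<lambda>x :: real^'m^'n. - ((transpose x ** x) $ a $ b))"
  unfolding matrix_matrix_mult_def transpose_def
  by (auto intro!: real_polynomial_component real_polynomial_function_minus real_polynomial_function_sum real_polynomial_function.intros(4))

lemma rapid_borel_gram_entries:
  fixes u :: "real^'m^'n \<Rightarrow> complex"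
  assumes "rapid u" "u \<in> borel_measurable borel"
  shows "rapid (\<lambda>x. complex_of_real (\<Prod>a\<leftarrow>as. - ((transpose x ** x) $ a $ \<sigma> a)) * u x)"
    and "(\<lambda>x. complex_of_real (\<Prod>a\<leftarrow>as. - ((transpose x ** x) $ a $ \<sigma> a)) * u x) \<in> borel_measurable borel"
proof -
  have q: "real_polynomial_function (\<lambda>x :: real^'m^'n. \<Prod>a\<leftarrow>as. - ((transpose x ** x) $ a $ \<sigma> a))"
  proof (induction as)
    case (Cons a as)
    then show ?case using real_polynomial_function.intros(4)[OF real_polynomial_gram_entry[of a "\<sigma> a"] Cons] by simp
  qed (simp add: real_polynomial_function.intros)
  show "rapid (\<lambda>x. complex_of_real (\<Prod>a\<leftarrow>as. - ((transpose x ** x) $ a $ \<sigma> a)) * u x)"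
    by (rule rapid_real_polynomial_mult[OF assms(1) q])
  note [measurable] = assms(2) real_polynomial_borel_measurable[OF q]
  show "(\<lambda>x. complex_of_real (\<Prod>a\<leftarrow>as. - ((transpose x ** x) $ a $ \<sigma> a)) * u x) \<in> borel_measurable borel"
    by measurable
qed

lemma foldr_d_transpose_d_FT:
  fixes u :: "real^'m^'n \<Rightarrow> complex"
  assumes "rapid u" "u \<in> borel_measurable borel"
  shows "foldr (\<lambda>a. d_transpose_d a (\<sigma> a)) as (FT u)
    = FT (\<lambda>x. complex_of_real (\<Prod>a\<leftarrow>as. - ((transpose x ** x) $ a $ \<sigma> a)) * u x)"
proof (induction as)
  case (Cons a as)
  then show ?case
    by (simp add: d_transpose_d_FT rapid_borel_gram_entries assms mult.assoc)
qed simp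

text \<open>On Fourier transforms the operator entries become multiplications, which commute, so the
  Leibniz expansion collapses to the determinant of \<open>- (transpose x ** x)\<close> whatever
  enumeration \<open>as\<close> was chosen. The \<open>CARD('m)\<close> rows account for the
  sign.\<close>

lemma cayley_laplace_FT:
  fixes u :: "real^'m^'n \<Rightarrow> complex"
  assumes u: "rapid u" "u \<in> borel_measurable borel"
  shows "cayley_laplace (FT u) = FT (\<lambda>x. complex_of_real ((-1) ^ CARD('m) * gdet x) * u x)"
proof
  fix y
  define as where "as = (SOME as :: 'm list. distinct as \<and> set as = UNIV)"
  have as: "distinct as" "set as = UNIV"
    using someI_ex[of "\<lambda>as :: 'm list. distinct as \<and> set as = UNIV"] finite_distinct_list[of "UNIV :: 'm set"]
    unfolding as_def by auto
  have len: "length as = CARD('m)" using as by (metis distinct_card)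
  have prod: "(\<Prod>a\<leftarrow>as. - ((transpose x ** x) $ a $ \<sigma> a)) = (-1) ^ CARD('m) * (\<Prod>a\<in>UNIV. (transpose x ** x) $ a $ \<sigma> a)"
    for \<sigma> and x :: "real^'m^'n"
    using as prod.distinct_set_conv_list[OF as(1), of "\<lambda>a. - ((transpose x ** x) $ a $ \<sigma> a)"]
    by (simp add: prod_uminus)
  have rb: "rapid (\<lambda>x. of_int (sign \<sigma>) * (complex_of_real (\<Prod>a\<leftarrow>as. - ((transpose x ** x) $ a $ \<sigma> a)) * u x))"
     "(\<lambda>x. of_int (sign \<sigma>) * (complex_of_real (\<Prod>a\<leftarrow>as. - ((transpose x ** x) $ a $ \<sigma> a)) * u x)) \<in> borel_measurable borel" for \<sigma>
    using rapid_borel_gram_entries[OF u, of \<sigma> as] by (auto intro: rapid_cmult)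
  have "cayley_laplace (FT u) y = (\<Sum>\<sigma> | \<sigma> permutes (UNIV :: 'm set). of_int (sign \<sigma>) *
        FT (\<lambda>x. complex_of_real (\<Prod>a\<leftarrow>as. - ((transpose x ** x) $ a $ \<sigma> a)) * u x) y)"
    unfolding cayley_laplace_def operator_det_def as_def[symmetric] by (simp only: foldr_d_transpose_d_FT[OF u])
  also have "\<dots> = (\<Sum>\<sigma> | \<sigma> permutes (UNIV :: 'm set).
        FT (\<lambda>x. of_int (sign \<sigma>) * (complex_of_real (\<Prod>a\<leftarrow>as. - ((transpose x ** x) $ a $ \<sigma> a)) * u x)) y)"
    by (simp only: FT_def mult.left_commute[of "cis _"] integral_mult_right_zero)
  also have "\<dots> = FT (\<lambda>x. \<Sum>\<sigma> | \<sigma> permutes (UNIV :: 'm set). of_int (sign \<sigma>) * (complex_of_real (\<Prod>a\<leftarrow>as. - ((transpose x ** x) $ a $ \<sigma> a)) * u x)) y"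
    by (rule FT_sum) (auto intro!: rapid_integrable rb finite_permutations)
  also have "(\<lambda>x. \<Sum>\<sigma> | \<sigma> permutes (UNIV :: 'm set). of_int (sign \<sigma>) * (complex_of_real (\<Prod>a\<leftarrow>as. - ((transpose x ** x) $ a $ \<sigma> a)) * u x))
      = (\<lambda>x. complex_of_real ((-1) ^ CARD('m) * gdet x) * u x)"
    unfolding prod det_def by (simp add: sum_distrib_left sum_distrib_right mult_ac)
  finally show "cayley_laplace (FT u) y = FT (\<lambda>x. complex_of_real ((-1) ^ CARD('m) * gdet x) * u x) y" .
qed

lemma cayley_laplace_power_FT:
  fixes u :: "real^'m^'n \<Rightarrow> complex"
  assumes u: "rapid u" "u \<in> borel_measurable borel"
  shows "(cayley_laplace ^^ j) (FT u) = FT (\<lambda>x. complex_of_real (((-1) ^ CARD('m) * gdet x) ^ j) * u x)"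
proof (induction j)
  case (Suc j)
  have q: "real_polynomial_function (\<lambda>x :: real^'m^'n. ((-1) ^ CARD('m) * gdet x) ^ i)" for i
    by (intro real_polynomial_function_power real_polynomial_function.intros(2,4) real_polynomial_gdet)
  note [measurable] = u(2) real_polynomial_borel_measurable[OF q]
  have "(\<lambda>x. complex_of_real (((-1) ^ CARD('m) * gdet x) ^ j) * u x) \<in> borel_measurable borel" by measurable
  from cayley_laplace_FT[OF rapid_real_polynomial_mult[OF u(1) q[of j]] this]
  show ?case by (simp add: Suc.IH mult.assoc)
qed simp

lemma cayley_laplace_power_eq_riesz_neg:
  fixes \<psi> :: "real^'m^'n \<Rightarrow> complex"
  assumes \<psi>: "\<psi> \<in> Psi_space" and "even k"
  shows "(cayley_laplace ^^ (k div 2)) (FT \<psi>) x = (-1) ^ (CARD('m) * k div 2) * riesz_neg k (FT \<psi>) x"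
proof -
  obtain j where k: "k = 2 * j" using assms(2) by (rule evenE)
  have "gdet x ^ j = mat_abs x ^ k" for x :: "real^'m^'n"
    by (simp add: k mat_abs_eq power_mult gdet_nonneg)
  then have "complex_of_real (((-1) ^ CARD('m) * gdet x) ^ j) * \<psi> x = (-1) ^ (CARD('m) * j) * (complex_of_real (mat_abs x ^ k) * \<psi> x)" for x
    by (simp add: power_mult_distrib power_mult)
  then have "(cayley_laplace ^^ j) (FT \<psi>) x = FT (\<lambda>x. (-1) ^ (CARD('m) * j) * (complex_of_real (mat_abs x ^ k) * \<psi> x)) x"
    by (simp only: cayley_laplace_power_FT[OF Psi_space_facts(1,3)[OF \<psi>]])
  also have "\<dots> = (-1) ^ (CARD('m) * j) * FT (\<lambda>x. complex_of_real (mat_abs x ^ k) * \<psi> x) x"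
    by (simp only: FT_def mult.left_commute[of "cis _"] integral_mult_right_zero)
  finally show ?thesis by (simp add: riesz_neg_FT[OF \<psi>] k)
qed

subsection \<open>Rotations adapted to a frame\<close>

definition adapted :: "real^('k + 'l)^('k::finite + 'l::finite) \<Rightarrow> real^'l^('k + 'l) \<Rightarrow> bool" where
  "adapted g \<xi> \<longleftrightarrow> orthogonal_matrix g \<and> g ** stack 0 (mat 1) = \<xi>"

text \<open>The choice in \<open>frame_rotation\<close> is from a nonempty set. An orthogonal
  \<open>g\<close> with the right lower block exists by transitivity on frames; if its determinant
  is -1, it is composed with the reflection \<open>d\<close> in one coordinate of the upper block,
  which has at least one row and does not meet the frame.\<close>

lemma frame_rotation_adapted:
  fixes \<xi> :: "real^'l^('k::finite + 'l::finite)"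
  assumes "\<xi> \<in> stiefel"
  shows "adapted (frame_rotation \<xi>) \<xi>"
proof -
  let ?e = "stack 0 (mat 1) :: real^'l^('k + 'l)"
  have "transpose ?e ** ?e = mat 1"
    by (simp add: transpose_stack_mult)
  moreover have "transpose \<xi> ** \<xi> = mat 1" using assms by (simp add: stiefel_def)
  ultimately obtain g where g: "orthogonal_matrix g" "g ** ?e = \<xi>"
    using orthogonal_matrix_between_frames by blast
  obtain a :: 'k where True by simp
  define d :: "real^('k + 'l)^('k + 'l)" where "d = (\<chi> i j. if i = j then (if i = Inl a then -1 else 1) else 0)"
  have td: "transpose d = d" by (auto simp: d_def transpose_def vec_eq_iff)
  have "d ** d = mat 1"
    by (auto simp: d_def matrix_matrix_mult_def mat_def vec_eq_iff if_distrib[of "\<lambda>x. x * _"] sum.delta cong: if_cong)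
  then have od: "orthogonal_matrix d" by (simp add: orthogonal_matrix td)
  have "det d = (\<Prod>i\<in>UNIV. d $ i $ i)" by (rule det_diagonal) (simp add: d_def)
  also have "\<dots> = -1" by (simp add: d_def prod.delta)
  finally have dd: "det d = -1" .
  have de: "d ** ?e = ?e"
    by (auto simp: d_def matrix_matrix_mult_def stack_def vec_eq_iff if_distrib[of "\<lambda>x. x * _"] sum.delta split: sum.split cong: if_cong)
  have "\<exists>g. rotation_matrix g \<and> g ** ?e = \<xi>"
  proof (cases "det g = 1")
    case True
    then show ?thesis using g unfolding rotation_matrix_def by blast
  next
    case False
    then have "det g = -1" using det_orthogonal_matrix[OF g(1)] by blast
    then have "rotation_matrix (g ** d)"
      using od g(1) dd by (simp add: rotation_matrix_def orthogonal_matrix_mul det_mul)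
    moreover have "(g ** d) ** ?e = \<xi>" using de g(2) by (simp flip: matrix_mul_assoc)
    ultimately show ?thesis by blast
  qed
  then have "rotation_matrix (frame_rotation \<xi>) \<and> frame_rotation \<xi> ** ?e = \<xi>"
    unfolding frame_rotation_def by (rule someI_ex)
  then show ?thesis by (simp add: adapted_def rotation_matrix_def)
qed

lemma stack_add: "stack a b + stack c d = stack (a + c) (b + d)"
  and stack_diff: "stack a b - stack c d = stack (a - c) (b - d)"
  by (auto simp: stack_def vec_eq_iff split: sum.split)

lemma adapted_simps:
  fixes \<xi> :: "real^'l^('k::finite + 'l::finite)" and t :: "real^'m^'l"
  assumes "adapted g \<xi>"
  shows "\<xi> ** t = g ** stack 0 t"
    and "transpose \<xi> ** (g ** stack \<omega> t) = t"
    and "\<xi> ** t + g ** stack \<omega> s - \<xi> ** s = g ** stack \<omega> t"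
    and "(g ** stack \<omega> t) \<bullet> (g ** stack \<eta> s) = \<omega> \<bullet> \<eta> + t \<bullet> s"
    and "(norm (g ** stack \<omega> t))\<^sup>2 = (norm \<omega>)\<^sup>2 + (norm t)\<^sup>2"
proof -
  have g: "orthogonal_matrix g" "transpose g ** g = mat 1" and \<xi>: "\<xi> = g ** stack 0 (mat 1)"
    using assms by (auto simp: adapted_def orthogonal_matrix)
  show 1: "\<xi> ** t = g ** stack 0 t" for t :: "real^'m^'l"
    by (simp add: \<xi> stack_mult flip: matrix_mul_assoc)
  have z: "transpose (0 :: real^'l^'k) ** \<omega> = 0"
    by (simp add: vec_eq_iff matrix_matrix_mult_def transpose_def)
  have "transpose \<xi> ** (g ** stack \<omega> t) = transpose (stack 0 (mat 1)) ** ((transpose g ** g) ** stack \<omega> t)"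
    by (simp add: \<xi> matrix_transpose_mul flip: matrix_mul_assoc)
  then show "transpose \<xi> ** (g ** stack \<omega> t) = t" by (simp add: g(2) transpose_stack_mult z)
  have "g ** stack 0 t + g ** stack \<omega> s - g ** stack 0 s = g ** (stack 0 t + stack \<omega> s - stack 0 s)"
    by (simp add: vec_eq_iff matrix_matrix_mult_def algebra_simps sum_subtractf sum.distrib)
  then show "\<xi> ** t + g ** stack \<omega> s - \<xi> ** s = g ** stack \<omega> t" by (simp add: 1 stack_add stack_diff)
  show "(g ** stack \<omega> t) \<bullet> (g ** stack \<eta> s) = \<omega> \<bullet> \<eta> + t \<bullet> s"
    by (simp add: inner_mult_left matrix_mul_assoc g(2) inner_stack)
  show "(norm (g ** stack \<omega> t))\<^sup>2 = (norm \<omega>)\<^sup>2 + (norm t)\<^sup>2"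
    by (simp add: norm_orthogonal_mult[OF g(1)] norm_stack)
qed

lemma norm_adapted_ge:
  fixes \<xi> :: "real^'l^('k::finite + 'l::finite)" and t :: "real^'m^'l"
  assumes "adapted g \<xi>"
  shows "norm \<omega> \<le> norm (g ** stack \<omega> t)" "norm t \<le> norm (g ** stack \<omega> t)"
    "1 + (norm t)\<^sup>2 \<le> (1 + norm (g ** stack \<omega> t))\<^sup>2"
proof -
  show "norm \<omega> \<le> norm (g ** stack \<omega> t)" "norm t \<le> norm (g ** stack \<omega> t)"
    by (rule power2_le_imp_le; simp add: adapted_simps(5)[OF assms])+
  show "1 + (norm t)\<^sup>2 \<le> (1 + norm (g ** stack \<omega> t))\<^sup>2"
    by (simp add: power2_sum adapted_simps(5)[OF assms] del: norm_stack)
qed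

lemma measurable_lborel_components [measurable (raw)]:
  "f \<in> M \<rightarrow>\<^sub>M N \<Otimes>\<^sub>M lborel \<Longrightarrow> (\<lambda>x. snd (f x)) \<in> borel_measurable M"
  "f' \<in> M \<rightarrow>\<^sub>M lborel \<Otimes>\<^sub>M N \<Longrightarrow> (\<lambda>x. fst (f' x)) \<in> borel_measurable M"
  using measurable_compose[OF _ measurable_snd, of f M N lborel] measurable_compose[OF _ measurable_fst, of f' M lborel N]
  by simp_all

lemma measurable_ident_lborel [measurable]: "(\<lambda>x. x) \<in> borel_measurable lborel"
  by simp

lemma measurable_adapted: "(\<lambda>(\<omega>, t). g ** stack \<omega> t) \<in> borel_measurable (lborel \<Otimes>\<^sub>M lborel)"
  unfolding case_prod_beta by measurable

lemma distr_adapted: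
  assumes "orthogonal_matrix g"
  shows "distr (lborel \<Otimes>\<^sub>M lborel) borel (\<lambda>(\<omega>, t). g ** stack \<omega> t) = (lborel :: (real^'m^('k::finite + 'l::finite)) measure)"
proof -
  have "distr (distr (lborel \<Otimes>\<^sub>M lborel) borel (\<lambda>(\<omega>, t). stack \<omega> t)) borel (\<lambda>y. g ** y) = (lborel :: (real^'m^('k + 'l)) measure)"
    unfolding distr_stack by (rule distr_orthogonal_mult[OF assms])
  moreover have "(\<lambda>(\<omega>, t). stack \<omega> t) \<in> borel_measurable (lborel \<Otimes>\<^sub>M lborel)"
    unfolding case_prod_beta by measurable
  ultimately show ?thesis
    by (subst (asm) distr_distr) (simp_all add: comp_def case_prod_beta')
qed

lemma nn_integral_adapted:
  fixes h :: "real^'m^('k::finite + 'l::finite) \<Rightarrow> ennreal"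
  assumes g: "orthogonal_matrix g" and [measurable]: "h \<in> borel_measurable borel"
  shows "(\<integral>\<^sup>+x. h x \<partial>lborel) = (\<integral>\<^sup>+t. \<integral>\<^sup>+\<omega>. h (g ** stack \<omega> t) \<partial>lborel \<partial>lborel)"
proof -
  have m: "(\<lambda>(\<omega>, t). h (g ** stack \<omega> t)) \<in> borel_measurable (lborel \<Otimes>\<^sub>M lborel)"
    unfolding case_prod_beta by measurable
  have "(\<integral>\<^sup>+x. h x \<partial>lborel) = (\<integral>\<^sup>+x. h x \<partial>distr (lborel \<Otimes>\<^sub>M lborel) borel (\<lambda>(\<omega>, t). g ** stack \<omega> t))"
    unfolding distr_adapted[OF g] ..
  also have "\<dots> = (\<integral>\<^sup>+(\<omega>, t). h (g ** stack \<omega> t) \<partial>(lborel \<Otimes>\<^sub>M lborel))"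
    by (subst nn_integral_distr[OF measurable_adapted]) (simp_all add: case_prod_beta')
  finally show ?thesis using lborel_pair.nn_integral_snd[OF m] by simp
qed

lemma integral_adapted:
  fixes h :: "real^'m^('k::finite + 'l::finite) \<Rightarrow> complex"
  assumes g: "orthogonal_matrix g" and h: "integrable lborel h"
  shows "(LINT x|lborel. h x) = (LINT t|lborel. LINT \<omega>|lborel. h (g ** stack \<omega> t))"
    and "(LINT x|lborel. h x) = (LINT \<omega>|lborel. LINT t|lborel. h (g ** stack \<omega> t))"
    and "AE t in lborel. integrable lborel (\<lambda>\<omega>. h (g ** stack \<omega> t))"
    and "integrable lborel (\<lambda>\<omega>. LINT t|lborel. h (g ** stack \<omega> t))"
proof -
  have [measurable]: "h \<in> borel_measurable borel" using borel_measurable_integrable[OF h] by simp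
  have "integrable (distr (lborel \<Otimes>\<^sub>M lborel) borel (\<lambda>(\<omega>, t). g ** stack \<omega> t)) h"
    unfolding distr_adapted[OF g] by (rule h)
  then have i: "integrable (lborel \<Otimes>\<^sub>M lborel) (\<lambda>(\<omega>, t). h (g ** stack \<omega> t))"
    by (subst (asm) integrable_distr_eq[OF measurable_adapted]) (simp_all add: case_prod_beta')
  have "(LINT x|lborel. h x) = (LINT x|distr (lborel \<Otimes>\<^sub>M lborel) borel (\<lambda>(\<omega>, t). g ** stack \<omega> t). h x)"
    unfolding distr_adapted[OF g] ..
  also have "\<dots> = (LINT (\<omega>, t)|(lborel \<Otimes>\<^sub>M lborel). h (g ** stack \<omega> t))"
    by (subst integral_distr[OF measurable_adapted]) (simp_all add: case_prod_beta')
  finally have e: "(LINT x|lborel. h x) = (LINT (\<omega>, t)|(lborel \<Otimes>\<^sub>M lborel). h (g ** stack \<omega> t))" .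
  show "(LINT x|lborel. h x) = (LINT t|lborel. LINT \<omega>|lborel. h (g ** stack \<omega> t))"
    using lborel_pair.integral_snd[OF i] e by simp
  show "(LINT x|lborel. h x) = (LINT \<omega>|lborel. LINT t|lborel. h (g ** stack \<omega> t))"
    using lborel_pair.integral_fst[OF i] e by simp
  show "AE t in lborel. integrable lborel (\<lambda>\<omega>. h (g ** stack \<omega> t))"
    using lborel_pair.AE_integrable_snd[OF i] .
  show "integrable lborel (\<lambda>\<omega>. LINT t|lborel. h (g ** stack \<omega> t))"
    using lborel_pair.integrable_fst[OF i] .
qed

subsection \<open>Integrals over matrix planes\<close>

text \<open>
  The rotation \<open>frame_rotation \<xi>\<close> is chosen without regard to measurability.  Averaging over the
  transversal variable gives a formula for the plane integral in terms of \<open>\<xi>\<close> alone, which is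
  jointly measurable in \<open>\<xi>\<close> and \<open>t\<close>.
\<close>

definition plane_nn_integral ::
    "(real^'m^('k::finite + 'l::finite) \<Rightarrow> ennreal) \<Rightarrow> real^'l^('k + 'l) \<Rightarrow> real^'m^'l \<Rightarrow> ennreal" where
  "plane_nn_integral h \<xi> t = (\<integral>\<^sup>+v. indicator (cbox 0 One) (transpose \<xi> ** v) * h (\<xi> ** t + v - \<xi> ** (transpose \<xi> ** v)) \<partial>lborel)"

definition plane_integral ::
    "(real^'m^('k::finite + 'l::finite) \<Rightarrow> complex) \<Rightarrow> real^'l^('k + 'l) \<Rightarrow> real^'m^'l \<Rightarrow> complex" where
  "plane_integral h \<xi> t = (LINT v|lborel. indicator (cbox 0 One) (transpose \<xi> ** v) * h (\<xi> ** t + v - \<xi> ** (transpose \<xi> ** v)))"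

lemma borel_measurable_indicator_cbox [measurable (raw)]:
  fixes f :: "'a \<Rightarrow> 'b::euclidean_space"
  assumes [measurable]: "f \<in> borel_measurable M"
  shows "(\<lambda>x. indicator (cbox a b) (f x) :: ennreal) \<in> borel_measurable M"
    "(\<lambda>x. indicator (cbox a b) (f x) :: complex) \<in> borel_measurable M"
  by (rule measurable_compose[OF assms], simp)+

lemma borel_measurable_plane_nn_integral:
  assumes [measurable]: "h \<in> borel_measurable borel"
  shows "(\<lambda>(\<xi>, t). plane_nn_integral h \<xi> t) \<in> borel_measurable (borel \<Otimes>\<^sub>M borel)"
  unfolding plane_nn_integral_def case_prod_beta by measurable

lemma borel_measurable_plane_integral:
  assumes [measurable]: "h \<in> borel_measurable borel"
  shows "(\<lambda>(\<xi>, t). plane_integral h \<xi> t) \<in> borel_measurable (borel \<Otimes>\<^sub>M borel)"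
  unfolding plane_integral_def case_prod_beta by measurable

lemma emeasure_unit_cbox: "emeasure lborel (cbox 0 One :: 'a::euclidean_space set) = 1"
  by (subst emeasure_lborel_cbox) auto

text \<open>In the coordinates \<open>v = g ** stack \<omega> s\<close> the indicator sees only
  \<open>s\<close> and the argument of \<open>h\<close> becomes
  \<open>g ** stack \<omega> t\<close>, free of \<open>s\<close>. The unit cube has measure 1, so
  the integration over \<open>s\<close> disappears. In particular the value does not depend on
  \<open>g\<close>.\<close>

lemma plane_nn_integral_adapted:
  fixes \<xi> :: "real^'l^('k::finite + 'l::finite)" and h :: "real^'m^('k + 'l) \<Rightarrow> ennreal"
  assumes g: "adapted g \<xi>" and [measurable]: "h \<in> borel_measurable borel"
  shows "plane_nn_integral h \<xi> t = (\<integral>\<^sup>+\<omega>. h (g ** stack \<omega> t) \<partial>lborel)"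
proof -
  have o: "orthogonal_matrix g" using g by (simp add: adapted_def)
  have "plane_nn_integral h \<xi> t = (\<integral>\<^sup>+s. \<integral>\<^sup>+\<omega>. indicator (cbox 0 One) s * h (g ** stack \<omega> t) \<partial>lborel \<partial>(lborel :: (real^'m^'l) measure))"
    unfolding plane_nn_integral_def by (subst nn_integral_adapted[OF o]) (simp_all add: adapted_simps(2,3)[OF g])
  also have "\<dots> = (\<integral>\<^sup>+s. indicator (cbox 0 One) s * (\<integral>\<^sup>+\<omega>. h (g ** stack \<omega> t) \<partial>lborel) \<partial>(lborel :: (real^'m^'l) measure))"
    by (intro nn_integral_cong nn_integral_cmult) measurable
  also have "\<dots> = (\<integral>\<^sup>+\<omega>. h (g ** stack \<omega> t) \<partial>lborel)"
    by (subst nn_integral_multc) (simp_all add: emeasure_unit_cbox)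
  finally show ?thesis .
qed

lemma plane_integral_adapted:
  fixes \<xi> :: "real^'l^('k::finite + 'l::finite)" and h :: "real^'m^('k + 'l) \<Rightarrow> complex"
  assumes g: "adapted g \<xi>" and [measurable]: "h \<in> borel_measurable borel"
    and int: "integrable lborel (\<lambda>\<omega>. h (g ** stack \<omega> t))"
  shows "plane_integral h \<xi> t = (LINT \<omega>|lborel. h (g ** stack \<omega> t))"
proof -
  have o: "orthogonal_matrix g" using g by (simp add: adapted_def)
  have i: "integrable lborel (\<lambda>v. indicator (cbox 0 One) (transpose \<xi> ** v) * h (\<xi> ** t + v - \<xi> ** (transpose \<xi> ** v)))"
  proof (rule integrableI_bounded)
    have "(\<integral>\<^sup>+v. ennreal (norm (indicator (cbox 0 One) (transpose \<xi> ** v) * h (\<xi> ** t + v - \<xi> ** (transpose \<xi> ** v)))) \<partial>lborel)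
        = plane_nn_integral (\<lambda>x. ennreal (norm (h x))) \<xi> t"
      unfolding plane_nn_integral_def by (intro nn_integral_cong) (auto simp: norm_mult indicator_def)
    also have "\<dots> < \<infinity>"
      using int by (subst plane_nn_integral_adapted[OF g]) (auto simp: integrable_iff_bounded)
    finally show "(\<integral>\<^sup>+v. ennreal (norm (indicator (cbox 0 One) (transpose \<xi> ** v) * h (\<xi> ** t + v - \<xi> ** (transpose \<xi> ** v)))) \<partial>lborel) < \<infinity>" .
  qed measurable
  have "plane_integral h \<xi> t = (LINT s|lborel. LINT \<omega>|lborel. indicator (cbox 0 One) (s :: real^'m^'l) * h (g ** stack \<omega> t))"
    unfolding plane_integral_def by (subst integral_adapted(1)[OF o i]) (simp add: adapted_simps(2,3)[OF g])
  also have "\<dots> = (LINT s|lborel. indicator (cbox 0 One) (s :: real^'m^'l) * (LINT \<omega>|lborel. h (g ** stack \<omega> t)))"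
    by simp
  also have "\<dots> = (LINT s|lborel. indicator (cbox 0 One) (s :: real^'m^'l) *\<^sub>R (LINT \<omega>|lborel. h (g ** stack \<omega> t)))"
    by (intro Bochner_Integration.integral_cong) (auto simp: indicator_def)
  also have "\<dots> = (LINT \<omega>|lborel. h (g ** stack \<omega> t))"
    by (subst integral_scaleR_left) (simp_all add: measure_def emeasure_unit_cbox)
  finally show ?thesis .
qed

lemma weight_adapted_le:
  fixes \<xi> :: "real^'l^('k::finite + 'l::finite)" and t :: "real^'m^'l"
  assumes g: "adapted g \<xi>"
  shows "1 / (1 + norm (g ** stack \<omega> t)) ^ (d + 2 * N) \<le> 1 / (1 + norm \<omega>) ^ d * inverse ((1 + (norm t)\<^sup>2) ^ N)"
proof -
  have "(1 + norm \<omega>) ^ d * (1 + (norm t)\<^sup>2) ^ N \<le> (1 + norm (g ** stack \<omega> t)) ^ d * ((1 + norm (g ** stack \<omega> t))\<^sup>2) ^ N"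
    using norm_adapted_ge[OF g] by (intro mult_mono power_mono) auto
  also have "\<dots> = (1 + norm (g ** stack \<omega> t)) ^ (d + 2 * N)" by (simp only: power_add power_mult)
  finally have "inverse ((1 + norm (g ** stack \<omega> t)) ^ (d + 2 * N)) \<le> inverse ((1 + norm \<omega>) ^ d * (1 + (norm t)\<^sup>2) ^ N)"
    by (intro le_imp_inverse_le mult_pos_pos zero_less_power) (auto simp: add_pos_nonneg)
  then show ?thesis by (simp add: divide_inverse)
qed

text \<open>The passage from functions of \<open>t\<close> to their pullbacks along
  \<open>\<lambda>x. transpose \<xi> ** x\<close>. The weight splits by the two blocks: one part
  makes the fibre direction \<omega> integrable with a constant independent of \<xi>, the other
  becomes the weight in \<open>t\<close>.\<close>

lemma weighted_dual_le:
  fixes \<xi> :: "real^'l^('k::finite + 'l::finite)" and H :: "real^'m^'l \<Rightarrow> ennreal"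
  assumes g: "adapted g \<xi>" and [measurable]: "H \<in> borel_measurable borel"
  shows "(\<integral>\<^sup>+x. ennreal (1 / (1 + norm x) ^ (2 * DIM(real^'m^'k) + 2 * N)) * H (transpose \<xi> ** x) \<partial>(lborel :: (real^'m^('k + 'l)) measure))
    \<le> (\<integral>\<^sup>+\<omega>. ennreal (1 / (1 + norm \<omega>) ^ (2 * DIM(real^'m^'k))) \<partial>(lborel :: (real^'m^'k) measure))
      * (\<integral>\<^sup>+t. ennreal (inverse ((1 + (norm t)\<^sup>2) ^ N)) * H t \<partial>lborel)"
proof -
  let ?d = "2 * DIM(real^'m^'k)"
  have o: "orthogonal_matrix g" using g by (simp add: adapted_def)
  have w': "ennreal (1 / (1 + norm (g ** stack \<omega> t)) ^ (?d + 2 * N)) \<le> ennreal (1 / (1 + norm \<omega>) ^ ?d) * ennreal (inverse ((1 + (norm t)\<^sup>2) ^ N))"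
    for \<omega> :: "real^'m^'k" and t :: "real^'m^'l"
    using ennreal_leI[OF weight_adapted_le[OF g, of \<omega> t ?d N]] by (subst (asm) ennreal_mult) simp_all
  have "(\<integral>\<^sup>+x. ennreal (1 / (1 + norm x) ^ (?d + 2 * N)) * H (transpose \<xi> ** x) \<partial>(lborel :: (real^'m^('k + 'l)) measure))
    = (\<integral>\<^sup>+t. \<integral>\<^sup>+\<omega>. ennreal (1 / (1 + norm (g ** stack \<omega> t)) ^ (?d + 2 * N)) * H t \<partial>(lborel :: (real^'m^'k) measure) \<partial>lborel)"
    by (subst nn_integral_adapted[OF o]) (simp_all add: adapted_simps[OF g])
  also have "\<dots> \<le> (\<integral>\<^sup>+t. \<integral>\<^sup>+\<omega>. ennreal (1 / (1 + norm \<omega>) ^ ?d) * (ennreal (inverse ((1 + (norm t)\<^sup>2) ^ N)) * H t) \<partial>(lborel :: (real^'m^'k) measure) \<partial>lborel)"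
    unfolding mult.assoc[symmetric]
    by (intro nn_integral_mono mult_right_mono w')  simp_all
  also have "\<dots> = (\<integral>\<^sup>+t. (\<integral>\<^sup>+\<omega>. ennreal (1 / (1 + norm \<omega>) ^ ?d) \<partial>(lborel :: (real^'m^'k) measure)) * (ennreal (inverse ((1 + (norm t)\<^sup>2) ^ N)) * H t) \<partial>lborel)"
    by (intro nn_integral_cong nn_integral_multc) measurable
  also have "\<dots> = (\<integral>\<^sup>+\<omega>. ennreal (1 / (1 + norm \<omega>) ^ ?d) \<partial>(lborel :: (real^'m^'k) measure)) * (\<integral>\<^sup>+t. ennreal (inverse ((1 + (norm t)\<^sup>2) ^ N)) * H t \<partial>lborel)"
    by (rule nn_integral_cmult) measurable
  finally show ?thesis .
qed

lemma nn_integral_weight_finite: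
  "(\<integral>\<^sup>+\<omega>. ennreal (1 / (1 + norm \<omega>) ^ (2 * DIM('a))) \<partial>(lborel :: 'a::euclidean_space measure)) < \<infinity>"
  using integrable_one_plus_norm_powr[where 'a = 'a] by (auto simp: integrable_iff_bounded)

subsection \<open>The Fourier slice theorem\<close>

lemma continuous_adapted:
  assumes "adapted g \<xi>" "X \<longlonglongrightarrow> \<omega>"
  shows "(\<lambda>n. g ** stack (X n) t) \<longlonglongrightarrow> g ** stack \<omega> t"
proof -
  have "dist (g ** stack (X n) t) (g ** stack \<omega> t) = dist (X n) \<omega>" for n
  proof -
    have "dist (g ** stack (X n) t) (g ** stack \<omega> t) = norm (g ** (stack (X n) t - stack \<omega> t))"
      unfolding dist_norm
      by (rule arg_cong[where f = norm]) (simp add: vec_eq_iff matrix_matrix_mult_def algebra_simps sum_subtractf)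
    also have "\<dots> = norm (stack (X n - \<omega>) (0 :: real^'c^'b))"
      using assms(1) by (simp add: adapted_def norm_orthogonal_mult stack_diff)
    also have "\<dots> = norm (X n - \<omega>)"
      using norm_stack[of "X n - \<omega>" "0 :: real^'c^'b"] by (simp add: power2_eq_iff_nonneg)
    finally show ?thesis by (simp add: dist_norm)
  qed
  then show ?thesis
    using assms(2) unfolding tendsto_dist_iff[of X] tendsto_dist_iff[of "\<lambda>n. g ** stack (X n) t"] by simp
qed

text \<open>Integrating \<theta> over the lower block with phase \<open>t\<close> gives a function
  \<open>u\<close> of the upper block, whose transform is the restriction of
  \<open>FT \<theta>\<close> to the plane. Inversion at zero then identifies the plane integral with
  \<open>u 0\<close>, the integral over matrices \<open>\<xi> ** s\<close>.\<close>

lemma Fourier_slice: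
  fixes \<xi> :: "real^'l^('k::finite + 'l::finite)" and \<theta> :: "real^'m^('k + 'l) \<Rightarrow> complex"
  assumes g: "adapted g \<xi>" and \<theta>: "rapid \<theta>" "continuous_on UNIV \<theta>" "rapid (FT \<theta>)"
  shows "integrable lborel (\<lambda>\<omega>. FT \<theta> (g ** stack \<omega> t))" (is ?I)
    and "(LINT \<omega>|lborel. FT \<theta> (g ** stack \<omega> t))
      = complex_of_real ((2 * pi) ^ (CARD('k) * CARD('m))) * (LINT s|lborel. cis (s \<bullet> t) * \<theta> (\<xi> ** s))" (is ?E)
proof -
  have o: "orthogonal_matrix g" using g by (simp add: adapted_def)
  have [measurable]: "\<theta> \<in> borel_measurable borel" by (rule borel_measurable_continuous_onI[OF \<theta>(2)])
  have int: "integrable lborel \<theta>" by (rule rapid_integrable[OF \<theta>(1)]) measurable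
  have [measurable]: "FT \<theta> \<in> borel_measurable borel" by (rule FT_measurable[OF int])
  define u where "u \<eta> = (LINT s|lborel. cis (s \<bullet> t) * \<theta> (g ** stack \<eta> s))" for \<eta> :: "real^'m^'k"
  have iy: "integrable lborel (\<lambda>y. cis ((g ** stack \<omega> t) \<bullet> y) * \<theta> y)" for \<omega> :: "real^'m^'k"
    using int by (subst integrable_cis_mult) auto
  have "integrable lborel (\<lambda>\<eta>. LINT s|lborel. cis ((g ** stack 0 t) \<bullet> (g ** stack \<eta> s)) * \<theta> (g ** stack \<eta> s))"
    by (rule integral_adapted(4)[OF o iy])
  then have u_int: "integrable lborel u"
    unfolding u_def adapted_simps(4)[OF g] by (simp add: inner_commute)
  have [measurable]: "u \<in> borel_measurable borel" using borel_measurable_integrable[OF u_int] by simp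
  have FTu: "FT u \<omega> = FT \<theta> (g ** stack \<omega> t)" for \<omega>
  proof -
    have "FT \<theta> (g ** stack \<omega> t) = (LINT \<eta>|lborel. LINT s|lborel. cis ((g ** stack \<omega> t) \<bullet> (g ** stack \<eta> s)) * \<theta> (g ** stack \<eta> s))"
      unfolding FT_def by (rule integral_adapted(2)[OF o iy])
    also have "\<dots> = (LINT \<eta>|lborel. cis (\<omega> \<bullet> \<eta>) * u \<eta>)"
      unfolding u_def adapted_simps(4)[OF g] cis_mult[symmetric] by (simp add: mult.assoc inner_commute)
    finally show ?thesis by (simp add: FT_def)
  qed
  have "rapid (\<lambda>\<omega>. FT \<theta> (g ** stack \<omega> t))"
  proof (rule rapidI)
    fix N
    obtain C where C: "\<And>x. (1 + norm x) ^ N * norm (FT \<theta> x) \<le> C" using \<theta>(3) unfolding rapid_def by blast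
    have "(1 + norm \<omega>) ^ N * norm (FT \<theta> (g ** stack \<omega> t)) \<le> C" for \<omega> :: "real^'m^'k"
    proof (rule order_trans[OF _ C])
      show "(1 + norm \<omega>) ^ N * norm (FT \<theta> (g ** stack \<omega> t)) \<le> (1 + norm (g ** stack \<omega> t)) ^ N * norm (FT \<theta> (g ** stack \<omega> t))"
        using norm_adapted_ge[OF g] by (intro mult_right_mono power_mono) auto
    qed
    then show "\<exists>C. \<forall>\<omega>. (1 + norm \<omega>) ^ N * norm (FT \<theta> (g ** stack \<omega> t)) \<le> C" by blast
  qed
  then show I: ?I by (rule rapid_integrable) measurable
  obtain C where C: "C \<ge> 0" "\<And>x. norm (\<theta> x) \<le> C / (1 + norm x) ^ (2 * DIM(real^'m^'l))" using rapidE[OF \<theta>(1)] by metis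
  have bnd: "norm (cis (s \<bullet> t) * \<theta> (g ** stack \<eta> s)) \<le> C * (1 / (1 + norm s) ^ (2 * DIM(real^'m^'l)))" for \<eta> :: "real^'m^'k" and s :: "real^'m^'l"
  proof -
    have "norm (cis (s \<bullet> t) * \<theta> (g ** stack \<eta> s)) \<le> C / (1 + norm (g ** stack \<eta> s)) ^ (2 * DIM(real^'m^'l))"
      by (simp add: norm_mult C(2)[simplified])
    also have "\<dots> \<le> C / (1 + norm s) ^ (2 * DIM(real^'m^'l))"
      using C(1) norm_adapted_ge[OF g] by (intro divide_left_mono power_mono mult_pos_pos zero_less_power) (auto simp: add_pos_nonneg)
    finally show ?thesis by simp
  qed
  have w: "integrable lborel (\<lambda>s :: real^'m^'l. C * (1 / (1 + norm s) ^ (2 * DIM(real^'m^'l))))"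
    by (intro integrable_mult_right integrable_one_plus_norm_powr)
  have "norm (u \<eta>) \<le> (LINT s|lborel. C * (1 / (1 + norm (s :: real^'m^'l)) ^ (2 * DIM(real^'m^'l))))" for \<eta>
  proof -
    have "integrable lborel (\<lambda>s. cis (s \<bullet> t) * \<theta> (g ** stack \<eta> s))"
      using bnd by (intro Bochner_Integration.integrable_bound[OF w] AE_I2) (auto simp: abs_mult C(1))
    then show ?thesis unfolding u_def by (rule Bochner_Integration.integral_norm_bound_integral[OF _ w]) (rule bnd)
  qed
  moreover have "isCont u 0"
    unfolding continuous_at_sequentially comp_def
  proof (intro allI impI)
    fix X assume X: "X \<longlonglongrightarrow> (0 :: real^'m^'k)"
    show "(\<lambda>n. u (X n)) \<longlonglongrightarrow> u 0"
      unfolding u_def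
    proof (rule integral_dominated_convergence[OF _ _ w])
      have "(\<lambda>n. cis (s \<bullet> t) * \<theta> (g ** stack (X n) s)) \<longlonglongrightarrow> cis (s \<bullet> t) * \<theta> (g ** stack 0 s)" for s
        using \<theta>(2) continuous_adapted[OF g X, of s]
        by (intro tendsto_mult tendsto_const) (auto simp: continuous_on_eq_continuous_at intro: isCont_tendsto_compose)
      then show "AE s in lborel. (\<lambda>n. cis (s \<bullet> t) * \<theta> (g ** stack (X n) s)) \<longlonglongrightarrow> cis (s \<bullet> t) * \<theta> (g ** stack 0 s)" by simp
      show "AE s in lborel. norm (cis (s \<bullet> t) * \<theta> (g ** stack (X n) s)) \<le> C * (1 / (1 + norm s) ^ (2 * DIM(real^'m^'l)))" for n
        using bnd by (intro AE_I2)
    qed measurable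
  qed
  moreover have "integrable lborel (FT u)" using I by (simp only: FTu[symmetric])
  ultimately have "(LINT \<omega>|lborel. FT u \<omega>) = complex_of_real ((2 * pi) ^ DIM(real^'m^'k)) * u 0"
    by (intro FT_inversion_at_zero[OF u_int]) auto
  then show ?E by (simp add: FTu u_def adapted_simps(1)[OF g])
qed

subsection \<open>Fubini's theorem over the Stiefel manifold\<close>

text \<open>Here \<open>f\<close> carries no measurability assumption of its own. This is what
  admits the Radon transform, built from unmeasurably chosen rotations, as an integrand: it agrees
  almost everywhere with the jointly measurable \<open>plane_integral\<close>.\<close>

lemma completion_AE_eq:
  fixes f g :: "'a \<Rightarrow> 'b::{banach,second_countable_topology}"
  assumes g: "g \<in> borel_measurable M" and ae: "AE x in M. f x = g x"
  shows "f \<in> borel_measurable (completion M)"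
    and "integrable (completion M) f \<longleftrightarrow> integrable M g"
    and "integral\<^sup>L (completion M) f = integral\<^sup>L M g"
proof -
  have ae': "AE x in completion M. f x = g x" using ae by (rule AE_completion)
  have g': "g \<in> borel_measurable (completion M)" using g by (rule measurable_completion)
  show f: "f \<in> borel_measurable (completion M)"
  proof (rule measurableI)
    fix A :: "'b set" assume "A \<in> sets borel"
    then have A: "g -` A \<inter> space (completion M) \<in> sets (completion M)" by (rule measurable_sets[OF g'])
    show "f -` A \<inter> space (completion M) \<in> sets (completion M)"
      by (rule completion.in_sets_AE[OF _ A]) (use ae' AE_space in \<open>auto elim!: eventually_elim2\<close>)
  qed simp
  show "integrable (completion M) f \<longleftrightarrow> integrable M g"
    using integrable_cong_AE[OF f g' ae'] integrable_completion[OF g] by simp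
  show "integral\<^sup>L (completion M) f = integral\<^sup>L M g"
    using integral_cong_AE[OF f g' ae'] integral_completion[OF g] by simp
qed

lemma borel_measurable_integral_lborelI:
  fixes f :: "'a::euclidean_space \<Rightarrow> 'b::euclidean_space \<Rightarrow> complex"
  assumes "(\<lambda>(x, t). f x t) \<in> borel_measurable (borel \<Otimes>\<^sub>M borel)"
  shows "(\<lambda>x. LINT t|lborel. f x t) \<in> borel_measurable borel"
proof -
  have e: "sets ((borel :: 'a measure) \<Otimes>\<^sub>M (lborel :: 'b measure)) = sets (borel \<Otimes>\<^sub>M borel)"
    by (intro sets_pair_measure_cong) simp_all
  have "(\<lambda>(x, t). f x t) \<in> borel_measurable ((borel :: 'a measure) \<Otimes>\<^sub>M (lborel :: 'b measure))"
    using assms measurable_cong_sets[OF e refl] by blast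
  then show ?thesis by (rule lborel.borel_measurable_lebesgue_integral)
qed

lemma stiefel_Fubini:
  fixes \<mu> :: "(real^'l^'n) measure" and f :: "real^'l^'n \<Rightarrow> 'b::euclidean_space \<Rightarrow> complex"
  assumes \<mu>: "stiefel_measure \<mu>"
    and f: "(\<lambda>(\<xi>, z). f \<xi> z) \<in> borel_measurable (borel \<Otimes>\<^sub>M borel)"
    and fin: "(\<integral>\<^sup>+\<xi>. \<integral>\<^sup>+z. ennreal (norm (f \<xi> z)) \<partial>lborel \<partial>\<mu>) < \<infinity>"
  shows "(LINT \<xi>|\<mu>. LINT z|lborel. f \<xi> z) = (LINT z|lborel. LINT \<xi>|\<mu>. f \<xi> z)"
    and "AE \<xi> in \<mu>. integrable lborel (f \<xi>)"
    and "AE z in lborel. integrable \<mu> (\<lambda>\<xi>. f \<xi> z)"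
    and "integrable lborel (\<lambda>z. LINT \<xi>|\<mu>. f \<xi> z)"
proof -
  interpret finite_measure \<mu> by (rule finite_measure_stiefel[OF \<mu>])
  interpret pair_sigma_finite \<mu> "lborel :: 'b measure" ..
  have f': "(\<lambda>(\<xi>, z). f \<xi> z) \<in> borel_measurable (\<mu> \<Otimes>\<^sub>M lborel)"
    by (rule borel_measurable_stiefel_pairI[OF \<mu> f])
  have i: "integrable (\<mu> \<Otimes>\<^sub>M lborel) (\<lambda>(\<xi>, z). f \<xi> z)"
  proof (rule integrableI_bounded[OF f'])
    have "(\<integral>\<^sup>+x. ennreal (norm (case x of (\<xi>, z) \<Rightarrow> f \<xi> z)) \<partial>(\<mu> \<Otimes>\<^sub>M lborel)) = (\<integral>\<^sup>+\<xi>. \<integral>\<^sup>+z. ennreal (norm (f \<xi> z)) \<partial>lborel \<partial>\<mu>)"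
      using f' by (subst lborel.nn_integral_fst[symmetric]) auto
    then show "(\<integral>\<^sup>+x. ennreal (norm (case x of (\<xi>, z) \<Rightarrow> f \<xi> z)) \<partial>(\<mu> \<Otimes>\<^sub>M lborel)) < \<infinity>" using fin by simp
  qed
  show "(LINT \<xi>|\<mu>. LINT z|lborel. f \<xi> z) = (LINT z|lborel. LINT \<xi>|\<mu>. f \<xi> z)"
    by (rule Fubini_integral[OF i, symmetric])
  show "AE \<xi> in \<mu>. integrable lborel (f \<xi>)" using AE_integrable_fst[OF i] by simp
  show "AE z in lborel. integrable \<mu> (\<lambda>\<xi>. f \<xi> z)" using AE_integrable_snd[OF i] by simp
  show "integrable lborel (\<lambda>z. LINT \<xi>|\<mu>. f \<xi> z)" using integrable_snd[OF i] by simp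
qed

text \<open>The version for nonnegative functions, tested on indicators, says that the image measure
  has the stated density; change of variables and Fubini's theorem then cover complex
  integrands.\<close>

lemma polar_coordinates_integral:
  fixes \<mu> :: "(real^'l^'n) measure" and h :: "real^'m^'n \<Rightarrow> complex"
  assumes \<mu>: "stiefel_measure \<mu>" and ml: "CARD('m) \<le> CARD('l)" and ln: "CARD('l) < CARD('n)"
    and [measurable]: "h \<in> borel_measurable borel"
    and int: "integrable lborel (\<lambda>y. gdet y powr (- ((real CARD('n) - real CARD('l)) / 2)) *\<^sub>R h y)"
  shows "(LINT \<xi>|\<mu>. LINT t|(lborel :: (real^'m^'l) measure). h (\<xi> ** t))
    = (stiefel_mass CARD('n) CARD('l) * polar_const CARD('n) CARD('l) CARD('m)) *\<^sub>R
      (LINT y|lborel. gdet y powr (- ((real CARD('n) - real CARD('l)) / 2)) *\<^sub>R h y)"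
proof -
  interpret finite_measure \<mu> by (rule finite_measure_stiefel[OF \<mu>])
  interpret pair_sigma_finite \<mu> "lborel :: (real^'m^'l) measure" ..
  define c where "c = stiefel_mass CARD('n) CARD('l) * polar_const CARD('n) CARD('l) CARD('m)"
  define D where "D y = gdet y powr (- ((real CARD('n) - real CARD('l)) / 2))" for y :: "real^'m^'n"
  have c: "c \<ge> 0" unfolding c_def using polar_const_pos[OF ml, of "CARD('n)"] stiefel_mass_pos[of "CARD('l)" "CARD('n)"] ln by simp
  have [measurable]: "D \<in> borel_measurable borel" unfolding D_def by measurable
  have m: "(\<lambda>(\<xi>, t). \<xi> ** t) \<in> borel_measurable (\<mu> \<Otimes>\<^sub>M (lborel :: (real^'m^'l) measure))"
    by (rule borel_measurable_stiefel_pairI[OF \<mu>]) (unfold case_prod_beta', measurable)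
  have P: "distr (\<mu> \<Otimes>\<^sub>M lborel) borel (\<lambda>(\<xi>, t). \<xi> ** t) = density (lborel :: (real^'m^'n) measure) (\<lambda>y. ennreal (c * D y))"
  proof (rule measure_eqI)
    fix A assume "A \<in> sets (distr (\<mu> \<Otimes>\<^sub>M lborel) borel (\<lambda>(\<xi>, t). \<xi> ** (t :: real^'m^'l)))"
    then have [measurable]: "A \<in> sets borel" by simp
    have mA: "(\<lambda>(\<xi>, t). indicator A (\<xi> ** t) :: ennreal) \<in> borel_measurable (\<mu> \<Otimes>\<^sub>M (lborel :: (real^'m^'l) measure))"
      by (rule borel_measurable_stiefel_pairI[OF \<mu>]) (unfold case_prod_beta', measurable)
    have "emeasure (distr (\<mu> \<Otimes>\<^sub>M lborel) borel (\<lambda>(\<xi>, t). \<xi> ** (t :: real^'m^'l))) A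
       = (\<integral>\<^sup>+y. indicator A y \<partial>distr (\<mu> \<Otimes>\<^sub>M lborel) borel (\<lambda>(\<xi>, t). \<xi> ** (t :: real^'m^'l)))"
      by (rule nn_integral_indicator[symmetric]) simp
    also have "\<dots> = (\<integral>\<^sup>+(\<xi>, t). indicator A (\<xi> ** t) \<partial>(\<mu> \<Otimes>\<^sub>M (lborel :: (real^'m^'l) measure)))"
      by (subst nn_integral_distr[OF m]) (simp_all add: case_prod_beta')
    also have "\<dots> = (\<integral>\<^sup>+\<xi>. \<integral>\<^sup>+t. indicator A (\<xi> ** t) \<partial>(lborel :: (real^'m^'l) measure) \<partial>\<mu>)"
      using lborel.nn_integral_fst[OF mA] by simp
    also have "\<dots> = ennreal c * (\<integral>\<^sup>+y. ennreal (D y) * indicator A y \<partial>lborel)"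
      unfolding c_def D_def by (rule polar_coordinates[OF \<mu> ml ln]) measurable
    also have "\<dots> = (\<integral>\<^sup>+y. ennreal (c * D y) * indicator A y \<partial>lborel)"
      using c by (subst nn_integral_cmult[symmetric]) (auto simp: ennreal_mult D_def mult.assoc)
    finally show "emeasure (distr (\<mu> \<Otimes>\<^sub>M lborel) borel (\<lambda>(\<xi>, t). \<xi> ** (t :: real^'m^'l))) A
       = emeasure (density lborel (\<lambda>y. ennreal (c * D y))) A"
      by (simp add: emeasure_density)
  qed simp
  have cD: "(c * D y) *\<^sub>R h y = c *\<^sub>R (D y *\<^sub>R h y)" for y by simp
  have "integrable lborel (\<lambda>y. (c * D y) *\<^sub>R h y)"
    unfolding cD unfolding D_def by (intro integrable_scaleR_right int)
  then have "integrable (density lborel (\<lambda>y. ennreal (c * D y))) h"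
    using c by (subst integrable_density) (simp_all add: D_def)
  then have i: "integrable (\<mu> \<Otimes>\<^sub>M lborel) (\<lambda>(\<xi>, t). h (\<xi> ** (t :: real^'m^'l)))"
    unfolding P[symmetric] by (subst (asm) integrable_distr_eq[OF m]) (simp_all add: case_prod_beta')
  have "(LINT \<xi>|\<mu>. LINT t|(lborel :: (real^'m^'l) measure). h (\<xi> ** t)) = (LINT (\<xi>, t)|(\<mu> \<Otimes>\<^sub>M lborel). h (\<xi> ** (t :: real^'m^'l)))"
    using integral_fst[OF i] .
  also have "\<dots> = (LINT y|distr (\<mu> \<Otimes>\<^sub>M lborel) borel (\<lambda>(\<xi>, t). \<xi> ** (t :: real^'m^'l)). h y)"
    by (subst integral_distr[OF m]) (simp_all add: case_prod_beta')
  also have "\<dots> = (LINT y|lborel. (c * D y) *\<^sub>R h y)"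
    unfolding P using c by (intro integral_density) (auto simp: D_def)
  also have "\<dots> = c *\<^sub>R (LINT y|lborel. D y *\<^sub>R h y)"
    unfolding cD by (rule integral_scaleR_right)
  finally show ?thesis by (simp only: c_def D_def)
qed

lemma norm_plane_integral_le:
  "ennreal (norm (plane_integral h \<xi> t)) \<le> plane_nn_integral (\<lambda>x. ennreal (norm (h x))) \<xi> t"
proof -
  let ?u = "\<lambda>v. indicator (cbox 0 One) (transpose \<xi> ** v) * h (\<xi> ** t + v - \<xi> ** (transpose \<xi> ** v))"
  have e: "plane_nn_integral (\<lambda>x. ennreal (norm (h x))) \<xi> t = (\<integral>\<^sup>+v. ennreal (norm (?u v)) \<partial>lborel)"
    unfolding plane_nn_integral_def by (intro nn_integral_cong) (auto simp: norm_mult indicator_def)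
  show ?thesis
  proof (cases "integrable lborel ?u")
    case True
    then show ?thesis unfolding e plane_integral_def by (rule integral_norm_bound_ennreal)
  next
    \<comment> \<open>Without integrability \<open>plane_integral\<close> has the default value
      0.\<close>
    case False
    then show ?thesis by (simp add: plane_integral_def not_integrable_integral_eq)
  qed
qed

lemma nn_integral_slice:
  fixes \<xi> :: "real^'l^('k::finite + 'l::finite)" and h :: "real^'m^('k + 'l) \<Rightarrow> ennreal"
  assumes g: "adapted g \<xi>" and [measurable]: "h \<in> borel_measurable borel" "H \<in> borel_measurable borel"
  shows "(\<integral>\<^sup>+t. H t * plane_nn_integral h \<xi> t \<partial>lborel) = (\<integral>\<^sup>+z. H (transpose \<xi> ** z) * h z \<partial>lborel)"
proof -
  have o: "orthogonal_matrix g" using g by (simp add: adapted_def)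
  have "(\<integral>\<^sup>+z. H (transpose \<xi> ** z) * h z \<partial>lborel) = (\<integral>\<^sup>+t. \<integral>\<^sup>+\<omega>. H t * h (g ** stack \<omega> t) \<partial>lborel \<partial>lborel)"
    by (subst nn_integral_adapted[OF o]) (simp_all add: adapted_simps(2)[OF g])
  also have "\<dots> = (\<integral>\<^sup>+t. H t * plane_nn_integral h \<xi> t \<partial>lborel)"
    unfolding plane_nn_integral_adapted[OF g assms(2)] by (intro nn_integral_cong nn_integral_cmult) measurable
  finally show ?thesis ..
qed

lemma integral_slice:
  fixes \<xi> :: "real^'l^('k::finite + 'l::finite)" and h :: "real^'m^('k + 'l) \<Rightarrow> complex"
  assumes g: "adapted g \<xi>" and i: "integrable lborel (\<lambda>x. u (transpose \<xi> ** x) * h x)"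
  shows "(LINT x|lborel. u (transpose \<xi> ** x) * h x) = (LINT t|lborel. u t * (LINT \<omega>|lborel. h (g ** stack \<omega> t)))"
proof -
  have o: "orthogonal_matrix g" using g by (simp add: adapted_def)
  show ?thesis by (subst integral_adapted(1)[OF o i]) (simp add: adapted_simps(2)[OF g])
qed

section \<open>Radon and dual Radon transforms of a function in an Lp space\<close>

context
  fixes \<mu> :: "(real^'l^('k::finite + 'l::finite)) measure" and f :: "real^'m^('k + 'l) \<Rightarrow> complex"
    and p :: real and N :: nat
  assumes \<mu>: "stiefel_measure \<mu>" and ml: "CARD('m) \<le> CARD('l)"
    and N: "real N > real (CARD('k + 'l) * CARD('l)) / 2"
    and f [measurable]: "f \<in> borel_measurable borel" and fp: "integrable lborel (\<lambda>x. norm (f x) powr p)"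
    and p: "1 \<le> p" "p * (real CARD('k) + real CARD('m) - 1) < real CARD('k + 'l)"
begin

abbreviation (input) nf where "nf \<equiv> plane_nn_integral (\<lambda>x. ennreal (norm (f x)))"

abbreviation (input) wt :: "real^'m^'l \<Rightarrow> real" where "wt t \<equiv> inverse ((1 + (norm t)\<^sup>2) ^ N)"

abbreviation (input) wx :: "real^'m^('k + 'l) \<Rightarrow> real"
  where "wx x \<equiv> 1 / (1 + norm x) ^ (2 * DIM(real^'m^'k) + 2 * N)"

lemma card_l_less: "CARD('l) < CARD('k + 'l)"
  by simp

lemma Lp_weighted: "(\<integral>\<^sup>+\<xi>. \<integral>\<^sup>+z. ennreal (norm (f z) * wt (transpose \<xi> ** z)) \<partial>lborel \<partial>\<mu>) < \<infinity>"
  by (rule Lp_stiefel_integrable[OF \<mu> card_l_less N f fp p(1)]) (use p(2) in simp)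

lemma measurable_nf [measurable]: "(\<lambda>(\<xi>, t). nf \<xi> t) \<in> borel_measurable (borel \<Otimes>\<^sub>M borel)"
  by (rule borel_measurable_plane_nn_integral) measurable

lemma nf_weighted: "(\<integral>\<^sup>+\<xi>. \<integral>\<^sup>+t. ennreal (wt t) * nf \<xi> t \<partial>lborel \<partial>\<mu>) < \<infinity>"
proof -
  have "(\<integral>\<^sup>+t. ennreal (wt t) * nf \<xi> t \<partial>lborel) = (\<integral>\<^sup>+z. ennreal (norm (f z) * wt (transpose \<xi> ** z)) \<partial>lborel)"
    if "\<xi> \<in> space \<mu>" for \<xi>
  proof -
    have "adapted (frame_rotation \<xi>) \<xi>" using that frame_rotation_adapted by (simp add: space_stiefel[OF \<mu>])
    from nn_integral_slice[OF this, of "\<lambda>x. ennreal (norm (f x))" "\<lambda>t. ennreal (wt t)"]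
    show ?thesis by (simp add: ennreal_mult mult.commute)
  qed
  then show ?thesis using Lp_weighted by (simp cong: nn_integral_cong)
qed

lemma dual_weighted_le:
  assumes H: "(\<lambda>(\<xi>, t). H \<xi> t) \<in> borel_measurable (borel \<Otimes>\<^sub>M borel)"
  shows "(\<integral>\<^sup>+\<xi>. \<integral>\<^sup>+x. ennreal (wx x) * H \<xi> (transpose \<xi> ** x) \<partial>lborel \<partial>\<mu>)
    \<le> (\<integral>\<^sup>+\<omega>. ennreal (1 / (1 + norm \<omega>) ^ (2 * DIM(real^'m^'k))) \<partial>(lborel :: (real^'m^'k) measure))
      * (\<integral>\<^sup>+\<xi>. \<integral>\<^sup>+t. ennreal (wt t) * H \<xi> t \<partial>lborel \<partial>\<mu>)"
proof -
  have [measurable]: "H \<xi> \<in> borel_measurable borel" for \<xi>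
    using measurable_compose[OF _ H, of "Pair \<xi>" borel] by simp
  have m: "(\<lambda>\<xi>. \<integral>\<^sup>+t. ennreal (wt t) * H \<xi> t \<partial>lborel) \<in> borel_measurable \<mu>"
    by (rule borel_measurable_stiefelI[OF \<mu>], rule borel_measurable_nn_integral_lborelI)
      (use H in measurable)
  have "(\<integral>\<^sup>+\<xi>. \<integral>\<^sup>+x. ennreal (wx x) * H \<xi> (transpose \<xi> ** x) \<partial>lborel \<partial>\<mu>)
     \<le> (\<integral>\<^sup>+\<xi>. (\<integral>\<^sup>+\<omega>. ennreal (1 / (1 + norm \<omega>) ^ (2 * DIM(real^'m^'k))) \<partial>(lborel :: (real^'m^'k) measure))
      * (\<integral>\<^sup>+t. ennreal (wt t) * H \<xi> t \<partial>lborel) \<partial>\<mu>)"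
    by (intro nn_integral_mono weighted_dual_le[OF frame_rotation_adapted]) (simp_all add: space_stiefel[OF \<mu>])
  also have "\<dots> = (\<integral>\<^sup>+\<omega>. ennreal (1 / (1 + norm \<omega>) ^ (2 * DIM(real^'m^'k))) \<partial>(lborel :: (real^'m^'k) measure))
      * (\<integral>\<^sup>+\<xi>. \<integral>\<^sup>+t. ennreal (wt t) * H \<xi> t \<partial>lborel \<partial>\<mu>)"
    by (rule nn_integral_cmult[OF m])
  finally show ?thesis .
qed

lemma nf_dual_weighted: "(\<integral>\<^sup>+\<xi>. \<integral>\<^sup>+x. ennreal (wx x) * nf \<xi> (transpose \<xi> ** x) \<partial>lborel \<partial>\<mu>) < \<infinity>"
  by (rule le_less_trans[OF dual_weighted_le[OF measurable_nf]])
    (use nf_weighted nn_integral_weight_finite[where 'a = "real^'m^'k"] in \<open>simp add: ennreal_mult_less_top\<close>)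

lemma measurable_pair_dual:
  assumes "(\<lambda>(\<xi>, t). H \<xi> t) \<in> borel_measurable (borel \<Otimes>\<^sub>M borel)"
  shows "(\<lambda>(\<xi> :: real^'l^('k + 'l), x :: real^'m^('k + 'l)). H \<xi> (transpose \<xi> ** x)) \<in> borel_measurable (borel \<Otimes>\<^sub>M borel)"
proof -
  have "(\<lambda>p. (fst p, transpose (fst p) ** snd p)) \<in> (borel :: (real^'l^('k + 'l)) measure) \<Otimes>\<^sub>M (borel :: (real^'m^('k + 'l)) measure) \<rightarrow>\<^sub>M borel \<Otimes>\<^sub>M (borel :: (real^'m^'l) measure)"
    by measurable
  from measurable_compose[OF this assms] show ?thesis by (simp add: case_prod_beta')
qed

text \<open>Exceptional sets of planes stay negligible when pulled back along
  \<open>\<lambda>x. transpose \<xi> ** x\<close>. The weighted estimate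
  \<open>dual_weighted_le\<close>, applied to the indicator \<open>B\<close> of the exceptional set,
  bounds its pullback by zero; the weight is positive, and Fubini's theorem exchanges the order of
  the two quantifiers.\<close>

lemma AE_dual:
  fixes P :: "real^'l^('k + 'l) \<Rightarrow> real^'m^'l \<Rightarrow> bool"
  assumes P: "Measurable.pred (borel \<Otimes>\<^sub>M borel) (\<lambda>(\<xi>, t). P \<xi> t)"
    and ae: "AE \<xi> in \<mu>. AE t in lborel. P \<xi> t"
  shows "AE x in lborel. AE \<xi> in \<mu>. P \<xi> (transpose \<xi> ** x)"
proof -
  define B :: "real^'l^('k + 'l) \<Rightarrow> real^'m^'l \<Rightarrow> ennreal" where "B \<xi> t = (if P \<xi> t then 0 else 1)" for \<xi> t
  have B: "(\<lambda>(\<xi>, t). B \<xi> t) \<in> borel_measurable (borel \<Otimes>\<^sub>M borel)"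
    using P unfolding B_def case_prod_beta' by measurable
  note Bx = measurable_pair_dual[OF B]
  have "(\<integral>\<^sup>+\<xi>. \<integral>\<^sup>+t. ennreal (wt t) * B \<xi> t \<partial>lborel \<partial>\<mu>) = (\<integral>\<^sup>+\<xi>. 0 \<partial>\<mu>)"
  proof (rule nn_integral_cong_AE, rule eventually_mono[OF ae])
    fix \<xi> assume "AE t in lborel. P \<xi> t"
    then have "(\<integral>\<^sup>+t. ennreal (wt t) * B \<xi> t \<partial>lborel) = (\<integral>\<^sup>+t. 0 \<partial>(lborel :: (real^'m^'l) measure))"
      by (intro nn_integral_cong_AE) (auto simp: B_def elim!: eventually_mono)
    then show "(\<integral>\<^sup>+t. ennreal (wt t) * B \<xi> t \<partial>lborel) = 0" by simp
  qed
  then have "(\<integral>\<^sup>+\<xi>. \<integral>\<^sup>+x. ennreal (wx x) * B \<xi> (transpose \<xi> ** x) \<partial>lborel \<partial>\<mu>) = 0"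
    using dual_weighted_le[OF B] by simp
  moreover have m: "(\<lambda>(\<xi>, x). ennreal (wx x) * B \<xi> (transpose \<xi> ** x)) \<in> borel_measurable (borel \<Otimes>\<^sub>M borel)"
    using Bx unfolding case_prod_beta' by measurable
  ultimately have 0: "(\<integral>\<^sup>+x. \<integral>\<^sup>+\<xi>. ennreal (wx x) * B \<xi> (transpose \<xi> ** x) \<partial>\<mu> \<partial>lborel) = 0"
    using stiefel_nn_Fubini[OF \<mu> m] by simp
  have sf: "sigma_finite_measure \<mu>" by (rule finite_measure.axioms(1)[OF finite_measure_stiefel[OF \<mu>]])
  have m': "(\<lambda>(\<xi>, x). ennreal (wx x) * B \<xi> (transpose \<xi> ** x)) \<in> borel_measurable (\<mu> \<Otimes>\<^sub>M lborel)"
    by (rule borel_measurable_stiefel_pairI[OF \<mu> m])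
  have m1: "(\<lambda>\<xi>. ennreal (wx x) * B \<xi> (transpose \<xi> ** x)) \<in> borel_measurable \<mu>" for x
    using measurable_compose[OF _ m, of "\<lambda>\<xi>. (\<xi>, x)" borel] by (intro borel_measurable_stiefelI[OF \<mu>]) simp
  have m2: "(\<lambda>x. \<integral>\<^sup>+\<xi>. ennreal (wx x) * B \<xi> (transpose \<xi> ** x) \<partial>\<mu>) \<in> borel_measurable lborel"
    using measurable_pair_swap[OF m'] by (intro sigma_finite_measure.borel_measurable_nn_integral[OF sf]) (simp add: case_prod_beta')
  have "AE x in lborel. (\<integral>\<^sup>+\<xi>. ennreal (wx x) * B \<xi> (transpose \<xi> ** x) \<partial>\<mu>) = 0"
    using 0 by (subst (asm) nn_integral_0_iff_AE[OF m2])
  then show ?thesis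
  proof (rule eventually_mono)
    fix x assume "(\<integral>\<^sup>+\<xi>. ennreal (wx x) * B \<xi> (transpose \<xi> ** x) \<partial>\<mu>) = 0"
    then have "AE \<xi> in \<mu>. ennreal (wx x) * B \<xi> (transpose \<xi> ** x) = 0"
      by (subst (asm) nn_integral_0_iff_AE[OF m1])
    then show "AE \<xi> in \<mu>. P \<xi> (transpose \<xi> ** x)"
    proof (rule eventually_mono)
      fix \<xi> assume a: "ennreal (wx x) * B \<xi> (transpose \<xi> ** x) = 0"
      have "1 + norm x > 0" by (simp add: add_pos_nonneg)
      then have "wx x > 0" by simp
      then have "ennreal (wx x) \<noteq> 0" by (simp only: ennreal_eq_0_iff not_le)
      then have "B \<xi> (transpose \<xi> ** x) = 0" using a by simp
      then show "P \<xi> (transpose \<xi> ** x)" by (simp add: B_def split: if_splits)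
    qed
  qed
qed

lemma AE_nf_finite: "AE \<xi> in \<mu>. AE t in lborel. nf \<xi> t < \<infinity>"
proof -
  have m: "(\<lambda>\<xi>. \<integral>\<^sup>+t. ennreal (wt t) * nf \<xi> t \<partial>lborel) \<in> borel_measurable \<mu>"
    by (rule borel_measurable_stiefelI[OF \<mu>], rule borel_measurable_nn_integral_lborelI)
      (use measurable_nf in measurable)
  have nfm: "nf \<xi> \<in> borel_measurable borel" for \<xi>
    using measurable_compose[OF _ measurable_nf, of "Pair \<xi>" borel] by simp
  have "AE \<xi> in \<mu>. (\<integral>\<^sup>+t. ennreal (wt t) * nf \<xi> t \<partial>lborel) \<noteq> \<infinity>"
    by (rule nn_integral_noteq_infinite[OF m]) (use nf_weighted in simp)
  then show ?thesis
  proof (rule eventually_mono)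
    fix \<xi> assume a: "(\<integral>\<^sup>+t. ennreal (wt t) * nf \<xi> t \<partial>lborel) \<noteq> \<infinity>"
    have "AE t in lborel. ennreal (wt t) * nf \<xi> t \<noteq> \<infinity>"
      by (rule nn_integral_noteq_infinite[OF _ a]) (use nfm in measurable)
    then show "AE t in lborel. nf \<xi> t < \<infinity>"
    proof (rule eventually_mono)
      fix t :: "real^'m^'l" assume b: "ennreal (wt t) * nf \<xi> t \<noteq> \<infinity>"
      have "(1 + (norm t)\<^sup>2) > 0" by (simp add: add_pos_nonneg)
      then have "wt t > 0" by simp
      then have "ennreal (wt t) \<noteq> 0" by (simp only: ennreal_eq_0_iff not_le)
      then show "nf \<xi> t < \<infinity>" using b by (auto simp: ennreal_mult_eq_top_iff less_top)
    qed
  qed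
qed

text \<open>For each \<xi> the measures of the plane sections of \<open>Z\<close> integrate over
  \<open>t\<close> to the Lebesgue measure of \<open>Z\<close>. This allows \<open>f\<close> to be
  changed on a null set.\<close>

lemma AE_plane_null:
  fixes Z :: "(real^'m^('k + 'l)) set"
  assumes Z: "Z \<in> null_sets lborel"
  shows "AE \<xi> in \<mu>. AE t in lborel. plane_nn_integral (indicator Z) \<xi> t = 0"
proof (rule AE_I2)
  fix \<xi> assume "\<xi> \<in> space \<mu>"
  then have g: "adapted (frame_rotation \<xi>) \<xi>" using frame_rotation_adapted by (simp add: space_stiefel[OF \<mu>])
  have [measurable]: "Z \<in> sets borel" using Z by auto
  have m: "(\<lambda>(\<xi> :: real^'l^('k + 'l), t :: real^'m^'l). plane_nn_integral (indicator Z) \<xi> t) \<in> borel_measurable (borel \<Otimes>\<^sub>M borel)"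
    by (rule borel_measurable_plane_nn_integral) measurable
  have m1: "(\<lambda>t :: real^'m^'l. plane_nn_integral (indicator Z) \<xi> t) \<in> borel_measurable lborel"
    using measurable_compose[OF _ m, of "Pair \<xi>" borel] by simp
  have "(\<integral>\<^sup>+t. plane_nn_integral (indicator Z) \<xi> t \<partial>(lborel :: (real^'m^'l) measure)) = (\<integral>\<^sup>+z. indicator Z z \<partial>lborel)"
    using nn_integral_slice[OF g, of "indicator Z" "\<lambda>_. 1"] by simp
  also have "\<dots> = 0" using Z by auto
  finally show "AE t in lborel. plane_nn_integral (indicator Z) \<xi> (t :: real^'m^'l) = 0"
    by (subst (asm) nn_integral_0_iff_AE[OF m1])
qed

lemma measurable_plane_integral: "(\<lambda>(\<xi>, t). plane_integral f \<xi> t) \<in> borel_measurable (borel \<Otimes>\<^sub>M borel)"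
  by (rule borel_measurable_plane_integral) measurable

lemma dual_plane_integral_finite:
  assumes F: "\<And>x. norm (F x) \<le> C * wx x"
  shows "(\<integral>\<^sup>+\<xi>. \<integral>\<^sup>+x. ennreal (norm (plane_integral f \<xi> (transpose \<xi> ** x) * F x)) \<partial>lborel \<partial>\<mu>) < \<infinity>"
proof -
  have C: "C \<ge> 0" using order_trans[OF norm_ge_zero F[of 0]] by simp
  have m0: "(\<lambda>(\<xi>, x). ennreal (wx x) * nf \<xi> (transpose \<xi> ** x)) \<in> borel_measurable (borel \<Otimes>\<^sub>M borel)"
    using measurable_pair_dual[OF measurable_nf] unfolding case_prod_beta' by measurable
  have m1: "(\<lambda>x. ennreal (wx x) * nf \<xi> (transpose \<xi> ** x)) \<in> borel_measurable lborel" for \<xi>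
    using measurable_compose[OF _ m0, of "Pair \<xi>" borel] by simp
  have m2: "(\<lambda>\<xi>. \<integral>\<^sup>+x. ennreal (wx x) * nf \<xi> (transpose \<xi> ** x) \<partial>lborel) \<in> borel_measurable \<mu>"
    by (rule borel_measurable_stiefelI[OF \<mu>], rule borel_measurable_nn_integral_lborelI[OF m0])
  have "(\<integral>\<^sup>+\<xi>. \<integral>\<^sup>+x. ennreal (norm (plane_integral f \<xi> (transpose \<xi> ** x) * F x)) \<partial>lborel \<partial>\<mu>)
      \<le> (\<integral>\<^sup>+\<xi>. \<integral>\<^sup>+x. ennreal C * (ennreal (wx x) * nf \<xi> (transpose \<xi> ** x)) \<partial>lborel \<partial>\<mu>)"
  proof (intro nn_integral_mono)
    fix \<xi> x
    have "ennreal (norm (plane_integral f \<xi> (transpose \<xi> ** x) * F x)) = ennreal (norm (F x)) * ennreal (norm (plane_integral f \<xi> (transpose \<xi> ** x)))"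
      by (simp add: norm_mult ennreal_mult mult.commute)
    also have "\<dots> \<le> ennreal (C * wx x) * nf \<xi> (transpose \<xi> ** x)"
      by (intro mult_mono ennreal_leI F norm_plane_integral_le) simp_all
    also have "\<dots> = ennreal C * (ennreal (wx x) * nf \<xi> (transpose \<xi> ** x))"
      using C by (subst ennreal_mult) (simp_all add: mult.assoc)
    finally show "ennreal (norm (plane_integral f \<xi> (transpose \<xi> ** x) * F x)) \<le> ennreal C * (ennreal (wx x) * nf \<xi> (transpose \<xi> ** x))" .
  qed
  also have "\<dots> = ennreal C * (\<integral>\<^sup>+\<xi>. \<integral>\<^sup>+x. ennreal (wx x) * nf \<xi> (transpose \<xi> ** x) \<partial>lborel \<partial>\<mu>)"
    by (simp only: nn_integral_cmult[OF m1] nn_integral_cmult[OF m2])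
  also have "\<dots> < \<infinity>"
    using nf_dual_weighted by (simp add: ennreal_mult_less_top)
  finally show ?thesis .
qed

lemma measurable_dual_mult:
  fixes F :: "real^'m^('k + 'l) \<Rightarrow> complex"
  assumes H: "(\<lambda>(\<xi> :: real^'l^('k + 'l), t :: real^'m^'l). H \<xi> t) \<in> borel_measurable (borel \<Otimes>\<^sub>M borel)" and [measurable]: "F \<in> borel_measurable borel"
  shows "(\<lambda>(\<xi>, x). H \<xi> (transpose \<xi> ** x) * F x) \<in> borel_measurable (borel \<Otimes>\<^sub>M borel)"
  using measurable_pair_dual[OF H] unfolding case_prod_beta' by measurable

text \<open>Fubini's theorem needs a decaying factor in \<open>x\<close>. The weight itself is taken
  for it and divided out afterwards, pointwise in \<open>x\<close>, being nonzero.\<close>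

lemma AE_integrable_dual: "AE x in lborel. integrable \<mu> (\<lambda>\<xi>. plane_integral f \<xi> (transpose \<xi> ** x))"
proof -
  have m: "(\<lambda>x. complex_of_real (wx x)) \<in> borel_measurable borel" by measurable
  have "norm (complex_of_real (wx x)) \<le> 1 * wx x" for x unfolding norm_of_real by simp
  from stiefel_Fubini(3)[OF \<mu> measurable_dual_mult[OF measurable_plane_integral m] dual_plane_integral_finite[OF this]]
  have "AE x in lborel. integrable \<mu> (\<lambda>\<xi>. plane_integral f \<xi> (transpose \<xi> ** x) * complex_of_real (wx x))" .
  then show ?thesis
  proof (rule eventually_mono)
    fix x assume i: "integrable \<mu> (\<lambda>\<xi>. plane_integral f \<xi> (transpose \<xi> ** x) * complex_of_real (wx x))"
    have "1 + norm x > 0" by (simp add: add_pos_nonneg)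
    then have "wx x > 0" by simp
    then have nz: "complex_of_real (wx x) \<noteq> 0" by (simp only: of_real_eq_0_iff)
    then show "integrable \<mu> (\<lambda>\<xi>. plane_integral f \<xi> (transpose \<xi> ** x))"
      using integrable_mult_left[of "1 / complex_of_real (wx x)", OF i] by (simp only: times_divide_eq_right mult_1_right nonzero_mult_div_cancel_right[OF nz])
  qed
qed

lemma plane_integral_eq:
  assumes "adapted g \<xi>" "nf \<xi> t < \<infinity>"
  shows "integrable lborel (\<lambda>\<omega>. f (g ** stack \<omega> t))"
    and "plane_integral f \<xi> t = (LINT \<omega>|lborel. f (g ** stack \<omega> t))"
proof -
  show i: "integrable lborel (\<lambda>\<omega>. f (g ** stack \<omega> t))"
    using assms(2) by (subst (asm) plane_nn_integral_adapted[OF assms(1)]) (auto intro!: integrableI_bounded)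
  show "plane_integral f \<xi> t = (LINT \<omega>|lborel. f (g ** stack \<omega> t))"
    by (rule plane_integral_adapted[OF assms(1) f i])
qed

text \<open>By the slice theorem \<open>S \<xi> t\<close> is the plane integral of
  \<open>FT \<theta>\<close>. For fixed \<xi> both inner integrals reduce to the integral of
  \<open>plane_integral f \<xi> t * S \<xi> t\<close> over \<open>t\<close>, which is symmetric in
  the two functions; Fubini's theorem over the Stiefel manifold is used on either side of this
  identity.\<close>

lemma dual_plane_integral_FT:
  fixes \<theta> :: "real^'m^('k + 'l) \<Rightarrow> complex"
  assumes \<theta>: "rapid \<theta>" "continuous_on UNIV \<theta>" "rapid (FT \<theta>)"
  defines "S \<equiv> \<lambda>\<xi> t. complex_of_real ((2 * pi) ^ (CARD('k) * CARD('m))) * (LINT s|lborel. cis (s \<bullet> t) * \<theta> (\<xi> ** s))"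
  shows "integrable lborel (\<lambda>x. (LINT \<xi>|\<mu>. plane_integral f \<xi> (transpose \<xi> ** x)) * FT \<theta> x)"
    and "(LINT x|lborel. (LINT \<xi>|\<mu>. plane_integral f \<xi> (transpose \<xi> ** x)) * FT \<theta> x)
      = (LINT z|lborel. f z * (LINT \<xi>|\<mu>. S \<xi> (transpose \<xi> ** z)))"
proof -
  have [measurable]: "\<theta> \<in> borel_measurable borel" by (rule borel_measurable_continuous_onI[OF \<theta>(2)])
  have [measurable]: "FT \<theta> \<in> borel_measurable borel"
    by (rule FT_measurable, rule rapid_integrable[OF \<theta>(1)]) measurable
  have S: "(\<lambda>(\<xi>, t). S \<xi> t) \<in> borel_measurable (borel \<Otimes>\<^sub>M borel)"
    unfolding S_def case_prod_beta' by measurable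
  have S1 [measurable]: "S \<xi> \<in> borel_measurable borel" for \<xi>
    using measurable_compose[OF _ S, of "Pair \<xi>" borel] by simp
  have r1 [measurable]: "plane_integral f \<xi> \<in> borel_measurable borel" for \<xi>
    using measurable_compose[OF _ measurable_plane_integral, of "Pair \<xi>" borel] by simp
  obtain C where C: "C \<ge> 0" "\<And>x. norm (FT \<theta> x) \<le> C / (1 + norm x) ^ (2 * DIM(real^'m^'k) + 2 * N)"
    using rapidE[OF \<theta>(3)] by metis
  \<comment> \<open>The formula for \<open>S\<close> is oscillatory and shows no decay in
    \<open>t\<close>. Rewritten as a plane integral of the rapidly decreasing
    \<open>FT \<theta>\<close>, it is bounded by the weight \<open>wt\<close>, the one against which
    \<open>f\<close> is known to be integrable.\<close>
  have Sb: "norm (S \<xi> t) \<le> (LINT \<omega>|(lborel :: (real^'m^'k) measure). C * (1 / (1 + norm \<omega>) ^ (2 * DIM(real^'m^'k)))) * wt t"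
    if "\<xi> \<in> stiefel" for \<xi> t
  proof -
    have g: "adapted (frame_rotation \<xi>) \<xi>" using frame_rotation_adapted[OF that] .
    have "norm (S \<xi> t) \<le> (LINT \<omega>|(lborel :: (real^'m^'k) measure). C * (1 / (1 + norm \<omega>) ^ (2 * DIM(real^'m^'k))) * wt t)"
      unfolding S_def Fourier_slice(2)[OF g \<theta>, symmetric]
    proof (rule Bochner_Integration.integral_norm_bound_integral[OF Fourier_slice(1)[OF g \<theta>]])
      show "integrable lborel (\<lambda>\<omega> :: real^'m^'k. C * (1 / (1 + norm \<omega>) ^ (2 * DIM(real^'m^'k))) * wt t)"
        by (intro integrable_mult_left integrable_mult_right integrable_one_plus_norm_powr)
      fix \<omega> :: "real^'m^'k"
      have "norm (FT \<theta> (frame_rotation \<xi> ** stack \<omega> t)) \<le> C * (1 / (1 + norm (frame_rotation \<xi> ** stack \<omega> t)) ^ (2 * DIM(real^'m^'k) + 2 * N))"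
        using C(2)[of "frame_rotation \<xi> ** stack \<omega> t"] by (simp only: times_divide_eq_right mult_1_right)
      also have "\<dots> \<le> C * (1 / (1 + norm \<omega>) ^ (2 * DIM(real^'m^'k)) * wt t)"
        by (rule mult_left_mono[OF weight_adapted_le[OF g] C(1)])
      also have "\<dots> = C * (1 / (1 + norm \<omega>) ^ (2 * DIM(real^'m^'k))) * wt t" by (simp only: mult.assoc)
      finally show "norm (FT \<theta> (frame_rotation \<xi> ** stack \<omega> t)) \<le> C * (1 / (1 + norm \<omega>) ^ (2 * DIM(real^'m^'k))) * wt t" .
    qed
    then show ?thesis by (simp only: integral_mult_left_zero)
  qed
  define B where "B = (LINT \<omega>|(lborel :: (real^'m^'k) measure). C * (1 / (1 + norm \<omega>) ^ (2 * DIM(real^'m^'k))))"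
  have B: "B \<ge> 0" unfolding B_def using C(1) by (intro Bochner_Integration.integral_nonneg) simp
  have finA: "(\<integral>\<^sup>+\<xi>. \<integral>\<^sup>+x. ennreal (norm (plane_integral f \<xi> (transpose \<xi> ** x) * FT \<theta> x)) \<partial>lborel \<partial>\<mu>) < \<infinity>"
    by (rule dual_plane_integral_finite[of _ C]) (use C(2) in simp)
  have finB: "(\<integral>\<^sup>+\<xi>. \<integral>\<^sup>+z. ennreal (norm (S \<xi> (transpose \<xi> ** z) * f z)) \<partial>lborel \<partial>\<mu>) < \<infinity>"
  proof -
    have m0: "(\<lambda>(\<xi>, z). ennreal (norm (f z) * wt (transpose \<xi> ** z))) \<in> borel_measurable ((borel :: (real^'l^('k + 'l)) measure) \<Otimes>\<^sub>M borel)"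
      unfolding case_prod_beta' by measurable
    have m2: "(\<lambda>\<xi>. \<integral>\<^sup>+z. ennreal (norm (f z) * wt (transpose \<xi> ** z)) \<partial>lborel) \<in> borel_measurable \<mu>"
      by (rule borel_measurable_stiefelI[OF \<mu>], rule borel_measurable_nn_integral_lborelI[OF m0])
    have "(\<integral>\<^sup>+\<xi>. \<integral>\<^sup>+z. ennreal (norm (S \<xi> (transpose \<xi> ** z) * f z)) \<partial>lborel \<partial>\<mu>)
      \<le> (\<integral>\<^sup>+\<xi>. \<integral>\<^sup>+z. ennreal B * ennreal (norm (f z) * wt (transpose \<xi> ** z)) \<partial>lborel \<partial>\<mu>)"
    proof (intro nn_integral_mono)
      fix \<xi> z assume "\<xi> \<in> space \<mu>"
      then have "norm (S \<xi> (transpose \<xi> ** z)) \<le> B * wt (transpose \<xi> ** z)"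
        unfolding B_def by (intro Sb) (simp add: space_stiefel[OF \<mu>])
      then have "norm (S \<xi> (transpose \<xi> ** z) * f z) \<le> B * wt (transpose \<xi> ** z) * norm (f z)"
        unfolding norm_mult by (rule mult_right_mono) simp
      then have "norm (S \<xi> (transpose \<xi> ** z) * f z) \<le> B * (norm (f z) * wt (transpose \<xi> ** z))"
        by (simp only: mult_ac)
      then show "ennreal (norm (S \<xi> (transpose \<xi> ** z) * f z)) \<le> ennreal B * ennreal (norm (f z) * wt (transpose \<xi> ** z))"
        using B by (subst ennreal_mult[symmetric]) (simp_all add: ennreal_leI)
    qed
    also have "\<dots> = ennreal B * (\<integral>\<^sup>+\<xi>. \<integral>\<^sup>+z. ennreal (norm (f z) * wt (transpose \<xi> ** z)) \<partial>lborel \<partial>\<mu>)"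
    proof -
      have m1: "(\<lambda>z. ennreal (norm (f z) * wt (transpose \<xi> ** z))) \<in> borel_measurable lborel" for \<xi> :: "real^'l^('k + 'l)" by measurable
      show ?thesis by (simp only: nn_integral_cmult[OF m1] nn_integral_cmult[OF m2])
    qed
    also have "\<dots> < \<infinity>" using Lp_weighted by (simp add: ennreal_mult_less_top)
    finally show ?thesis .
  qed
  note A = stiefel_Fubini[OF \<mu> measurable_dual_mult[OF measurable_plane_integral \<open>FT \<theta> \<in> borel_measurable borel\<close>] finA]
  note B' = stiefel_Fubini[OF \<mu> measurable_dual_mult[OF S f] finB]
  show "integrable lborel (\<lambda>x. (LINT \<xi>|\<mu>. plane_integral f \<xi> (transpose \<xi> ** x)) * FT \<theta> x)"
    using A(4) by simp
  have "(LINT x|lborel. (LINT \<xi>|\<mu>. plane_integral f \<xi> (transpose \<xi> ** x)) * FT \<theta> x)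
      = (LINT \<xi>|\<mu>. LINT x|lborel. plane_integral f \<xi> (transpose \<xi> ** x) * FT \<theta> x)"
    using A(1) by simp
  also have "\<dots> = (LINT \<xi>|\<mu>. LINT z|lborel. S \<xi> (transpose \<xi> ** z) * f z)"
  proof (rule integral_cong_AE)
    show "(\<lambda>\<xi>. LINT x|lborel. plane_integral f \<xi> (transpose \<xi> ** x) * FT \<theta> x) \<in> borel_measurable \<mu>"
      by (intro borel_measurable_stiefelI[OF \<mu>] borel_measurable_integral_lborelI
          measurable_dual_mult[OF measurable_plane_integral]) measurable
    show "(\<lambda>\<xi>. LINT z|lborel. S \<xi> (transpose \<xi> ** z) * f z) \<in> borel_measurable \<mu>"
      by (intro borel_measurable_stiefelI[OF \<mu>] borel_measurable_integral_lborelI measurable_dual_mult[OF S]) measurable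
    \<comment> \<open>Almost everywhere in \<xi> only: both integrands must be integrable for
      slicing, and the plane integral must converge for almost all \<open>t\<close> to be identified
      with an integral over \<omega>.\<close>
    show "AE \<xi> in \<mu>. (LINT x|lborel. plane_integral f \<xi> (transpose \<xi> ** x) * FT \<theta> x) = (LINT z|lborel. S \<xi> (transpose \<xi> ** z) * f z)"
      using A(2) B'(2) AE_nf_finite AE_space
    proof eventually_elim
      case (elim \<xi>)
      let ?g = "frame_rotation \<xi>"
      have g: "adapted ?g \<xi>" using frame_rotation_adapted elim(4) by (simp add: space_stiefel[OF \<mu>])
      have "(LINT x|lborel. plane_integral f \<xi> (transpose \<xi> ** x) * FT \<theta> x) = (LINT t|lborel. plane_integral f \<xi> t * S \<xi> t)"
        using integral_slice[OF g elim(1)] by (simp add: Fourier_slice(2)[OF g \<theta>] S_def)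
      also have "\<dots> = (LINT t|lborel. S \<xi> t * (LINT \<omega>|lborel. f (?g ** stack \<omega> t)))"
        using elim(3) by (intro integral_cong_AE) (auto simp: plane_integral_eq(2)[OF g] mult.commute elim!: eventually_mono)
      also have "\<dots> = (LINT z|lborel. S \<xi> (transpose \<xi> ** z) * f z)"
        using integral_slice[OF g elim(2)] by simp
      finally show ?case .
    qed
  qed
  also have "\<dots> = (LINT z|lborel. f z * (LINT \<xi>|\<mu>. S \<xi> (transpose \<xi> ** z)))"
    using B'(1) by (simp add: mult.commute)
  finally show "(LINT x|lborel. (LINT \<xi>|\<mu>. plane_integral f \<xi> (transpose \<xi> ** x)) * FT \<theta> x)
      = (LINT z|lborel. f z * (LINT \<xi>|\<mu>. S \<xi> (transpose \<xi> ** z)))" .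
qed

text \<open>Moving \<open>transpose \<xi>\<close> across the inner product makes the phase depend on
  \<open>\<xi> ** s\<close> alone. The inner double integral is then one over polar coordinates,
  with \<open>\<lambda>y. cis (z \<bullet> y) * \<theta> y\<close> as the integrand.\<close>

lemma dual_plane_integral_inversion:
  fixes \<psi> :: "real^'m^('k + 'l) \<Rightarrow> complex"
  assumes \<psi>: "\<psi> \<in> Psi_space"
  defines "\<theta> \<equiv> \<lambda>y. complex_of_real (mat_abs y ^ CARD('k)) * \<psi> y"
  shows "integrable lborel (\<lambda>x. (LINT \<xi>|\<mu>. plane_integral f \<xi> (transpose \<xi> ** x)) * FT \<theta> x)"
    and "(LINT x|lborel. (LINT \<xi>|\<mu>. plane_integral f \<xi> (transpose \<xi> ** x)) * FT \<theta> x)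
      = complex_of_real (stiefel_mass CARD('k + 'l) CARD('l) * inversion_const CARD('k + 'l) CARD('k) CARD('m)) * (LINT z|lborel. f z * FT \<psi> z)"
proof -
  note [measurable] = Psi_space_facts(3)[OF \<psi>]
  have [measurable]: "mat_abs \<in> borel_measurable (borel :: (real^'m^('k + 'l)) measure)"
    unfolding mat_abs_def by measurable
  have \<theta>: "rapid \<theta>" "rapid (FT \<theta>)" unfolding \<theta>_def using Psi_space_facts(5,6)[OF \<psi>] by auto
  have cont: "continuous_on UNIV \<theta>"
  proof -
    have "continuous_on UNIV (gdet :: real^'m^('k + 'l) \<Rightarrow> real)"
      by (intro continuous_at_imp_continuous_on ballI continuous_real_polymonial_function real_polynomial_gdet)
    then show ?thesis unfolding \<theta>_def mat_abs_def
      by (intro continuous_intros Psi_space_facts(2)[OF \<psi>])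
  qed
  have [measurable]: "\<theta> \<in> borel_measurable borel" by (rule borel_measurable_continuous_onI[OF cont])
  show "integrable lborel (\<lambda>x. (LINT \<xi>|\<mu>. plane_integral f \<xi> (transpose \<xi> ** x)) * FT \<theta> x)"
    by (rule dual_plane_integral_FT(1)[OF \<theta>(1) cont \<theta>(2)])
  let ?c = "stiefel_mass CARD('k + 'l) CARD('l) * polar_const CARD('k + 'l) CARD('l) CARD('m)"
  have S: "(LINT \<xi>|\<mu>. LINT s|(lborel :: (real^'m^'l) measure). cis (s \<bullet> (transpose \<xi> ** z)) * \<theta> (\<xi> ** s)) = complex_of_real ?c * FT \<psi> z" for z
  proof -
    \<comment> \<open>The density has exponent \<open>- CARD('k) / 2\<close> in
      \<open>gdet y\<close>, that is the inverse of \<open>mat_abs y ^ CARD('k)\<close>. On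
      rank-deficient \<open>y\<close>, where this cancellation fails, \<psi> vanishes.\<close>
    have eq: "gdet y powr (- ((real CARD('k + 'l) - real CARD('l)) / 2)) *\<^sub>R (cis (z \<bullet> y) * \<theta> y) = cis (z \<bullet> y) * \<psi> y" for y
    proof (cases "gdet y = 0")
      case True
      then show ?thesis using Psi_spaceD(2)[OF \<psi> True, of "[]"] by simp
    next
      case False
      then have "gdet y > 0" using gdet_nonneg[of y] by simp
      then have "gdet y powr (real CARD('k) / 2) = mat_abs y ^ CARD('k)"
        by (simp add: mat_abs_eq powr_half_sqrt[symmetric] powr_realpow[symmetric] powr_powr)
      then have "gdet y powr (- ((real CARD('k + 'l) - real CARD('l)) / 2)) * mat_abs y ^ CARD('k) = 1"
        using \<open>gdet y > 0\<close> by (simp add: powr_minus mat_abs_eq)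
      then have "complex_of_real (gdet y powr (- ((real CARD('k + 'l) - real CARD('l)) / 2))) * complex_of_real (mat_abs y ^ CARD('k)) = 1"
        by (simp only: of_real_mult[symmetric] of_real_1)
      then show ?thesis unfolding \<theta>_def scaleR_conv_of_real
        by (metis (no_types, lifting) mult.assoc mult.left_commute mult_1)
    qed
    have "(LINT \<xi>|\<mu>. LINT s|(lborel :: (real^'m^'l) measure). cis (s \<bullet> (transpose \<xi> ** z)) * \<theta> (\<xi> ** s))
        = (LINT \<xi>|\<mu>. LINT s|(lborel :: (real^'m^'l) measure). cis (z \<bullet> (\<xi> ** s)) * \<theta> (\<xi> ** s))"
      by (simp add: inner_mult_left[symmetric] inner_commute[of z])
    also have "\<dots> = ?c *\<^sub>R (LINT y|lborel. gdet y powr (- ((real CARD('k + 'l) - real CARD('l)) / 2)) *\<^sub>R (cis (z \<bullet> y) * \<theta> y))"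
    proof (rule polar_coordinates_integral[OF \<mu> ml card_l_less])
      show "integrable lborel (\<lambda>y. gdet y powr (- ((real CARD('k + 'l) - real CARD('l)) / 2)) *\<^sub>R (cis (z \<bullet> y) * \<theta> y))"
        unfolding eq using rapid_integrable[OF Psi_space_facts(1,3)[OF \<psi>]] by (subst integrable_cis_mult) auto
    qed measurable
    also have "\<dots> = complex_of_real ?c * FT \<psi> z" unfolding eq FT_def by (simp add: scaleR_conv_of_real)
    finally show ?thesis .
  qed
  have ic: "inversion_const CARD('k + 'l) CARD('k) CARD('m) = (2 * pi) ^ (CARD('k) * CARD('m)) * polar_const CARD('k + 'l) CARD('l) CARD('m)"
    using inversion_const_eq_polar_const[of "CARD('m)" "CARD('k + 'l)" "CARD('k)"] ml by simp
  have "(LINT x|lborel. (LINT \<xi>|\<mu>. plane_integral f \<xi> (transpose \<xi> ** x)) * FT \<theta> x)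
      = (LINT z|lborel. f z * (complex_of_real ((2 * pi) ^ (CARD('k) * CARD('m))) * (complex_of_real ?c * FT \<psi> z)))"
    unfolding dual_plane_integral_FT(2)[OF \<theta>(1) cont \<theta>(2)] integral_mult_right_zero S ..
  also have "\<dots> = (LINT z|lborel. complex_of_real (stiefel_mass CARD('k + 'l) CARD('l) * inversion_const CARD('k + 'l) CARD('k) CARD('m)) * (f z * FT \<psi> z))"
    unfolding ic by (simp add: mult_ac)
  finally show "(LINT x|lborel. (LINT \<xi>|\<mu>. plane_integral f \<xi> (transpose \<xi> ** x)) * FT \<theta> x)
      = complex_of_real (stiefel_mass CARD('k + 'l) CARD('l) * inversion_const CARD('k + 'l) CARD('k) CARD('m)) * (LINT z|lborel. f z * FT \<psi> z)"
    by simp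
qed

end

subsection \<open>The inversion formula\<close>

lemma borel_representative:
  fixes f :: "'a::euclidean_space \<Rightarrow> complex"
  assumes "f \<in> borel_measurable lebesgue"
  obtains (rep) f0 Z where "f0 \<in> borel_measurable borel" "Z \<in> null_sets lborel" "\<And>x. x \<notin> Z \<Longrightarrow> f x = f0 x"
proof -
  have "(\<lambda>x. Re (f x)) \<in> borel_measurable lebesgue" "(\<lambda>x. Im (f x)) \<in> borel_measurable lebesgue"
    using assms by measurable
  note Re_Im = completion_ex_borel_measurable_real[OF this(1)] completion_ex_borel_measurable_real[OF this(2)]
  obtain u where u: "u \<in> borel_measurable lborel" "AE x in lborel. Re (f x) = u x"
    using Re_Im(1) by (rule bexE)
  obtain v where v: "v \<in> borel_measurable lborel" "AE x in lborel. Im (f x) = v x"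
    using Re_Im(2) by (rule bexE)
  have [measurable]: "u \<in> borel_measurable borel" using u(1) measurable_cong_sets[OF sets_lborel refl] by (rule subst[rotated])
  have [measurable]: "v \<in> borel_measurable borel" using v(1) measurable_cong_sets[OF sets_lborel refl] by (rule subst[rotated])
  have "AE x in lborel. f x = Complex (u x) (v x)"
    using eventually_conj[OF u(2) v(2)] by (rule eventually_mono) (auto intro: complex_eqI)
  then obtain Z where Z: "Z \<in> null_sets lborel" "{x \<in> space lborel. f x \<noteq> Complex (u x) (v x)} \<subseteq> Z"
    unfolding eventually_ae_filter by blast
  have "(\<lambda>x. Complex (u x) (v x)) \<in> borel_measurable borel"
    unfolding borel_measurable_complex_iff complex.sel by (intro conjI) fact+
  moreover have "f x = Complex (u x) (v x)" if "x \<notin> Z" for x using Z(2) that by auto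
  ultimately show thesis using Z(1) rep by blast
qed

theorem theorem0p10:
  fixes f :: "real^'m^('k::finite + 'l::finite) \<Rightarrow> complex"
    and \<mu> :: "(real^'l^('k + 'l)) measure"
    and n k m :: nat and p :: real
  assumes "n = CARD('k + 'l)" and "k = CARD('k)" and "m = CARD('m)"
    and "1 \<le> m" and "m \<le> n" and "1 \<le> k" and "k \<le> n - 1"
    and "stiefel_measure \<mu>"
    and "1 \<le> p" and "p < real n / (real k + real m - 1)"
    and "in_Lp p f"
  shows "(AE (\<xi>, t) in \<mu> \<Otimes>\<^sub>M lborel. radon_converges f \<xi> t) \<and>
    (AE x in lebesgue. integrable (completion \<mu>) (\<lambda>\<xi>. radon f \<xi> (transpose \<xi> ** x))) \<and>
    (\<forall>\<phi>\<in>Phi_space.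
       integrable lebesgue (\<lambda>x. f x * \<phi> x) \<and>
       integrable lebesgue (\<lambda>x. dual_radon \<mu> (radon f) x * riesz_neg k \<phi> x) \<and>
       complex_of_real (inversion_const n k m) * pairing f \<phi> =
         pairing (dual_radon \<mu> (radon f)) (riesz_neg k \<phi>)) \<and>
    (even k \<longrightarrow> (\<forall>\<phi>\<in>Phi_space.
       integrable lebesgue
         (\<lambda>x. dual_radon \<mu> (radon f) x * (cayley_laplace ^^ (k div 2)) \<phi> x) \<and>
       complex_of_real (inversion_const n k m) * pairing f \<phi> =
         (-1) ^ (m * k div 2) *
         pairing (dual_radon \<mu> (radon f)) ((cayley_laplace ^^ (k div 2)) \<phi>)))"
proof -
  note \<mu> = \<open>stiefel_measure \<mu>\<close>
  note nkm = assms(1-3)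
  have "real k + real m - 1 > 0" using assms(4,6) by simp
  then have pn: "p * (real k + real m - 1) < real n" using assms(10) by (simp add: pos_less_divide_eq)
  have "real k + real m - 1 \<le> p * (real k + real m - 1)"
    using assms(9) \<open>real k + real m - 1 > 0\<close> by simp
  then have "real k + real m - 1 < real n" using pn by linarith
  \<comment> \<open>From \<open>1 \<le> p < n / (k + m - 1)\<close> follows
    \<open>k + m - 1 < n\<close>; in integers this is \<open>m \<le> n - k\<close>.\<close>
  then have ml: "CARD('m) \<le> CARD('l)" using nkm by simp
  have pn': "p * (real CARD('k) + real CARD('m) - 1) < real CARD('k + 'l)" using pn nkm by simp
  \<comment> \<open>Any exponent above half this product would do for the averaging
    estimate.\<close>
  define N where "N = CARD('k + 'l) * CARD('l)"
  have "N > 0" unfolding N_def by (simp only: nat_0_less_mult_iff zero_less_card_finite)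
  then have N: "real N > real (CARD('k + 'l) * CARD('l)) / 2" unfolding N_def[symmetric] by simp
  have fL: "f \<in> borel_measurable lebesgue" "integrable lebesgue (\<lambda>x. norm (f x) powr p)"
    using \<open>in_Lp p f\<close> by (auto simp: in_Lp_def)
  obtain f0 Z where f0 [measurable]: "f0 \<in> borel_measurable borel" and Z: "Z \<in> null_sets lborel"
    and ff0: "\<And>x. x \<notin> Z \<Longrightarrow> f x = f0 x"
    using borel_representative[OF fL(1)] by blast
  have [measurable]: "Z \<in> sets borel" using Z by auto
  have aeZ: "AE x in lborel. x \<notin> Z" by (rule AE_not_in[OF Z])
  have aef: "AE x in lborel. f x = f0 x" using aeZ ff0 by (auto elim!: eventually_mono)
  have f0p: "integrable lborel (\<lambda>x. norm (f0 x) powr p)"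
  proof -
    have "(\<lambda>x. norm (f0 x) powr p) \<in> borel_measurable lborel" by simp
    moreover have "AE x in lborel. norm (f x) powr p = norm (f0 x) powr p"
      using aef by (rule eventually_mono) simp
    ultimately have "integrable lebesgue (\<lambda>x. norm (f x) powr p) \<longleftrightarrow> integrable lborel (\<lambda>x. norm (f0 x) powr p)"
      by (rule completion_AE_eq(2))
    then show ?thesis using fL(2) by (rule iffD1)
  qed
  note ctx = \<mu> ml N f0 f0p \<open>1 \<le> p\<close> pn'
  \<comment> \<open>The planes over which \<open>f0\<close> is absolutely integrable and which meet
    the exceptional set \<open>Z\<close> in a null set. On these the Radon transform of
    \<open>f\<close> converges and equals the measurable plane integral of
    \<open>f0\<close>.\<close>
  let ?good = "\<lambda>\<xi> t. plane_nn_integral (\<lambda>x. ennreal (norm (f0 x))) \<xi> t < \<infinity> \<and> plane_nn_integral (indicator Z) \<xi> t = 0"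
  have good: "radon_converges f \<xi> t" "radon f \<xi> t = plane_integral f0 \<xi> t" if "\<xi> \<in> stiefel" "?good \<xi> t" for \<xi> and t :: "real^'m^'l"
  proof -
    let ?g = "frame_rotation \<xi>"
    have g: "adapted ?g \<xi>" using frame_rotation_adapted[OF \<open>\<xi> \<in> stiefel\<close>] .
    have "(\<integral>\<^sup>+\<omega>. indicator Z (?g ** stack \<omega> t) \<partial>(lborel :: (real^'m^'k) measure)) = 0"
      using \<open>?good \<xi> t\<close> by (subst (asm) (2) plane_nn_integral_adapted[OF g]) auto
    then have "AE \<omega> in (lborel :: (real^'m^'k) measure). indicator Z (?g ** stack \<omega> t) = (0 :: ennreal)"
      by (subst (asm) nn_integral_0_iff_AE) auto
    then have ae: "AE \<omega> in (lborel :: (real^'m^'k) measure). f (?g ** stack \<omega> t) = f0 (?g ** stack \<omega> t)"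
    proof (rule eventually_mono)
      fix \<omega> :: "real^'m^'k" assume "indicator Z (?g ** stack \<omega> t) = (0 :: ennreal)"
      then have "?g ** stack \<omega> t \<notin> Z" by (simp add: indicator_def split: if_splits)
      then show "f (?g ** stack \<omega> t) = f0 (?g ** stack \<omega> t)" by (rule ff0)
    qed
    have m: "(\<lambda>\<omega> :: real^'m^'k. f0 (?g ** stack \<omega> t)) \<in> borel_measurable lborel" by measurable
    have nf: "plane_nn_integral (\<lambda>x. ennreal (norm (f0 x))) \<xi> t < \<infinity>" using \<open>?good \<xi> t\<close> by blast
    show "radon_converges f \<xi> t" unfolding radon_converges_def
      using completion_AE_eq(2)[OF m ae] plane_integral_eq(1)[OF ctx g nf] by simp
    show "radon f \<xi> t = plane_integral f0 \<xi> t" unfolding radon_def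
      using completion_AE_eq(3)[OF m ae] plane_integral_eq(2)[OF ctx g nf] by simp
  qed
  have mgood: "Measurable.pred (borel \<Otimes>\<^sub>M borel) (\<lambda>(\<xi> :: real^'l^('k + 'l), t :: real^'m^'l). ?good \<xi> t)"
  proof -
    have "(\<lambda>x. ennreal (norm (f0 x))) \<in> borel_measurable borel" "indicator Z \<in> borel_measurable borel" by measurable
    note [measurable] = this[THEN borel_measurable_plane_nn_integral]
    show ?thesis unfolding case_prod_beta' by measurable
  qed
  have aegood: "AE \<xi> in \<mu>. AE t in lborel. ?good \<xi> (t :: real^'m^'l)"
    using AE_nf_finite[OF ctx] AE_plane_null[OF ctx Z] by eventually_elim (rule AE_conjI)
  have 1: "AE (\<xi>, t) in \<mu> \<Otimes>\<^sub>M lborel. radon_converges f \<xi> t"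
  proof -
    interpret finite_measure \<mu> by (rule finite_measure_stiefel[OF \<mu>])
    interpret pair_sigma_finite \<mu> "lborel :: (real^'m^'l) measure" ..
    let ?P = "\<lambda>x :: (real^'l^('k + 'l)) \<times> (real^'m^'l). case x of (\<xi>, t) \<Rightarrow> ?good \<xi> t"
    \<comment> \<open>The predicate is measurable for the Borel product. It is turned into a real
      function because \<open>borel_measurable_stiefel_pairI\<close> transfers measurability of
      functions to \<open>\<mu> \<Otimes>\<^sub>M lborel\<close>.\<close>
    have "(\<lambda>x. of_bool (?P x) :: real) \<in> borel_measurable (borel \<Otimes>\<^sub>M borel)"
      using mgood by (rule measurable_compose) simp
    then have "(\<lambda>x. of_bool (?P x) :: real) \<in> borel_measurable (\<mu> \<Otimes>\<^sub>M lborel)"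
      by (rule borel_measurable_stiefel_pairI[OF \<mu>])
    then have "(\<lambda>x. of_bool (?P x) :: real) -` {1} \<inter> space (\<mu> \<Otimes>\<^sub>M lborel) \<in> sets (\<mu> \<Otimes>\<^sub>M lborel)"
      by (rule measurable_sets) simp
    moreover have "(\<lambda>x. of_bool (?P x) :: real) -` {1} \<inter> space (\<mu> \<Otimes>\<^sub>M lborel) = {x \<in> space (\<mu> \<Otimes>\<^sub>M lborel). ?P x}"
      by (intro set_eqI) (simp only: Int_iff vimage_eq singleton_iff of_bool_eq_1_iff mem_Collect_eq conj_commute)
    ultimately have "{x \<in> space (\<mu> \<Otimes>\<^sub>M lborel). ?P x} \<in> sets (\<mu> \<Otimes>\<^sub>M lborel)" by (simp only:)
    then have "AE x in \<mu> \<Otimes>\<^sub>M (lborel :: (real^'m^'l) measure). case x of (\<xi>, t) \<Rightarrow> ?good \<xi> t"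
      using aegood by (intro AE_pair_measure) auto
    then show ?thesis
      using AE_space
    proof eventually_elim
      case (elim x)
      then show ?case using good(1) by (auto simp: space_pair_measure space_stiefel[OF \<mu>] split: prod.splits)
    qed
  qed
  have ae_dual: "AE x in lborel. AE \<xi> in \<mu>. ?good \<xi> (transpose \<xi> ** x :: real^'m^'l)"
    by (rule AE_dual[OF ctx mgood aegood])
  have dual: "AE x in lborel. integrable (completion \<mu>) (\<lambda>\<xi>. radon f \<xi> (transpose \<xi> ** x)) \<and>
      dual_radon \<mu> (radon f) x = complex_of_real (1 / stiefel_mass n CARD('l)) * (LINT \<xi>|\<mu>. plane_integral f0 \<xi> (transpose \<xi> ** x))"
    using ae_dual AE_integrable_dual[OF ctx]
  proof eventually_elim
    case (elim x)
    have ae: "AE \<xi> in \<mu>. radon f \<xi> (transpose \<xi> ** x) = plane_integral f0 \<xi> (transpose \<xi> ** x)"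
      using elim(1) AE_space by eventually_elim (auto simp: space_stiefel[OF \<mu>] intro: good(2))
    note c = completion_AE_eq[OF borel_measurable_integrable[OF elim(2)] ae]
    show ?case unfolding dual_radon_def c(3) using c(2) elim(2) nkm by simp
  qed
  have 2: "AE x in lebesgue. integrable (completion \<mu>) (\<lambda>\<xi>. radon f \<xi> (transpose \<xi> ** x))"
    using dual by (intro AE_completion) (auto elim!: eventually_mono)
  have main: "integrable lebesgue (\<lambda>x. f x * FT \<psi> x)"
      "integrable lebesgue (\<lambda>x. dual_radon \<mu> (radon f) x * riesz_neg k (FT \<psi>) x)"
      "complex_of_real (inversion_const n k m) * pairing f (FT \<psi>) = pairing (dual_radon \<mu> (radon f)) (riesz_neg k (FT \<psi>))"
    if \<psi>: "\<psi> \<in> Psi_space" for \<psi> :: "real^'m^('k + 'l) \<Rightarrow> complex"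
  proof -
    let ?\<theta> = "\<lambda>y. complex_of_real (mat_abs y ^ CARD('k)) * \<psi> y"
    have R: "riesz_neg k (FT \<psi>) = FT ?\<theta>" using riesz_neg_FT[OF \<psi>] nkm by simp
    have [measurable]: "FT \<psi> \<in> borel_measurable borel"
      by (rule FT_measurable, rule rapid_integrable[OF Psi_space_facts(1,3)[OF \<psi>]])
    have i1: "integrable lborel (\<lambda>x. f0 x * FT \<psi> x)"
    proof -
      obtain C where C: "\<And>x. norm (FT \<psi> x) \<le> C" using rapid_bounded[OF Psi_space_facts(4)[OF \<psi>]] by blast
      have "integrable lborel (FT \<psi>)" by (rule rapid_integrable[OF Psi_space_facts(4)[OF \<psi>]]) measurable
      then have "integrable lborel (\<lambda>x. norm (FT \<psi> x) + C * norm (f0 x) powr p)"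
        by (intro Bochner_Integration.integrable_add integrable_norm integrable_mult_right f0p)
      then show ?thesis
      proof (rule Bochner_Integration.integrable_bound)
        have "norm (f0 x * FT \<psi> x) \<le> norm (FT \<psi> x) + C * norm (f0 x) powr p" for x
        proof -
          \<comment> \<open>This spares Hoelder's inequality: \<open>FT \<psi>\<close> is
            integrable, which takes care of the constant, and bounded, which takes care of the
            \<open>p\<close>-th power.\<close>
          have "norm (f0 x) \<le> 1 + norm (f0 x) powr p"
          proof (cases "norm (f0 x) \<le> 1")
            case False
            then have "norm (f0 x) powr 1 \<le> norm (f0 x) powr p" using \<open>1 \<le> p\<close> by (intro powr_mono) auto
            then show ?thesis using False by simp
          qed (simp add: add_increasing2)
          then have "norm (f0 x) * norm (FT \<psi> x) \<le> (1 + norm (f0 x) powr p) * norm (FT \<psi> x)"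
            by (rule mult_right_mono) simp
          also have "\<dots> \<le> norm (FT \<psi> x) + C * norm (f0 x) powr p"
            using mult_right_mono[OF C[of x], of "norm (f0 x) powr p"] by (simp add: algebra_simps)
          finally show ?thesis by (simp add: norm_mult)
        qed
        then show "AE x in lborel. norm (f0 x * FT \<psi> x) \<le> norm (norm (FT \<psi> x) + C * norm (f0 x) powr p)"
          by (intro AE_I2) (simp add: order_trans[OF _ abs_ge_self])
      qed measurable
    qed
    have ae1: "AE x in lborel. f x * FT \<psi> x = f0 x * FT \<psi> x" using aef by (auto elim!: eventually_mono)
    note c1 = completion_AE_eq[OF borel_measurable_integrable[OF i1] ae1]
    show "integrable lebesgue (\<lambda>x. f x * FT \<psi> x)" using c1(2) i1 by simp
    let ?d = "\<lambda>x. LINT \<xi>|\<mu>. plane_integral f0 \<xi> (transpose \<xi> ** x)"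
    note inv = dual_plane_integral_inversion[OF ctx \<psi>]
    let ?s = "complex_of_real (1 / stiefel_mass n CARD('l))"
    have i2: "integrable lborel (\<lambda>x. ?s * (?d x * FT ?\<theta> x))" using inv(1) by (rule integrable_mult_right)
    have ae2: "AE x in lborel. dual_radon \<mu> (radon f) x * FT ?\<theta> x = ?s * (?d x * FT ?\<theta> x)"
      using dual by (rule eventually_mono) (simp add: mult.assoc)
    note c2 = completion_AE_eq[OF borel_measurable_integrable[OF i2] ae2]
    show "integrable lebesgue (\<lambda>x. dual_radon \<mu> (radon f) x * riesz_neg k (FT \<psi>) x)"
      unfolding R using c2(2) i2 by simp
    have pos: "stiefel_mass n CARD('l) > 0" by (rule stiefel_mass_pos) (use nkm in simp)
    have "pairing (dual_radon \<mu> (radon f)) (riesz_neg k (FT \<psi>)) = ?s * (LINT x|lborel. ?d x * FT ?\<theta> x)"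
      unfolding pairing_def R c2(3) by (rule integral_mult_right_zero)
    moreover have "pairing f (FT \<psi>) = (LINT z|lborel. f0 z * FT \<psi> z)" unfolding pairing_def by (rule c1(3))
    moreover have "(LINT x|lborel. ?d x * FT ?\<theta> x) = complex_of_real (stiefel_mass n CARD('l) * inversion_const n k m) * (LINT z|lborel. f0 z * FT \<psi> z)"
      using inv(2) by (simp only: nkm)
    ultimately show "complex_of_real (inversion_const n k m) * pairing f (FT \<psi>) = pairing (dual_radon \<mu> (radon f)) (riesz_neg k (FT \<psi>))"
      using pos by simp
  qed
  have Phi: "\<exists>\<psi>\<in>Psi_space. \<phi> = FT \<psi>" if "\<phi> \<in> Phi_space" for \<phi> :: "real^'m^('k + 'l) \<Rightarrow> complex"
    using that fourier_eq_FT[OF Psi_space_facts(3)] unfolding Phi_space_def by auto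
  have even: "integrable lebesgue (\<lambda>x. dual_radon \<mu> (radon f) x * (cayley_laplace ^^ (k div 2)) (FT \<psi>) x) \<and>
       complex_of_real (inversion_const n k m) * pairing f (FT \<psi>) =
         (-1) ^ (m * k div 2) * pairing (dual_radon \<mu> (radon f)) ((cayley_laplace ^^ (k div 2)) (FT \<psi>))"
    if "even k" and \<psi>: "\<psi> \<in> Psi_space" for \<psi> :: "real^'m^('k + 'l) \<Rightarrow> complex"
  proof -
    let ?e = "(-1) ^ (m * k div 2) :: complex"
    have e: "dual_radon \<mu> (radon f) x * (cayley_laplace ^^ (k div 2)) (FT \<psi>) x
        = ?e * (dual_radon \<mu> (radon f) x * riesz_neg k (FT \<psi>) x)" for x
      by (simp only: cayley_laplace_power_eq_riesz_neg[OF \<psi> \<open>even k\<close>] nkm(3) mult.left_commute)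
    \<comment> \<open>The sign is its own inverse, so it may stand on either side of the
      formula.\<close>
    have ee: "?e * ?e = 1" by (simp flip: power_mult_distrib)
    have "integrable lebesgue (\<lambda>x. dual_radon \<mu> (radon f) x * (cayley_laplace ^^ (k div 2)) (FT \<psi>) x)"
      unfolding e by (rule integrable_mult_right[OF main(2)[OF \<psi>]])
    moreover have "pairing (dual_radon \<mu> (radon f)) ((cayley_laplace ^^ (k div 2)) (FT \<psi>)) = ?e * pairing (dual_radon \<mu> (radon f)) (riesz_neg k (FT \<psi>))"
      unfolding pairing_def e by (rule integral_mult_right_zero)
    ultimately show ?thesis
      by (simp only: main(3)[OF \<psi>] mult.assoc[symmetric] ee mult_1_left simp_thms)
  qed
  show ?thesis
    using 1 2 main even Phi by blast
qed

end
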